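(* Suppose that $k=3$. Then the finite adaptability problem $(\mathrm{Adapt}_k(\Omega))$ with $A(\cdot)$ and $B(\cdot)$ deterministic (i.e. $A(\omega)$ and $B(\omega)$ do not depend on $\omega$) can be solved by at most $7^{|V(\Omega)|+|E(\Omega)|}$ resolutions of a linear program of polynomial size (or a mixed linear program in case of integral variables), where $V(\Omega)$ is the set of vertices of $\Omega$ and $E(\Omega)$ is its set of edges.
   Context: The uncertainty set $\Omega$ is a polytope of $\mathbb{R}^n$. $A(\omega)$, $B(\omega)$ are input matrices and $\boldsymbol{b}(\omega)$ is an input vector, all depending affinely on $\omega\in\Omega$; $\boldsymbol{c}$ and $\boldsymbol{d}$ are deterministic vectors. For a positive integer $k$, with $[k]=\{1,\dots,k\}$, the finite adaptability problem $(\mathrm{Adapt}_k(\Omega))$ is $$\min_{\Omega_1,\dots,\Omega_k,\ \boldsymbol{x},\boldsymbol{y}_1,\ldots,\boldsymbol{y}_k}\ \boldsymbol{c}^\top\boldsymbol{x}+\max_{i\in[k]}\boldsymbol{d}^\top\boldsymbol{y}_i\quad\text{s.t.}\quad A(\omega)\boldsymbol{x}+B(\omega)\boldsymbol{y}_i\leq\boldsymbol{b}(\omega)\quad\forall i\in[k]\ \forall\omega\in\Omega_i,$$ where the $\Omega_i$ are constrained to form a cover of $\Omega$. The variables $\boldsymbol{x}$ and $\boldsymbol{y}_i$ are continuous, or can moreover be constrained to be integer, depending on the context. From a computational perspective, only $\boldsymbol{x},\boldsymbol{y}_1,\ldots,\boldsymbol{y}_k$ are expected to be output, and not the $\Omega_i$'s.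 *)

theory Defs
  imports
    "HOL-Analysis.Analysis"
    "HOL-Computational_Algebra.Polynomial"
    "HOL-Analysis.Finite_Function_Topology"
    "HOL-Library.Log_Nat"
    "Jordan_Normal_Form.Matrix"
begin

unbundle no inner_syntax
hide_const (open) Finite_Cartesian_Product.vec Finite_Cartesian_Product.vec_nth

section \<open>Outcome of a minimization problem\<close>

text \<open>Over the reals, a feasible mixed integer linear program that is bounded below may fail to
  attain its infimum (its data may be irrational); \<open>Unattained\<close> covers this case.\<close>

datatype 's outcome = Infeasible | Unbounded | Unattained real | Optimal 's

fun is_outcome :: "'s set \<Rightarrow> ('s \<Rightarrow> real) \<Rightarrow> 's outcome \<Rightarrow> bool" where
  "is_outcome S f Infeasible \<longleftrightarrow> S = {}"
| "is_outcome S f Unbounded \<longleftrightarrow> \<not> bdd_below (f ` S)"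
| "is_outcome S f (Unattained r) \<longleftrightarrow>
     S \<noteq> {} \<and> bdd_below (f ` S) \<and> r = Inf (f ` S) \<and> r \<notin> f ` S"
| "is_outcome S f (Optimal s) \<longleftrightarrow> s \<in> S \<and> (\<forall>t\<in>S. f s \<le> f t)"


section \<open>The finite adaptability problem\<close>

definition adapt_feasible ::
  "nat \<Rightarrow> 'u set \<Rightarrow> ('u \<Rightarrow> real mat) \<Rightarrow> ('u \<Rightarrow> real mat) \<Rightarrow> ('u \<Rightarrow> real vec) \<Rightarrow>
   real vec set \<Rightarrow> real vec set \<Rightarrow> (real vec \<times> (nat \<Rightarrow> real vec)) set" where
  "adapt_feasible k \<Omega> A B b X Y = {(x, y). x \<in> X \<and> (\<forall>i\<in>{1..k}. y i \<in> Y) \<and>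
     (\<exists>\<Omega>s. (\<Union>i\<in>{1..k}. \<Omega>s i) = \<Omega> \<and>
       (\<forall>i\<in>{1..k}. \<forall>\<omega>\<in>\<Omega>s i. A \<omega> *\<^sub>v x + B \<omega> *\<^sub>v y i \<le> b \<omega>))}"

definition adapt_cost ::
  "nat \<Rightarrow> real vec \<Rightarrow> real vec \<Rightarrow> real vec \<times> (nat \<Rightarrow> real vec) \<Rightarrow> real" where
  "adapt_cost k c d = (\<lambda>(x, y). c \<bullet> x + Max ((\<lambda>i. d \<bullet> y i) ` {1..k}))"

definition partly_integral :: "nat \<Rightarrow> nat set \<Rightarrow> real vec set" where
  "partly_integral n I = {z \<in> carrier_vec n. \<forall>i\<in>I. vec_index z i \<in> \<int>}"

text \<open>The dimension \<open>n\<close> of the uncertainty space is part of the input of an algorithm and has to be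
  quantified inside the statement. Hence \<open>\<real>\<^sup>n\<close> is the subspace of the finitely supported sequences
  \<^typ>\<open>nat \<Rightarrow>\<^sub>0 real\<close> with support in \<open>{..<n}\<close>; the notions of polytope, face and vertex do not
  depend on the ambient space.\<close>

type_synonym point = "nat \<Rightarrow>\<^sub>0 real"

definition coords :: "nat \<Rightarrow> point \<Rightarrow> real vec" where
  "coords n \<omega> = Matrix.vec n (Poly_Mapping.lookup \<omega>)"

definition vertices :: "'a::real_vector set \<Rightarrow> 'a set" where
  "vertices S = {v. v extreme_point_of S}"

text \<open>Faces of affine dimension one. The library's \<^const>\<open>edge_of\<close> is restricted to Euclidean
  types because \<^const>\<open>aff_dim\<close> is; the condition on \<open>B\<close> is what \<open>aff_dim F = 1\<close> unfolds to.\<close>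

definition edges :: "'a::real_vector set \<Rightarrow> 'a set set" where
  "edges S = {F. F face_of S \<and>
     (\<exists>B. affine hull B = affine hull F \<and> \<not> affine_dependent B \<and> card B = 2)}"

text \<open>Input of the problem with deterministic matrices: \<open>A(\<omega>) = A_mat\<close>, \<open>B(\<omega>) = B_mat\<close> and
  \<open>b(\<omega>) = b_const + b_lin \<omega>\<close>. The polytope is handed to an algorithm as the list of its vertices.
  The components of \<open>x\<close> in \<open>x_ints\<close> and those of every \<open>y\<^sub>i\<close> in \<open>y_ints\<close> have to be integers.\<close>

record adapt_input =
  u_dim :: nat
  u_set :: "point set"
  u_verts :: "point list"
  A_mat :: "real mat"
  B_mat :: "real mat"
  b_const :: "real vec"
  b_lin :: "real mat"
  c_vec :: "real vec"
  d_vec :: "real vec"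
  x_ints :: "nat set"
  y_ints :: "nat set"

definition adapt_input_ok :: "adapt_input \<Rightarrow> bool" where
  "adapt_input_ok D \<longleftrightarrow>
     polytope (u_set D) \<and>
     (\<forall>\<omega>\<in>u_set D. Poly_Mapping.keys \<omega> \<subseteq> {..<u_dim D}) \<and>
     distinct (u_verts D) \<and> set (u_verts D) = vertices (u_set D) \<and>
     A_mat D \<in> carrier_mat (dim_vec (b_const D)) (dim_vec (c_vec D)) \<and>
     B_mat D \<in> carrier_mat (dim_vec (b_const D)) (dim_vec (d_vec D)) \<and>
     b_lin D \<in> carrier_mat (dim_vec (b_const D)) (u_dim D) \<and>
     x_ints D \<subseteq> {..<dim_vec (c_vec D)} \<and>
     y_ints D \<subseteq> {..<dim_vec (d_vec D)}"

definition adapt_outcome ::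
  "nat \<Rightarrow> adapt_input \<Rightarrow> (real vec \<times> (nat \<Rightarrow> real vec)) outcome \<Rightarrow> bool" where
  "adapt_outcome k D = is_outcome
     (adapt_feasible k (u_set D) (\<lambda>\<omega>. A_mat D) (\<lambda>\<omega>. B_mat D)
        (\<lambda>\<omega>. b_const D + b_lin D *\<^sub>v coords (u_dim D) \<omega>)
        (partly_integral (dim_vec (c_vec D)) (x_ints D))
        (partly_integral (dim_vec (d_vec D)) (y_ints D)))
     (adapt_cost k (c_vec D) (d_vec D))"

definition has_integral_variables :: "adapt_input \<Rightarrow> bool" where
  "has_integral_variables D \<longleftrightarrow> x_ints D \<noteq> {} \<or> y_ints D \<noteq> {}"


section \<open>Linear programs\<close>

text \<open>Minimize \<open>obj \<bullet> z\<close> subject to \<open>lhs z \<le> rhs\<close> and \<open>z\<^sub>i \<in> \<int>\<close> for \<open>i \<in> ints\<close>.\<close>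

record lp =
  obj :: "real vec"
  lhs :: "real mat"
  rhs :: "real vec"
  ints :: "nat set"

definition lp_ok :: "lp \<Rightarrow> bool" where
  "lp_ok P \<longleftrightarrow> lhs P \<in> carrier_mat (dim_vec (rhs P)) (dim_vec (obj P)) \<and>
     ints P \<subseteq> {..<dim_vec (obj P)}"

definition lp_outcome :: "lp \<Rightarrow> real vec outcome \<Rightarrow> bool" where
  "lp_outcome P = is_outcome
     {z \<in> partly_integral (dim_vec (obj P)) (ints P). lhs P *\<^sub>v z \<le> rhs P}
     (\<lambda>z. obj P \<bullet> z)"


section \<open>Algorithms that call a linear programming solver\<close>

text \<open>Data are binary trees with real numbers at the leaves; a list is a right comb ending in
  \<open>Null\<close>.\<close>

datatype val = Null | Num real | Node val val

text \<open>Encoding length: a rational number counts with the binary lengths of its numerator and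
  denominator, any other real number is a single symbol.\<close>

definition num_len :: "real \<Rightarrow> nat" where
  "num_len r = (if r \<in> \<rat>
     then (case quotient_of (THE q. of_rat q = r) of (a, b) \<Rightarrow>
            floorlog 2 (nat \<bar>a\<bar>) + floorlog 2 (nat b))
     else 0)"

fun val_len :: "val \<Rightarrow> nat" where
  "val_len Null = 1"
| "val_len (Num r) = 1 + num_len r"
| "val_len (Node v w) = 1 + val_len v + val_len w"

primrec enc_list :: "val list \<Rightarrow> val" where
  "enc_list [] = Null"
| "enc_list (v # vs) = Node v (enc_list vs)"

definition enc_vec :: "real vec \<Rightarrow> val" where
  "enc_vec z = enc_list (map Num (list_of_vec z))"

definition enc_mat :: "real mat \<Rightarrow> val" where
  "enc_mat M = enc_list (map enc_vec (rows M))"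

definition enc_ints :: "nat \<Rightarrow> nat set \<Rightarrow> val" where
  "enc_ints n I = enc_list (map (\<lambda>i. Num (of_bool (i \<in> I))) [0..<n])"

definition enc_lp :: "lp \<Rightarrow> val" where
  "enc_lp P = enc_list
     [enc_vec (obj P), enc_mat (lhs P), enc_vec (rhs P), enc_ints (dim_vec (obj P)) (ints P)]"

definition enc_adapt_input :: "adapt_input \<Rightarrow> val" where
  "enc_adapt_input D = enc_list
     [enc_list (map (\<lambda>v. enc_vec (coords (u_dim D) v)) (u_verts D)),
      enc_mat (A_mat D), enc_mat (B_mat D), enc_vec (b_const D), enc_mat (b_lin D),
      enc_vec (c_vec D), enc_vec (d_vec D),
      enc_ints (dim_vec (c_vec D)) (x_ints D), enc_ints (dim_vec (d_vec D)) (y_ints D)]"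

definition enc_adapt_solution :: "nat \<Rightarrow> real vec \<times> (nat \<Rightarrow> real vec) \<Rightarrow> val" where
  "enc_adapt_solution k = (\<lambda>(x, y). Node (enc_vec x) (enc_list (map (\<lambda>i. enc_vec (y i)) [1..<Suc k])))"

fun enc_outcome :: "('s \<Rightarrow> val) \<Rightarrow> 's outcome \<Rightarrow> val" where
  "enc_outcome e Infeasible = Node (Num 0) Null"
| "enc_outcome e Unbounded = Node (Num 1) Null"
| "enc_outcome e (Unattained r) = Node (Num 2) (Num r)"
| "enc_outcome e (Optimal s) = Node (Num 3) (e s)"

text \<open>A solver returns a correct outcome for every linear program; nothing is known about its
  behaviour on trees that do not encode one.\<close>

definition lp_solver :: "(val \<Rightarrow> val) \<Rightarrow> bool" where
  "lp_solver slv \<longleftrightarrow>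
     (\<forall>P. lp_ok P \<longrightarrow> (\<exists>r. lp_outcome P r \<and> slv (enc_lp P) = enc_outcome enc_vec r))"

text \<open>Programs transform one tree into another. \<open>Fork p q\<close> pairs the results of \<open>p\<close> and \<open>q\<close> on
  the same argument, \<open>Branch t p q\<close> tests whether \<open>t\<close> yields a positive number, and \<open>Fold p\<close>,
  applied to a pair of an initial value and a list, iterates \<open>p\<close> along the list. The only loops
  are folds, so every program terminates. Instructions that do not fit the shape of their
  argument yield \<open>Null\<close>.\<close>

datatype prog =
    Skip | Seq prog prog | Fork prog prog | Branch prog prog prog | Fold prog
  | MkNull | MkNum int | GetL | GetR | IsNode
  | Plus | Times | Uminus | Recip
  | Solve

fun is_pos :: "val \<Rightarrow> bool" where
  "is_pos (Num r) \<longleftrightarrow> r > 0"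
| "is_pos _ \<longleftrightarrow> False"

fun get_left :: "val \<Rightarrow> val" where
  "get_left (Node v w) = v"
| "get_left _ = Null"

fun get_right :: "val \<Rightarrow> val" where
  "get_right (Node v w) = w"
| "get_right _ = Null"

fun is_node :: "val \<Rightarrow> val" where
  "is_node (Node v w) = Num 1"
| "is_node _ = Num 0"

fun arith1 :: "(real \<Rightarrow> real) \<Rightarrow> val \<Rightarrow> val" where
  "arith1 f (Num r) = Num (f r)"
| "arith1 f _ = Null"

fun arith2 :: "(real \<Rightarrow> real \<Rightarrow> real) \<Rightarrow> val \<Rightarrow> val" where
  "arith2 f (Node (Num r) (Num s)) = Num (f r s)"
| "arith2 f _ = Null"

text \<open>A run yields the result, the number of steps (every instruction counts one, including exact
  arithmetic on reals as in the Blum--Shub--Smale model; trees are immutable and shared, so they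
  are not copied) and the arguments of the calls to the solver, in order.\<close>

type_synonym run_result = "val \<times> nat \<times> val list"

fun fold_run :: "(val \<Rightarrow> run_result) \<Rightarrow> val \<Rightarrow> val \<Rightarrow> run_result" where
  "fold_run f a (Node v vs) =
     (case f (Node a v) of (a', s, Q) \<Rightarrow>
      case fold_run f a' vs of (r, t, R) \<Rightarrow> (r, 1 + s + t, Q @ R))"
| "fold_run f a _ = (a, 1, [])"

primrec run :: "(val \<Rightarrow> val) \<Rightarrow> prog \<Rightarrow> val \<Rightarrow> run_result" where
  "run slv Skip = (\<lambda>v. (v, 1, []))"
| "run slv (Seq p q) = (\<lambda>v.
     case run slv p v of (w, s, Q) \<Rightarrow>
     case run slv q w of (r, t, R) \<Rightarrow> (r, 1 + s + t, Q @ R))"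
| "run slv (Fork p q) = (\<lambda>v.
     case run slv p v of (w, s, Q) \<Rightarrow>
     case run slv q v of (r, t, R) \<Rightarrow> (Node w r, 1 + s + t, Q @ R))"
| "run slv (Branch b p q) = (\<lambda>v.
     case run slv b v of (w, s, Q) \<Rightarrow>
     case (if is_pos w then run slv p v else run slv q v) of (r, t, R) \<Rightarrow> (r, 1 + s + t, Q @ R))"
| "run slv (Fold p) = (\<lambda>v. fold_run (run slv p) (get_left v) (get_right v))"
| "run slv MkNull = (\<lambda>v. (Null, 1, []))"
| "run slv (MkNum i) = (\<lambda>v. (Num (of_int i), 1, []))"
| "run slv GetL = (\<lambda>v. (get_left v, 1, []))"
| "run slv GetR = (\<lambda>v. (get_right v, 1, []))"
| "run slv IsNode = (\<lambda>v. (is_node v, 1, []))"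
| "run slv Plus = (\<lambda>v. (arith2 (+) v, 1, []))"
| "run slv Times = (\<lambda>v. (arith2 (*) v, 1, []))"
| "run slv Uminus = (\<lambda>v. (arith1 uminus v, 1, []))"
| "run slv Recip = (\<lambda>v. (arith1 inverse v, 1, []))"
| "run slv Solve = (\<lambda>v. (slv v, 1, [v]))"

text \<open>One program works for all inputs and all solvers. Its result is correct; it makes at most
  \<open>N i\<close> calls to the solver; each call is for a linear program whose encoding length is polynomial
  in that of the input, without integral variables unless the input is \<open>mixed\<close>; and the work
  outside the solver amounts to polynomially many steps for each of the \<open>N i\<close> resolutions.\<close>

definition solvable_by_lp_resolutions ::
  "'i set \<Rightarrow> ('i \<Rightarrow> val) \<Rightarrow> ('i \<Rightarrow> val \<Rightarrow> bool) \<Rightarrow> ('i \<Rightarrow> bool) \<Rightarrow> ('i \<Rightarrow> nat) \<Rightarrow> bool" where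
  "solvable_by_lp_resolutions inputs enc correct mixed N \<longleftrightarrow>
     (\<exists>(p::prog) (\<pi>::nat poly). \<forall>i\<in>inputs. \<forall>slv. lp_solver slv \<longrightarrow>
       (case run slv p (enc i) of (out, steps, calls) \<Rightarrow>
         correct i out \<and>
         length calls \<le> N i \<and>
         (\<forall>q\<in>set calls. \<exists>P. lp_ok P \<and> q = enc_lp P \<and>
            (\<not> mixed i \<longrightarrow> ints P = {}) \<and> val_len q \<le> poly \<pi> (val_len (enc i))) \<and>
         steps \<le> N i * poly \<pi> (val_len (enc i))))"

end

theory Submission
  imports Defs
begin

text \<open>For fixed \<open>x\<close> and \<open>y\<^sub>1, y\<^sub>2, y\<^sub>3\<close> let \<open>C i\<close> be the polyhedron of the scenarios served by \<open>y\<^sub>i\<close>. A guess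
  assigns a label in \<open>{1, 2, 3}\<close> to every vertex and every edge, and it imposes conditions of the form
  ``\<open>convex hull T\<close> meets \<open>C i\<close> for all \<open>i \<in> I\<close> in a common point'': for every end \<open>u\<close> of an edge \<open>E\<close>,
  \<open>T = E\<close> and \<open>I\<close> consists of the labels of \<open>E\<close> and \<open>u\<close>; and for every smallest face containing three
  given vertices, \<open>T\<close> is that face and \<open>I = {1, 2, 3}\<close>, provided that inside \<open>T\<close> labels change between
  an edge and one of its ends for each of the three pairs of indices.

  If the sets \<open>C i\<close> cover the polytope, then some guess is met, because segments are connected and three
  closed convex sets that pairwise meet and have a convex union have a common point (Berge). Conversely,
  suppose that the conditions hold and a point is not covered. Three affine functions, nonnegative on
  the respective \<open>C i\<close>, are negative at that point. In a smallest face that contains such a point the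
  vertices and edges on the negative side of each function are connected, which forces all three
  kinds of label changes. Moving the point in the space of the three function values towards the
  boundary shows that this face is spanned by three vertices and contradicts the common point.

  The conditions are linear in \<open>x, y\<^sub>1, y\<^sub>2, y\<^sub>3\<close> and additional variables, so that every guess
  needs one linear program. With \<open>V\<close> vertices and \<open>E\<close> edges, feasibility programs detect the edges and
  smallest faces in \<open>V\<^sup>2 + V\<^sup>3 + V\<^sup>4\<close> calls, and \<open>V\<^sup>2 + V\<^sup>3 + V\<^sup>4 + 3 ^ (V + E) \<le> 7 ^ (V + E)\<close>.\<close>

section \<open>Faces described by weights\<close>

text \<open>The input lists only the vertices, so the edges have to be found by calls that count as
  well. There is room for them: a label is one of three indices, so the guesses use the base 3 only.
  Faces are described by weights and not by supporting hyperplanes, since then a test for membership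
  in a smallest face is the feasibility of a linear system, and since the geometry can be done in
  any real vector space. Topology enters only on the line, in the plane and in the space of three
  function values. That this space has dimension 3 is the reason for the triples: unless the image
  of a face is three-dimensional, Caratheodory's theorem represents each of its points by three
  vertices. There are polynomially many triples, and what is asked of their faces follows from the
  labels of vertices and edges, so that faces of higher dimension need no labels of their own. The
  common point in a condition is itself unknown. Its coordinates are multiplied by data only,
  because A and B do not depend on the scenario; otherwise they would meet \<open>x\<close> and
  \<open>y\<^sub>i\<close> in bilinear terms.\<close>

text \<open>\<open>cface V W\<close>: the set \<open>W\<close> is the trace on \<open>V\<close> of a face of \<open>convex hull V\<close>. The weights need
  not sum up to one, which makes the condition homogeneous and a matter of linear programming.\<close>

definition cface :: "'p::real_vector set \<Rightarrow> 'p set \<Rightarrow> bool" where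
  "cface V W \<longleftrightarrow> W \<subseteq> V \<and> (\<forall>a b. (\<forall>v\<in>V. 0 \<le> a v) \<and> (\<forall>v\<in>V. 0 \<le> b v) \<and> (\<forall>v\<in>V - W. b v = 0) \<and>
     sum a V = sum b V \<and> (\<Sum>v\<in>V. a v *\<^sub>R v) = (\<Sum>v\<in>V. b v *\<^sub>R v) \<longrightarrow> (\<forall>v\<in>V - W. a v = 0))"

lemma cfaceD:
  assumes "cface V W" "\<And>v. v \<in> V \<Longrightarrow> 0 \<le> a v" "\<And>v. v \<in> V \<Longrightarrow> 0 \<le> b v" "\<And>v. v \<in> V - W \<Longrightarrow> b v = 0"
    "sum a V = sum b V" "(\<Sum>v\<in>V. a v *\<^sub>R v) = (\<Sum>v\<in>V. b v *\<^sub>R v)" "v \<in> V - W"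
  shows "a v = 0"
  using assms unfolding cface_def by blast

lemma cface_subset: "cface V W \<Longrightarrow> W \<subseteq> V"
  by (simp add: cface_def)

section \<open>Affine functions and their faces of minimizers\<close>

definition affine_fun :: "('p::real_vector \<Rightarrow> real) \<Rightarrow> bool" where
  "affine_fun h \<longleftrightarrow> (\<exists>g c. linear g \<and> h = (\<lambda>x. g x + c))"

lemma affine_fun_weights:
  assumes "affine_fun h" "sum a V = sum b V" "(\<Sum>v\<in>V. a v *\<^sub>R v) = (\<Sum>v\<in>V. b v *\<^sub>R v)"
  shows "(\<Sum>v\<in>V. a v * h v) = (\<Sum>v\<in>V. b v * h v)"
proof -
  obtain g c where g: "linear g" "h = (\<lambda>x. g x + c)" using assms(1) unfolding affine_fun_def by blast
  have "(\<Sum>v\<in>V. a v * h v) = g (\<Sum>v\<in>V. a v *\<^sub>R v) + c * sum a V" for a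
    using g by (simp add: linear_sum linear_cmul ring_distribs sum.distrib sum_distrib_left mult.commute)
  then show ?thesis using assms by simp
qed

lemma affine_fun_sum:
  assumes "affine_fun h" "sum a V = 1"
  shows "h (\<Sum>v\<in>V. a v *\<^sub>R v) = (\<Sum>v\<in>V. a v * h v)"
proof -
  obtain g c where g: "linear g" "h = (\<lambda>x. g x + c)" using assms(1) unfolding affine_fun_def by blast
  have "(\<Sum>v\<in>V. a v * h v) = g (\<Sum>v\<in>V. a v *\<^sub>R v) + c * sum a V"
    using g by (simp add: linear_sum linear_cmul ring_distribs sum.distrib sum_distrib_left mult.commute)
  then show ?thesis using assms g by simp
qed

lemma affine_fun_between:
  assumes "affine_fun h"
  shows "h ((1 - t) *\<^sub>R x + t *\<^sub>R y) = (1 - t) * h x + t * h y"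
  using assms unfolding affine_fun_def
  by (auto simp: linear_add linear_cmul) (simp add: algebra_simps)

lemma affine_fun_comb:
  assumes "affine_fun f" "affine_fun g"
  shows "affine_fun (\<lambda>x. s * f x + t * g x)"
proof -
  obtain f' c where f: "linear f'" "f = (\<lambda>x. f' x + c)" using assms(1) unfolding affine_fun_def by blast
  obtain g' d where g: "linear g'" "g = (\<lambda>x. g' x + d)" using assms(2) unfolding affine_fun_def by blast
  have "linear (\<lambda>x. s * f' x + t * g' x)"
    using f g by (auto intro!: linearI simp: linear_add linear_cmul algebra_simps)
  then show ?thesis unfolding affine_fun_def f g
    by (intro exI[of _ "\<lambda>x. s * f' x + t * g' x"] exI[of _ "s * c + t * d"]) (auto simp: algebra_simps)
qed

text \<open>Weights \<open>a\<close> equivalent to weights \<open>b\<close> on the minimizers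
  satisfy \<open>(\<Sum>v\<in>V. a v * (h v - m)) = 0\<close>. They live on \<open>W\<close>, where
  all terms are nonnegative, so every term vanishes. As \<open>m\<close> is merely a lower bound,
  the result may be the empty face.\<close>

lemma cface_argmin:
  assumes V: "finite V" and W: "cface V W" and h: "affine_fun h" and m: "\<And>w. w \<in> W \<Longrightarrow> m \<le> h w"
  shows "cface V {w \<in> W. h w = m}"
  unfolding cface_def
proof (intro conjI allI impI ballI)
  show "{w \<in> W. h w = m} \<subseteq> V" using cface_subset[OF W] by auto
  fix a b v
  assume *: "(\<forall>v\<in>V. 0 \<le> a v) \<and> (\<forall>v\<in>V. 0 \<le> b v) \<and> (\<forall>v\<in>V - {w \<in> W. h w = m}. b v = 0) \<and>
     sum a V = sum b V \<and> (\<Sum>v\<in>V. a v *\<^sub>R v) = (\<Sum>v\<in>V. b v *\<^sub>R v)" and v: "v \<in> V - {w \<in> W. h w = m}"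
  have a0: "a v = 0" if "v \<in> V - W" for v
    by (rule cfaceD[OF W _ _ _ _ _ that, of a b]) (use * in auto)
  have "(\<Sum>v\<in>V. a v * (h v - m)) = (\<Sum>v\<in>V. b v * (h v - m))"
    using affine_fun_weights[OF h, of a V b] * by (simp add: right_diff_distrib sum_subtractf flip: sum_distrib_right)
  also have "\<dots> = 0" using * by (intro sum.neutral) auto
  finally have "\<forall>v\<in>V. a v * (h v - m) = 0"
  proof (subst (asm) sum_nonneg_eq_0_iff[OF V])
    fix v assume "v \<in> V"
    show "0 \<le> a v * (h v - m)"
    proof (cases "v \<in> W")
      case True then show ?thesis using * \<open>v \<in> V\<close> m[OF True] by simp
    next
      case False then show ?thesis using a0[of v] \<open>v \<in> V\<close> by simp
    qed
  qed auto
  then show "a v = 0" using v a0[of v] by (cases "v \<in> W") auto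
qed

text \<open>Defined by witnesses and not as the intersection of all faces around \<open>T\<close>:
  membership is then decided for each \<open>x\<close> separately by the feasibility of one linear
  system, which is what the algorithm can ask the solver.\<close>

definition minface :: "'p::real_vector set \<Rightarrow> 'p set \<Rightarrow> 'p set" where
  "minface V T = {x \<in> V. \<exists>a b. (\<forall>v\<in>V. 0 \<le> a v) \<and> (\<forall>v\<in>V. 0 \<le> b v) \<and> (\<forall>v\<in>V - T. b v = 0) \<and>
     sum a V = sum b V \<and> (\<Sum>v\<in>V. a v *\<^sub>R v) = (\<Sum>v\<in>V. b v *\<^sub>R v) \<and> 0 < a x}"

lemma minfaceI:
  assumes "x \<in> V" "\<And>v. v \<in> V \<Longrightarrow> 0 \<le> a v" "\<And>v. v \<in> V \<Longrightarrow> 0 \<le> b v" "\<And>v. v \<in> V - T \<Longrightarrow> b v = 0"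
    "sum a V = sum b V" "(\<Sum>v\<in>V. a v *\<^sub>R v) = (\<Sum>v\<in>V. b v *\<^sub>R v)" "0 < a x"
  shows "x \<in> minface V T"
  using assms unfolding minface_def by blast

lemma minface_subset_cface:
  assumes "cface V W" "T \<subseteq> W"
  shows "minface V T \<subseteq> W"
proof
  fix x assume "x \<in> minface V T"
  then obtain a b where "x \<in> V" and *: "\<forall>v\<in>V. 0 \<le> a v" "\<forall>v\<in>V. 0 \<le> b v" "\<forall>v\<in>V - T. b v = 0"
     "sum a V = sum b V" "(\<Sum>v\<in>V. a v *\<^sub>R v) = (\<Sum>v\<in>V. b v *\<^sub>R v)" "0 < a x"
    unfolding minface_def by blast
  show "x \<in> W"
  proof (rule ccontr)
    assume "x \<notin> W"
    then have "a x = 0" by (intro cfaceD[OF assms(1), of a b]) (use * assms \<open>x \<in> V\<close> in auto)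
    then show False using * by simp
  qed
qed

lemma subset_minface:
  assumes "finite V" "T \<subseteq> V"
  shows "T \<subseteq> minface V T"
proof
  fix x assume x: "x \<in> T"
  then show "x \<in> minface V T" using assms
    by (intro minfaceI[where a = "\<lambda>v. if v = x then 1 else 0" and b = "\<lambda>v. if v = x then 1 else 0"]) auto
qed

text \<open>Adding up the witnesses of all members gives one pair \<alpha>, \<beta> with \<alpha>
  positive on the whole of \<open>minface V T\<close> and \<beta> carried by \<open>T\<close>. If
  weights \<open>b\<close> on this set could be traded for weights \<open>a\<close> that charge a
  further vertex \<open>x\<close>, the trade could be made within a small part of \<alpha>, and the
  result would be a witness for \<open>x\<close>.\<close>

lemma cface_minface:
  assumes V: "finite V"
  shows "cface V (minface V T)"
proof -
  let ?W = "minface V T"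
  have WV: "?W \<subseteq> V" by (auto simp: minface_def)
  then have fW: "finite ?W" using V finite_subset by blast
  define P where "P x a b \<longleftrightarrow> (\<forall>v\<in>V. 0 \<le> a v) \<and> (\<forall>v\<in>V. 0 \<le> b v) \<and> (\<forall>v\<in>V - T. b v = 0) \<and>
     sum a V = sum b V \<and> (\<Sum>v\<in>V. a v *\<^sub>R v) = (\<Sum>v\<in>V. b v *\<^sub>R v) \<and> 0 < a x" for x and a b :: "'a \<Rightarrow> real"
  have "\<forall>x\<in>?W. \<exists>a b. P x a b" by (auto simp: minface_def P_def)
  then obtain A B where "\<forall>x\<in>?W. P x (A x) (B x)" by metis
  then have AB: "\<And>x v. x \<in> ?W \<Longrightarrow> v \<in> V \<Longrightarrow> 0 \<le> A x v" "\<And>x v. x \<in> ?W \<Longrightarrow> v \<in> V \<Longrightarrow> 0 \<le> B x v"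
      "\<And>x v. x \<in> ?W \<Longrightarrow> v \<in> V - T \<Longrightarrow> B x v = 0" "\<And>x. x \<in> ?W \<Longrightarrow> sum (A x) V = sum (B x) V"
      "\<And>x. x \<in> ?W \<Longrightarrow> (\<Sum>v\<in>V. A x v *\<^sub>R v) = (\<Sum>v\<in>V. B x v *\<^sub>R v)" "\<And>x. x \<in> ?W \<Longrightarrow> 0 < A x x"
    by (simp_all add: P_def)
  define \<alpha> where "\<alpha> = (\<lambda>v. \<Sum>x\<in>?W. A x v)"
  define \<beta> where "\<beta> = (\<lambda>v. \<Sum>x\<in>?W. B x v)"
  have nn: "v \<in> V \<Longrightarrow> 0 \<le> \<alpha> v" "v \<in> V \<Longrightarrow> 0 \<le> \<beta> v" for v
    using AB by (auto simp: \<alpha>_def \<beta>_def intro!: sum_nonneg)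
  have \<beta>0: "v \<in> V - T \<Longrightarrow> \<beta> v = 0" for v using AB by (auto simp: \<beta>_def intro!: sum.neutral)
  have s1: "sum \<alpha> V = sum \<beta> V"
    unfolding \<alpha>_def \<beta>_def sum.swap[of _ _ V] by (intro sum.cong refl AB(4))
  have s2: "(\<Sum>v\<in>V. \<alpha> v *\<^sub>R v) = (\<Sum>v\<in>V. \<beta> v *\<^sub>R v)" 
    unfolding \<alpha>_def \<beta>_def scaleR_sum_left sum.swap[of _ _ V] by (intro sum.cong refl AB(5))
  have pos: "0 < \<alpha> x" if "x \<in> ?W" for x
    unfolding \<alpha>_def using AB WV that by (intro sum_pos2[OF fW that]) auto
  show ?thesis unfolding cface_def
  proof (intro conjI allI impI ballI)
    show "?W \<subseteq> V" by (rule WV)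
    fix a b x
    assume *: "(\<forall>v\<in>V. 0 \<le> a v) \<and> (\<forall>v\<in>V. 0 \<le> b v) \<and> (\<forall>v\<in>V - ?W. b v = 0) \<and>
     sum a V = sum b V \<and> (\<Sum>v\<in>V. a v *\<^sub>R v) = (\<Sum>v\<in>V. b v *\<^sub>R v)" and x: "x \<in> V - ?W"
    show "a x = 0"
    proof (rule ccontr)
      assume "a x \<noteq> 0"
      then have ax: "a x > 0" using * x by (metis DiffD1 less_eq_real_def)
      \<comment> \<open>Small enough for \<open>\<alpha> v - e * b v\<close> to stay nonnegative.
        Adding 1 to \<open>b v\<close> avoids a division by zero, and the inserted 1 keeps the set
        nonempty.\<close>
      define e where "e = Min (insert 1 ((\<lambda>v. \<alpha> v / (b v + 1)) ` ?W))"
      have e: "e > 0" unfolding e_def using fW pos * WV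
        by (subst Min_gr_iff) (auto intro!: divide_pos_pos add_nonneg_pos)
      have eb: "e * b v \<le> \<alpha> v" if "v \<in> V" for v
      proof (cases "v \<in> ?W")
        case True
        then have "e \<le> \<alpha> v / (b v + 1)" unfolding e_def using fW by (intro Min_le) auto
        moreover have b: "0 \<le> b v" using * that by auto
        ultimately have "e * (b v + 1) \<le> \<alpha> v" by (simp add: pos_le_divide_eq)
        then show ?thesis using e by (simp add: algebra_simps)
      next
        case False then show ?thesis using * that nn by auto
      qed
      have "x \<in> minface V T"
      proof (rule minfaceI[where a = "\<lambda>v. \<alpha> v - e * b v + e * a v" and b = \<beta>])
        show "x \<in> V" using x by auto
        show "0 \<le> \<alpha> v - e * b v + e * a v" if "v \<in> V" for v using eb[OF that] e * that
          by (simp add: add_nonneg_nonneg)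
        show "0 < \<alpha> x - e * b x + e * a x" using eb[of x] e ax x
          by (simp add: add_nonneg_pos)
        show "sum (\<lambda>v. \<alpha> v - e * b v + e * a v) V = sum \<beta> V"
          using s1 * by (simp add: sum.distrib sum_subtractf flip: sum_distrib_left)
        show "(\<Sum>v\<in>V. (\<alpha> v - e * b v + e * a v) *\<^sub>R v) = (\<Sum>v\<in>V. \<beta> v *\<^sub>R v)"
        proof -
          have "(\<Sum>v\<in>V. (\<alpha> v - e * b v + e * a v) *\<^sub>R v) =
             (\<Sum>v\<in>V. \<alpha> v *\<^sub>R v) - e *\<^sub>R (\<Sum>v\<in>V. b v *\<^sub>R v) + e *\<^sub>R (\<Sum>v\<in>V. a v *\<^sub>R v)"
            by (simp add: scaleR_add_left scaleR_diff_left sum.distrib sum_subtractf scaleR_sum_right)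
          then show ?thesis using s2 * by simp
        qed
      qed (use nn \<beta>0 in auto)
      then show False using x by simp
    qed
  qed
qed

section \<open>Edges at a vertex of a face\<close>

lemma sum_pair_supp:
  fixes g :: "'a \<Rightarrow> 'b::comm_monoid_add"
  assumes "finite V" "u \<in> V" "v \<in> V" "u \<noteq> v" "\<And>x. x \<in> V - {u, v} \<Longrightarrow> g x = 0"
  shows "sum g V = g u + g v"
proof -
  have "sum g V = sum g {u, v}" using assms by (intro sum.mono_neutral_right) auto
  then show ?thesis using assms by simp
qed

text \<open>Unnormalized weights \<open>r\<close> and \<open>s\<close> let one lemma serve whichever
  of three collinear points lies in the middle.\<close>

lemma cface_single_not_between:
  assumes V: "finite V" and y: "cface V {y}" and uv: "u \<in> V" "v \<in> V" "u \<noteq> v" "u \<noteq> y"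
    and t: "0 \<le> s" "0 < r" and eq: "(s + r) *\<^sub>R y = r *\<^sub>R u + s *\<^sub>R v"
  shows False
proof -
  have yV: "y \<in> V" using y by (simp add: cface_def)
  define a where "a = (\<lambda>w. (if w = u then r else 0) + (if w = v then s else 0))"
  define b where "b = (\<lambda>w. if w = y then r + s else 0)"
  have "a u = 0"
  proof (rule cfaceD[OF y, of a b])
    have "sum a V = r + s" using V uv by (simp add: a_def sum.distrib)
    then show "sum a V = sum b V" using V yV by (simp add: b_def)
    have "(\<Sum>v\<in>V. a v *\<^sub>R v) = r *\<^sub>R u + s *\<^sub>R v"
      using V uv by (simp add: a_def scaleR_add_left sum.distrib if_distrib[of "\<lambda>x. x *\<^sub>R _"] cong: if_cong)
    moreover have "(\<Sum>v\<in>V. b v *\<^sub>R v) = (r + s) *\<^sub>R y"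
      using V yV by (simp add: b_def if_distrib[of "\<lambda>x. x *\<^sub>R _"] cong: if_cong)
    ultimately show "(\<Sum>v\<in>V. a v *\<^sub>R v) = (\<Sum>v\<in>V. b v *\<^sub>R v)" using eq by (simp add: add.commute)
  qed (use t uv in \<open>auto simp: a_def b_def\<close>)
  then show False using t by (auto simp: a_def split: if_splits)
qed

text \<open>The edge directions at a vertex generate the cone of the face at that vertex: a minimal
  generating set of the cone can only consist of edge directions.\<close>

lemma cface_neighbour:
  assumes V: "finite V" and V1: "\<And>v. v \<in> V \<Longrightarrow> cface V {v}" and W: "cface V W"
    and u: "u \<in> W" and x: "x \<in> W" and h: "affine_fun h" and less: "h x < h u"
  shows "\<exists>v\<in>W. cface V {u, v} \<and> h v < h u"
proof -
  have WV: "W \<subseteq> V" and fW: "finite W" using W V finite_subset by (auto simp: cface_def)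
  \<comment> \<open>The cone of \<open>W\<close> at \<open>u\<close> is generated by the directions
    from \<open>u\<close> to the members of \<open>S\<close>; a smallest such \<open>S\<close> will
    turn out to consist of neighbours of \<open>u\<close>.\<close>
  define gen where "gen S \<longleftrightarrow> S \<subseteq> W - {u} \<and>
     (\<forall>w\<in>W. \<exists>c. (\<forall>s\<in>S. 0 \<le> c s) \<and> w - u = (\<Sum>s\<in>S. c s *\<^sub>R (s - u)))" for S
  have "gen (W - {u})" unfolding gen_def
  proof (intro conjI ballI)
    fix w assume w: "w \<in> W"
    show "\<exists>c. (\<forall>s\<in>W - {u}. 0 \<le> c s) \<and> w - u = (\<Sum>s\<in>W - {u}. c s *\<^sub>R (s - u))"
      using w fW by (intro exI[of _ "\<lambda>s. if s = w then 1 else 0"])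
        (auto simp: if_distrib[of "\<lambda>x. x *\<^sub>R _"] cong: if_cong)
  qed auto
  then have "\<exists>S. gen S \<and> (\<forall>S'. gen S' \<longrightarrow> card S \<le> card S')"
    using ex_has_least_nat[of gen "W - {u}" card] by auto
  then obtain S where gS: "gen S" and minS: "\<And>S'. gen S' \<Longrightarrow> card S \<le> card S'" by blast
  have SW: "S \<subseteq> W - {u}" and fS: "finite S" using gS fW finite_subset[of S W] by (auto simp: gen_def)
  have "\<forall>w\<in>W. \<exists>c. (\<forall>s\<in>S. 0 \<le> c s) \<and> w - u = (\<Sum>s\<in>S. c s *\<^sub>R (s - u))" using gS gen_def by auto
  then obtain C where C: "\<And>w s. w \<in> W \<Longrightarrow> s \<in> S \<Longrightarrow> 0 \<le> C w s"
    "\<And>w. w \<in> W \<Longrightarrow> w - u = (\<Sum>s\<in>S. C w s *\<^sub>R (s - u))" unfolding bchoice_iff by metis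
  obtain g c where g: "linear g" "h = (\<lambda>x. g x + c)" using h unfolding affine_fun_def by blast
  have "h x - h u = g (x - u)" using g by (simp add: linear_diff)
  also have "\<dots> = (\<Sum>s\<in>S. C x s * (h s - h u))"
    by (subst C(2)[OF x]) (use g in \<open>simp add: linear_sum linear_cmul linear_diff\<close>)
  \<comment> \<open>\<open>x - u\<close> is a nonnegative combination of the generators and
    \<open>h\<close> decreases along it, so it decreases along one of them.\<close>
  finally have "\<not> (\<forall>s\<in>S. h u \<le> h s)" using less C(1)[OF x] sum_nonneg[of S "\<lambda>s. C x s * (h s - h u)"] by force
  then obtain v where v: "v \<in> S" "h v < h u" by (auto simp: not_le)
  have vu: "v \<noteq> u" "v \<in> W" "v \<in> V" "u \<in> V" using v SW WV u by auto
  have "cface V {u, v}" unfolding cface_def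
  proof (intro conjI allI impI ballI)
    show "{u, v} \<subseteq> V" using vu by auto
    fix a b y
    assume *: "(\<forall>v\<in>V. 0 \<le> a v) \<and> (\<forall>v\<in>V. 0 \<le> b v) \<and> (\<forall>w\<in>V - {u, v}. b w = 0) \<and>
     sum a V = sum b V \<and> (\<Sum>v\<in>V. a v *\<^sub>R v) = (\<Sum>v\<in>V. b v *\<^sub>R v)" and y: "y \<in> V - {u, v}"
    have aW: "a w = 0" if "w \<in> V - W" for w
      by (rule cfaceD[OF W, of a b]) (use * vu u that in auto)
    define \<kappa> where "\<kappa> s = (\<Sum>w\<in>W. a w * C w s)" for s
    have \<kappa>: "0 \<le> \<kappa> s" if "s \<in> S" for s using * C(1) that WV by (auto simp: \<kappa>_def intro!: sum_nonneg)
    have "b v *\<^sub>R (v - u) = (\<Sum>w\<in>V. b w *\<^sub>R (w - u))"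
      using * vu V by (subst sum_pair_supp[of V u v]) auto
    also have "\<dots> = (\<Sum>w\<in>V. b w *\<^sub>R w) - sum b V *\<^sub>R u"
      by (simp add: scaleR_diff_right sum_subtractf scaleR_sum_left)
    also have "\<dots> = (\<Sum>w\<in>V. a w *\<^sub>R w) - sum a V *\<^sub>R u" using * by simp
    also have "\<dots> = (\<Sum>w\<in>V. a w *\<^sub>R (w - u))"
      by (simp add: scaleR_diff_right sum_subtractf scaleR_sum_left)
    also have "\<dots> = (\<Sum>w\<in>W. a w *\<^sub>R (w - u))"
      using V WV aW by (intro sum.mono_neutral_right) auto
    also have "\<dots> = (\<Sum>w\<in>W. \<Sum>s\<in>S. (a w * C w s) *\<^sub>R (s - u))"
      by (intro sum.cong refl) (subst C(2), auto simp: scaleR_sum_right)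
    also have "\<dots> = (\<Sum>s\<in>S. \<kappa> s *\<^sub>R (s - u))" by (subst sum.swap) (simp add: \<kappa>_def scaleR_sum_left)
    also have "\<dots> = \<kappa> v *\<^sub>R (v - u) + (\<Sum>s\<in>S - {v}. \<kappa> s *\<^sub>R (s - u))"
      using v fS by (simp add: sum.remove)
    finally have rel: "b v *\<^sub>R (v - u) = \<kappa> v *\<^sub>R (v - u) + (\<Sum>s\<in>S - {v}. \<kappa> s *\<^sub>R (s - u))" .
    show "a y = 0"
    proof (rule ccontr)
      assume ay: "a y \<noteq> 0"
      then have yW: "y \<in> W" using aW y by auto
      show False
      \<comment> \<open>In the first case \<open>rel\<close> expresses \<open>v - u\<close> by the
        other generators, against minimality. Otherwise it is a nonnegative combination of
        directions that vanishes, and a vertex \<open>u\<close> admits only the trivial one. Then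
        all \<open>\<kappa> s\<close> with \<open>s \<noteq> v\<close> are zero, so that
        \<open>y\<close>, which has positive weight, uses the direction to \<open>v\<close>
        only.\<close>
      proof (cases "\<kappa> v < b v")
        case True
        define \<delta> where "\<delta> s = \<kappa> s / (b v - \<kappa> v)" for s
        have "(b v - \<kappa> v) *\<^sub>R (v - u) = (\<Sum>s\<in>S - {v}. \<kappa> s *\<^sub>R (s - u))" using rel by (simp add: scaleR_diff_left)
        then have "(1 / (b v - \<kappa> v)) *\<^sub>R (b v - \<kappa> v) *\<^sub>R (v - u) = (1 / (b v - \<kappa> v)) *\<^sub>R (\<Sum>s\<in>S - {v}. \<kappa> s *\<^sub>R (s - u))"
          by simp
        then have d: "v - u = (\<Sum>s\<in>S - {v}. \<delta> s *\<^sub>R (s - u))"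
          using True by (simp add: \<delta>_def scaleR_sum_right)
        have "gen (S - {v})" unfolding gen_def
        proof (intro conjI ballI)
          show "S - {v} \<subseteq> W - {u}" using SW by auto
          fix w assume w: "w \<in> W"
          have "w - u = C w v *\<^sub>R (v - u) + (\<Sum>s\<in>S - {v}. C w s *\<^sub>R (s - u))"
            using C(2)[OF w] v fS by (simp add: sum.remove)
          also have "\<dots> = (\<Sum>s\<in>S - {v}. (C w v * \<delta> s + C w s) *\<^sub>R (s - u))"
            by (subst d) (simp add: scaleR_add_left scaleR_sum_right sum.distrib)
          finally show "\<exists>c. (\<forall>s\<in>S - {v}. 0 \<le> c s) \<and> w - u = (\<Sum>s\<in>S - {v}. c s *\<^sub>R (s - u))"
            using C(1)[OF w] \<kappa> True v by (intro exI conjI) (auto simp: \<delta>_def)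
        qed
        from minS[OF this] show False using card_Diff1_less[OF fS \<open>v \<in> S\<close>] by simp
      next
        case False
        define \<delta> where "\<delta> s = (if s \<in> S then (if s = v then \<kappa> v - b v else \<kappa> s) else 0)" for s
        have \<delta>0: "0 \<le> \<delta> s" for s using \<kappa> False by (auto simp: \<delta>_def)
        have "(\<Sum>s\<in>V. \<delta> s *\<^sub>R (s - u)) = (\<Sum>s\<in>S. \<delta> s *\<^sub>R (s - u))"
          using SW WV V by (intro sum.mono_neutral_right) (auto simp: \<delta>_def)
        also have "\<dots> = (\<kappa> v - b v) *\<^sub>R (v - u) + (\<Sum>s\<in>S - {v}. \<kappa> s *\<^sub>R (s - u))"
          using v fS by (simp add: sum.remove \<delta>_def)
        also have "\<dots> = 0" using rel by (simp add: scaleR_diff_left)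
        finally have z: "(\<Sum>s\<in>V. \<delta> s *\<^sub>R s) = sum \<delta> V *\<^sub>R u"
          by (simp add: scaleR_diff_right sum_subtractf scaleR_sum_left)
        have \<delta>z: "\<delta> s = 0" if "s \<in> V - {u}" for s
        proof (rule cfaceD[OF V1[OF \<open>u \<in> V\<close>], of \<delta> "\<lambda>w. if w = u then sum \<delta> V else 0"])
          show "(\<Sum>v\<in>V. \<delta> v *\<^sub>R v) = (\<Sum>v\<in>V. (if v = u then sum \<delta> V else 0) *\<^sub>R v)"
            using z V vu by (simp add: if_distrib[of "\<lambda>x. x *\<^sub>R _"] cong: if_cong)
        qed (use \<delta>0 V vu that in \<open>auto intro!: sum_nonneg\<close>)
        have "\<kappa> s = 0" if "s \<in> S - {v}" for s
        proof -
          have "s \<in> V - {u}" using that SW WV by auto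
          from \<delta>z[OF this] show ?thesis using that by (auto simp: \<delta>_def split: if_splits)
        qed
        then have Cy: "C y s = 0" if "s \<in> S - {v}" for s
        proof -
          have "\<forall>w\<in>W. a w * C w s = 0"
            using \<open>\<And>s. s \<in> S - {v} \<Longrightarrow> \<kappa> s = 0\<close>[OF that] unfolding \<kappa>_def
            by (subst (asm) sum_nonneg_eq_0_iff[OF fW]) (use * C(1) that WV in auto)
          then show ?thesis using yW ay by auto
        qed
        have "y - u = C y v *\<^sub>R (v - u) + (\<Sum>s\<in>S - {v}. C y s *\<^sub>R (s - u))"
          using C(2)[OF yW] v fS by (simp add: sum.remove)
        then have yu: "y - u = C y v *\<^sub>R (v - u)" using Cy by simp
        define t where "t = C y v"
        have t: "0 \<le> t" using C(1)[OF yW] v by (simp add: t_def)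
        have yu': "y = (1 - t) *\<^sub>R u + t *\<^sub>R v" using yu unfolding t_def
          by (simp add: algebra_simps)
        have "t \<noteq> 1" using yu' y by auto
        \<comment> \<open>Either \<open>y\<close> lies between \<open>u\<close> and
          \<open>v\<close>, or \<open>v\<close> lies between \<open>u\<close> and \<open>y\<close>;
          a vertex cannot be the one in the middle.\<close>
        consider "t < 1" | "t > 1" using \<open>t \<noteq> 1\<close> by linarith
        then show False
        proof cases
          case 1
          show False by (rule cface_single_not_between[of V y u v t "1 - t"])
            (use V V1 y vu t 1 yu' in auto)
        next
          case 2
          show False
          proof (rule cface_single_not_between[of V v y u "t - 1" 1])
            show "(t - 1 + 1) *\<^sub>R v = 1 *\<^sub>R y + (t - 1) *\<^sub>R u" by (simp add: yu' algebra_simps)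
          qed (use V V1 y vu t 2 in auto)
        qed
      qed
    qed
  qed
  then show ?thesis using v vu by blast
qed

section \<open>Connectivity of the vertex-edge graph on one side of a hyperplane\<close>

definition adj :: "'p::real_vector set \<Rightarrow> 'p set \<Rightarrow> ('p \<times> 'p) set" where
  "adj V U = {(u, v). u \<in> U \<and> v \<in> U \<and> cface V {u, v}}"

lemma adj_rtrancl_mono: "U \<subseteq> U' \<Longrightarrow> (u, v) \<in> (adj V U)\<^sup>* \<Longrightarrow> (u, v) \<in> (adj V U')\<^sup>*"
  by (rule rtrancl_mono[THEN subsetD, of "adj V U"]) (auto simp: adj_def)

lemma adj_rtrancl_sym: "(u, v) \<in> (adj V U)\<^sup>* \<Longrightarrow> (v, u) \<in> (adj V U)\<^sup>*"
proof -
  have "sym (adj V U)" by (auto simp: sym_def adj_def insert_commute)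
  then show "(u, v) \<in> (adj V U)\<^sup>* \<Longrightarrow> (v, u) \<in> (adj V U)\<^sup>*" using sym_rtrancl[of "adj V U"] by (simp add: sym_def)
qed

text \<open>The descent of the simplex method: unless the minimum is reached,
  \<open>cface_neighbour\<close> supplies an edge of the face to a lower vertex, and fewer vertices
  remain below that one. The path is confined to the sublevel set of \<open>h u\<close>, so that it
  never leaves an open half-space in which it starts.\<close>

lemma descend:
  assumes V: "finite V" and V1: "\<And>v. v \<in> V \<Longrightarrow> cface V {v}" and W: "cface V W"
    and h: "affine_fun h" and m: "\<And>w. w \<in> W \<Longrightarrow> m \<le> h w" "\<exists>w\<in>W. h w = m"
  shows "u \<in> W \<Longrightarrow> \<exists>w\<in>W. h w = m \<and> (u, w) \<in> (adj V {x \<in> W. h x \<le> h u})\<^sup>*"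
proof (induction "card {x \<in> W. h x < h u}" arbitrary: u rule: less_induct)
  case less
  have fW: "finite W" using W V finite_subset by (auto simp: cface_def)
  show ?case
  proof (cases "h u = m")
    case True then show ?thesis using less by blast
  next
    case False
    obtain x where "x \<in> W" "h x = m" using m by blast
    then have "h x < h u" using m(1)[OF less.prems] False by simp
    from cface_neighbour[OF V V1 W less.prems \<open>x \<in> W\<close> h this]
    obtain v where v: "v \<in> W" "cface V {u, v}" "h v < h u" by blast
    have "{x \<in> W. h x < h v} \<subset> {x \<in> W. h x < h u}" using v by auto
    then have "card {x \<in> W. h x < h v} < card {x \<in> W. h x < h u}"
      using fW by (intro psubset_card_mono) auto
    from less.hyps[OF this v(1)] obtain w where w: "w \<in> W" "h w = m"
      "(v, w) \<in> (adj V {x \<in> W. h x \<le> h v})\<^sup>*" by blast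
    have "(v, w) \<in> (adj V {x \<in> W. h x \<le> h u})\<^sup>*" by (rule adj_rtrancl_mono[OF _ w(3)]) (use v in auto)
    moreover have "(u, v) \<in> adj V {x \<in> W. h x \<le> h u}" using less.prems v by (auto simp: adj_def)
    ultimately have "(u, w) \<in> (adj V {x \<in> W. h x \<le> h u})\<^sup>*" by (rule converse_rtrancl_into_rtrancl[rotated])
    then show ?thesis using w by blast
  qed
qed

lemma exists_min: "finite W \<Longrightarrow> W \<noteq> {} \<Longrightarrow> \<exists>m. (\<forall>w\<in>W. m \<le> h w) \<and> (\<exists>w\<in>W. h w = (m::real))"
proof (intro exI conjI ballI)
  assume *: "finite W" "W \<noteq> {}"
  show "Min (h ` W) \<le> h w" if "w \<in> W" for w using * that by simp
  have "Min (h ` W) \<in> h ` W" using * by (intro Min_in) auto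
  then show "\<exists>w\<in>W. h w = Min (h ` W)" by auto
qed

text \<open>A linear function that separates the two vertices is minimal on a proper face. Both
  vertices descend to this face, whose graph is connected by induction on the number of
  vertices.\<close>

lemma cface_connected:
  assumes V: "finite V" and V1: "\<And>v. v \<in> V \<Longrightarrow> cface V {v}"
  shows "cface V W \<Longrightarrow> u \<in> W \<Longrightarrow> v \<in> W \<Longrightarrow> (u, v) \<in> (adj V W)\<^sup>*"
proof (induction "card W" arbitrary: W u v rule: less_induct)
  case less
  have fW: "finite W" using less.prems V finite_subset by (auto simp: cface_def)
  show ?case
  proof (cases "u = v")
    case False
    \<comment> \<open>No inner product is available; a functional that separates \<open>u\<close>
      from \<open>v\<close> arises by extension from the single vector \<open>u - v\<close>.\<close>
    have "independent {u - v}" using False by simp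
    then obtain h :: "'a \<Rightarrow> real" where h: "linear h" "\<forall>x\<in>{u - v}. h x = 1"
      using linear_independent_extend[of "{u - v}" "\<lambda>_. 1"] by blast
    have ah: "affine_fun h" unfolding affine_fun_def using h(1) by (intro exI[of _ h] exI[of _ 0]) auto
    have huv: "h u \<noteq> h v" using h False by (simp add: linear_diff)
    obtain m where m: "\<And>w. w \<in> W \<Longrightarrow> m \<le> h w" "\<exists>w\<in>W. h w = m"
      using exists_min[OF fW, of h] less.prems by blast
    let ?W = "{w \<in> W. h w = m}"
    have "?W \<noteq> W" using huv less.prems by (metis (mono_tags, lifting) mem_Collect_eq)
    then have "?W \<subset> W" by auto
    then have card: "card ?W < card W" using fW by (simp add: psubset_card_mono)
    have face: "cface V ?W" by (rule cface_argmin[OF V less.prems(1) ah m(1)])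
    obtain x where x: "x \<in> W" "h x = m" "(u, x) \<in> (adj V {x \<in> W. h x \<le> h u})\<^sup>*"
      using descend[OF V V1 less.prems(1) ah m less.prems(2)] by blast
    obtain y where y: "y \<in> W" "h y = m" "(v, y) \<in> (adj V {x \<in> W. h x \<le> h v})\<^sup>*"
      using descend[OF V V1 less.prems(1) ah m less.prems(3)] by blast
    have "(x, y) \<in> (adj V ?W)\<^sup>*" by (rule less.hyps[OF card face]) (use x y in auto)
    then have "(x, y) \<in> (adj V W)\<^sup>*" by (rule adj_rtrancl_mono[rotated]) auto
    moreover have "(u, x) \<in> (adj V W)\<^sup>*" by (rule adj_rtrancl_mono[OF _ x(3)]) auto
    moreover have "(v, y) \<in> (adj V W)\<^sup>*" by (rule adj_rtrancl_mono[OF _ y(3)]) auto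
    ultimately show ?thesis using adj_rtrancl_sym[of v y] by (blast intro: rtrancl_trans)
  qed auto
qed

text \<open>The descents from both ends stay negative and arrive in the face of minimizers, whose
  graph is connected and on which \<open>h\<close> has the negative value \<open>m\<close>.\<close>

lemma halfspace_connected:
  assumes V: "finite V" and V1: "\<And>v. v \<in> V \<Longrightarrow> cface V {v}" and W: "cface V W" and h: "affine_fun h"
    and u: "u \<in> W" "h u < 0" and v: "v \<in> W" "h v < 0"
  shows "(u, v) \<in> (adj V {w \<in> W. h w < 0})\<^sup>*"
proof -
  have fW: "finite W" using W V finite_subset by (auto simp: cface_def)
  obtain m where m: "\<And>w. w \<in> W \<Longrightarrow> m \<le> h w" "\<exists>w\<in>W. h w = m"
      using exists_min[OF fW, of h] u by blast
  let ?W = "{w \<in> W. h w = m}"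
  have m0: "m < 0" using m(1)[OF u(1)] u by simp
  have face: "cface V ?W" by (rule cface_argmin[OF V W h m(1)])
  obtain x where x: "x \<in> W" "h x = m" "(u, x) \<in> (adj V {x \<in> W. h x \<le> h u})\<^sup>*"
    using descend[OF V V1 W h m u(1)] by blast
  obtain y where y: "y \<in> W" "h y = m" "(v, y) \<in> (adj V {x \<in> W. h x \<le> h v})\<^sup>*"
    using descend[OF V V1 W h m v(1)] by blast
  have "(x, y) \<in> (adj V ?W)\<^sup>*" by (rule cface_connected[OF V V1 face]) (use x y in auto)
  then have "(x, y) \<in> (adj V {w \<in> W. h w < 0})\<^sup>*" by (rule adj_rtrancl_mono[rotated]) (use m0 in auto)
  moreover have "(u, x) \<in> (adj V {w \<in> W. h w < 0})\<^sup>*" by (rule adj_rtrancl_mono[OF _ x(3)]) (use u in auto)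
  moreover have "(v, y) \<in> (adj V {w \<in> W. h w < 0})\<^sup>*" by (rule adj_rtrancl_mono[OF _ y(3)]) (use v in auto)
  ultimately show ?thesis using adj_rtrancl_sym[of v y] by (blast intro: rtrancl_trans)
qed

lemma affine_fun_neg_vertex:
  assumes V: "finite V" and h: "affine_fun h" and p: "p \<in> convex hull V" "h p < 0"
  shows "\<exists>v\<in>V. h v < 0"
proof (rule ccontr)
  assume "\<not> ?thesis"
  then have nn: "\<forall>v\<in>V. 0 \<le> h v" by auto
  obtain a where a: "\<forall>v\<in>V. 0 \<le> a v" "sum a V = 1" "(\<Sum>v\<in>V. a v *\<^sub>R v) = p"
    using p V by (auto simp: convex_hull_finite)
  have "h p = (\<Sum>v\<in>V. a v * h v)" using affine_fun_sum[OF h a(2)] a(3) by simp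
  also have "\<dots> \<ge> 0" using a nn by (intro sum_nonneg) auto
  finally show False using p by simp
qed

text \<open>Suppose that no edge works. For every \<mu> in the unit interval \<open>h \<mu>\<close>
  is negative at \<open>p\<close>, hence at a vertex, and there exactly one of \<open>f\<close> and
  \<open>g\<close> is negative. The parameters with a vertex of the first kind and those with a
  vertex of the second kind form open sets that cover the interval, so some \<mu> belongs to both.
  The negative side of this \<open>h \<mu>\<close> is connected, and a path from one kind to the
  other runs along an edge with a point where \<open>f = g\<close>. Both equal
  \<open>h \<mu>\<close> there and are negative.\<close>

lemma two_halfspaces_edge:
  assumes V: "finite V" and V1: "\<And>v. v \<in> V \<Longrightarrow> cface V {v}" and W: "cface V W"
    and f: "affine_fun f" and g: "affine_fun g" and p: "p \<in> convex hull W" "f p < 0" "g p < 0"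
  shows "\<exists>u\<in>W. \<exists>v\<in>W. cface V {u, v} \<and>
    (\<exists>t. 0 \<le> t \<and> t \<le> 1 \<and> f ((1 - t) *\<^sub>R u + t *\<^sub>R v) < 0 \<and> g ((1 - t) *\<^sub>R u + t *\<^sub>R v) < 0)"
proof (rule ccontr)
  assume no: "\<not> ?thesis"
  have fW: "finite W" and WV: "W \<subseteq> V" using W V finite_subset by (auto simp: cface_def)
  \<comment> \<open>A vertex counts as the degenerate edge with \<open>u = v\<close>.\<close>
  have nov: "\<not> (f v < 0 \<and> g v < 0)" if "v \<in> W" for v
  proof
    assume "f v < 0 \<and> g v < 0"
    then show False using that V1 WV by - (rule notE[OF no], intro bexI[of _ v] conjI exI[of _ 0], auto)
  qed
  define h where "h \<mu> x = \<mu> * f x + (1 - \<mu>) * g x" for \<mu> x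
  have ah: "affine_fun (h \<mu>)" for \<mu> unfolding h_def[abs_def] by (rule affine_fun_comb[OF f g])
  have hp: "h \<mu> p < 0" if "0 \<le> \<mu>" "\<mu> \<le> 1" for \<mu>
  proof (cases "\<mu> = 0")
    case False
    then have "\<mu> * f p < 0" "(1 - \<mu>) * g p \<le> 0" using that p by (auto simp: mult_less_0_iff mult_le_0_iff)
    then show ?thesis by (simp add: h_def)
  qed (use p in \<open>simp add: h_def\<close>)
  define M where "M k = (\<Union>v\<in>{v \<in> W. k v < 0}. {\<mu>. h \<mu> v < 0})" for k :: "'a \<Rightarrow> real"
  have opM: "open (M k)" for k unfolding M_def h_def
    by (intro open_UN ballI open_Collect_less continuous_intros)
  have cov: "{0..1} \<subseteq> M f \<union> M g"
  proof
    fix \<mu> :: real assume \<mu>: "\<mu> \<in> {0..1}"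
    then obtain v where v: "v \<in> W" "h \<mu> v < 0" using affine_fun_neg_vertex[OF fW ah p(1) hp] by auto
    then have "f v < 0 \<or> g v < 0" using \<mu> unfolding h_def
      by (smt (verit, ccfv_threshold) atLeastAtMost_iff mult_nonneg_nonneg)
    then show "\<mu> \<in> M f \<union> M g" using v by (auto simp: M_def)
  qed
  have ne: "0 \<in> M g" "1 \<in> M f"
    using affine_fun_neg_vertex[OF fW g p(1,3)] affine_fun_neg_vertex[OF fW f p(1,2)] by (auto simp: M_def h_def)
  have step: "f v < 0" if uv: "(u, v) \<in> adj V {w \<in> W. h \<mu> w < 0}" and u: "f u < 0" and \<mu>: "0 \<le> \<mu>" "\<mu> \<le> 1" for u v \<mu>
  proof (rule ccontr)
    assume v: "\<not> f v < 0"
    have uvW: "u \<in> W" "v \<in> W" "cface V {u, v}" "h \<mu> u < 0" "h \<mu> v < 0" using uv by (auto simp: adj_def)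
    have gv: "g v < 0" using uvW(5) v \<mu> unfolding h_def by (smt (verit) mult_nonneg_nonneg)
    have gu: "\<not> g u < 0" using nov[OF uvW(1)] u by auto
    \<comment> \<open>The difference \<open>g - f\<close> changes its sign along the edge;
      \<open>t\<close> is the parameter at which it vanishes.\<close>
    define r where "r = (g u - f u) + (f v - g v)"
    define t where "t = (g u - f u) / r"
    have r: "r > 0" using u v gv gu by (simp add: r_def)
    have t: "0 \<le> t" "t \<le> 1" using u v gv gu r by (auto simp: t_def) (simp add: r_def)
    have tr: "t * r = g u - f u" using r by (simp add: t_def)
    define x where "x = (1 - t) *\<^sub>R u + t *\<^sub>R v"
    have "f x = (1 - t) * f u + t * f v" "g x = (1 - t) * g u + t * g v"
      unfolding x_def by (rule affine_fun_between[OF f], rule affine_fun_between[OF g])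
    then have "g x - f x = (g u - f u) - t * r" by (simp add: r_def algebra_simps)
    then have eq: "g x = f x" using tr by simp
    have hx: "h \<mu> x = (1 - t) * h \<mu> u + t * h \<mu> v" unfolding x_def by (rule affine_fun_between[OF ah])
    have "h \<mu> x < 0"
    proof (cases "t = 0")
      case False
      then have "t * h \<mu> v < 0" "(1 - t) * h \<mu> u \<le> 0" using t uvW by (auto simp: mult_less_0_iff mult_le_0_iff)
      then show ?thesis using hx by simp
    qed (use hx uvW in simp)
    moreover have "h \<mu> x = f x" using eq by (simp add: h_def algebra_simps)
    ultimately have "f x < 0" "g x < 0" using eq by auto
    then show False using no uvW t unfolding x_def by blast
  qed
  have "M f \<inter> M g \<inter> {0..1} = {}"
  proof (rule ccontr)
    assume "M f \<inter> M g \<inter> {0..1} \<noteq> {}"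
    then obtain \<mu> u v where *: "0 \<le> \<mu>" "\<mu> \<le> 1" "u \<in> W" "f u < 0" "h \<mu> u < 0" "v \<in> W" "g v < 0" "h \<mu> v < 0"
      by (auto simp: M_def)
    have "(u, v) \<in> (adj V {w \<in> W. h \<mu> w < 0})\<^sup>*"
      by (rule halfspace_connected[OF V V1 W ah]) (use * in auto)
    then have "f v < 0" by (induction rule: rtrancl_induct) (use * step in auto)
    then show False using nov * by auto
  qed
  then show False
    using connectedD[OF connected_Icc opM opM _ cov] ne by (auto simp: Int_assoc)
qed

section \<open>Labels of faces\<close>

definition hit :: "(nat \<Rightarrow> 'p::real_vector set) \<Rightarrow> 'p set \<Rightarrow> nat set \<Rightarrow> bool" where
  "hit C T I \<longleftrightarrow> (\<exists>q\<in>convex hull T. \<forall>i\<in>I. q \<in> C i)"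

text \<open>The intended labels: \<open>u \<in> C (l {u})\<close>, and on the edge \<open>{u, v}\<close> the set \<open>C (l {u, v})\<close> meets both
  \<open>C (l {u})\<close> and \<open>C (l {v})\<close>.\<close>

definition switches :: "('p::real_vector set \<Rightarrow> nat) \<Rightarrow> 'p set \<Rightarrow> 'p set \<Rightarrow> nat \<Rightarrow> nat \<Rightarrow> bool" where
  "switches l V W i j \<longleftrightarrow> (\<exists>u\<in>W. \<exists>v\<in>W. cface V {u, v} \<and> {l {u, v}, l {u}} = {i, j})"

lemma convex_hull_pair:
  "x \<in> convex hull {u, v} \<longleftrightarrow> (\<exists>t. 0 \<le> t \<and> t \<le> 1 \<and> x = (1 - t) *\<^sub>R u + t *\<^sub>R v)"
  unfolding segment_convex_hull[symmetric] closed_segment_def by auto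

text \<open>Where \<open>f c\<close> is negative, neither vertices nor the edges between them can
  have the label \<open>c\<close>; without changes between \<open>a\<close> and \<open>b\<close>,
  the label is constant on this connected side, namely \<open>a'\<close>. Some edge has a point at
  which \<open>f a'\<close> and \<open>f c\<close> are both negative, whereas its labels provide a
  point at which both are nonnegative. From the end \<open>u\<close> with \<open>f c u < 0\<close>
  on, \<open>f a'\<close> decreases and \<open>f c\<close> increases, so that the two points cannot
  coexist.\<close>

lemma two_switch_types_cover:
  assumes V: "finite V" and V1: "\<And>v. v \<in> V \<Longrightarrow> cface V {v}" and W: "cface V W"
    and f: "\<And>i. i \<in> {1, 2, 3} \<Longrightarrow> affine_fun (f i)"
    and lab: "\<And>E. l E \<in> {1, 2, 3::nat}"
    and edge: "\<And>u v. u \<in> V \<Longrightarrow> v \<in> V \<Longrightarrow> cface V {u, v} \<Longrightarrow> hit (\<lambda>i. {q. 0 \<le> f i q}) {u, v} {l {u, v}, l {u}}"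
    and abc: "{a, b, c} = {1, 2, 3}" "a \<noteq> b" "a \<noteq> c" "b \<noteq> c" and no: "\<not> switches l V W a b"
    and p: "p \<in> convex hull W" "\<And>i. i \<in> {1, 2, 3} \<Longrightarrow> f i p < 0"
  shows False
proof -
  have fW: "finite W" and WV: "W \<subseteq> V" using W V finite_subset by (auto simp: cface_def)
  have inabc: "a \<in> {1,2,3}" "b \<in> {1,2,3}" "c \<in> {1,2,3}" using abc by blast+
  have labc: "l E = a \<or> l E = b \<or> l E = c" for E using lab[of E] abc by blast
  have vl: "0 \<le> f (l {v}) v" if "v \<in> W" for v
    using edge[of v v] that WV V1 by (auto simp: hit_def)
  obtain u0 where u0: "u0 \<in> W" "f c u0 < 0"
    using affine_fun_neg_vertex[OF fW f[OF inabc(3)] p(1)] p(2) inabc by blast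
  have nsw: "\<not> {l {u, v}, l {u}} = {a, b}" if "u \<in> W" "v \<in> W" "cface V {u, v}" for u v
    using no that unfolding switches_def by blast
  have mono: "l {v} = l {u0}" if v: "v \<in> W" "f c v < 0" for v
  proof -
    have "(u0, v) \<in> (adj V {w \<in> W. f c w < 0})\<^sup>*"
      by (rule halfspace_connected[OF V V1 W f[OF inabc(3)]]) (use u0 v in auto)
    then show ?thesis
    proof (induction rule: rtrancl_induct)
      case (step y z)
      then have yz: "y \<in> W" "z \<in> W" "cface V {y, z}" "f c y < 0" "f c z < 0" by (auto simp: adj_def)
      have "l {y} \<noteq> c" "l {z} \<noteq> c" using vl[OF yz(1)] vl[OF yz(2)] yz by auto
      moreover have "l {y, z} \<noteq> c"
      proof
        assume "l {y, z} = c"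
        then obtain q where q: "q \<in> convex hull {y, z}" "0 \<le> f c q"
          using edge[of y z] yz WV by (auto simp: hit_def)
        then obtain t where t: "0 \<le> t" "t \<le> 1" "q = (1 - t) *\<^sub>R y + t *\<^sub>R z" by (auto simp: convex_hull_pair)
        have "f c q = (1 - t) * f c y + t * f c z" unfolding t by (rule affine_fun_between[OF f[OF inabc(3)]])
        then show False using q t yz by (smt (verit) mult_minus_right mult_nonneg_nonneg mult_eq_0_iff)
      qed
      moreover have "{l {y, z}, l {y}} \<noteq> {a, b}" "{l {z, y}, l {z}} \<noteq> {a, b}"
        using nsw[of y z] nsw[of z y] yz by (auto simp: insert_commute)
      ultimately have "l {z} = l {y}" using labc[of "{y}"] labc[of "{z}"] labc[of "{y, z}"]
        by (auto simp: insert_commute)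
      then show ?case using step by simp
    qed simp
  qed
  define a' where "a' = l {u0}"
  have a': "a' = a \<or> a' = b" using labc[of "{u0}"] vl[OF u0(1)] u0 unfolding a'_def by auto
  then have a'in: "a' \<in> {1, 2, 3}" using inabc by auto
  have lab': "l {v} = a'" if "v \<in> W" "f c v < 0" for v using mono[OF that] by (simp add: a'_def)
  obtain u v t where uv: "u \<in> W" "v \<in> W" "cface V {u, v}" and t: "0 \<le> t" "t \<le> 1"
    "f a' ((1 - t) *\<^sub>R u + t *\<^sub>R v) < 0" "f c ((1 - t) *\<^sub>R u + t *\<^sub>R v) < 0"
    using two_halfspaces_edge[OF V V1 W f[OF a'in] f[OF inabc(3)] p(1)] p(2) a'in inabc by blast
  have main: False if uv: "u \<in> W" "v \<in> W" "cface V {u, v}" and t: "0 \<le> t" "t \<le> 1"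
    "f a' ((1 - t) *\<^sub>R u + t *\<^sub>R v) < 0" "f c ((1 - t) *\<^sub>R u + t *\<^sub>R v) < 0" and uc: "f c u < 0" for u v t
  proof -
    note bw = affine_fun_between[OF f[OF a'in]] affine_fun_between[OF f[OF inabc(3)]]
    have lu: "l {u} = a'" using lab' uv uc by auto
    have fau: "0 \<le> f a' u" using vl[OF uv(1)] lu by simp
    have fav: "f a' v < 0" using t fau unfolding bw by (smt (verit) mult_nonneg_nonneg)
    have lv: "l {v} \<noteq> a'" using vl[OF uv(2)] fav by auto
    \<comment> \<open>The label of the edge is \<open>c\<close> or \<open>a'\<close>, since the
      remaining index would be a change between \<open>a\<close> and \<open>b\<close>. If it is
      \<open>a'\<close>, then \<open>v\<close> has the label \<open>c\<close>, again for lack of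
      such a change, and the condition at the end \<open>v\<close> applies.\<close>
    have "\<exists>q\<in>convex hull {u, v}. 0 \<le> f a' q \<and> 0 \<le> f c q"
    proof (cases "l {u, v} = c")
      case True
      then show ?thesis using edge[of u v] uv WV lu by (auto simp: hit_def)
    next
      case False
      have "l {u, v} = a'" using False labc[of "{u, v}"] nsw[OF uv] lu a' by (auto simp: insert_commute)
      moreover have "l {v} = c"
        using lv labc[of "{v}"] nsw[of v u] uv a' \<open>l {u, v} = a'\<close> by (auto simp: insert_commute)
      ultimately show ?thesis using edge[of v u] uv WV by (auto simp: hit_def insert_commute)
    qed
    then obtain s where s: "0 \<le> s" "s \<le> 1" "0 \<le> f a' ((1 - s) *\<^sub>R u + s *\<^sub>R v)" "0 \<le> f c ((1 - s) *\<^sub>R u + s *\<^sub>R v)"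
      by (auto simp: convex_hull_pair)
    have A: "(1 - t) * f a' u + t * f a' v < 0" "0 \<le> (1 - s) * f a' u + s * f a' v" using t s bw by auto
    have C: "(1 - t) * f c u + t * f c v < 0" "0 \<le> (1 - s) * f c u + s * f c v" using t s bw by auto
    have "(t - s) * (f a' v - f a' u) < 0" using A by (simp add: algebra_simps)
    then have st: "s < t" using fau fav by (simp add: mult_less_0_iff)
    then have "(1 - s) * f c u < 0" using uc t by (simp add: mult_less_0_iff)
    then have "0 < s * f c v" using C(2) by linarith
    then have "0 < f c v" using s by (simp add: zero_less_mult_iff)
    moreover have "(t - s) * (f c v - f c u) < 0" using C by (simp add: algebra_simps)
    ultimately show False using uc st by (simp add: mult_less_0_iff)
  qed
  have "f c u < 0 \<or> f c v < 0"
    using t affine_fun_between[OF f[OF inabc(3)], of t u v] by (smt (verit) mult_nonneg_nonneg)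
  then show False
  proof
    assume "f c u < 0" then show False using main uv t by blast
  next
    assume vc: "f c v < 0"
    have eq: "(1 - t) *\<^sub>R u + t *\<^sub>R v = (1 - (1 - t)) *\<^sub>R v + (1 - t) *\<^sub>R u" by simp
    show False by (rule main[of v u "1 - t"]) (use uv t vc in \<open>auto simp: insert_commute eq[symmetric] add.commute\<close>)
  qed
qed

section \<open>Moving a point to a proper face\<close>

lemma affine_map_convex_hull:
  fixes F :: "'p::real_vector \<Rightarrow> 'e::real_vector"
  assumes g: "linear g" and F: "F = (\<lambda>x. g x + c)"
  shows "F ` (convex hull S) = convex hull (F ` S)"
proof -
  have Fi: "F ` S = (\<lambda>x. x + c) ` g ` S" for S by (auto simp: F)
  show ?thesis unfolding Fi convex_hull_linear_image[OF g]
    using convex_hull_translation[of c "g ` S"] by (simp add: add.commute)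
qed

text \<open>\<open>F\<close> carries the polytope into a Euclidean space, where a ray from
  \<open>F p\<close> leaves the image through its relative boundary. A supporting hyperplane at the
  exit point, pulled back along \<open>F\<close>, is an affine function that is not constant on
  \<open>W\<close> and is minimal at every preimage of that point. Hence the preimage lies in a
  proper face.\<close>

lemma push_to_face:
  fixes F :: "'p::real_vector \<Rightarrow> 'e::euclidean_space"
  assumes W: "finite W" and g: "linear g" and F: "F = (\<lambda>x. g x + c)" and p: "p \<in> convex hull W"
    and d: "d \<noteq> 0" "F p + d \<in> affine hull (F ` W)"
  shows "\<exists>t\<ge>0. \<exists>h m p'. affine_fun h \<and> (\<forall>w\<in>W. m \<le> h w) \<and> (\<exists>w\<in>W. h w \<noteq> m) \<and>
    p' \<in> convex hull {w \<in> W. h w = m} \<and> F p' = F p + t *\<^sub>R d"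
proof -
  define K where "K = convex hull (F ` W)"
  have FK: "F ` (convex hull W) = K"
    unfolding K_def by (rule affine_map_convex_hull[OF g F])
  have K: "compact K" "convex K" unfolding K_def using W by (auto simp: finite_imp_compact_convex_hull)
  have FpK: "F p \<in> K" using FK p by blast
  \<comment> \<open>If \<open>F p\<close> is on the relative boundary already, then
    \<open>t = 0\<close> works.\<close>
  have "\<exists>t\<ge>0. F p + t *\<^sub>R d \<in> rel_frontier K"
  proof (cases "F p \<in> rel_interior K")
    case True
    have "F p + d \<in> affine hull K" using d by (simp add: K_def)
    from ray_to_rel_frontier[OF compact_imp_bounded[OF K(1)] True this d(1)]
    show ?thesis by (metis less_imp_le)
  next
    case False
    then show ?thesis using FpK closure_subset[of K] by (intro exI[of _ 0]) (auto simp: rel_frontier_def)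
  qed
  then obtain t where t: "t \<ge> 0" "F p + t *\<^sub>R d \<in> rel_frontier K" by blast
  let ?q = "F p + t *\<^sub>R d"
  have q: "?q \<in> K" "?q \<notin> rel_interior K"
    using t K compact_imp_closed[of K] by (auto simp: rel_frontier_def)
  obtain a where a: "\<And>y. y \<in> K \<Longrightarrow> inner a ?q \<le> inner a y" "\<And>y. y \<in> rel_interior K \<Longrightarrow> inner a ?q < inner a y"
    using supporting_hyperplane_rel_boundary[OF K(2) q] by metis
  obtain y where y: "y \<in> rel_interior K" using rel_interior_eq_empty[OF K(2)] q(1) by blast
  define h where "h x = inner a (F x)" for x
  define m where "m = inner a ?q"
  have ah: "affine_fun h" unfolding affine_fun_def h_def F
    using g by (intro exI[of _ "\<lambda>x. inner a (g x)"] exI[of _ "inner a c"])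
      (auto intro!: linearI simp: linear_add linear_cmul inner_add_right)
  have mW: "m \<le> h w" if "w \<in> W" for w
    using a(1)[of "F w"] that FK hull_subset[of W convex] unfolding h_def m_def by blast
  have strict: "\<exists>w\<in>W. h w \<noteq> m"
  proof (rule ccontr)
    assume all: "\<not> ?thesis"
    obtain z where z: "z \<in> convex hull W" "F z = y" using y rel_interior_subset[of K] FK by blast
    then obtain b where b: "sum b W = 1" "(\<Sum>v\<in>W. b v *\<^sub>R v) = z" using W by (auto simp: convex_hull_finite)
    have "h z = (\<Sum>v\<in>W. b v * h v)" using affine_fun_sum[OF ah b(1)] b(2) by simp
    also have "\<dots> = (\<Sum>v\<in>W. b v * m)" using all by (intro sum.cong) auto
    also have "\<dots> = m" using b by (simp flip: sum_distrib_right)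
    finally show False using a(2)[OF y] z by (simp add: h_def m_def)
  qed
  obtain p' where p': "p' \<in> convex hull W" "F p' = ?q" using q(1) FK by (metis imageE)
  then obtain b where b: "\<forall>v\<in>W. 0 \<le> b v" "sum b W = 1" "(\<Sum>v\<in>W. b v *\<^sub>R v) = p'" using W by (auto simp: convex_hull_finite)
  have "h p' = (\<Sum>v\<in>W. b v * h v)" using affine_fun_sum[OF ah b(2)] b(3) by simp
  moreover have "h p' = (\<Sum>v\<in>W. b v * m)" using b p' by (simp add: h_def m_def flip: sum_distrib_right)
  ultimately have "(\<Sum>v\<in>W. b v * (h v - m)) = 0" by (simp add: right_diff_distrib sum_subtractf)
  then have "\<forall>v\<in>W. b v * (h v - m) = 0"
    by (subst (asm) sum_nonneg_eq_0_iff[OF W]) (use b mW in auto)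
  then have b0: "b v = 0" if "v \<in> W - {w \<in> W. h w = m}" for v using that by auto
  have "p' \<in> convex hull {w \<in> W. h w = m}"
  proof -
    have "sum b {w \<in> W. h w = m} = 1" "(\<Sum>v\<in>{w \<in> W. h w = m}. b v *\<^sub>R v) = p'"
      using b(2,3) W b0 by (subst sum.mono_neutral_left[of W]; auto)+
    then show ?thesis using W b(1) by (subst convex_hull_finite) auto
  qed
  then show ?thesis using ah mW strict p' t by blast
qed

text \<open>In a smallest face with an uncovered point, this point cannot be pushed to a proper face
  along a direction that keeps the three values negative. If the image of the face is
  three-dimensional, lowering all values is such a direction. Otherwise three vertices have a point
  with the same values in their hull, and by minimality the face is their \<open>minface\<close>.
  Then either a kind of label change is missing, or there is a point with three nonnegative values,
  and moving away from it keeps the values negative.\<close>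

lemma uncovered_point_absurd:
  assumes V: "finite V" and V1: "\<And>v. v \<in> V \<Longrightarrow> cface V {v}"
    and f: "\<And>i. i \<in> {1, 2, 3} \<Longrightarrow> affine_fun (f i)"
    and lab: "\<And>E. l E \<in> {1, 2, 3::nat}"
    and edge: "\<And>u v. u \<in> V \<Longrightarrow> v \<in> V \<Longrightarrow> cface V {u, v} \<Longrightarrow> hit (\<lambda>i. {q. 0 \<le> f i q}) {u, v} {l {u, v}, l {u}}"
    and tri: "\<And>x y z W. x \<in> V \<Longrightarrow> y \<in> V \<Longrightarrow> z \<in> V \<Longrightarrow> W = minface V {x, y, z} \<Longrightarrow> switches l V W 1 2 \<Longrightarrow>
       switches l V W 1 3 \<Longrightarrow> switches l V W 2 3 \<Longrightarrow> hit (\<lambda>i. {q. 0 \<le> f i q}) W {1, 2, 3}"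
    and p: "p \<in> convex hull V" "\<And>i. i \<in> {1, 2, 3} \<Longrightarrow> f i p < 0"
  shows False
proof -
  define bad where "bad W \<longleftrightarrow> cface V W \<and> (\<exists>p\<in>convex hull W. \<forall>i\<in>{1, 2, 3}. f i p < 0)" for W
  have "cface V V" by (simp add: cface_def)
  then have "bad V" using p by (auto simp: bad_def)
  then obtain W where W: "bad W" and min: "\<And>W'. bad W' \<Longrightarrow> card W \<le> card W'"
    using ex_has_least_nat[of bad V card] by blast
  then obtain p where p: "p \<in> convex hull W" "\<And>i. i \<in> {1, 2, 3} \<Longrightarrow> f i p < 0" and fW: "cface V W"
    by (auto simp: bad_def)
  have finW: "finite W" and WV: "W \<subseteq> V" using fW V finite_subset by (auto simp: cface_def)
  define F where "F x = (f 1 x, f 2 x, f 3 x)" for x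
  have "\<forall>i\<in>{1, 2, 3}. \<exists>g c. linear g \<and> f i = (\<lambda>x. g x + c)" using f by (auto simp: affine_fun_def)
  then obtain g c where gc: "\<forall>i\<in>{1, 2, 3}. linear (g i) \<and> f i = (\<lambda>x. g i x + c i)" by metis
  define G where "G x = (g 1 x, g 2 x, g 3 x)" for x
  have G: "linear G" using gc unfolding G_def by (auto intro!: linearI simp: linear_add linear_cmul)
  have FG: "F = (\<lambda>x. G x + (c 1, c 2, c 3))" using gc by (auto simp: F_def G_def)
  note FH = affine_map_convex_hull[OF G FG]
  have p123: "f 1 p < 0" "f 2 p < 0" "f 3 p < 0" using p(2) by auto
  have push: False if d: "d \<noteq> 0" "F p + d \<in> affine hull (F ` W)"
    and neg: "\<And>t q. 0 \<le> t \<Longrightarrow> F q = F p + t *\<^sub>R d \<Longrightarrow> \<forall>i\<in>{1, 2, 3}. f i q < 0" for d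
  proof -
    obtain t h m q where *: "t \<ge> 0" "affine_fun h" "\<And>w. w \<in> W \<Longrightarrow> m \<le> h w" "\<exists>w\<in>W. h w \<noteq> m"
      "q \<in> convex hull {w \<in> W. h w = m}" "F q = F p + t *\<^sub>R d"
      using push_to_face[OF finW G FG p(1) d] by blast
    have "bad {w \<in> W. h w = m}" unfolding bad_def
      using cface_argmin[OF V fW *(2,3)] neg[OF *(1,6)] *(5) by blast
    moreover have "card {w \<in> W. h w = m} < card W" using *(4) finW by (intro psubset_card_mono) auto
    ultimately show False using min by fastforce
  qed
  show False
  proof (cases "aff_dim (F ` W) = 3")
    case True
    then have "affine hull (F ` W) = UNIV" by (intro affine_hull_UNIV) auto
    then show False by (intro push[of "(-1, -1, -1)"]) (use p123 in \<open>auto simp: F_def zero_prod_def\<close>)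
  next
    case False
    have "aff_dim (F ` W) \<le> 3" using aff_dim_le_DIM[of "F ` W"] by simp
    \<comment> \<open>The bound of Caratheodory's theorem: in an image of dimension at most 2, three
      points suffice.\<close>
    with False have dim: "aff_dim (F ` W) + 1 \<le> 3" by simp
    have "F p \<in> convex hull (F ` W)"
      using p(1) FH[of W] by blast
    then obtain S where S: "finite S" "S \<subseteq> F ` W" "int (card S) \<le> aff_dim (F ` W) + 1" "F p \<in> convex hull S"
      by (subst (asm) caratheodory_aff_dim) auto
    obtain T where T: "T \<subseteq> W" "inj_on F T" "S = F ` T" using S(2) by (metis subset_image_inj)
    have card: "card T \<le> 3" using S(3) dim T by (simp add: card_image)
    have "T \<noteq> {}" using S T by auto
    have finT: "finite T" using T finW finite_subset by blast
    \<comment> \<open>A set of one or two vertices is turned into a triple by repetition.\<close>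
    have "\<exists>x y z. T = {x, y, z}"
    proof -
      consider "card T = 1" | "card T = 2" | "card T = 3"
        using card \<open>T \<noteq> {}\<close> finT by (metis One_nat_def card_0_eq le_Suc_eq numeral_2_eq_2 numeral_3_eq_3 le_zero_eq)
      then show ?thesis
      proof cases
        case 1 then show ?thesis by (metis card_1_singletonE insert_absorb2)
      next
        case 2 then show ?thesis by (metis card_2_iff insert_absorb2)
      next
        case 3 then show ?thesis by (metis card_3_iff)
      qed
    qed
    then obtain x y z where xyz: "T = {x, y, z}" by blast
    have "F p \<in> F ` (convex hull T)"
      using S(4) T(3) FH[of T] by simp
    then obtain q where q: "q \<in> convex hull T" "F q = F p" by auto
    let ?M = "minface V T"
    have TM: "T \<subseteq> ?M" using subset_minface[OF V] T WV by blast
    have MW: "?M \<subseteq> W" by (rule minface_subset_cface[OF fW T(1)])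
    have "q \<in> convex hull ?M" using q(1) hull_mono[OF TM] by blast
    moreover have "\<forall>i\<in>{1, 2, 3}. f i q < 0" using q(2) p123 by (auto simp: F_def)
    ultimately have "bad ?M" unfolding bad_def using cface_minface[OF V] by blast
    then have WM: "W = ?M" using min MW finW card_seteq by blast
    have tri': "switches l V W 1 2 \<Longrightarrow> switches l V W 1 3 \<Longrightarrow> switches l V W 2 3 \<Longrightarrow> hit (\<lambda>i. {q. 0 \<le> f i q}) W {1, 2, 3}"
      by (rule tri[of x y z]) (use xyz T WV WM in auto)
    consider "hit (\<lambda>i. {q. 0 \<le> f i q}) W {1, 2, 3}" | "\<not> switches l V W 1 2" | "\<not> switches l V W 1 3" | "\<not> switches l V W 2 3"
      using tri' by blast
    then show False
    proof cases
      case 1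
      then obtain t where t: "t \<in> convex hull W" "0 \<le> f 1 t" "0 \<le> f 2 t" "0 \<le> f 3 t" by (auto simp: hit_def)
      have "F t \<in> affine hull (F ` W)" "F p \<in> affine hull (F ` W)"
        using p(1) t(1) FH[of W] convex_hull_subset_affine_hull[of "F ` W"] by blast+
      then have "2 *\<^sub>R F p + (-1) *\<^sub>R F t \<in> affine hull (F ` W)"
        by (intro mem_affine[OF affine_affine_hull]) auto
      then have aff: "F p + (F p - F t) \<in> affine hull (F ` W)" by (simp add: scaleR_2 algebra_simps)
      show False
      proof (rule push[OF _ aff])
        show "F p - F t \<noteq> 0" using t p123 by (auto simp: F_def zero_prod_def)
        fix s q assume s: "0 \<le> s" "F q = F p + s *\<^sub>R (F p - F t)"
        have "s * (f i p - f i t) \<le> 0" if "i \<in> {1, 2, 3}" for i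
          using s(1) p(2)[OF that] t that by (intro mult_nonneg_nonpos) (auto intro: order_trans[of _ 0])
        then show "\<forall>i\<in>{1, 2, 3}. f i q < 0" using s(2) p(2) by (auto simp: F_def add_neg_nonpos)
      qed
    next
      case 2 then show False by (intro two_switch_types_cover[OF V V1 fW f lab edge _ _ _ _ _ p, of 1 2 3]) auto
    next
      case 3 then show False by (intro two_switch_types_cover[OF V V1 fW f lab edge _ _ _ _ _ p, of 1 3 2]) auto
    next
      case 4 then show False by (intro two_switch_types_cover[OF V V1 fW f lab edge _ _ _ _ _ p, of 2 3 1]) auto
    qed
  qed
qed

text \<open>A hyperplane separating \<open>D \<inter> E\<close> from \<open>F\<close> meets the union in a
  connected set that is split by \<open>D\<close> and \<open>E\<close>.\<close>

lemma berge_three: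
  fixes D E F :: "'a::euclidean_space set"
  assumes D: "compact D" "convex D" and E: "compact E" "convex E" and F: "compact F" "convex F"
    and U: "convex (D \<union> E \<union> F)" and meet: "D \<inter> E \<noteq> {}" "D \<inter> F \<noteq> {}" "E \<inter> F \<noteq> {}"
  shows "D \<inter> E \<inter> F \<noteq> {}"
proof
  assume empty: "D \<inter> E \<inter> F = {}"
  have "compact (D \<inter> E)" "convex (D \<inter> E)" using D E by (auto intro: compact_Int convex_Int)
  then obtain a b where ab: "\<forall>x\<in>D \<inter> E. inner a x < b" "\<forall>x\<in>F. inner a x > b"
    using separating_hyperplane_compact_closed[of "D \<inter> E" F] meet F compact_imp_closed empty by blast
  define H where "H = {x. inner a x = b}"
  have cross: "X \<inter> H \<noteq> {}" if X: "convex X" and xy: "x \<in> X" "inner a x < b" "y \<in> X" "inner a y > b" for X x y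
  proof -
    define t where "t = (b - inner a x) / (inner a y - inner a x)"
    have t: "0 \<le> t" "t \<le> 1" using xy by (auto simp: t_def divide_simps)
    have "(1 - t) *\<^sub>R x + t *\<^sub>R y \<in> X" using X xy t by (auto simp: convex_alt)
    moreover have "t * (inner a y - inner a x) = b - inner a x" using xy by (simp add: t_def)
    then have "inner a ((1 - t) *\<^sub>R x + t *\<^sub>R y) = b" by (simp add: inner_add_right algebra_simps)
    ultimately show ?thesis by (auto simp: H_def)
  qed
  obtain x where x: "x \<in> D \<inter> E" using meet by blast
  have DH: "D \<inter> H \<noteq> {}" "E \<inter> H \<noteq> {}" using cross[OF D(2), of x] cross[OF E(2), of x] ab x meet by blast+
  have "convex ((D \<union> E \<union> F) \<inter> H)" unfolding H_def by (intro convex_Int U convex_hyperplane)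
  then have con: "connected ((D \<union> E \<union> F) \<inter> H)" by (rule convex_connected)
  have "(D \<union> E \<union> F) \<inter> H \<subseteq> D \<union> E" using ab by (auto simp: H_def)
  moreover have "D \<inter> E \<inter> ((D \<union> E \<union> F) \<inter> H) = {}" using ab by (auto simp: H_def)
  ultimately show False
    using con DH D E compact_imp_closed unfolding connected_closed by blast
qed

text \<open>Takes the place of closed convex sets: only \<open>real_vector\<close> is assumed, so
  closedness is meaningful only for preimages in the line or the plane. In addition, each point
  outside comes with an affine function that separates it from the set.\<close>

definition polyhedral :: "'p::real_vector set \<Rightarrow> bool" where
  "polyhedral C \<longleftrightarrow> (\<exists>H. (\<forall>h\<in>H. affine_fun h) \<and> C = {q. \<forall>h\<in>H. 0 \<le> h q})"

text \<open>Affine functions of the point become affine functions of the two parameters, so the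
  preimage is an intersection of closed half-planes within a bounded triangle. The corners
  \<open>a\<close>, \<open>b\<close>, \<open>c\<close> may coincide or be collinear.\<close>

lemma polyhedral_triangle_preimage:
  fixes C :: "'p::real_vector set" and a b c :: 'p
  assumes "polyhedral C"
  defines "D \<equiv> {(s, t). 0 \<le> s \<and> 0 \<le> t \<and> s + t \<le> 1 \<and> a + s *\<^sub>R (b - a) + t *\<^sub>R (c - a) \<in> C}"
  shows "compact D" "convex D"
proof -
  obtain H where H: "\<And>h. h \<in> H \<Longrightarrow> affine_fun h" "C = {q. \<forall>h\<in>H. 0 \<le> h q}"
    using assms(1) unfolding polyhedral_def by blast
  have hD: "h (a + s *\<^sub>R (b - a) + t *\<^sub>R (c - a)) = h a + s * (h b - h a) + t * (h c - h a)" if "h \<in> H" for h s t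
    using H(1)[OF that] unfolding affine_fun_def by (auto simp: linear_add linear_cmul linear_diff)
  have D: "D = {x. 0 \<le> fst x} \<inter> {x. 0 \<le> snd x} \<inter> {x. fst x + snd x \<le> 1} \<inter>
      (\<Inter>h\<in>H. {x. 0 \<le> h a + fst x * (h b - h a) + snd x * (h c - h a)})"
    unfolding D_def H(2) using hD by auto
  have cl: "closed D" unfolding D
    by (intro closed_Int closed_INT ballI closed_Collect_le continuous_intros)
  have "D \<subseteq> cbox (0, 0) (1, 1)" unfolding D_def by (auto simp: cbox_Pair_iff)
  then have "bounded D" using bounded_cbox bounded_subset by blast
  then show "compact D" using cl by (simp add: compact_eq_bounded_closed)
  show "convex D" unfolding D
  proof (intro convex_Int convex_INT)
    have *: "convex {x::real \<times> real. k \<le> inner v x}" for v k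
      using convex_halfspace_ge[of k v] by simp
    show "convex {x::real \<times> real. 0 \<le> fst x}" using *[of 0 "(1, 0)"] by (simp add: inner_prod_def)
    show "convex {x::real \<times> real. 0 \<le> snd x}" using *[of 0 "(0, 1)"] by (simp add: inner_prod_def)
    show "convex {x::real \<times> real. fst x + snd x \<le> 1}"
      using *[of "-1" "(-1, -1)"] by (simp add: inner_prod_def algebra_simps)
    fix h
    show "convex {x::real \<times> real. 0 \<le> h a + fst x * (h b - h a) + snd x * (h c - h a)}"
      using *[of "- h a" "(h b - h a, h c - h a)"] by (simp add: inner_prod_def algebra_simps)
  qed
qed

lemma triangle_common_point:
  assumes C: "\<And>i. i \<in> {1, 2, 3::nat} \<Longrightarrow> polyhedral (C i)" and cov: "convex hull {a, b, c} \<subseteq> C 1 \<union> C 2 \<union> C 3"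
    and abc: "a \<in> C 1 \<inter> C 2" "b \<in> C 2 \<inter> C 3" "c \<in> C 1 \<inter> C 3"
  shows "\<exists>q\<in>convex hull {a, b, c}. q \<in> C 1 \<inter> C 2 \<inter> C 3"
proof -
  define D where "D i = {(s, t). 0 \<le> s \<and> 0 \<le> t \<and> s + t \<le> 1 \<and> a + s *\<^sub>R (b - a) + t *\<^sub>R (c - a) \<in> C i}" for i
  have D: "compact (D i)" "convex (D i)" if "i \<in> {1, 2, 3}" for i
    using polyhedral_triangle_preimage[OF C[OF that]] unfolding D_def by auto
  have tri: "a + s *\<^sub>R (b - a) + t *\<^sub>R (c - a) \<in> convex hull {a, b, c}" if "0 \<le> s" "0 \<le> t" "s + t \<le> 1" for s t
    using that unfolding convex_hull_3_alt by blast
  have "D 1 \<union> D 2 \<union> D 3 = {(s, t). 0 \<le> s \<and> 0 \<le> t \<and> s + t \<le> 1}"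
    unfolding D_def using tri cov by auto
  \<comment> \<open>The full parameter triangle is convex as the preimage of the whole
    space.\<close>
  moreover have "polyhedral (UNIV :: 'a set)" unfolding polyhedral_def by (intro exI[of _ "{}"]) auto
  note polyhedral_triangle_preimage(2)[OF this]
  ultimately have U: "convex (D 1 \<union> D 2 \<union> D 3)" by simp
  have "(0, 0) \<in> D 1 \<inter> D 2" "(1, 0) \<in> D 2 \<inter> D 3" "(0, 1) \<in> D 1 \<inter> D 3" using abc by (auto simp: D_def)
  then have "D 1 \<inter> D 2 \<inter> D 3 \<noteq> {}" by (intro berge_three D U) auto
  then show ?thesis using tri unfolding D_def by auto
qed

text \<open>If \<open>C i\<close> and \<open>C j\<close> meet on the segment, then
  \<open>m = i\<close> works. Otherwise the third index does: as the segment is connected, its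
  closed part in \<open>C i\<close> meets the part covered by the others, which can happen only
  inside the third set, and likewise for \<open>C j\<close>.\<close>

lemma segment_middle_label:
  fixes C :: "nat \<Rightarrow> 'p::real_vector set"
  assumes C: "\<And>i. i \<in> {1, 2, 3::nat} \<Longrightarrow> polyhedral (C i)" and cov: "convex hull {u, v} \<subseteq> C 1 \<union> C 2 \<union> C 3"
    and ij: "i \<in> {1, 2, 3}" "j \<in> {1, 2, 3}" "u \<in> C i" "v \<in> C j"
  shows "\<exists>m\<in>{1, 2, 3}. (\<exists>q\<in>convex hull {u, v}. q \<in> C m \<inter> C i) \<and> (\<exists>q\<in>convex hull {u, v}. q \<in> C m \<inter> C j)"
proof (rule ccontr)
  assume no: "\<not> ?thesis"
  have uv: "u \<in> convex hull {u, v}" "v \<in> convex hull {u, v}" by (auto intro: hull_inc)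
  have nij: "\<not> (\<exists>q\<in>convex hull {u, v}. q \<in> C i \<inter> C j)" using no ij uv by blast
  then have "i \<noteq> j" using ij uv by blast
  obtain k where k: "k \<in> {1, 2, 3}" "{1, 2, 3} = {i, j, k}" using ij \<open>i \<noteq> j\<close> by fastforce
  define x where "x t = (1 - t) *\<^sub>R u + t *\<^sub>R v" for t
  define D where "D m = {t. x t \<in> C m}" for m
  have clD: "closed (D m)" if m: "m \<in> {1, 2, 3}" for m
  proof -
    obtain H where H: "\<And>h. h \<in> H \<Longrightarrow> affine_fun h" "C m = {q. \<forall>h\<in>H. 0 \<le> h q}"
      using C[OF m] unfolding polyhedral_def by blast
    have "D m = (\<Inter>h\<in>H. {t. 0 \<le> (1 - t) * h u + t * h v})"
      unfolding D_def H(2) x_def using H(1) by (auto simp: affine_fun_between)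
    then show ?thesis by (simp add: closed_INT closed_Collect_le continuous_intros)
  qed
  have xh: "x t \<in> convex hull {u, v}" if "t \<in> {0..1}" for t using that by (auto simp: convex_hull_pair x_def)
  have cov': "{0..1} \<subseteq> D i \<union> D j \<union> D k"
  proof
    fix t :: real assume "t \<in> {0..1}"
    then have "x t \<in> C 1 \<union> C 2 \<union> C 3" using xh cov by blast
    then have "\<exists>m\<in>{1, 2, 3}. x t \<in> C m" by auto
    then show "t \<in> D i \<union> D j \<union> D k" unfolding k(2) D_def by auto
  qed
  have ends: "0 \<in> D i" "1 \<in> D j" using ij by (auto simp: D_def x_def)
  have split: "\<not> ({0..1} \<subseteq> A \<union> B \<and> A \<inter> B \<inter> {0..1} = {} \<and> A \<inter> {0..1} \<noteq> {} \<and> B \<inter> {0..1} \<noteq> {})"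
    if "closed A" "closed B" for A B :: "real set"
    using connected_Icc[of 0 "1::real"] that unfolding connected_closed by blast
  have dij: "D i \<inter> D j \<inter> {0..1} = {}" using nij xh by (auto simp: D_def)
  have "D i \<inter> (D j \<union> D k) \<inter> {0..1} \<noteq> {}"
  proof (rule ccontr)
    assume "\<not> ?thesis"
    then show False
      using split[OF clD[OF ij(1)] closed_Un[OF clD[OF ij(2)] clD[OF k(1)]]] ends cov'
      by (force simp: Un_assoc)
  qed
  then have 1: "\<exists>q\<in>convex hull {u, v}. q \<in> C k \<inter> C i" using dij xh by (auto simp: D_def)
  have "D j \<inter> (D i \<union> D k) \<inter> {0..1} \<noteq> {}"
  proof (rule ccontr)
    assume "\<not> ?thesis"
    then show False
      using split[OF clD[OF ij(2)] closed_Un[OF clD[OF ij(1)] clD[OF k(1)]]] ends cov'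
      by (force simp: Un_assoc Un_left_commute)
  qed
  then have "\<exists>q\<in>convex hull {u, v}. q \<in> C k \<inter> C j" using dij xh by (auto simp: D_def)
  then show False using no 1 k by blast
qed

text \<open>An uncovered point violates one inequality of each \<open>C i\<close>. Replacing
  \<open>C i\<close> by the half-space of this inequality enlarges it, so that all common points
  persist and the case of three affine functions applies.\<close>

lemma labels_imp_cover:
  assumes V: "finite V" and V1: "\<And>v. v \<in> V \<Longrightarrow> cface V {v}"
    and C: "\<And>i. i \<in> {1, 2, 3::nat} \<Longrightarrow> polyhedral (C i)"
    and lab: "\<And>E. l E \<in> {1, 2, 3::nat}"
    and edge: "\<And>u v. u \<in> V \<Longrightarrow> v \<in> V \<Longrightarrow> cface V {u, v} \<Longrightarrow> hit C {u, v} {l {u, v}, l {u}}"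
    and tri: "\<And>x y z W. x \<in> V \<Longrightarrow> y \<in> V \<Longrightarrow> z \<in> V \<Longrightarrow> W = minface V {x, y, z} \<Longrightarrow> switches l V W 1 2 \<Longrightarrow>
       switches l V W 1 3 \<Longrightarrow> switches l V W 2 3 \<Longrightarrow> hit C W {1, 2, 3}"
  shows "convex hull V \<subseteq> C 1 \<union> C 2 \<union> C 3"
proof
  fix p assume p: "p \<in> convex hull V"
  show "p \<in> C 1 \<union> C 2 \<union> C 3"
  proof (rule ccontr)
    assume np: "p \<notin> C 1 \<union> C 2 \<union> C 3"
    have "\<exists>h. affine_fun h \<and> h p < 0 \<and> (\<forall>q\<in>C i. 0 \<le> h q)" if i: "i \<in> {1, 2, 3}" for i
    proof -
      obtain H where H: "\<And>h. h \<in> H \<Longrightarrow> affine_fun h" "C i = {q. \<forall>h\<in>H. 0 \<le> h q}"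
        using C[OF i] unfolding polyhedral_def by blast
      have "p \<notin> C i" using np i by auto
      then obtain h where "h \<in> H" "h p < 0" using H(2) by (auto simp: not_le)
      then show ?thesis using H by blast
    qed
    then obtain f where f: "\<And>i. i \<in> {1, 2, 3} \<Longrightarrow> affine_fun (f i)" "\<And>i. i \<in> {1, 2, 3} \<Longrightarrow> f i p < 0"
      "\<And>i q. i \<in> {1, 2, 3} \<Longrightarrow> q \<in> C i \<Longrightarrow> 0 \<le> f i q" by metis
    have hitf: "hit (\<lambda>i. {q. 0 \<le> f i q}) T I" if "hit C T I" "I \<subseteq> {1, 2, 3}" for T I
    proof -
      obtain q where q: "q \<in> convex hull T" "\<forall>i\<in>I. q \<in> C i" using \<open>hit C T I\<close> by (auto simp: hit_def)
      have "\<forall>i\<in>I. q \<in> {q. 0 \<le> f i q}" using f(3) q(2) that(2) by blast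
      then show ?thesis using q(1) unfolding hit_def by blast
    qed
    show False
    proof (rule uncovered_point_absurd[OF V V1 f(1) lab _ _ p f(2)])
      fix u v assume *: "u \<in> V" "v \<in> V" "cface V {u, v}"
      show "hit (\<lambda>i. {q. 0 \<le> f i q}) {u, v} {l {u, v}, l {u}}"
        by (rule hitf[OF edge[OF *]]) (use lab in blast)
    next
      fix x y z W assume *: "x \<in> V" "y \<in> V" "z \<in> V" "W = minface V {x, y, z}"
        "switches l V W 1 2" "switches l V W 1 3" "switches l V W 2 3"
      show "hit (\<lambda>i. {q. 0 \<le> f i q}) W {1, 2, 3}" by (rule hitf[OF tri[OF *]]) simp
    qed
  qed
qed

text \<open>A vertex gets the index of a set that contains it, a pair gets a middle label of its
  segment. If all three kinds of changes occur in \<open>W\<close>, its hull contains a point common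
  to each two of the sets, and the triangle of these points is covered, so that all three sets meet
  in it.\<close>

lemma cover_imp_labels:
  fixes V :: "'p::real_vector set"
  assumes C: "\<And>i. i \<in> {1, 2, 3::nat} \<Longrightarrow> polyhedral (C i)"
    and cov: "convex hull V \<subseteq> C 1 \<union> C 2 \<union> C 3"
  shows "\<exists>l. (\<forall>E. l E \<in> {1, 2, 3}) \<and> (\<forall>u\<in>V. \<forall>v\<in>V. hit C {u, v} {l {u, v}, l {u}}) \<and>
    (\<forall>W\<subseteq>V. switches l V W 1 2 \<longrightarrow> switches l V W 1 3 \<longrightarrow> switches l V W 2 3 \<longrightarrow> hit C W {1, 2, 3})"
proof -
  have "\<exists>i\<in>{1, 2, 3}. v \<in> C i" if "v \<in> V" for v using cov hull_inc[OF that, of convex] by auto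
  then obtain L where L: "\<And>v. v \<in> V \<Longrightarrow> L v \<in> {1, 2, 3}" "\<And>v. v \<in> V \<Longrightarrow> v \<in> C (L v)" by metis
  \<comment> \<open>Quantifying over all ways to write \<open>E\<close> with one or two vertices
    makes the label depend on the set alone; sets that are not of this form get the label 1.\<close>
  define P where "P E m \<longleftrightarrow> m \<in> {1, 2, 3} \<and> (\<forall>v\<in>V. E = {v} \<longrightarrow> m = L v) \<and>
      (\<forall>u\<in>V. \<forall>v\<in>V. E = {u, v} \<longrightarrow> (\<exists>q\<in>convex hull E. q \<in> C m \<and> q \<in> C (L u)))" for E m
  have "\<exists>m. P E m" for E
  proof (cases "\<exists>v\<in>V. E = {v}")
    case True
    then obtain v where v: "v \<in> V" "E = {v}" by blast
    then have "\<And>u w. E = {u, w} \<Longrightarrow> u = v \<and> w = v" by (auto simp: doubleton_eq_iff)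
    then show ?thesis using v L unfolding P_def by (intro exI[of _ "L v"]) auto
  next
    case False
    show ?thesis
    proof (cases "\<exists>u\<in>V. \<exists>v\<in>V. E = {u, v}")
      case True
      then obtain u v where uv: "u \<in> V" "v \<in> V" "E = {u, v}" by blast
      have "convex hull {u, v} \<subseteq> C 1 \<union> C 2 \<union> C 3" using cov hull_mono[of "{u, v}" V convex] uv by auto
      from segment_middle_label[OF C this L(1)[OF uv(1)] L(1)[OF uv(2)] L(2)[OF uv(1)] L(2)[OF uv(2)]]
      obtain m where m: "m \<in> {1, 2, 3}" "\<exists>q\<in>convex hull E. q \<in> C m \<and> q \<in> C (L u)" "\<exists>q\<in>convex hull E. q \<in> C m \<and> q \<in> C (L v)"
        unfolding uv(3) by blast
      have "\<exists>q\<in>convex hull E. q \<in> C m \<and> q \<in> C (L x)" if "E = {x, y}" for x y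
      proof -
        have "x = u \<or> x = v" using that uv by (auto simp: doubleton_eq_iff)
        then show ?thesis using m by auto
      qed
      then show ?thesis unfolding P_def
        by (intro exI[of _ m] conjI m(1) ballI impI) (use False in blast)+
    next
      case F: False
      then show ?thesis using False unfolding P_def by (intro exI[of _ 1]) auto
    qed
  qed
  then obtain l where "\<And>E. P E (l E)" by metis
  then have l: "\<And>E. l E \<in> {1, 2, 3}" "\<And>E v. v \<in> V \<Longrightarrow> E = {v} \<Longrightarrow> l E = L v"
    "\<And>E u v. u \<in> V \<Longrightarrow> v \<in> V \<Longrightarrow> E = {u, v} \<Longrightarrow> \<exists>q\<in>convex hull E. q \<in> C (l E) \<and> q \<in> C (L u)"
    unfolding P_def by blast+
  have edge: "hit C {u, v} {l {u, v}, l {u}}" if "u \<in> V" "v \<in> V" for u v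
    using l(3)[OF that refl] l(2)[OF that(1) refl] by (auto simp: hit_def)
  have sw: "\<exists>q\<in>convex hull W. q \<in> C i \<inter> C j" if sw: "switches l V W i j" and WV: "W \<subseteq> V" for W i j
  proof -
    obtain u v where uv: "u \<in> W" "v \<in> W" "{l {u, v}, l {u}} = {i, j}" using sw unfolding switches_def by metis
    have "hit C {u, v} {i, j}" using edge[of u v] uv WV by (auto simp: subset_iff)
    moreover have "convex hull {u, v} \<subseteq> convex hull W" using uv by (intro hull_mono) auto
    ultimately show ?thesis by (auto simp: hit_def)
  qed
  have "hit C W {1, 2, 3}" if W: "W \<subseteq> V" and s: "switches l V W 1 2" "switches l V W 1 3" "switches l V W 2 3" for W
  proof -
    obtain a b c where abc: "a \<in> convex hull W" "b \<in> convex hull W" "c \<in> convex hull W"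
      "a \<in> C 1 \<inter> C 2" "b \<in> C 2 \<inter> C 3" "c \<in> C 1 \<inter> C 3" using sw[OF s(1) W] sw[OF s(2) W] sw[OF s(3) W] by blast
    have h: "convex hull {a, b, c} \<subseteq> convex hull W" using abc by (intro hull_minimal) auto
    have "convex hull {a, b, c} \<subseteq> C 1 \<union> C 2 \<union> C 3" using h hull_mono[OF W, of convex] cov by blast
    from triangle_common_point[OF C this abc(4,5,6)] show ?thesis using h by (auto simp: hit_def)
  qed
  then show ?thesis using l(1) edge by blast
qed

section \<open>Faces given by extreme points and edges\<close>

lemma convex_combination_split:
  assumes V: "finite V" and v: "v \<in> V" and a: "\<forall>w\<in>V. 0 \<le> a w" "sum a V = 1" and a1: "a v < 1"
  shows "\<exists>u\<in>convex hull (V - {v}). (\<Sum>w\<in>V. a w *\<^sub>R w) = (1 - a v) *\<^sub>R u + a v *\<^sub>R v"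
proof
  let ?u = "\<Sum>w\<in>V - {v}. (a w / (1 - a v)) *\<^sub>R w"
  have "sum a (V - {v}) = 1 - a v" using a V v by (simp add: sum_diff1)
  then have "(\<Sum>w\<in>V - {v}. a w / (1 - a v)) = 1" using a1 by (simp flip: sum_divide_distrib)
  moreover have "\<forall>w\<in>V - {v}. 0 \<le> a w / (1 - a v)" using a a1 by auto
  ultimately show "?u \<in> convex hull (V - {v})"
    unfolding convex_hull_finite[OF finite_Diff[OF V]]
    by (intro CollectI exI[of _ "\<lambda>w. a w / (1 - a v)"]) simp
  have "(1 - a v) *\<^sub>R ?u = (\<Sum>w\<in>V - {v}. a w *\<^sub>R w)" using a1 by (simp add: scaleR_sum_right)
  then show "(\<Sum>w\<in>V. a w *\<^sub>R w) = (1 - a v) *\<^sub>R ?u + a v *\<^sub>R v" using V v by (simp add: sum_diff1)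
qed

text \<open>If another vertex had positive weight in a representation of \<open>v\<close>, splitting
  off the share of \<open>v\<close> itself would put \<open>v\<close> into the hull of the other
  vertices. But the polytope without an extreme point is still convex and therefore contains that
  hull.\<close>

lemma cface_singleton_if_extreme:
  assumes V: "finite V" and v: "v \<in> V" and ext: "v extreme_point_of (convex hull V)"
  shows "cface V {v}"
  unfolding cface_def
proof (intro conjI allI impI ballI)
  show "{v} \<subseteq> V" using v by simp
  fix a b w
  assume *: "(\<forall>v\<in>V. 0 \<le> a v) \<and> (\<forall>v\<in>V. 0 \<le> b v) \<and> (\<forall>w\<in>V - {v}. b w = 0) \<and>
     sum a V = sum b V \<and> (\<Sum>v\<in>V. a v *\<^sub>R v) = (\<Sum>v\<in>V. b v *\<^sub>R v)" and w: "w \<in> V - {v}"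
  show "a w = 0"
  proof (rule ccontr)
    assume "a w \<noteq> 0"
    then have aw: "a w > 0" using * w by (metis DiffD1 less_eq_real_def)
    have bV: "sum b V = b v" "(\<Sum>x\<in>V. b x *\<^sub>R x) = b v *\<^sub>R v"
      using * v V by (subst sum.mono_neutral_right[of V "{v}"]; auto)+
    have "a w \<le> sum a V" using V w * by (intro member_le_sum) auto
    then have bv: "b v > 0" using * bV aw by simp
    define k where "k x = a x / b v" for x
    have k: "\<forall>x\<in>V. 0 \<le> k x" "sum k V = 1" "(\<Sum>x\<in>V. k x *\<^sub>R x) = v"
    proof -
      show "\<forall>x\<in>V. 0 \<le> k x" using * bv by (auto simp: k_def)
      show "sum k V = 1" using * bv bV by (simp add: k_def flip: sum_divide_distrib)
      have "(\<Sum>x\<in>V. k x *\<^sub>R x) = (1 / b v) *\<^sub>R (\<Sum>x\<in>V. a x *\<^sub>R x)"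
        by (simp add: k_def scaleR_sum_right)
      then show "(\<Sum>x\<in>V. k x *\<^sub>R x) = v" using * bv bV by simp
    qed
    have kw: "k w > 0" using aw bv by (simp add: k_def)
    have con: "convex (convex hull V - {v})" using ext by (simp add: extreme_point_of_stillconvex)
    have sub: "V - {v} \<subseteq> convex hull V - {v}" using hull_subset[of V convex] by auto
    have k1: "k v < 1"
    proof -
      have "sum k V = k v + sum k (V - {v})" using V v by (simp add: sum.remove)
      moreover have "k w \<le> sum k (V - {v})" using V w k by (intro member_le_sum) auto
      ultimately show ?thesis using k kw by simp
    qed
    obtain u where u: "u \<in> convex hull (V - {v})" "v = (1 - k v) *\<^sub>R u + k v *\<^sub>R v"
      using convex_combination_split[OF V v k(1,2) k1] k(3) by auto
    have "convex hull (V - {v}) \<subseteq> convex hull V - {v}" using sub con by (rule hull_minimal)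
    moreover have "u = v"
    proof -
      have "(1 - k v) *\<^sub>R u = v - k v *\<^sub>R v" using u(2)[symmetric] by (simp only: eq_diff_eq)
      then have "(1 - k v) *\<^sub>R u = (1 - k v) *\<^sub>R v" by (simp add: scaleR_diff_left)
      then show ?thesis using k1 by simp
    qed
    ultimately show False using u(1) by blast
  qed
qed

text \<open>Minkowski's theorem by counting, without topology: in a generating set of least
  cardinality no point lies in the hull of the others, and such a point is extreme.\<close>

lemma convex_hull_vertices:
  assumes "finite S"
  shows "convex hull S = convex hull {x. x extreme_point_of (convex hull S)}"
proof -
  define P where "P T \<longleftrightarrow> T \<subseteq> S \<and> convex hull T = convex hull S" for T
  have "P S" by (simp add: P_def)
  then obtain T where T: "P T" and min: "\<And>T'. P T' \<Longrightarrow> card T \<le> card T'"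
    using ex_has_least_nat[of P S card] by blast
  have finT: "finite T" using T assms finite_subset by (auto simp: P_def)
  have "x extreme_point_of (convex hull S)" if x: "x \<in> T" for x
  proof -
    have "x \<notin> convex hull (T - {x})"
    proof
      assume *: "x \<in> convex hull (T - {x})"
      have "convex hull (T - {x}) = convex hull T"
        using * by (intro antisym hull_mono hull_minimal convex_convex_hull) (auto intro: hull_inc)
      then have "P (T - {x})" using T by (auto simp: P_def)
      then show False using min card_Diff1_less[OF finT x] by force
    qed
    then have "x extreme_point_of (convex hull (insert x (T - {x})))"
      using finT by (intro extreme_point_of_convex_hull_insert) auto
    then show ?thesis using T x by (simp add: insert_absorb P_def)
  qed
  then have "convex hull T \<subseteq> convex hull {x. x extreme_point_of (convex hull S)}"
    by (intro hull_mono) auto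
  moreover have "convex hull {x. x extreme_point_of (convex hull S)} \<subseteq> convex hull S"
    by (intro hull_minimal convex_convex_hull) (auto simp: extreme_point_of_def)
  ultimately show ?thesis using T by (auto simp: P_def)
qed

text \<open>If a proper mixture of two weight vectors represents a point of the segment, the
  condition on \<open>{u, v}\<close> makes the mixture vanish outside the pair; both parts are
  nonnegative and so vanish there, too.\<close>

lemma cface_pair_edge:
  assumes V: "finite V" and uv: "u \<noteq> v" and face: "cface V {u, v}"
  shows "convex hull {u, v} \<in> edges (convex hull V)"
proof -
  have uvV: "{u, v} \<subseteq> V" using face by (simp add: cface_def)
  have "convex hull {u, v} face_of convex hull V"
    unfolding face_of_def
  proof (intro conjI ballI impI)
    show "convex hull {u, v} \<subseteq> convex hull V" by (rule hull_mono[OF uvV])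
    show "convex (convex hull {u, v})" by simp
  next
    fix p q x assume p: "p \<in> convex hull V" and q: "q \<in> convex hull V" and x: "x \<in> convex hull {u, v}"
      and seg: "x \<in> open_segment p q"
    obtain a where a: "\<forall>w\<in>V. 0 \<le> a w" "sum a V = 1" "(\<Sum>w\<in>V. a w *\<^sub>R w) = p" using p V by (auto simp: convex_hull_finite)
    obtain b where b: "\<forall>w\<in>V. 0 \<le> b w" "sum b V = 1" "(\<Sum>w\<in>V. b w *\<^sub>R w) = q" using q V by (auto simp: convex_hull_finite)
    obtain c where c: "\<forall>w\<in>{u, v}. 0 \<le> c w" "sum c {u, v} = 1" "(\<Sum>w\<in>{u, v}. c w *\<^sub>R w) = x"
      using x by (auto simp: convex_hull_finite)
    obtain t where t: "0 < t" "t < 1" "x = (1 - t) *\<^sub>R p + t *\<^sub>R q" using seg by (auto simp: in_segment)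
    define d where "d w = (if w \<in> {u, v} then c w else 0)" for w
    have d: "sum d V = 1" "(\<Sum>w\<in>V. d w *\<^sub>R w) = x"
    proof -
      show "sum d V = 1" using c(2) V uvV by (subst sum.mono_neutral_right[of V "{u, v}"]) (auto simp: d_def)
      show "(\<Sum>w\<in>V. d w *\<^sub>R w) = x" using c(3) V uvV uv by (subst sum.mono_neutral_right[of V "{u, v}"]) (auto simp: d_def)
    qed
    have z: "(1 - t) * a w + t * b w = 0" if "w \<in> V - {u, v}" for w
    proof (rule cfaceD[OF face, of "\<lambda>w. (1 - t) * a w + t * b w" d])
      show "(\<Sum>w\<in>V. (1 - t) * a w + t * b w) = sum d V"
        using a(2) b(2) d by (simp add: sum.distrib flip: sum_distrib_left)
      have "(\<Sum>w\<in>V. ((1 - t) * a w + t * b w) *\<^sub>R w) = (1 - t) *\<^sub>R (\<Sum>w\<in>V. a w *\<^sub>R w) + t *\<^sub>R (\<Sum>w\<in>V. b w *\<^sub>R w)"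
        by (simp add: scaleR_add_left sum.distrib scaleR_sum_right)
      then show "(\<Sum>w\<in>V. ((1 - t) * a w + t * b w) *\<^sub>R w) = (\<Sum>w\<in>V. d w *\<^sub>R w)"
        using a b d t by simp
    qed (use a b c t that in \<open>auto simp: d_def\<close>)
    have z': "a w = 0" "b w = 0" if "w \<in> V - {u, v}" for w
    proof -
      have "0 \<le> (1 - t) * a w" "0 \<le> t * b w" using a b t that by auto
      with z[OF that] have "(1 - t) * a w = 0" "t * b w = 0" by linarith+
      then show "a w = 0" "b w = 0" using t by auto
    qed
    have "sum a {u, v} = 1" "(\<Sum>w\<in>{u, v}. a w *\<^sub>R w) = p" "sum b {u, v} = 1" "(\<Sum>w\<in>{u, v}. b w *\<^sub>R w) = q"
      using a(2,3) b(2,3) z' V uvV by (subst sum.mono_neutral_left[of V "{u, v}"]; auto)+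
    then show "p \<in> convex hull {u, v}" "q \<in> convex hull {u, v}"
      using a(1) b(1) uvV by (subst convex_hull_finite; auto)+
  qed
  moreover have "affine hull {u, v} = affine hull (convex hull {u, v})" by simp
  moreover have "\<not> affine_dependent {u, v}" by (rule affine_independent_2)
  ultimately show ?thesis unfolding edges_def using uv by (auto intro!: exI[of _ "{u, v}"])
qed

text \<open>A generator with positive weight in a point \<open>x\<close> of \<open>F\<close> either
  equals \<open>x\<close> or is an end of a segment with \<open>x\<close> in its interior, hence
  belongs to \<open>F\<close>. The consequence of interest is that a polytope has finitely many
  faces.\<close>

lemma face_of_hull_eq_hull:
  assumes V: "finite V" and F: "F face_of convex hull V"
  shows "F = convex hull (F \<inter> V)"
proof
  have cF: "convex F" using F by (simp add: face_of_def)
  show "convex hull (F \<inter> V) \<subseteq> F" by (intro hull_minimal cF) auto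
  show "F \<subseteq> convex hull (F \<inter> V)"
  proof
    fix x assume x: "x \<in> F"
    then have "x \<in> convex hull V" using F by (auto simp: face_of_def)
    then obtain a where a: "\<forall>w\<in>V. 0 \<le> a w" "sum a V = 1" "(\<Sum>w\<in>V. a w *\<^sub>R w) = x" using V by (auto simp: convex_hull_finite)
    have inF: "v \<in> F" if v: "v \<in> V" "a v > 0" for v
    proof (cases "a v = 1")
      case True
      have "a w = 0" if "w \<in> V - {v}" for w
      proof -
        have "sum a (V - {v}) = 0" using a(2) True V v by (simp add: sum_diff1)
        then show ?thesis using V a(1) that by (subst (asm) sum_nonneg_eq_0_iff) auto
      qed
      then have "x = v" using a(3) V v True by (subst (asm) sum.mono_neutral_right[of V "{v}"]) auto
      then show ?thesis using x by simp
    next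
      case False
      have "a v \<le> sum a V" using V v a by (intro member_le_sum) auto
      then have a1: "a v < 1" using False a(2) by simp
      obtain u where u: "u \<in> convex hull (V - {v})" and xe: "x = (1 - a v) *\<^sub>R u + a v *\<^sub>R v"
        using convex_combination_split[OF V v(1) a(1,2) a1] a(3) by auto
      have uV: "u \<in> convex hull V" using u hull_mono[of "V - {v}" V convex] by blast
      show ?thesis
      proof (cases "u = v")
        case True then show ?thesis using xe x by (simp flip: scaleR_add_left)
      next
        case False
        then have "x \<in> open_segment u v" using xe v a1 by (auto simp: in_segment)
        then show ?thesis using face_ofD[OF F _ uV _ x] hull_inc[OF v(1), of convex] by blast
      qed
    qed
    have a0: "a w = 0" if "w \<in> V - F \<inter> V" for w using inF[of w] a(1) that by force
    have "sum a (F \<inter> V) = 1" "(\<Sum>w\<in>F \<inter> V. a w *\<^sub>R w) = x"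
      using a(2,3) a0 V by (subst sum.mono_neutral_left[of V "F \<inter> V"]; auto)+
    then show "x \<in> convex hull (F \<inter> V)" using a(1) V by (subst convex_hull_finite) auto
  qed
qed

text \<open>The hull of a pair determines the pair, whose members are extreme points. An inequality
  is enough because edges are counted only in upper bounds.\<close>

lemma card_pair_faces_le_edges:
  assumes V: "finite V" and ext: "\<And>v. v \<in> V \<Longrightarrow> v extreme_point_of (convex hull V)"
  shows "card {E. card E = 2 \<and> cface V E} \<le> card (edges (convex hull V))"
proof (rule card_inj_on_le[of "\<lambda>E. convex hull E"])
  show "inj_on (\<lambda>E. convex hull E) {E. card E = 2 \<and> cface V E}"
  proof (rule inj_onI)
    fix E E' assume E: "E \<in> {E. card E = 2 \<and> cface V E}" "E' \<in> {E. card E = 2 \<and> cface V E}"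
      and eq: "convex hull E = convex hull E'"
    have sub: "X \<subseteq> Y" if X: "X \<subseteq> V" and Y: "Y \<subseteq> V" "convex hull X = convex hull Y" for X Y
    proof
      fix v assume v: "v \<in> X"
      then have ve: "v extreme_point_of (convex hull V)" using ext X by blast
      have "v \<in> convex hull Y" using v that by (metis hull_inc)
      moreover have "convex hull Y \<subseteq> convex hull V" by (rule hull_mono[OF Y(1)])
      ultimately have "v extreme_point_of (convex hull Y)" using ve by (auto simp: extreme_point_of_def)
      then show "v \<in> Y" by (rule extreme_point_of_convex_hull)
    qed
    show "E = E'" using sub[of E E'] sub[of E' E] E eq by (auto simp: cface_def)
  qed
  show "(\<lambda>E. convex hull E) ` {E. card E = 2 \<and> cface V E} \<subseteq> edges (convex hull V)"
    using cface_pair_edge[OF V] by (auto simp: card_2_iff)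
  \<comment> \<open>Finiteness is essential: the cardinality of an infinite set would be 0.\<close>
  have "edges (convex hull V) \<subseteq> (\<lambda>S. convex hull S) ` Pow V"
    using face_of_hull_eq_hull[OF V] by (force simp: edges_def)
  then show "finite (edges (convex hull V))" using V finite_subset by blast
qed

section \<open>Running programs\<close>

text \<open>The number of steps is at most \<open>cost M p\<close> as long as no fold runs along a list of length more
  than \<open>M\<close>.\<close>

primrec cost :: "nat \<Rightarrow> prog \<Rightarrow> nat" where
  "cost M Skip = 1"
| "cost M (Seq p q) = 1 + cost M p + cost M q"
| "cost M (Fork p q) = 1 + cost M p + cost M q"
| "cost M (Branch b p q) = 1 + cost M b + cost M p + cost M q"
| "cost M (Fold p) = 1 + M * (1 + cost M p)"
| "cost M MkNull = 1"
| "cost M (MkNum i) = 1"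
| "cost M GetL = 1"
| "cost M GetR = 1"
| "cost M IsNode = 1"
| "cost M Plus = 1"
| "cost M Times = 1"
| "cost M Uminus = 1"
| "cost M Recip = 1"
| "cost M Solve = 1"

text \<open>The program is fixed, and every level of nested folds contributes one factor
  \<open>M\<close>, so the degree does not depend on the input.\<close>

lemma cost_poly: "\<exists>\<pi>::nat poly. \<forall>M. cost M p = poly \<pi> M"
proof (induction p)
  case (Seq p q)
  then obtain a b where "\<forall>M. cost M p = poly a M" "\<forall>M. cost M q = poly b M" by auto
  then show ?case by (intro exI[of _ "1 + a + b"]) simp
next
  case (Fork p q)
  then obtain a b where "\<forall>M. cost M p = poly a M" "\<forall>M. cost M q = poly b M" by auto
  then show ?case by (intro exI[of _ "1 + a + b"]) simp
next
  case (Branch c p q)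
  then obtain a b d where "\<forall>M. cost M p = poly a M" "\<forall>M. cost M q = poly b M" "\<forall>M. cost M c = poly d M" by auto
  then show ?case by (intro exI[of _ "1 + d + a + b"]) simp
next
  case (Fold p)
  then obtain a where "\<forall>M. cost M p = poly a M" by auto
  then show ?case by (intro exI[of _ "1 + [:0, 1:] * (1 + a)"]) simp
qed (auto intro!: exI[of _ 1])

section \<open>Programs on stacks of values\<close>

primrec skip_env :: "nat \<Rightarrow> prog" where
  "skip_env 0 = Skip"
| "skip_env (Suc i) = Seq GetR (skip_env i)"

text \<open>Programs below work on environments, that is, on stacks of trees: \<open>var i\<close> reads entry \<open>i\<close>,
  and the binders push their bound values on top.\<close>

definition var :: "nat \<Rightarrow> prog" where
  "var i = Seq (skip_env i) GetL"

definition let_in :: "prog \<Rightarrow> prog \<Rightarrow> prog" where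
  "let_in p b = Seq (Fork p Skip) b"

text \<open>\<open>Fold\<close> shows its body nothing but the accumulator and the element, so the
  environment travels inside the accumulator. The inner rearrangement gives \<open>b\<close> the
  element as entry 0, the accumulated value as entry 1 and the old environment below; the last
  \<open>GetL\<close> drops the environment.\<close>

definition fold_in :: "prog \<Rightarrow> prog \<Rightarrow> prog \<Rightarrow> prog" where
  "fold_in ini l b = Seq (Seq (Fork (Fork ini Skip) l)
     (Fold (Seq (Fork GetR GetL) (Fork b (Seq GetR GetR))))) GetL"

definition rev_of :: "prog \<Rightarrow> prog" where
  "rev_of l = fold_in MkNull l (Fork (var 0) (var 1))"

text \<open>\<open>skip_env 2\<close> hides the accumulator from \<open>b\<close>, which therefore
  sees just the element on top of the environment. Results are pushed in front, hence the final
  reversal.\<close>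

definition map_in :: "prog \<Rightarrow> prog \<Rightarrow> prog" where
  "map_in l b = rev_of (fold_in MkNull l (Fork (Seq (Fork GetL (skip_env 2)) b) (var 1)))"

definition append_of :: "prog \<Rightarrow> prog \<Rightarrow> prog" where
  "append_of a b = fold_in b (rev_of a) (Fork (var 0) (var 1))"

text \<open>The accumulator is a pair: the part of the second list not yet consumed, and the results
  so far in reverse order.\<close>

definition zip_of :: "prog \<Rightarrow> prog \<Rightarrow> prog \<Rightarrow> prog" where
  "zip_of a b c = rev_of (Seq (fold_in (Fork b MkNull) a
     (Fork (Seq (Seq (var 1) GetL) GetR)
       (Fork (Seq (Fork GetL (Fork (Seq (Seq (var 1) GetL) GetL) (skip_env 2))) c) (Seq (var 1) GetR)))) GetR)"

definition concat_map_in :: "prog \<Rightarrow> prog \<Rightarrow> prog" where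
  "concat_map_in l b = fold_in MkNull (rev_of l) (append_of (Seq (Fork GetL (skip_env 2)) b) (var 1))"

definition neg_of :: "prog \<Rightarrow> prog" where
  "neg_of a = map_in a (Seq (var 0) Uminus)"

definition const_of :: "int \<Rightarrow> prog \<Rightarrow> prog" where
  "const_of k a = map_in a (MkNum k)"

text \<open>The accumulator holds a zero vector and an identity matrix of the current size, and each
  element enlarges both; the list \<open>l\<close> acts as a unary number.\<close>

definition unit_rows_of :: "prog \<Rightarrow> prog" where
  "unit_rows_of l = Seq (fold_in (Fork MkNull MkNull) l
     (Fork (Fork (MkNum 0) (Seq (var 1) GetL))
       (Fork (Fork (MkNum 1) (Seq (var 1) GetL)) (map_in (Seq (var 1) GetR) (Fork (MkNum 0) (var 0)))))) GetR"

text \<open>The first row acts as a unary counter of the columns. The accumulator consists of the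
  columns collected so far and the remaining tails of all rows.\<close>

definition transpose_of :: "prog \<Rightarrow> prog" where
  "transpose_of l = rev_of (Seq (fold_in (Fork MkNull l) (Seq l GetL)
     (Fork (Fork (map_in (Seq (var 1) GetR) (Seq (var 0) GetL)) (Seq (var 1) GetL))
       (map_in (Seq (var 1) GetR) (Seq (var 0) GetR)))) GetL)"

definition dot_of :: "prog \<Rightarrow> prog \<Rightarrow> prog" where
  "dot_of a b = Seq (fold_in (Fork b (MkNum 0)) a
     (Fork (Seq (Seq (var 1) GetL) GetR)
       (Seq (Fork (Seq (Fork (var 0) (Seq (Seq (var 1) GetL) GetL)) Times) (Seq (var 1) GetR)) Plus))) GetR"

text \<open>There are no counters in the machine: here and in \<open>drop_of\<close>, the list
  \<open>a\<close> gives the number of elements in unary.\<close>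

definition take_of :: "prog \<Rightarrow> prog \<Rightarrow> prog" where
  "take_of a z = zip_of a z (var 1)"

definition drop_of :: "prog \<Rightarrow> prog \<Rightarrow> prog" where
  "drop_of a z = fold_in z a (Seq (var 1) GetR)"

definition encl :: "('a \<Rightarrow> val) \<Rightarrow> 'a list \<Rightarrow> val" where
  "encl X xs = enc_list (map X xs)"

lemma encl_simps [simp]: "encl X [] = Null" "encl X (x # xs) = Node (X x) (encl X xs)"
  by (simp_all add: encl_def)

primrec unit_rows :: "nat \<Rightarrow> real list list" where
  "unit_rows 0 = []"
| "unit_rows (Suc k) = (1 # replicate k 0) # map ((#) 0) (unit_rows k)"

lemma length_unit_rows [simp]: "length (unit_rows k) = k"
  by (induction k) auto

definition transp :: "nat \<Rightarrow> real list list \<Rightarrow> real list list" where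
  "transp n vs = map (\<lambda>l. map (\<lambda>v. v ! l) vs) [0..<n]"

definition dot :: "real list \<Rightarrow> real list \<Rightarrow> real" where
  "dot xs ys = sum_list (map2 (*) xs ys)"

lemma dot_Nil [simp]: "dot [] ys = 0" "dot xs [] = 0"
  by (auto simp: dot_def)

lemma dot_Cons [simp]: "dot (x # xs) (y # ys) = x * y + dot xs ys"
  by (simp add: dot_def)

section \<open>Execution with bounds on steps and solver calls\<close>

locale machine =
  fixes slv :: "val \<Rightarrow> val" and good :: "val \<Rightarrow> bool" and M :: nat
begin

text \<open>Result, step bound, number of calls and the form of each call are kept in a single
  judgement, so that a compound program is verified by chaining one rule for each construct. The
  number \<open>q\<close> is only an upper bound, whereas the result is exact.\<close>

definition exec :: "prog \<Rightarrow> val \<Rightarrow> val \<Rightarrow> nat \<Rightarrow> bool" where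
  "exec p e r q \<longleftrightarrow> (\<exists>t Q. run slv p e = (r, t, Q) \<and> t \<le> cost M p \<and> length Q \<le> q \<and> (\<forall>x\<in>set Q. good x))"

lemma exec_eq: "exec p e r q \<Longrightarrow> r = r' \<Longrightarrow> exec p e r' q"
  by simp

lemma exec_mono: "exec p e r q \<Longrightarrow> q \<le> q' \<Longrightarrow> exec p e r q'"
  unfolding exec_def by fastforce

lemma exec_Seq: "exec p e w q1 \<Longrightarrow> exec p' w r q2 \<Longrightarrow> exec (Seq p p') e r (q1 + q2)"
  unfolding exec_def by fastforce

lemma exec_Fork: "exec p e w q1 \<Longrightarrow> exec p' e r q2 \<Longrightarrow> exec (Fork p p') e (Node w r) (q1 + q2)"
  unfolding exec_def by fastforce

lemma exec_Branch:
  assumes "exec b e w q1" "is_pos w \<Longrightarrow> exec p e r q2" "\<not> is_pos w \<Longrightarrow> exec p' e r q2"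
  shows "exec (Branch b p p') e r (q1 + q2)"
  using assms unfolding exec_def by (cases "is_pos w") fastforce+

lemma exec_Seq0: "exec p e w 0 \<Longrightarrow> exec p' w r 0 \<Longrightarrow> exec (Seq p p') e r 0"
  using exec_Seq[of p e w 0 p' r 0] by simp

lemma exec_Fork0: "exec p e w 0 \<Longrightarrow> exec p' e r 0 \<Longrightarrow> exec (Fork p p') e (Node w r) 0"
  using exec_Fork[of p e w 0 p' r 0] by simp

lemma exec_Branch0:
  assumes "exec b e w 0" "is_pos w \<Longrightarrow> exec p e r 0" "\<not> is_pos w \<Longrightarrow> exec p' e r 0"
  shows "exec (Branch b p p') e r 0"
  using exec_Branch[OF assms] by simp

lemma exec_atoms:
  "exec Skip e e 0" "exec MkNull e (encl X []) 0" "exec (MkNum i) e (Num (of_int i)) 0"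
  "exec GetL (Node a b) a 0" "exec GetR (Node a b) b 0"
  "exec Plus (Node (Num x) (Num y)) (Num (x + y)) 0"
  "exec Times (Node (Num x) (Num y)) (Num (x * y)) 0" "exec Uminus (Num x) (Num (- x)) 0"
  by (simp_all add: exec_def)

lemma exec_Null: "exec MkNull e Null 0"
  by (simp add: exec_def)

lemma exec_Solve: "good e \<Longrightarrow> exec Solve e (slv e) 1"
  by (simp add: exec_def)

lemma exec_skip_env: "exec (skip_env i) e ((get_right ^^ i) e) 0"
proof (induction i arbitrary: e)
  case 0 then show ?case by (simp add: exec_def)
next
  case (Suc i)
  have "exec GetR e (get_right e) 0" by (simp add: exec_def)
  from exec_Seq0[OF this Suc] show ?case by (simp add: funpow_swap1)
qed

lemma exec_var: "exec (var i) e (get_left ((get_right ^^ i) e)) 0"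
  unfolding var_def by (rule exec_Seq0[OF exec_skip_env]) (simp add: exec_def)

lemma exec_var_Suc: "exec (var i) e r 0 \<Longrightarrow> exec (var (Suc i)) (Node a e) r 0"
proof -
  assume *: "exec (var i) e r 0"
  have "r = get_left ((get_right ^^ i) e)" using * exec_var[of i e] by (auto simp: exec_def)
  then show ?thesis using exec_var[of "Suc i" "Node a e"] by (simp add: funpow_swap1)
qed

text \<open>Each index is listed separately because numerals do not match \<open>Suc i\<close>; with
  these rules, repeated resolution walks down the stack to the entry in question.\<close>

lemma exec_vars:
  "exec (var 0) (Node a e) a 0"
  "exec (var 0) e r 0 \<Longrightarrow> exec (var 1) (Node a e) r 0"
  "exec (var 1) e r 0 \<Longrightarrow> exec (var 2) (Node a e) r 0"
  "exec (var 2) e r 0 \<Longrightarrow> exec (var 3) (Node a e) r 0"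
  "exec (var 3) e r 0 \<Longrightarrow> exec (var 4) (Node a e) r 0"
  "exec (var 4) e r 0 \<Longrightarrow> exec (var 5) (Node a e) r 0"
  "exec (var 5) e r 0 \<Longrightarrow> exec (var 6) (Node a e) r 0"
  "exec (var 6) e r 0 \<Longrightarrow> exec (var 7) (Node a e) r 0"
  "exec (var 7) e r 0 \<Longrightarrow> exec (var 8) (Node a e) r 0"
  "exec (var 8) e r 0 \<Longrightarrow> exec (var 9) (Node a e) r 0"
  "exec (var 9) e r 0 \<Longrightarrow> exec (var 10) (Node a e) r 0"
  "exec (var 10) e r 0 \<Longrightarrow> exec (var 11) (Node a e) r 0"
  "exec (var 11) e r 0 \<Longrightarrow> exec (var 12) (Node a e) r 0"
  "exec (var 12) e r 0 \<Longrightarrow> exec (var 13) (Node a e) r 0"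
  "exec (var 13) e r 0 \<Longrightarrow> exec (var 14) (Node a e) r 0"
  "exec (var 14) e r 0 \<Longrightarrow> exec (var 15) (Node a e) r 0"
  "exec (var 15) e r 0 \<Longrightarrow> exec (var 16) (Node a e) r 0"
  "exec (var 16) e r 0 \<Longrightarrow> exec (var 17) (Node a e) r 0"
  "exec (var 17) e r 0 \<Longrightarrow> exec (var 18) (Node a e) r 0"
  "exec (var 18) e r 0 \<Longrightarrow> exec (var 19) (Node a e) r 0"
  "exec (var 19) e r 0 \<Longrightarrow> exec (var 20) (Node a e) r 0"
  "exec (var 20) e r 0 \<Longrightarrow> exec (var 21) (Node a e) r 0"
  "exec (var 21) e r 0 \<Longrightarrow> exec (var 22) (Node a e) r 0"
  "exec (var 22) e r 0 \<Longrightarrow> exec (var 23) (Node a e) r 0"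
  by (rule exec_eq[OF exec_var], simp, (drule exec_var_Suc[where a = a], simp add: numeral_eq_Suc)+)

lemma exec_var1: "exec (var 1) (Node a (Node b e)) b 0"
  by (rule exec_vars)+

lemma exec_skips: "exec (skip_env 2) (Node a (Node b e)) e 0"
  by (rule exec_eq[OF exec_skip_env], simp add: numeral_eq_Suc)

lemma exec_SeqL: "exec p e (Node a b) 0 \<Longrightarrow> exec (Seq p GetL) e a 0"
  by (rule exec_Seq0[OF _ exec_atoms(4)])

lemma exec_SeqR: "exec p e (Node a b) 0 \<Longrightarrow> exec (Seq p GetR) e b 0"
  by (rule exec_Seq0[OF _ exec_atoms(5)])

lemmas exec_intros = exec_Fork0 exec_SeqL exec_SeqR exec_vars exec_skips exec_atoms exec_Seq0

lemma exec_let: "exec p e w q1 \<Longrightarrow> exec b (Node w e) r q2 \<Longrightarrow> exec (let_in p b) e r (q1 + q2)"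
  unfolding let_in_def using exec_Seq[OF exec_Fork[OF _ exec_atoms(1)]] by fastforce

lemma exec_let0: "exec p e w 0 \<Longrightarrow> exec b (Node w e) r 0 \<Longrightarrow> exec (let_in p b) e r 0"
  using exec_let[of p e w 0 b r 0] by simp

text \<open>The body has to work only for accumulators reached after a prefix \<open>us\<close>.
  Invariants, such as the second list of \<open>zip_of\<close> not being exhausted yet, are read off
  from this prefix. The environment \<open>e\<close> comes back unchanged from every
  iteration.\<close>

lemma fold_run_exec:
  assumes "\<And>us x vs. xs = us @ x # vs \<Longrightarrow>
    exec p (Node (Node (A (foldl g a us)) e) (X x)) (Node (A (g (foldl g a us) x)) e) q"
  shows "\<exists>t Q. fold_run (run slv p) (Node (A a) e) (encl X xs) = (Node (A (foldl g a xs)) e, t, Q) \<and>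
    t \<le> 1 + length xs * (1 + cost M p) \<and> length Q \<le> length xs * q \<and> (\<forall>x\<in>set Q. good x)"
  using assms
proof (induction xs arbitrary: a)
  case (Cons x xs)
  have "exec p (Node (Node (A a) e) (X x)) (Node (A (g a x)) e) q"
    using Cons.prems[of "[]" x xs] by simp
  then obtain t Q where 1: "run slv p (Node (Node (A a) e) (X x)) = (Node (A (g a x)) e, t, Q)" "t \<le> cost M p"
    "length Q \<le> q" "\<forall>x\<in>set Q. good x" by (auto simp: exec_def)
  obtain t' Q' where 2: "fold_run (run slv p) (Node (A (g a x)) e) (encl X xs) = (Node (A (foldl g (g a x) xs)) e, t', Q')"
    "t' \<le> 1 + length xs * (1 + cost M p)" "length Q' \<le> length xs * q" "\<forall>x\<in>set Q'. good x"
    using Cons.IH[of "g a x"] Cons.prems[of "x # us" for us] by auto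
  show ?case using 1 2 by auto
qed simp

text \<open>The list of guesses is exponentially long. Folds along it are not covered by \<open>exec\<close>,
  whose step bound refers to \<open>M\<close>, and are counted separately.\<close>

lemma run_fold:
  assumes ini: "exec ini e (A a0) q0" and l: "exec l e (encl X xs) q1"
    and b: "\<And>us x vs. xs = us @ x # vs \<Longrightarrow>
      exec b (Node (X x) (Node (A (foldl g a0 us)) e)) (A (g (foldl g a0 us) x)) q"
  shows "\<exists>t Q. run slv (fold_in ini l b) e = (A (foldl g a0 xs), t, Q) \<and>
    t \<le> 7 + cost M ini + cost M l + length xs * (9 + cost M b) \<and>
    length Q \<le> q0 + q1 + length xs * q \<and> (\<forall>x\<in>set Q. good x)"
proof -
  let ?p = "Seq (Fork GetR GetL) (Fork b (Seq GetR GetR))"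
  have "exec ?p (Node (Node (A (foldl g a0 us)) e) (X x)) (Node (A (g (foldl g a0 us) x)) e) q"
    if *: "xs = us @ x # vs" for us x vs
  proof -
    let ?a = "foldl g a0 us"
    have "exec (Fork GetR GetL) (Node (Node (A ?a) e) (X x)) (Node (X x) (Node (A ?a) e)) 0"
      by (rule exec_Fork0) (rule exec_atoms)+
    moreover have "exec (Seq GetR GetR) (Node (X x) (Node (A ?a) e)) e 0"
      by (rule exec_Seq0) (rule exec_atoms)+
    then have "exec (Fork b (Seq GetR GetR)) (Node (X x) (Node (A ?a) e)) (Node (A (g ?a x)) e) (q + 0)"
      using b[OF *] by (intro exec_Fork) auto
    ultimately have "exec ?p (Node (Node (A ?a) e) (X x)) (Node (A (g ?a x)) e) (0 + (q + 0))" by (rule exec_Seq)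
    then show ?thesis by simp
  qed
  then have "\<exists>t Q. fold_run (run slv ?p) (Node (A a0) e) (encl X xs) = (Node (A (foldl g a0 xs)) e, t, Q) \<and>
    t \<le> 1 + length xs * (1 + cost M ?p) \<and> length Q \<le> length xs * q \<and> (\<forall>x\<in>set Q. good x)"
    by (rule fold_run_exec)
  then obtain t Q where f: "fold_run (run slv ?p) (Node (A a0) e) (encl X xs) = (Node (A (foldl g a0 xs)) e, t, Q)"
    "t \<le> 1 + length xs * (1 + cost M ?p)" "length Q \<le> length xs * q" "\<forall>x\<in>set Q. good x" by blast
  obtain t1 Q1 where 1: "run slv ini e = (A a0, t1, Q1)" "t1 \<le> cost M ini" "length Q1 \<le> q0" "\<forall>x\<in>set Q1. good x"
    using ini by (auto simp: exec_def)
  obtain t2 Q2 where 2: "run slv l e = (encl X xs, t2, Q2)" "t2 \<le> cost M l" "length Q2 \<le> q1" "\<forall>x\<in>set Q2. good x"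
    using l by (auto simp: exec_def)
  have f': "run slv (Fold ?p) (Node (Node (A a0) e) (encl X xs)) = (Node (A (foldl g a0 xs)) e, t, Q)" using f(1) by simp
  have "run slv (fold_in ini l b) e = (A (foldl g a0 xs), 6 + t1 + t2 + t, Q1 @ Q2 @ Q)"
    unfolding fold_in_def using 1(1) 2(1) f' by (simp del: run.simps(5))
  moreover have "t \<le> 1 + length xs * (9 + cost M b)"
  proof -
    \<comment> \<open>Eight instructions wrap the body, and each iteration is charged one
      more.\<close>
    have "1 + cost M ?p = 9 + cost M b" by simp
    then show ?thesis using f(2) by (simp only:)
  qed
  then have "6 + t1 + t2 + t \<le> 7 + cost M ini + cost M l + length xs * (9 + cost M b)"
    using 1(2) 2(2) by linarith
  moreover have "length (Q1 @ Q2 @ Q) \<le> q0 + q1 + length xs * q" using f(3) 1(3) 2(3) by simp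
  moreover have "\<forall>x\<in>set (Q1 @ Q2 @ Q). good x" using f(4) 1(4) 2(4) by auto
  ultimately show ?thesis by blast
qed

lemma exec_fold_prefix:
  assumes "exec ini e (A a0) q0" "exec l e (encl X xs) q1" and len: "length xs \<le> M"
    and b: "\<And>us x vs. xs = us @ x # vs \<Longrightarrow>
      exec b (Node (X x) (Node (A (foldl g a0 us)) e)) (A (g (foldl g a0 us) x)) q"
  shows "exec (fold_in ini l b) e (A (foldl g a0 xs)) (q0 + q1 + length xs * q)"
proof -
  obtain t Q where *: "run slv (fold_in ini l b) e = (A (foldl g a0 xs), t, Q)"
    "t \<le> 7 + cost M ini + cost M l + length xs * (9 + cost M b)"
    "length Q \<le> q0 + q1 + length xs * q" "\<forall>x\<in>set Q. good x"
    using run_fold[of ini e A a0 q0 l X xs q1 b g q, OF assms(1,2)] b by metis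
  have "length xs * (9 + cost M b) \<le> M * (9 + cost M b)" using len by (rule mult_le_mono1)
  moreover have "cost M (fold_in ini l b) = 7 + cost M ini + cost M l + M * (9 + cost M b)"
    by (simp add: fold_in_def algebra_simps)
  ultimately have "t \<le> cost M (fold_in ini l b)" using *(2) by linarith
  then show ?thesis using * unfolding exec_def by auto
qed

lemma exec_fold:
  assumes "exec ini e (A a0) q0" "exec l e (encl X xs) q1" "length xs \<le> M"
    and "\<And>a x. x \<in> set xs \<Longrightarrow> exec b (Node (X x) (Node (A a) e)) (A (g a x)) q"
  shows "exec (fold_in ini l b) e (A (foldl g a0 xs)) (q0 + q1 + length xs * q)"
  using assms by (intro exec_fold_prefix) auto

lemma exec_fold_prefix0:
  assumes "exec ini e (A a0) 0" "exec l e (encl X xs) 0" "length xs \<le> M"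
    and "\<And>us x vs. xs = us @ x # vs \<Longrightarrow>
      exec b (Node (X x) (Node (A (foldl g a0 us)) e)) (A (g (foldl g a0 us) x)) 0"
  shows "exec (fold_in ini l b) e (A (foldl g a0 xs)) 0"
  using exec_fold_prefix[of ini e A a0 0 l X xs 0 b g 0] assms by simp

lemma exec_fold0:
  assumes "exec ini e (A a0) 0" "exec l e (encl X xs) 0" "length xs \<le> M"
    and "\<And>a x. x \<in> set xs \<Longrightarrow> exec b (Node (X x) (Node (A a) e)) (A (g a x)) 0"
  shows "exec (fold_in ini l b) e (A (foldl g a0 xs)) 0"
  using exec_fold[of ini e A a0 0 l X xs 0 b g 0] assms by simp

lemma foldl_push: "foldl (\<lambda>a x. f x # a) ys xs = rev (map f xs) @ ys"
  by (induction xs arbitrary: ys) auto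

lemma exec_rev:
  assumes "exec l e (encl X xs) q" "length xs \<le> M"
  shows "exec (rev_of l) e (encl X (rev xs)) q"
proof -
  have "exec (fold_in MkNull l (Fork (var 0) (var 1))) e (encl X (foldl (\<lambda>a x. x # a) [] xs)) (0 + q + length xs * 0)"
  proof (rule exec_fold[of MkNull e "encl X" "[]" 0 l X xs q])
    fix a x
    show "exec (Fork (var 0) (var 1)) (Node (X x) (Node (encl X a) e)) (encl X (x # a)) 0"
      unfolding encl_simps by (rule exec_Fork0 exec_vars)+
  qed (use assms in \<open>auto intro: exec_Null\<close>)
  then show ?thesis unfolding rev_of_def using foldl_push[of id "[]" xs] by simp
qed

lemma exec_map:
  assumes "exec l e (encl X xs) q1" "length xs \<le> M"
    and "\<And>x. x \<in> set xs \<Longrightarrow> exec b (Node (X x) e) (Y (f x)) q"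
  shows "exec (map_in l b) e (encl Y (map f xs)) (q1 + length xs * q)"
proof -
  have "exec (fold_in MkNull l (Fork (Seq (Fork GetL (skip_env 2)) b) (var 1))) e
      (encl Y (foldl (\<lambda>a x. f x # a) [] xs)) (0 + q1 + length xs * q)"
  proof (rule exec_fold[of MkNull e "encl Y" "[]" 0 l X xs q1])
    fix a x assume x: "x \<in> set xs"
    have "exec (Fork GetL (skip_env 2)) (Node (X x) (Node (encl Y a) e)) (Node (X x) e) 0"
      by (intro exec_Fork0 exec_atoms exec_skips)
    from exec_Fork[OF exec_Seq[OF this assms(3)[OF x]] exec_var1]
    show "exec (Fork (Seq (Fork GetL (skip_env 2)) b) (var 1)) (Node (X x) (Node (encl Y a) e)) (encl Y (f x # a)) q"
      by simp
  qed (use assms in \<open>auto intro: exec_Null\<close>)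
  then have "exec (map_in l b) e (encl Y (rev (foldl (\<lambda>a x. f x # a) [] xs))) (0 + q1 + length xs * q)"
    unfolding map_in_def by (rule exec_rev) (use assms in \<open>simp add: foldl_push\<close>)
  then show ?thesis by (simp add: foldl_push)
qed

lemma exec_map0:
  assumes "exec l e (encl X xs) 0" "length xs \<le> M"
    and "\<And>x. x \<in> set xs \<Longrightarrow> exec b (Node (X x) e) (Y (f x)) 0"
  shows "exec (map_in l b) e (encl Y (map f xs)) 0"
  using exec_map[of l e X xs 0 b Y f 0] assms by simp

lemma exec_append:
  assumes "exec a e (encl X xs) q1" "exec b e (encl X ys) q2" "length xs \<le> M"
  shows "exec (append_of a b) e (encl X (xs @ ys)) (q1 + q2)"
proof -
  have "exec (fold_in b (rev_of a) (Fork (var 0) (var 1))) e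
      (encl X (foldl (\<lambda>a x. x # a) ys (rev xs))) (q2 + q1 + length (rev xs) * 0)"
  proof (rule exec_fold[of b e "encl X" ys q2 _ X "rev xs" q1])
    fix a x
    show "exec (Fork (var 0) (var 1)) (Node (X x) (Node (encl X a) e)) (encl X (x # a)) 0"
      unfolding encl_simps by (rule exec_Fork0 exec_vars)+
  qed (use assms in \<open>auto intro: exec_rev\<close>)
  then show ?thesis unfolding append_of_def using foldl_push[of id ys "rev xs"] by (simp add: add.commute)
qed

lemma exec_append0:
  assumes "exec a e (encl X xs) 0" "exec b e (encl X ys) 0" "length xs \<le> M"
  shows "exec (append_of a b) e (encl X (xs @ ys)) 0"
  using exec_append[OF assms] by simp

lemma exec_zip:
  assumes a: "exec a e (encl X xs) 0" and b: "exec b e (encl Y ys) 0" and len: "length xs \<le> length ys" "length xs \<le> M"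
    and c: "\<And>x y. x \<in> set xs \<Longrightarrow> y \<in> set ys \<Longrightarrow> exec c (Node (X x) (Node (Y y) e)) (Z (f x y)) 0"
  shows "exec (zip_of a b c) e (encl Z (map2 f xs ys)) 0"
proof -
  define g where "g st x = (tl (fst st), f x (hd (fst st)) # snd st)" for st x
  define A where "A st = Node (encl Y (fst st)) (encl Z (snd st))" for st
  have fg: "foldl g (zs, os) us = (drop (length us) zs, rev (map2 f us zs) @ os)" if "length us \<le> length zs" for zs os us
    using that
  proof (induction us arbitrary: zs os)
    case (Cons x us)
    then obtain y zs' where "zs = y # zs'" by (cases zs) auto
    then show ?case using Cons by (simp add: g_def)
  qed simp
  let ?b = "Fork (Seq (Seq (var 1) GetL) GetR)
       (Fork (Seq (Fork GetL (Fork (Seq (Seq (var 1) GetL) GetL) (skip_env 2))) c) (Seq (var 1) GetR))"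
  have "exec (fold_in (Fork b MkNull) a ?b) e (A (foldl g (ys, []) xs)) 0"
  proof (rule exec_fold_prefix0[of _ _ A, OF _ a len(2)])
    show "exec (Fork b MkNull) e (A (ys, [])) 0" unfolding A_def using b by (auto intro!: exec_Fork0 exec_Null)
    fix us x vs assume xs: "xs = us @ x # vs"
    then have "drop (length us) ys \<noteq> []" using len by simp
    then obtain y zs where y: "drop (length us) ys = y # zs" by (cases "drop (length us) ys") auto
    have "y \<in> set ys" by (metis y in_set_dropD list.set_intros(1))
    have st: "foldl g (ys, []) us = (y # zs, rev (map2 f us ys))" using fg[of us ys "[]"] len xs y by simp
    have cx: "exec c (Node (X x) (Node (Y y) e)) (Z (f x y)) 0" by (rule c) (use xs \<open>y \<in> set ys\<close> in auto)
    show "exec ?b (Node (X x) (Node (A (foldl g (ys, []) us)) e)) (A (g (foldl g (ys, []) us) x)) 0"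
      unfolding st g_def A_def fst_conv snd_conv encl_simps list.sel
      by (rule exec_intros cx)+
  qed
  then have "exec (zip_of a b c) e (encl Z (rev (rev (map2 f xs ys)))) 0" unfolding zip_of_def
    by (intro exec_rev exec_Seq0[OF _ exec_atoms(5)]) (use len fg[of xs ys "[]"] in \<open>auto simp: A_def\<close>)
  then show ?thesis by simp
qed

lemma exec_concat_map:
  assumes l: "exec l e (encl X xs) q1" "length xs \<le> M"
    and b: "\<And>x. x \<in> set xs \<Longrightarrow> exec b (Node (X x) e) (encl Y (f x)) q" "\<And>x. x \<in> set xs \<Longrightarrow> length (f x) \<le> M"
  shows "exec (concat_map_in l b) e (encl Y (concat (map f xs))) (q1 + length xs * q)"
proof -
  have "exec (fold_in MkNull (rev_of l) (append_of (Seq (Fork GetL (skip_env 2)) b) (var 1))) e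
      (encl Y (foldl (\<lambda>a x. f x @ a) [] (rev xs))) (0 + q1 + length (rev xs) * q)"
  proof (rule exec_fold[of MkNull e "encl Y" "[]" 0 _ X "rev xs" q1])
    fix a x assume x: "x \<in> set (rev xs)"
    have "exec (Fork GetL (skip_env 2)) (Node (X x) (Node (encl Y a) e)) (Node (X x) e) 0"
      by (rule exec_intros)+
    from exec_append[OF exec_Seq[OF this b(1)] exec_var1 b(2)] x
    show "exec (append_of (Seq (Fork GetL (skip_env 2)) b) (var 1)) (Node (X x) (Node (encl Y a) e)) (encl Y (f x @ a)) q"
      by simp
  qed (use assms in \<open>auto intro: exec_Null exec_rev\<close>)
  moreover have "foldl (\<lambda>a x. f x @ a) ys (rev xs) = concat (map f xs) @ ys" for ys
    by (induction xs arbitrary: ys) auto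
  ultimately show ?thesis unfolding concat_map_in_def by simp
qed

lemma exec_concat_map0:
  assumes "exec l e (encl X xs) 0" "length xs \<le> M"
    and "\<And>x. x \<in> set xs \<Longrightarrow> exec b (Node (X x) e) (encl Y (f x)) 0" "\<And>x. x \<in> set xs \<Longrightarrow> length (f x) \<le> M"
  shows "exec (concat_map_in l b) e (encl Y (concat (map f xs))) 0"
  using exec_concat_map[of l e X xs 0 b Y f 0] assms by simp

lemma exec_neg:
  assumes "exec a e (encl Num xs) 0" "length xs \<le> M"
  shows "exec (neg_of a) e (encl Num (map uminus xs)) 0"
  unfolding neg_of_def by (rule exec_map0[OF assms]) (rule exec_intros)+

lemma exec_const:
  assumes "exec a e (encl X xs) 0" "length xs \<le> M"
  shows "exec (const_of k a) e (encl Num (replicate (length xs) (of_int k))) 0"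
  unfolding const_of_def map_replicate_const[symmetric] by (rule exec_map0[OF assms]) (rule exec_intros)

lemma exec_take:
  assumes "exec a e (encl X xs) 0" "exec z e (encl Y zs) 0" "length xs \<le> length zs" "length xs \<le> M"
  shows "exec (take_of a z) e (encl Y (take (length xs) zs)) 0"
proof -
  have "map2 (\<lambda>x y. y) xs zs = take (length xs) zs" using assms(3)
    by (simp add: list_eq_iff_nth_eq)
  moreover have "exec (zip_of a z (var 1)) e (encl Y (map2 (\<lambda>x y. y) xs zs)) 0"
    by (rule exec_zip[OF assms]) (rule exec_intros)+
  ultimately show ?thesis unfolding take_of_def by simp
qed

lemma exec_drop:
  assumes "exec a e (encl X xs) 0" "exec z e (encl Y zs) 0" "length xs \<le> length zs" "length xs \<le> M"
  shows "exec (drop_of a z) e (encl Y (drop (length xs) zs)) 0"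
proof -
  have fd: "foldl (\<lambda>a x. tl a) zs us = drop (length us) zs" for us :: "'a list"
    by (induction us arbitrary: zs) (auto simp: drop_Suc)
  have "exec (fold_in z a (Seq (var 1) GetR)) e (encl Y (foldl (\<lambda>a x. tl a) zs xs)) 0"
  proof (rule exec_fold_prefix0[of _ _ "encl Y", OF assms(2,1,4)])
    fix us x vs assume xs: "xs = us @ x # vs"
    then have "drop (length us) zs \<noteq> []" using assms by simp
    then obtain y ys where y: "drop (length us) zs = y # ys" by (cases "drop (length us) zs") auto
    show "exec (Seq (var 1) GetR) (Node (X x) (Node (encl Y (foldl (\<lambda>a x. tl a) zs us)) e)) (encl Y (tl (foldl (\<lambda>a x. tl a) zs us))) 0"
      unfolding fd y encl_simps list.sel by (rule exec_intros)+
  qed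
  then show ?thesis unfolding drop_of_def fd .
qed

lemma exec_dot:
  assumes a: "exec a e (encl Num xs) 0" and b: "exec b e (encl Num ys) 0" and len: "length xs \<le> length ys" "length xs \<le> M"
  shows "exec (dot_of a b) e (Num (dot xs ys)) 0"
proof -
  define g where "g st x = (tl (fst st), x * hd (fst st) + snd st)" for st and x :: real
  define A where "A st = Node (encl Num (fst st)) (Num (snd st))" for st
  have fg: "foldl g (zs, s) us = (drop (length us) zs, dot us zs + s)" if "length us \<le> length zs" for zs s us
    using that
  proof (induction us arbitrary: zs s)
    case (Cons x us)
    then obtain y zs' where "zs = y # zs'" by (cases zs) auto
    then show ?case using Cons by (simp add: g_def)
  qed simp
  let ?b = "Fork (Seq (Seq (var 1) GetL) GetR)
       (Seq (Fork (Seq (Fork (var 0) (Seq (Seq (var 1) GetL) GetL)) Times) (Seq (var 1) GetR)) Plus)"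
  have "exec (fold_in (Fork b (MkNum 0)) a ?b) e (A (foldl g (ys, 0) xs)) 0"
  proof (rule exec_fold_prefix0[of _ _ A, OF _ a len(2)])
    have "exec (MkNum 0) e (Num 0) 0" using exec_atoms(3)[of 0 e] by simp
    then show "exec (Fork b (MkNum 0)) e (A (ys, 0)) 0" unfolding A_def using b by (auto intro!: exec_Fork0)
    fix us x vs assume xs: "xs = us @ x # vs"
    then have "drop (length us) ys \<noteq> []" using len by simp
    then obtain y zs where y: "drop (length us) ys = y # zs" by (cases "drop (length us) ys") auto
    have st: "foldl g (ys, 0) us = (y # zs, dot us ys)" using fg[of us ys 0] len xs y by simp
    show "exec ?b (Node (Num x) (Node (A (foldl g (ys, 0) us)) e)) (A (g (foldl g (ys, 0) us) x)) 0"
      unfolding st g_def A_def fst_conv snd_conv encl_simps list.sel by (rule exec_intros)+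
  qed
  then show ?thesis unfolding dot_of_def
    by (intro exec_SeqR) (use len fg[of xs ys 0] in \<open>auto simp: A_def\<close>)
qed

lemma exec_unit_rows:
  assumes l: "exec l e (encl X xs) 0" and len: "length xs \<le> M"
  shows "exec (unit_rows_of l) e (encl (encl Num) (unit_rows (length xs))) 0"
proof -
  define g where "g st x = (0 # fst st, (1 # fst st) # map ((#) 0) (snd st))" for st :: "real list \<times> real list list" and x :: 'a
  define A where "A st = Node (encl Num (fst st)) (encl (encl Num) (snd st))" for st
  have fg: "foldl g ([], []) us = (replicate (length us) 0, unit_rows (length us))" for us
    by (induction us rule: rev_induct) (auto simp: g_def)
  let ?b = "Fork (Fork (MkNum 0) (Seq (var 1) GetL))
       (Fork (Fork (MkNum 1) (Seq (var 1) GetL)) (map_in (Seq (var 1) GetR) (Fork (MkNum 0) (var 0))))"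
  have c: "exec (MkNum 0) e (Num 0) 0" "exec (MkNum 1) e (Num 1) 0" for e
    using exec_atoms(3)[of 0 e] exec_atoms(3)[of 1 e] by auto
  have "exec (fold_in (Fork MkNull MkNull) l ?b) e (A (foldl g ([], []) xs)) 0"
  proof (rule exec_fold_prefix0[of _ _ A, OF _ l len])
    show "exec (Fork MkNull MkNull) e (A ([], [])) 0" unfolding A_def by (auto intro!: exec_Fork0 exec_Null)
    fix us x vs assume xs: "xs = us @ x # vs"
    obtain Z R where st: "foldl g ([], []) us = (Z, R)" and "length R = length us" using fg by auto
    then have R: "length R \<le> M" using len xs by simp
    have "exec (map_in (Seq (var 1) GetR) (Fork (MkNum 0) (var 0))) (Node (X x) (Node (Node (encl Num Z) (encl (encl Num) R)) e))
       (encl (encl Num) (map ((#) 0) R)) 0"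
      by (rule exec_map0[OF _ R]) (simp_all only: encl_simps, (rule exec_intros c)+)
    note m = this
    show "exec ?b (Node (X x) (Node (A (foldl g ([], []) us)) e)) (A (g (foldl g ([], []) us) x)) 0"
      unfolding st g_def A_def fst_conv snd_conv encl_simps by (rule m exec_intros c)+
  qed
  then show ?thesis unfolding unit_rows_of_def
    by (intro exec_SeqR) (use fg[of xs] in \<open>auto simp: A_def\<close>)
qed

lemma exec_GetL_Null: "exec GetL Null Null 0"
  by (simp add: exec_def)

text \<open>On the empty list the instruction \<open>GetL\<close> yields \<open>Null\<close>, which
  is also the encoding of the empty vector.\<close>

definition head :: "real list list \<Rightarrow> real list" where
  "head vs = (if vs = [] then [] else hd vs)"

lemma exec_head: "exec l e (encl (encl Num) vs) 0 \<Longrightarrow> exec (Seq l GetL) e (encl Num (head vs)) 0"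
  by (cases vs) (auto simp: head_def intro: exec_SeqL exec_Seq0[OF _ exec_GetL_Null])

text \<open>The empty list of rows is transposed to the empty list, whence the side condition on \<open>n\<close>.\<close>

lemma exec_transpose:
  assumes l: "exec l e (encl (encl Num) vs) 0" and vs: "vs = [] \<Longrightarrow> n = 0" "\<And>v. v \<in> set vs \<Longrightarrow> length v = n"
    and len: "length vs \<le> M" "n \<le> M"
  shows "exec (transpose_of l) e (encl (encl Num) (transp n vs)) 0"
proof -
  define g where "g st x = (map hd (snd st) # fst st, map tl (snd st))" for st :: "real list list \<times> real list list" and x :: real
  define A where "A st = Node (encl (encl Num) (fst st)) (encl (encl Num) (snd st))" for st
  have fg: "length us \<le> n \<Longrightarrow> foldl g ([], vs) us = (rev (map (\<lambda>l. map (\<lambda>v. v ! l) vs) [0..<length us]), map (drop (length us)) vs)" for us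
  proof (induction us rule: rev_induct)
    case (snoc x us)
    have "map hd (map (drop (length us)) vs) = map (\<lambda>v. v ! length us) vs"
      using snoc.prems vs(2) by (auto simp: hd_drop_conv_nth)
    then show ?case using snoc by (auto simp: g_def drop_Suc tl_drop)
  qed simp
  let ?b = "Fork (Fork (map_in (Seq (var 1) GetR) (Seq (var 0) GetL)) (Seq (var 1) GetL))
       (map_in (Seq (var 1) GetR) (Seq (var 0) GetR))"
  define v0 where "v0 = head vs"
  have v0: "length v0 = n" using vs by (cases vs) (auto simp: v0_def head_def)
  have h: "exec (Seq l GetL) e (encl Num v0) 0" unfolding v0_def by (rule exec_head[OF l])
  have "exec (fold_in (Fork MkNull l) (Seq l GetL) ?b) e (A (foldl g ([], vs) v0)) 0"
  proof (rule exec_fold_prefix0[of _ _ A, OF _ h])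
    show "length v0 \<le> M" using v0 len by simp
    show "exec (Fork MkNull l) e (A ([], vs)) 0" unfolding A_def using l by (auto intro!: exec_Fork0 exec_Null)
    fix us x ws assume v0': "v0 = us @ x # ws"
    then have us: "length us < n" using v0 by auto
    obtain R C where st: "foldl g ([], vs) us = (R, C)" and C: "C = map (drop (length us)) vs" using fg[of us] us by auto
    have lC: "length C \<le> M" using C len by simp
    have Cc: "\<exists>y ys. c = y # ys" if "c \<in> set C" for c
      using that us vs(2) unfolding C by (auto simp: neq_Nil_conv[symmetric])
    have "exec (map_in (Seq (var 1) GetR) (Seq (var 0) GetL)) (Node (Num x) (Node (Node (encl (encl Num) R) (encl (encl Num) C)) e))
       (encl Num (map hd C)) 0"
    proof (rule exec_map0[OF _ lC])
      fix c assume "c \<in> set C"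
      then obtain y ys where c: "c = y # ys" using Cc by blast
      show "exec (Seq (var 0) GetL) (Node (encl Num c) (Node (Num x) (Node (Node (encl (encl Num) R) (encl (encl Num) C)) e))) (Num (hd c)) 0"
        unfolding c encl_simps list.sel by (rule exec_intros)+
    qed (rule exec_intros)+
    note m1 = this
    have "exec (map_in (Seq (var 1) GetR) (Seq (var 0) GetR)) (Node (Num x) (Node (Node (encl (encl Num) R) (encl (encl Num) C)) e))
       (encl (encl Num) (map tl C)) 0"
    proof (rule exec_map0[OF _ lC])
      fix c assume "c \<in> set C"
      then obtain y ys where c: "c = y # ys" using Cc by blast
      show "exec (Seq (var 0) GetR) (Node (encl Num c) (Node (Num x) (Node (Node (encl (encl Num) R) (encl (encl Num) C)) e))) (encl Num (tl c)) 0"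
        unfolding c encl_simps list.sel by (rule exec_intros)+
    qed (rule exec_intros)+
    note m2 = this
    show "exec ?b (Node (Num x) (Node (A (foldl g ([], vs) us)) e)) (A (g (foldl g ([], vs) us) x)) 0"
      unfolding st g_def A_def fst_conv snd_conv encl_simps by (rule m1 m2 exec_intros)+
  qed
  then have "exec (transpose_of l) e (encl (encl Num) (rev (rev (transp n vs)))) 0" unfolding transpose_of_def
    by (intro exec_rev exec_SeqL) (use fg[of v0] v0 len in \<open>auto simp: A_def transp_def\<close>)
  then show ?thesis by simp
qed

end

section \<open>Outcomes and linear programs on lists\<close>

text \<open>Every value of \<open>g\<close> is a value of \<open>f\<close>, and every value of
  \<open>f\<close> is matched or undercut by one of \<open>g\<close>, so boundedness, infimum and
  attainment carry over. The inequality leaves room for an auxiliary variable that bounds a maximum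
  from above without being tight.\<close>

lemma map_outcome_correct:
  assumes out: "is_outcome S f r" and maps: "\<And>s. s \<in> S \<Longrightarrow> \<phi> s \<in> T \<and> g (\<phi> s) \<le> f s"
    and onto: "\<And>t. t \<in> T \<Longrightarrow> \<exists>s\<in>S. f s = (g t :: real)"
  shows "is_outcome T g (map_outcome \<phi> r)"
proof -
  have sub: "g ` T \<subseteq> f ` S" using onto by (metis image_iff image_subsetI)
  have bdd: "bdd_below (f ` S) \<longleftrightarrow> bdd_below (g ` T)"
  proof
    show "bdd_below (f ` S) \<Longrightarrow> bdd_below (g ` T)" using sub by (rule bdd_below_mono[rotated])
    assume "bdd_below (g ` T)"
    then obtain b where "\<And>t. t \<in> T \<Longrightarrow> b \<le> g t" by (auto simp: bdd_below_def)
    then have "b \<le> f s" if "s \<in> S" for s using maps[OF that] by (meson order_trans)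
    then show "bdd_below (f ` S)" by (auto simp: bdd_below_def)
  qed
  show ?thesis
  proof (cases r)
    case Infeasible then show ?thesis using out onto by auto
  next
    case Unbounded then show ?thesis using out bdd by auto
  next
    case (Unattained x)
    then have S: "S \<noteq> {}" "bdd_below (f ` S)" "x = Inf (f ` S)" "x \<notin> f ` S" using out by auto
    have T: "T \<noteq> {}" using S maps by auto
    have "Inf (g ` T) = Inf (f ` S)"
    proof (rule antisym)
      show "Inf (f ` S) \<le> Inf (g ` T)" using sub S T by (intro cInf_superset_mono) auto
      show "Inf (g ` T) \<le> Inf (f ` S)"
      proof (rule cInf_greatest)
        fix y assume "y \<in> f ` S"
        then obtain s where "s \<in> S" "y = f s" by auto
        then show "Inf (g ` T) \<le> y" using maps[of s] S bdd by (auto intro: cInf_lower2)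
      qed (use S in auto)
    qed
    then show ?thesis using Unattained S T bdd sub by auto
  next
    case (Optimal s)
    then have s: "s \<in> S" "\<forall>t\<in>S. f s \<le> f t" using out by auto
    have "g (\<phi> s) \<le> g t" if "t \<in> T" for t using onto[OF that] s maps[OF s(1)] by fastforce
    then show ?thesis using Optimal maps[OF s(1)] by auto
  qed
qed

fun outcome_value :: "('s \<Rightarrow> real) \<Rightarrow> 's outcome \<Rightarrow> real" where
  "outcome_value f (Unattained r) = r"
| "outcome_value f (Optimal s) = f s"
| "outcome_value f _ = 0"

fun better :: "('s \<Rightarrow> real) \<Rightarrow> 's outcome \<Rightarrow> 's outcome \<Rightarrow> 's outcome" where
  "better f r Infeasible = r"
| "better f Infeasible r = r"
| "better f Unbounded r = Unbounded"
| "better f r Unbounded = Unbounded"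
| "better f r r' = (if outcome_value f r < outcome_value f r' then r
     else if outcome_value f r' < outcome_value f r then r'
     else case r' of Optimal s \<Rightarrow> r' | _ \<Rightarrow> r)"

text \<open>Ties dictate the form of \<open>better\<close>: an optimal solution has to win against
  an unattained infimum of the same value.\<close>

lemma better_correct:
  assumes "is_outcome S f r" "is_outcome T f r'"
  shows "is_outcome (S \<union> T) f (better f r r')"
proof -
  \<comment> \<open>A description of unattained infima without \<open>Inf\<close>, which behaves
    well under unions.\<close>
  have inf: "is_outcome S f (Unattained x) \<longleftrightarrow> S \<noteq> {} \<and> (\<forall>s\<in>S. x < f s) \<and> (\<forall>y>x. \<exists>s\<in>S. f s < y)" for S x
  proof
    assume *: "is_outcome S f (Unattained x)"
    then have S: "S \<noteq> {}" "bdd_below (f ` S)" "x = Inf (f ` S)" "x \<notin> f ` S" by auto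
    have "x < f s" if "s \<in> S" for s
      using cInf_lower[OF _ S(2), of "f s"] that S(3,4) by (metis imageI order_le_less)
    moreover have "\<exists>s\<in>S. f s < y" if "y > x" for y
      using cInf_lessD[of "f ` S" y] S that by auto
    ultimately show "S \<noteq> {} \<and> (\<forall>s\<in>S. x < f s) \<and> (\<forall>y>x. \<exists>s\<in>S. f s < y)" using S by blast
  next
    assume *: "S \<noteq> {} \<and> (\<forall>s\<in>S. x < f s) \<and> (\<forall>y>x. \<exists>s\<in>S. f s < y)"
    have b: "bdd_below (f ` S)" using * by (intro bdd_belowI[of _ x]) auto
    have "Inf (f ` S) = x"
    proof (rule cInf_eq_non_empty)
      show "f ` S \<noteq> {}" using * by auto
      fix y show "y \<in> f ` S \<Longrightarrow> x \<le> y" using * by auto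
    next
      fix y assume "\<And>z. z \<in> f ` S \<Longrightarrow> y \<le> z"
      then show "y \<le> x" using * by (metis imageI leD leI)
    qed
    then show "is_outcome S f (Unattained x)" using * b by auto
  qed
  have unb: "is_outcome S f Unbounded \<Longrightarrow> is_outcome (S \<union> T) f Unbounded" for S T
    by (auto simp: image_Un)
  show ?thesis
  proof (cases r)
    case Infeasible then show ?thesis using assms by (cases r') auto
  next
    case Unbounded then show ?thesis using assms unb[of S T] by (cases r') auto
  next
    case (Unattained x)
    show ?thesis
    proof (cases r')
      case Infeasible then show ?thesis using assms by auto
    next
      case U: Unbounded then show ?thesis using assms unb[of T S] Unattained by (auto simp: Un_commute)
    next
      case U: (Unattained y)
      have 1: "S \<noteq> {} \<and> (\<forall>s\<in>S. x < f s) \<and> (\<forall>y>x. \<exists>s\<in>S. f s < y)" using assms(1) unfolding Unattained inf .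
      have 2: "T \<noteq> {} \<and> (\<forall>s\<in>T. y < f s) \<and> (\<forall>z>y. \<exists>s\<in>T. f s < z)" using assms(2) unfolding U inf .
      have "is_outcome (S \<union> T) f (Unattained (min x y))"
        unfolding inf using 1 2 by (auto simp: min_def)
      then show ?thesis unfolding Unattained U by (auto simp: min_def split: if_splits simp del: is_outcome.simps)
    next
      case U: (Optimal s)
      have 1: "S \<noteq> {} \<and> (\<forall>s\<in>S. x < f s) \<and> (\<forall>y>x. \<exists>s\<in>S. f s < y)" using assms(1) unfolding Unattained inf .
      have 2: "s \<in> T" "\<forall>t\<in>T. f s \<le> f t" using assms(2) U by auto
      show ?thesis
      proof (cases "x < f s")
        case True
        then have "is_outcome (S \<union> T) f (Unattained x)" unfolding inf using 1 2 by (auto intro: less_le_trans)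
        then show ?thesis unfolding Unattained U using True by (simp del: is_outcome.simps)
      next
        case False
        then have "is_outcome (S \<union> T) f (Optimal s)" using 1 2 by (auto intro: less_imp_le order_trans)
        then show ?thesis unfolding Unattained U using False by (simp del: is_outcome.simps)
      qed
    qed
  next
    case (Optimal s)
    have 1: "s \<in> S" "\<forall>t\<in>S. f s \<le> f t" using assms(1) Optimal by auto
    show ?thesis
    proof (cases r')
      case Infeasible then show ?thesis using assms by auto
    next
      case U: Unbounded then show ?thesis using assms unb[of T S] Optimal by (auto simp: Un_commute)
    next
      case U: (Unattained x)
      have 2: "T \<noteq> {} \<and> (\<forall>s\<in>T. x < f s) \<and> (\<forall>y>x. \<exists>s\<in>T. f s < y)" using assms(2) unfolding U inf .
      show ?thesis
      proof (cases "x < f s")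
        case True
        then have "is_outcome (S \<union> T) f (Unattained x)" unfolding inf using 1 2 by (auto intro: less_le_trans)
        then show ?thesis unfolding Optimal U using True by (simp del: is_outcome.simps)
      next
        case False
        then have "is_outcome (S \<union> T) f (Optimal s)" using 1 2 by (auto intro: less_imp_le order_trans)
        then show ?thesis unfolding Optimal U using False by (simp del: is_outcome.simps)
      qed
    next
      case U: (Optimal s')
      then show ?thesis using 1 assms(2) Optimal by (auto intro: less_imp_le order_trans)
    qed
  qed
qed

section \<open>Linear programs as lists of rows\<close>

definition sat :: "(real list \<times> real) list \<Rightarrow> real list \<Rightarrow> bool" where
  "sat rs z \<longleftrightarrow> (\<forall>(l, r)\<in>set rs. dot l z \<le> r)"

lemma sat_simps [simp]: "sat [] z" "sat (q # qs) z \<longleftrightarrow> dot (fst q) z \<le> snd q \<and> sat qs z"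
  "sat (qs @ qs') z \<longleftrightarrow> sat qs z \<and> sat qs' z"
  by (auto simp: sat_def)

lemma sat_map: "sat (map f xs) z \<longleftrightarrow> (\<forall>x\<in>set xs. dot (fst (f x)) z \<le> snd (f x))"
  by (auto simp: sat_def split: prod.splits)

lemma dot_sum: "length xs = length ys \<Longrightarrow> dot xs ys = (\<Sum>i<length xs. xs ! i * ys ! i)"
  by (induction xs ys rule: list_induct2) (simp_all add: sum.lessThan_Suc_shift del: sum.lessThan_Suc)

lemma dot_append [simp]: "length xs = length xs' \<Longrightarrow> dot (xs @ ys) (xs' @ ys') = dot xs xs' + dot ys ys'"
  by (simp add: dot_def)

lemma dot_zeros [simp]: "dot (replicate k 0) ys = 0"
  by (induction k arbitrary: ys) (auto, case_tac ys, auto)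

lemma dot_uminus [simp]: "dot (map uminus xs) ys = - dot xs ys"
proof (induction xs arbitrary: ys)
  case (Cons x xs) then show ?case by (cases ys) auto
qed simp

lemma dot_ones: "length ys = k \<Longrightarrow> dot (replicate k 1) ys = sum_list ys"
  by (induction ys arbitrary: k) (auto simp: Suc_length_conv)

lemma dot_unit_rows: "i < k \<Longrightarrow> length ys = k \<Longrightarrow> dot (unit_rows k ! i) ys = ys ! i"
proof (induction k arbitrary: i ys)
  case (Suc k)
  then obtain y ys' where ys: "ys = y # ys'" "length ys' = k" by (cases ys) auto
  then show ?case using Suc by (cases i) auto
qed simp

lemma length_unit_rows_nth [simp]: "e \<in> set (unit_rows k) \<Longrightarrow> length e = k"
  by (induction k arbitrary: e) auto

lemma ball_unit_rows: "length ys = k \<Longrightarrow> (\<forall>e\<in>set (unit_rows k). P (dot e ys)) \<longleftrightarrow> (\<forall>i<k. P (ys ! i))"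
  by (auto simp: all_set_conv_all_nth dot_unit_rows)

definition list_lp :: "real list \<Rightarrow> (real list \<times> real) list \<Rightarrow> real list \<Rightarrow> lp" where
  "list_lp ob rs I = \<lparr>obj = vec_of_list ob, lhs = mat (length rs) (length ob) (\<lambda>(i, j). fst (rs ! i) ! j),
     rhs = vec_of_list (map snd rs), ints = {i. i < length ob \<and> I ! i = 1}\<rparr>"

definition lp_set :: "nat \<Rightarrow> (real list \<times> real) list \<Rightarrow> real list \<Rightarrow> real list set" where
  "lp_set N rs I = {z. length z = N \<and> (\<forall>i<N. I ! i = 1 \<longrightarrow> z ! i \<in> \<int>) \<and> sat rs z}"

definition enc_row :: "real list \<times> real \<Rightarrow> val" where
  "enc_row q = Node (encl Num (fst q)) (Num (snd q))"

definition lp_val :: "real list \<Rightarrow> (real list \<times> real) list \<Rightarrow> real list \<Rightarrow> val" where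
  "lp_val ob rs I = Node (encl Num ob) (Node (encl (encl Num) (map fst rs))
     (Node (encl Num (map snd rs)) (Node (encl Num I) Null)))"

lemma lp_ok_list_lp: "lp_ok (list_lp ob rs I)"
  by (auto simp: lp_ok_def list_lp_def)

lemma enc_vec_list: "enc_vec (vec_of_list xs) = encl Num xs"
  by (simp add: enc_vec_def encl_def list_vec)

lemma enc_list_lp:
  assumes "\<And>q. q \<in> set rs \<Longrightarrow> length (fst q) = length ob" "length I = length ob" "set I \<subseteq> {0, 1}"
  shows "enc_lp (list_lp ob rs I) = lp_val ob rs I"
proof -
  let ?A = "mat (length rs) (length ob) (\<lambda>(i, j). fst (rs ! i) ! j)"
  have row: "Matrix.row ?A i = vec_of_list (fst (rs ! i))" if "i < length rs" for i
    using assms(1) that by (intro eq_vecI) (auto simp: vec_of_list_index)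
  have "map enc_vec (Matrix.rows ?A) = map (encl Num) (map fst rs)"
    by (rule nth_equalityI) (auto simp: row enc_vec_list simp del: row_mat)
  then have "enc_mat ?A = encl (encl Num) (map fst rs)" unfolding enc_mat_def encl_def by simp
  moreover have "map (\<lambda>i. Num (of_bool (i \<in> {i. i < length ob \<and> I ! i = 1}))) [0..<length ob] = map Num I"
  proof (rule nth_equalityI)
    fix i assume "i < length (map (\<lambda>i. Num (of_bool (i \<in> {i. i < length ob \<and> I ! i = 1}))) [0..<length ob])"
    then have i: "i < length ob" by simp
    then have "I ! i \<in> {0, 1}" using assms(2,3) nth_mem by (metis subsetD)
    then show "map (\<lambda>i. Num (of_bool (i \<in> {i. i < length ob \<and> I ! i = 1}))) [0..<length ob] ! i = map Num I ! i"
      using i assms(2) by auto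
  qed (use assms in simp)
  then have "enc_ints (length ob) {i. i < length ob \<and> I ! i = 1} = encl Num I"
    unfolding enc_ints_def encl_def by simp
  ultimately show ?thesis
    by (simp add: enc_lp_def list_lp_def lp_val_def enc_vec_list del: vec_of_list_map)
qed

lemma scalar_prod_lists: "length xs = length ys \<Longrightarrow> scalar_prod (vec_of_list xs) (vec_of_list ys) = dot xs ys"
  by (simp add: scalar_prod_def dot_sum vec_of_list_index atLeast0LessThan)

lemma lp_outcome_list:
  assumes out: "lp_outcome (list_lp ob rs I) r"
    and len: "\<And>q. q \<in> set rs \<Longrightarrow> length (fst q) = length ob"
  shows "is_outcome (lp_set (length ob) rs I) (dot ob) (map_outcome list_of_vec r)"
proof -
  let ?P = "list_lp ob rs I"
  have dims: "dim_vec (obj ?P) = length ob" "ints ?P = {i. i < length ob \<and> I ! i = 1}"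
    by (simp_all add: list_lp_def)
  have mem: "z \<in> partly_integral (dim_vec (obj ?P)) (ints ?P) \<and> lhs ?P *\<^sub>v z \<le> rhs ?P \<longleftrightarrow>
      list_of_vec z \<in> lp_set (length ob) rs I" for z
  proof (cases "dim_vec z = length ob")
    case True
    have row: "vec_index (lhs ?P *\<^sub>v z) i = dot (fst (rs ! i)) (list_of_vec z)" if "i < length rs" for i
    proof -
      have "Matrix.row (lhs ?P) i = vec_of_list (fst (rs ! i))"
        using len that by (intro eq_vecI) (auto simp: list_lp_def vec_of_list_index)
      then have "vec_index (lhs ?P *\<^sub>v z) i = scalar_prod (vec_of_list (fst (rs ! i))) (vec_of_list (list_of_vec z))"
        using that by (simp add: list_lp_def vec_list)
      then show ?thesis using that len True by (simp add: scalar_prod_lists)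
    qed
    have "lhs ?P *\<^sub>v z \<le> rhs ?P \<longleftrightarrow> (\<forall>i<length rs. vec_index (lhs ?P *\<^sub>v z) i \<le> snd (rs ! i))"
      by (auto simp: less_eq_vec_def list_lp_def vec_of_list_index)
    also have "\<dots> \<longleftrightarrow> (\<forall>i<length rs. dot (fst (rs ! i)) (list_of_vec z) \<le> snd (rs ! i))" using row by simp
    also have "\<dots> \<longleftrightarrow> sat rs (list_of_vec z)"
      unfolding sat_def all_set_conv_all_nth by (simp add: case_prod_beta)
    finally have 1: "lhs ?P *\<^sub>v z \<le> rhs ?P \<longleftrightarrow> sat rs (list_of_vec z)" .
    have "z \<in> partly_integral (dim_vec (obj ?P)) (ints ?P) \<longleftrightarrow> (\<forall>i<length ob. I ! i = 1 \<longrightarrow> list_of_vec z ! i \<in> \<int>)"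
      unfolding dims partly_integral_def mem_Collect_eq carrier_vec_def list_of_vec_index using True by blast
    then show ?thesis unfolding 1 lp_set_def mem_Collect_eq length_list_of_vec using True by blast
  next
    case False
    then show ?thesis
      unfolding dims partly_integral_def lp_set_def carrier_vec_def mem_Collect_eq length_list_of_vec by blast
  qed
  have ob: "scalar_prod (obj ?P) z = dot ob (list_of_vec z)" if "length (list_of_vec z) = length ob" for z
    using scalar_prod_lists[of ob "list_of_vec z"] that by (simp add: list_lp_def vec_list)
  show ?thesis
  proof (rule map_outcome_correct[OF out[unfolded lp_outcome_def]])
    fix z assume "z \<in> {z \<in> partly_integral (dim_vec (obj ?P)) (ints ?P). lhs ?P *\<^sub>v z \<le> rhs ?P}"
    then show "list_of_vec z \<in> lp_set (length ob) rs I \<and> dot ob (list_of_vec z) \<le> scalar_prod (obj ?P) z"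
      using mem ob by (auto simp: lp_set_def)
  next
    fix t assume t: "t \<in> lp_set (length ob) rs I"
    then show "\<exists>z\<in>{z \<in> partly_integral (dim_vec (obj ?P)) (ints ?P). lhs ?P *\<^sub>v z \<le> rhs ?P}. scalar_prod (obj ?P) z = dot ob t"
      using mem[of "vec_of_list t"] ob[of "vec_of_list t"]
      by (intro bexI[of _ "vec_of_list t"]) (auto simp: lp_set_def list_vec)
  qed
qed

section \<open>The linear program of a guess\<close>

lemma length_transp [simp]: "length (transp n vs) = n"
  by (simp add: transp_def)

lemma transp_row_length [simp]: "t \<in> set (transp n vs) \<Longrightarrow> length t = length vs"
  by (auto simp: transp_def)

lemma dot_transp: "l < n \<Longrightarrow> length z = length vs \<Longrightarrow> dot (transp n vs ! l) z = (\<Sum>v<length vs. z ! v * vs ! v ! l)"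
  by (simp add: transp_def dot_sum mult.commute)

lemma ball_map2: "length xs = length ys \<Longrightarrow> (\<forall>q\<in>set (map2 f xs ys). P q) \<longleftrightarrow> (\<forall>i<length xs. P (f (xs ! i) (ys ! i)))"
  by (auto simp: set_zip)

lemma sat_map2: "length xs = length ys \<Longrightarrow>
  sat (map2 f xs ys) z \<longleftrightarrow> (\<forall>i<length xs. dot (fst (f (xs ! i) (ys ! i))) z \<le> snd (f (xs ! i) (ys ! i)))"
  unfolding sat_def by (subst ball_map2) (auto simp: case_prod_beta)

text \<open>The columns of the homogeneous system behind \<open>minface\<close>: the leading 1
  encodes the equality of total weights, and the negated columns bring the weights of the given
  points to the left-hand side.\<close>

definition face_gens :: "real list list \<Rightarrow> real list list \<Rightarrow> real list list" where
  "face_gens vs T = map ((#) 1) vs @ map (\<lambda>t. map uminus (1 # t)) T"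

text \<open>A linear program has no strict inequalities; since the system is homogeneous, positive
  weight at the tested vertex can be replaced by weight at least 1. The three zeros skip the
  multipliers of the given points.\<close>

definition face_rows :: "nat \<Rightarrow> real list list \<Rightarrow> real list \<Rightarrow> (real list \<times> real) list" where
  "face_rows k G e = map (\<lambda>t. (t, 0)) (transp k G) @ map (\<lambda>t. (map uminus t, 0)) (transp k G) @
     map (\<lambda>t. (map uminus t, 0)) (unit_rows (length G)) @ [(map uminus (e @ [0, 0, 0]), -1)]"

lemma sat_face_rows:
  assumes z: "length z = length G" and x: "x < V" and G: "length G = V + 3"
  shows "sat (face_rows k G (unit_rows V ! x)) z \<longleftrightarrow>
    (\<forall>l<k. (\<Sum>v<length G. z ! v * G ! v ! l) = 0) \<and> (\<forall>v<length G. 0 \<le> z ! v) \<and> 1 \<le> z ! x"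
proof -
  have 1: "sat (map (\<lambda>t. (map uminus t, 0)) (unit_rows (length G))) z \<longleftrightarrow> (\<forall>v<length G. 0 \<le> z ! v)"
    using ball_unit_rows[OF z, of "\<lambda>r. 0 \<le> r"] by (simp add: sat_map)
  have 2: "sat (map (\<lambda>t. (t, 0)) (transp k G)) z \<and> sat (map (\<lambda>t. (map uminus t, 0)) (transp k G)) z \<longleftrightarrow>
      (\<forall>l<k. (\<Sum>v<length G. z ! v * G ! v ! l) = 0)"
    using dot_transp[OF _ z, of _ k] unfolding sat_map all_set_conv_all_nth by (auto intro: antisym)
  have "dot (unit_rows V ! x @ [0, 0, 0]) (take V z @ drop V z) = take V z ! x + dot [0, 0, 0] (drop V z)"
    using x z G by (subst dot_append) (auto simp: dot_unit_rows)
  moreover have "dot [0, 0, 0] (drop V z) = 0" using dot_zeros[of 3 "drop V z"] by (simp add: numeral_3_eq_3)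
  ultimately have 3: "dot (unit_rows V ! x @ [0, 0, 0]) z = z ! x" using x by simp
  show ?thesis unfolding face_rows_def sat_simps fst_conv snd_conv dot_uminus 3 using 1 2 by auto
qed

text \<open>The program reads \<open>n\<close> off the first vertex. For an empty list of vertices
  it therefore works with 0, whatever the dimension is, hence the premise
  \<open>vs \<noteq> []\<close> for the rows of \<open>bl\<close>.\<close>

locale adapt_lists =
  fixes vs A B bl :: "real list list" and bc c d xi yi :: "real list" and n :: nat
  assumes vs_len: "\<And>v. v \<in> set vs \<Longrightarrow> length v = n"
    and A_len: "length A = length bc" "\<And>a. a \<in> set A \<Longrightarrow> length a = length c"
    and B_len: "length B = length bc" "\<And>b. b \<in> set B \<Longrightarrow> length b = length d"
    and bl_len: "length bl = length bc" "vs \<noteq> [] \<Longrightarrow> a \<in> set bl \<Longrightarrow> length a = n"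
    and ints_len: "length xi = length c" "length yi = length d" "set xi \<subseteq> {0, 1}" "set yi \<subseteq> {0, 1}"
begin

definition slot :: "nat \<Rightarrow> nat \<Rightarrow> real list \<Rightarrow> real list" where
  "slot k i b = (if k = i then b else replicate (length d) 0)"

text \<open>The last variable is an upper bound for all costs of the \<open>y i\<close> and turns
  the maximum into linear rows. The index 0 selects none of the three slots and serves for the
  objective.\<close>

definition base_row :: "nat \<Rightarrow> real list \<Rightarrow> real list \<Rightarrow> real \<Rightarrow> real list" where
  "base_row i a b w = a @ slot 1 i b @ slot 2 i b @ slot 3 i b @ [w]"

definition base_dim :: nat where
  "base_dim = length c + 3 * length d + 1"

definition base_vec :: "real list \<Rightarrow> (nat \<Rightarrow> real list) \<Rightarrow> real \<Rightarrow> real list" where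
  "base_vec x y t = x @ y 1 @ y 2 @ y 3 @ [t]"

definition base_rows :: "(real list \<times> real) list" where
  "base_rows = map (\<lambda>i. (base_row i (replicate (length c) 0) d (-1), 0)) [1, 2, 3]"

definition base_obj :: "real list" where
  "base_obj = base_row 0 c [] 1"

definition base_ints :: "real list" where
  "base_ints = xi @ yi @ yi @ yi @ [0]"

definition row_data :: "(real list \<times> real list \<times> real list \<times> real) list" where
  "row_data = zip A (zip B (zip bl bc))"

text \<open>The products with \<open>x\<close> and \<open>y i\<close> do not involve the uncertain
  point, so the row is jointly linear in \<open>x\<close>, \<open>y i\<close> and the coordinates of
  the point. This is where the matrices being deterministic matters.\<close>

definition con_rows :: "real list \<Rightarrow> nat \<Rightarrow> (real list \<times> real) list" where
  "con_rows Z i = map (\<lambda>(a, b, l, r). (replicate (length vs) 0 @ map uminus l @ Z @ base_row i a b 0, r)) row_data"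

text \<open>The variables of a block are the weights of the vertices and the coordinates of the point they
  represent. The blocks of earlier requirements follow as \<open>Z\<close> and the variables of \<open>base_vec\<close> come last.\<close>

definition block_rows :: "real list \<Rightarrow> real list \<Rightarrow> real list \<Rightarrow> (real list \<times> real) list" where
  "block_rows F I Z = (let T = Z @ replicate base_dim 0; zn = replicate n 0 in
     map (\<lambda>e. (map uminus e @ zn @ T, 0)) (unit_rows (length vs)) @
     map2 (\<lambda>e f. (e @ zn @ T, f)) (unit_rows (length vs)) F @
     [(replicate (length vs) 1 @ zn @ T, 1), (map uminus (replicate (length vs) 1) @ zn @ T, -1)] @
     map2 (\<lambda>t e. (t @ map uminus e @ T, 0)) (transp n vs) (unit_rows n) @
     map2 (\<lambda>t e. (map uminus t @ e @ T, 0)) (transp n vs) (unit_rows n) @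
     concat (map (\<lambda>i. if 0 < I ! (i - 1) then con_rows Z i else []) [1, 2, 3]))"

text \<open>A new block is put in front of all variables, so old rows are padded with zeros on the
  left. The second component is always the zero vector of the present number of block
  variables.\<close>

definition step_rows :: "(real list \<times> real) list \<times> real list \<Rightarrow> real list \<times> real list \<Rightarrow> (real list \<times> real) list \<times> real list" where
  "step_rows st q = (let zb = replicate (length vs) 0 @ replicate n 0 in
     (block_rows (fst q) (snd q) (snd st) @ map (\<lambda>r. (zb @ fst r, snd r)) (fst st), zb @ snd st))"

definition build :: "(real list \<times> real list) list \<Rightarrow> (real list \<times> real) list \<times> real list" where
  "build qs = foldl step_rows (base_rows, []) qs"

text \<open>\<open>fst q\<close> holds the 0/1 flags of a face: an upper bound 0 forbids a vertex
  outside the face, and the upper bound 1 follows from the sum anyway. Positive entries of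
  \<open>snd q\<close> mark the indices \<open>i\<close> whose constraints the point has to
  satisfy.\<close>

definition block_sat :: "real list \<times> real list \<Rightarrow> real list \<Rightarrow> (nat \<Rightarrow> real list) \<Rightarrow> real list \<Rightarrow> real list \<Rightarrow> bool" where
  "block_sat q x y al om \<longleftrightarrow> (\<forall>v<length vs. 0 \<le> al ! v \<and> al ! v \<le> fst q ! v) \<and> sum_list al = 1 \<and>
     (\<forall>l<n. (\<Sum>v<length vs. al ! v * vs ! v ! l) = om ! l) \<and>
     (\<forall>i\<in>{1, 2, 3}. 0 < snd q ! (i - 1) \<longrightarrow>
        (\<forall>r<length bc. dot (A ! r) x + dot (B ! r) (y i) - dot (bl ! r) om \<le> bc ! r))"

lemma dot_base_row:
  assumes "length x = length c" "\<And>k. length (y k) = length d" "length a = length c" "length b = length d" "i \<in> {1, 2, 3}"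
  shows "dot (base_row i a b w) (base_vec x y t) = dot a x + dot b (y i) + w * t"
  using assms by (auto simp: base_row_def base_vec_def slot_def)

lemma length_base_row: "length a = length c \<Longrightarrow> i \<in> {1, 2, 3} \<Longrightarrow> length b = length d \<Longrightarrow> length (base_row i a b w) = base_dim"
  by (auto simp: base_row_def base_dim_def slot_def)

lemma row_data_nth:
  "length row_data = length bc" "r < length bc \<Longrightarrow> row_data ! r = (A ! r, B ! r, bl ! r, bc ! r)"
  using A_len B_len bl_len by (auto simp: row_data_def)

lemma sat_base_rows:
  assumes "length x = length c" "\<And>k. length (y k) = length d"
  shows "sat base_rows (base_vec x y t) \<longleftrightarrow> (\<forall>i\<in>{1, 2, 3}. dot d (y i) \<le> t)"
  using assms by (simp add: base_rows_def dot_base_row)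

lemma sat_con_rows:
  assumes len: "length x = length c" "\<And>k. length (y k) = length d" "length al = length vs" "length om = n"
      "length z = length Z" and Z: "Z = replicate k 0" and i: "i \<in> {1, 2, 3}" and ne: "vs \<noteq> []"
  shows "sat (con_rows Z i) (al @ om @ z @ base_vec x y t) \<longleftrightarrow>
     (\<forall>r<length bc. dot (A ! r) x + dot (B ! r) (y i) - dot (bl ! r) om \<le> bc ! r)"
proof -
  have "dot (replicate (length vs) 0 @ map uminus (bl ! r) @ Z @ base_row i (A ! r) (B ! r) 0) (al @ om @ z @ base_vec x y t) =
     dot (A ! r) x + dot (B ! r) (y i) - dot (bl ! r) om" if r: "r < length bc" for r
  proof -
    have l: "length (A ! r) = length c" "length (B ! r) = length d" "length (bl ! r) = n"
      using A_len B_len bl_len r ne by auto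
    show ?thesis using len l Z dot_base_row[OF len(1,2) l(1,2) i] by simp
  qed
  then show ?thesis unfolding con_rows_def sat_map all_set_conv_all_nth row_data_nth(1)
    by (simp add: row_data_nth(2))
qed

lemma sat_block_rows:
  assumes len: "length x = length c" "\<And>k. length (y k) = length d" "length al = length vs" "length om = n"
      "length z = length Z" "length (fst q) = length vs" and Z: "Z = replicate k 0" and ne: "vs \<noteq> []"
  shows "sat (block_rows (fst q) (snd q) Z) (al @ om @ z @ base_vec x y t) \<longleftrightarrow> block_sat q x y al om"
proof -
  let ?T = "Z @ replicate base_dim 0" and ?zn = "replicate n (0::real)" and ?w = "al @ om @ z @ base_vec x y t"
  have T: "dot ?T (z @ base_vec x y t) = 0" using len Z by simp
  have d1: "dot (e @ ?zn @ ?T) ?w = dot e al" if "length e = length vs" for e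
    using that len T by simp
  have d2: "dot (t' @ e @ ?T) ?w = dot t' al + dot e om" if "length t' = length vs" "length e = n" for t' e
    using that len T by simp
  have p1: "sat (map (\<lambda>e. (map uminus e @ ?zn @ ?T, 0)) (unit_rows (length vs))) ?w \<longleftrightarrow> (\<forall>v<length vs. 0 \<le> al ! v)"
    using ball_unit_rows[OF len(3), of "\<lambda>r. 0 \<le> r"] by (simp add: sat_map d1)
  have p2: "sat (map2 (\<lambda>e f. (e @ ?zn @ ?T, f)) (unit_rows (length vs)) (fst q)) ?w \<longleftrightarrow> (\<forall>v<length vs. al ! v \<le> fst q ! v)"
    using len by (subst sat_map2) (auto simp: dot_unit_rows Z)
  have p3: "sat [(replicate (length vs) 1 @ ?zn @ ?T, 1), (map uminus (replicate (length vs) 1) @ ?zn @ ?T, -1)] ?w \<longleftrightarrow> sum_list al = 1"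
  proof -
    have "dot (replicate (length vs) 1 @ ?zn @ ?T) ?w = sum_list al"
      "dot (map uminus (replicate (length vs) 1) @ ?zn @ ?T) ?w = - sum_list al"
      using len(3) by (subst d1; simp only: dot_uminus dot_ones length_map length_replicate)+
    then show ?thesis by (simp only: sat_simps fst_conv snd_conv) auto
  qed
  have tr: "length (transp n vs ! l) = length vs" "length (unit_rows n ! l) = n" if "l < n" for l
    using that by (auto simp: transp_def)
  have p4: "sat (map2 (\<lambda>t e. (t @ map uminus e @ ?T, 0)) (transp n vs) (unit_rows n)) ?w \<and>
      sat (map2 (\<lambda>t e. (map uminus t @ e @ ?T, 0)) (transp n vs) (unit_rows n)) ?w \<longleftrightarrow>
      (\<forall>l<n. (\<Sum>v<length vs. al ! v * vs ! v ! l) = om ! l)"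
  proof -
    have "dot (transp n vs ! l @ map uminus (unit_rows n ! l) @ ?T) ?w = (\<Sum>v<length vs. al ! v * vs ! v ! l) - om ! l"
      "dot (map uminus (transp n vs ! l) @ unit_rows n ! l @ ?T) ?w = om ! l - (\<Sum>v<length vs. al ! v * vs ! v ! l)" if "l < n" for l
      using that tr[OF that] len by (subst d2; simp add: dot_transp dot_unit_rows)+
    then show ?thesis by (subst (1 2) sat_map2) (auto simp: antisym_conv)
  qed
  have p5: "sat (concat (map (\<lambda>i. if 0 < snd q ! (i - 1) then con_rows Z i else []) [1, 2, 3])) ?w \<longleftrightarrow>
     (\<forall>i\<in>{1, 2, 3}. 0 < snd q ! (i - 1) \<longrightarrow>
        (\<forall>r<length bc. dot (A ! r) x + dot (B ! r) (y i) - dot (bl ! r) om \<le> bc ! r))"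
  proof -
    have "sat (con_rows Z i) ?w \<longleftrightarrow> (\<forall>r<length bc. dot (A ! r) x + dot (B ! r) (y i) - dot (bl ! r) om \<le> bc ! r)"
      if "i \<in> {1, 2, 3}" for i by (rule sat_con_rows[OF len(1-5) Z that ne])
    from this[of 1] this[of 2] this[of 3] show ?thesis by simp
  qed
  show ?thesis unfolding block_rows_def Let_def sat_simps(3) p1 p2 p3 p5 block_sat_def using p4 by blast
qed

lemma build_snoc: "build (qs @ [q]) = step_rows (build qs) q"
  by (simp add: build_def)

lemma snd_build: "snd (build qs) = replicate (length qs * (length vs + n)) 0"
  by (induction qs rule: rev_induct)
    (simp_all add: build_snoc step_rows_def Let_def replicate_add[symmetric] algebra_simps, simp add: build_def)

lemma row_data_len:
  assumes "(a, b, l, r) \<in> set row_data" "vs \<noteq> []"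
  shows "length a = length c" "length b = length d" "length l = n"
proof -
  obtain k where k: "k < length bc" "row_data ! k = (a, b, l, r)"
    using assms(1) row_data_nth(1) by (metis in_set_conv_nth)
  then have "a = A ! k" "b = B ! k" "l = bl ! k" using row_data_nth(2) by auto
  then show "length a = length c" "length b = length d" "length l = n"
    using A_len B_len bl_len k assms(2) by auto
qed

lemma in_map2: "r \<in> set (map2 f xs ys) \<Longrightarrow> \<exists>x\<in>set xs. \<exists>y\<in>set ys. r = f x y"
  by (auto dest: set_zip_leftD set_zip_rightD)

lemma block_row_length:
  assumes "r \<in> set (block_rows F I Z)" "vs \<noteq> []"
  shows "length (fst r) = length vs + n + length Z + base_dim"
proof -
  have con: "length (fst r) = length vs + n + length Z + base_dim" if "r \<in> set (con_rows Z i)" "i \<in> {1, 2, 3}" for i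
    using that row_data_len[OF _ assms(2)] unfolding con_rows_def by (auto simp: length_base_row)
  show ?thesis
    using assms(1) unfolding block_rows_def Let_def set_append
  proof (elim UnE)
    assume "r \<in> set (map2 (\<lambda>e f. (e @ replicate n 0 @ Z @ replicate base_dim 0, f)) (unit_rows (length vs)) F)"
    from in_map2[OF this] show ?thesis by auto
  next
    assume "r \<in> set (map2 (\<lambda>t e. (t @ map uminus e @ Z @ replicate base_dim 0, 0)) (transp n vs) (unit_rows n))"
    from in_map2[OF this] show ?thesis by auto
  next
    assume "r \<in> set (map2 (\<lambda>t e. (map uminus t @ e @ Z @ replicate base_dim 0, 0)) (transp n vs) (unit_rows n))"
    from in_map2[OF this] show ?thesis by auto
  next
    assume "r \<in> set (concat (map (\<lambda>i. if 0 < I ! (i - 1) then con_rows Z i else []) [1, 2, 3]))"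
    then obtain i where "i \<in> {1, 2, 3}" "r \<in> set (con_rows Z i)" by (auto split: if_splits)
    then show ?thesis using con by blast
  qed auto
qed

lemma build_row_length:
  assumes "vs = [] \<Longrightarrow> qs = []"
  shows "\<forall>r\<in>set (fst (build qs)). length (fst r) = length (snd (build qs)) + base_dim"
  using assms
proof (induction qs rule: rev_induct)
  case Nil
  then show ?case by (auto simp: build_def base_rows_def length_base_row)
next
  case (snoc q qs)
  have ne: "vs \<noteq> []" using snoc by auto
  have IH: "length (fst r) = length (snd (build qs)) + base_dim" if "r \<in> set (fst (build qs))" for r
    using snoc ne that by auto
  have "length (fst r) = length vs + n + length (snd (build qs)) + base_dim"
    if r: "r \<in> set (fst (build (qs @ [q])))" for r
  proof -
    from r consider "r \<in> set (block_rows (fst q) (snd q) (snd (build qs)))"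
      | r' where "r' \<in> set (fst (build qs))" "fst r = (replicate (length vs) 0 @ replicate n 0) @ fst r'"
      unfolding build_snoc step_rows_def Let_def by auto
    then show ?thesis
    proof cases
      case 1 then show ?thesis by (rule block_row_length[OF _ ne])
    next
      case 2 then show ?thesis using IH[of r'] by simp
    qed
  qed
  then show ?case by (simp add: build_snoc step_rows_def Let_def)
qed

text \<open>Different requirements have separate block variables and share only the base variables,
  so the existence of all block variables splits into one existence statement for each
  requirement.\<close>

lemma ex_sat_build:
  assumes len: "length x = length c" "\<And>k. length (y k) = length d"
    and qs: "\<And>q. q \<in> set qs \<Longrightarrow> length (fst q) = length vs" "vs = [] \<Longrightarrow> qs = []"
  shows "(\<exists>z. length z = length (snd (build qs)) \<and> sat (fst (build qs)) (z @ base_vec x y t)) \<longleftrightarrow>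
     (\<forall>i\<in>{1, 2, 3}. dot d (y i) \<le> t) \<and>
     (\<forall>q\<in>set qs. \<exists>al om. length al = length vs \<and> length om = n \<and> block_sat q x y al om)"
  using qs
proof (induction qs rule: rev_induct)
  case Nil
  then show ?case using sat_base_rows[OF len] by (auto simp: build_def)
next
  case (snoc q qs)
  have ne: "vs \<noteq> []" using snoc by auto
  let ?Z = "snd (build qs)" and ?R = "fst (build qs)"
  have Z: "?Z = replicate (length qs * (length vs + n)) 0" by (rule snd_build)
  have q: "length (fst q) = length vs" using snoc by auto
  have split: "sat (fst (build (qs @ [q]))) (al @ om @ z @ base_vec x y t) \<longleftrightarrow> block_sat q x y al om \<and> sat ?R (z @ base_vec x y t)"
    if l: "length al = length vs" "length om = n" "length z = length ?Z" for al om z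
  proof -
    have "sat (map (\<lambda>r. ((replicate (length vs) 0 @ replicate n 0) @ fst r, snd r)) ?R) (al @ om @ z @ base_vec x y t) \<longleftrightarrow>
        sat ?R (z @ base_vec x y t)"
      using l unfolding sat_map by (simp add: sat_def case_prod_beta)
    then show ?thesis unfolding build_snoc step_rows_def Let_def fst_conv sat_simps(3)
      using sat_block_rows[OF len l q Z ne] by simp
  qed
  have lZ: "length (snd (build (qs @ [q]))) = length vs + n + length ?Z"
    by (simp add: build_snoc step_rows_def Let_def)
  have "(\<exists>z. length z = length (snd (build (qs @ [q]))) \<and> sat (fst (build (qs @ [q]))) (z @ base_vec x y t)) \<longleftrightarrow>
     (\<exists>al om z. length al = length vs \<and> length om = n \<and> length z = length ?Z \<and>
        sat (fst (build (qs @ [q]))) (al @ om @ z @ base_vec x y t))" (is "?l \<longleftrightarrow> ?r")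
  proof
    assume ?l
    then obtain z where z: "length z = length vs + n + length ?Z" "sat (fst (build (qs @ [q]))) (z @ base_vec x y t)" using lZ by auto
    then show ?r
      by (intro exI[of _ "take (length vs) z"] exI[of _ "take n (drop (length vs) z)"] exI[of _ "drop n (drop (length vs) z)"])
        (simp flip: append_assoc drop_drop add: append_assoc[symmetric] del: append_assoc drop_drop)
  next
    assume ?r
    then obtain al om z where "length al = length vs" "length om = n" "length z = length ?Z"
        "sat (fst (build (qs @ [q]))) ((al @ om @ z) @ base_vec x y t)" by auto
    then show ?l using lZ by (intro exI[of _ "al @ om @ z"]) auto
  qed
  also have "\<dots> \<longleftrightarrow> (\<exists>al om. length al = length vs \<and> length om = n \<and> block_sat q x y al om) \<and>
      (\<exists>z. length z = length ?Z \<and> sat ?R (z @ base_vec x y t))" using split by blast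
  finally show ?case using snoc by auto
qed

end

section \<open>The algorithm\<close>

definition lp_prog :: prog where
  "lp_prog = Fork (var 0) (Fork (map_in (var 1) (Seq (var 0) GetL)) (Fork (map_in (var 1) (Seq (var 0) GetR)) (Fork (var 2) MkNull)))"

definition list_prog :: "prog list \<Rightarrow> prog" where
  "list_prog ps = foldr Fork ps MkNull"

definition zeros_of :: "prog \<Rightarrow> prog" where
  "zeros_of a = const_of 0 a"

definition slot_prog :: "nat \<Rightarrow> nat \<Rightarrow> prog \<Rightarrow> prog \<Rightarrow> prog" where
  "slot_prog k i b zy = (if k = i then b else zy)"

definition base_row_prog :: "nat \<Rightarrow> prog \<Rightarrow> prog \<Rightarrow> int \<Rightarrow> prog \<Rightarrow> prog" where
  "base_row_prog i a b w zy = append_of a (append_of (slot_prog 1 i b zy) (append_of (slot_prog 2 i b zy)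
     (append_of (slot_prog 3 i b zy) (list_prog [MkNum w]))))"

definition nth_prog :: "nat \<Rightarrow> prog \<Rightarrow> prog" where
  "nth_prog i l = Seq l (var i)"

text \<open>Environment of \<open>block_prog\<close>: \<open>F, I, Z\<close>, the unit rows of size \<open>V\<close> and \<open>n\<close>, the transposed
  vertices, zero vectors of size \<open>V\<close>, \<open>n\<close>, of the number of components of \<open>x\<close> and of \<open>y\<close> and of the
  size of the base block, and the constraint rows.\<close>

definition con_prog :: "nat \<Rightarrow> prog" where
  "con_prog i = Branch (nth_prog (i - 1) (var 2))
     (map_in (var 12) (Fork
        (append_of (var 8) (append_of (neg_of (Seq (Seq (Seq (var 0) GetR) GetR) GetL))
           (append_of (var 4) (base_row_prog i (Seq (var 0) GetL) (Seq (Seq (var 0) GetR) GetL) 0 (var 11)))))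
        (Seq (Seq (Seq (var 0) GetR) GetR) GetR)))
     MkNull"

text \<open>The bound value, \<open>Z\<close> padded with the zeros of the base block, shifts all
  entries of the environment by one; inside \<open>map_in\<close> and \<open>zip_of\<close> they are
  shifted by one or two more.\<close>

definition block_prog :: prog where
  "block_prog = let_in (append_of (var 2) (var 10))
     (append_of (map_in (var 4) (Fork (append_of (neg_of (var 0)) (append_of (var 9) (var 1))) (MkNum 0)))
     (append_of (zip_of (var 4) (var 1) (Fork (append_of (var 0) (append_of (var 10) (var 2))) (var 1)))
     (append_of (list_prog [Fork (append_of (const_of 1 (var 4)) (append_of (var 8) (var 0))) (MkNum 1),
        Fork (append_of (neg_of (const_of 1 (var 4))) (append_of (var 8) (var 0))) (MkNum (-1))])
     (append_of (zip_of (var 6) (var 5) (Fork (append_of (var 0) (append_of (neg_of (var 1)) (var 2))) (MkNum 0)))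
     (append_of (zip_of (var 6) (var 5) (Fork (append_of (neg_of (var 0)) (append_of (var 1) (var 2))) (MkNum 0)))
     (append_of (con_prog 1) (append_of (con_prog 2) (con_prog 3))))))))"

context machine
begin

lemma exec_Num: "exec (MkNum 0) e (Num 0) 0" "exec (MkNum 1) e (Num 1) 0" "exec (MkNum (-1)) e (Num (-1)) 0"
    "exec (MkNum (-2)) e (Num (-2)) 0"
  using exec_atoms(3)[of 0 e] exec_atoms(3)[of 1 e] exec_atoms(3)[of "-1" e] exec_atoms(3)[of "-2" e] by auto

lemmas exec_rules = exec_Fork0 exec_SeqL exec_SeqR exec_vars exec_skips exec_Num exec_Null
  exec_atoms(1,4-8) exec_Seq0

lemma exec_zeros: "exec a e (encl X xs) 0 \<Longrightarrow> length xs \<le> M \<Longrightarrow> exec (zeros_of a) e (encl Num (replicate (length xs) 0)) 0"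
  using exec_const[of a e X xs 0] by (simp add: zeros_of_def)

lemma exec_ones: "exec a e (encl X xs) 0 \<Longrightarrow> length xs \<le> M \<Longrightarrow> exec (const_of 1 a) e (encl Num (replicate (length xs) 1)) 0"
  using exec_const[of a e X xs 1] by simp

lemma exec_lp_prog:
  assumes "length rs \<le> M"
  shows "exec lp_prog (Node (encl Num ob) (Node (encl enc_row rs) (Node (encl Num I) e))) (lp_val ob rs I) 0"
proof -
  let ?e = "Node (encl Num ob) (Node (encl enc_row rs) (Node (encl Num I) e))"
  have rs: "exec (var 1) ?e (encl enc_row rs) 0" by (rule exec_rules)+
  have 1: "exec (map_in (var 1) (Seq (var 0) GetL)) ?e (encl (encl Num) (map fst rs)) 0"
    by (rule exec_map0[OF rs assms]) (simp only: enc_row_def, (rule exec_rules)+)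
  have 2: "exec (map_in (var 1) (Seq (var 0) GetR)) ?e (encl Num (map snd rs)) 0"
    by (rule exec_map0[OF rs assms]) (simp only: enc_row_def, (rule exec_rules)+)
  show ?thesis unfolding lp_prog_def lp_val_def by (rule 1 2 exec_rules)+
qed

lemma exec_single: "exec p e (X x) 0 \<Longrightarrow> exec (list_prog [p]) e (encl X [x]) 0"
  unfolding list_prog_def by (auto intro!: exec_Fork0 exec_Null)

lemma exec_nth:
  assumes "exec l e (encl X xs) 0" "i < length xs"
  shows "exec (nth_prog i l) e (X (xs ! i)) 0"
proof -
  have "exec (var i) (encl X xs) (X (xs ! i)) 0" using assms(2)
  proof (induction xs arbitrary: i)
    case (Cons x xs)
    then show ?case by (cases i) (auto intro: exec_vars(1) exec_var_Suc)
  qed simp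
  then show ?thesis unfolding nth_prog_def by (rule exec_Seq0[OF assms(1)])
qed

end

locale adapt_machine = adapt_lists + machine
begin

text \<open>A common bound for the rows of one block, for the variables that it adds and for the
  size of the base block.\<close>

definition width :: nat where
  "width = 2 * length vs + 2 * n + 3 * length bc + base_dim + 10"

lemma exec_base_row:
  assumes a: "exec pa e (encl Num a) 0" "length a \<le> M" and b: "exec pb e (encl Num b) 0" "length b \<le> M"
    and zy: "exec z e (encl Num (replicate (length d) 0)) 0" "length d \<le> M" and w: "exec (MkNum w) e (Num w') 0"
  shows "exec (base_row_prog i pa pb w z) e (encl Num (base_row i a b w')) 0"
proof -
  have s: "exec (slot_prog k i pb z) e (encl Num (slot k i b)) 0" "length (slot k i b) \<le> M" for k
    using b zy by (auto simp: slot_prog_def slot_def)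
  show ?thesis unfolding base_row_prog_def base_row_def
    by (intro exec_append0 a s exec_single w)
qed

definition enc_data :: "real list \<times> real list \<times> real list \<times> real \<Rightarrow> val" where
  "enc_data = (\<lambda>(a, b, l, r). Node (encl Num a) (Node (encl Num b) (Node (encl Num l) (Num r))))"

text \<open>Everything that does not depend on the guess, computed once before the loop over the
  guesses and addressed by position.\<close>

definition data_env :: val where
  "data_env = Node (encl (encl Num) (unit_rows (length vs))) (Node (encl (encl Num) (unit_rows n))
     (Node (encl (encl Num) (transp n vs)) (Node (encl Num (replicate (length vs) 0)) (Node (encl Num (replicate n 0))
     (Node (encl Num (replicate (length c) 0)) (Node (encl Num (replicate (length d) 0)) (Node (encl Num (replicate base_dim 0))
     (Node (encl enc_data row_data) (Node (encl enc_row base_rows) (Node (encl Num base_obj) (Node (encl Num base_ints)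
     (Node (encl Num c) (Node (encl Num d) Null)))))))))))))"

lemma block_lengths:
  assumes "length F = length vs"
  shows "length (block_rows F I Z) \<le> width" "length (con_rows Z i) \<le> length bc"
proof -
  show c: "length (con_rows Z i) \<le> length bc" for i by (simp add: con_rows_def row_data_nth)
  show "length (block_rows F I Z) \<le> width"
    unfolding block_rows_def Let_def width_def using assms c[of 1] c[of 2] c[of 3] by auto
qed

lemma exec_block:
  assumes F: "length F = length vs" "length I = 3" and M: "length Z + width \<le> M" and ne: "vs \<noteq> []"
  shows "exec block_prog (Node (encl Num F) (Node (encl Num I) (Node (encl Num Z) data_env))) (encl enc_row (block_rows F I Z)) 0"
proof -
  define T where "T = Z @ replicate base_dim 0"
  let ?f = "Node (encl Num F) (Node (encl Num I) (Node (encl Num Z) data_env))"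
  let ?e = "Node (encl Num T) ?f"
  have le: "length Z \<le> M" "length vs \<le> M" "n \<le> M" "length c \<le> M" "length d \<le> M" "length T \<le> M" "length bc \<le> M" "base_dim \<le> M" "2 \<le> M"
    using M by (auto simp: width_def base_dim_def T_def)
  have T: "exec (append_of (var 2) (var 10)) ?f (encl Num T) 0"
    unfolding T_def by (rule exec_append0[OF _ _ le(1)]) (unfold data_env_def, (rule exec_rules)+)
  have U: "exec (var 4) ?e (encl (encl Num) (unit_rows (length vs))) 0" "exec (var 5) ?e (encl (encl Num) (unit_rows n)) 0"
     "exec (var 6) ?e (encl (encl Num) (transp n vs)) 0" "exec (var 1) ?e (encl Num F) 0" "exec (var 2) ?e (encl Num I) 0"
     "exec (var 8) ?e (encl Num (replicate n 0)) 0" "exec (var 0) ?e (encl Num T) 0" "exec (var 12) ?e (encl enc_data row_data) 0"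
    unfolding data_env_def by ((rule exec_rules)+)
  have enc: "exec p e (encl Num l) 0 \<Longrightarrow> exec q e (Num r) 0 \<Longrightarrow> exec (Fork p q) e (enc_row (l, r)) 0" for p q e l r
    unfolding enc_row_def by (simp add: exec_Fork0)
  have r1: "exec (map_in (var 4) (Fork (append_of (neg_of (var 0)) (append_of (var 9) (var 1))) (MkNum 0))) ?e
     (encl enc_row (map (\<lambda>e. (map uminus e @ replicate n 0 @ T, 0)) (unit_rows (length vs)))) 0"
  proof (rule exec_map0[OF U(1)])
    fix u assume "u \<in> set (unit_rows (length vs))"
    note u = length_unit_rows_nth[OF this]
    show "exec (Fork (append_of (neg_of (var 0)) (append_of (var 9) (var 1))) (MkNum 0)) (Node (encl Num u) ?e)
        (enc_row (map uminus u @ replicate n 0 @ T, 0)) 0"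
      by (rule enc exec_append0 exec_neg exec_rules | (simp add: le u; fail) | (unfold data_env_def, rule exec_rules))+
  qed (simp add: le)
  have r2: "exec (zip_of (var 4) (var 1) (Fork (append_of (var 0) (append_of (var 10) (var 2))) (var 1))) ?e
     (encl enc_row (map2 (\<lambda>e f. (e @ replicate n 0 @ T, f)) (unit_rows (length vs)) F)) 0"
  proof (rule exec_zip[OF U(1,4)])
    fix u f assume "u \<in> set (unit_rows (length vs))"
    note u = length_unit_rows_nth[OF this]
    show "exec (Fork (append_of (var 0) (append_of (var 10) (var 2))) (var 1)) (Node (encl Num u) (Node (Num f) ?e))
        (enc_row (u @ replicate n 0 @ T, f)) 0"
      by (rule enc exec_append0 exec_rules | (simp add: le u; fail) | (unfold data_env_def, rule exec_rules))+
  qed (simp_all add: le F)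
  have r3: "exec (list_prog [Fork (append_of (const_of 1 (var 4)) (append_of (var 8) (var 0))) (MkNum 1),
        Fork (append_of (neg_of (const_of 1 (var 4))) (append_of (var 8) (var 0))) (MkNum (-1))]) ?e
     (encl enc_row [(replicate (length vs) 1 @ replicate n 0 @ T, 1), (map uminus (replicate (length vs) 1) @ replicate n 0 @ T, -1)]) 0"
  proof -
    have o: "exec (const_of 1 (var 4)) ?e (encl Num (replicate (length vs) 1)) 0"
      using exec_ones[OF U(1)] le by simp
    have "exec (Fork (append_of (const_of 1 (var 4)) (append_of (var 8) (var 0))) (MkNum 1)) ?e (enc_row (replicate (length vs) 1 @ replicate n 0 @ T, 1)) 0"
      by (intro enc exec_append0 o U exec_Num) (simp_all add: le)
    moreover have "exec (Fork (append_of (neg_of (const_of 1 (var 4))) (append_of (var 8) (var 0))) (MkNum (-1))) ?e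
        (enc_row (map uminus (replicate (length vs) 1) @ replicate n 0 @ T, -1)) 0"
      by (intro enc exec_append0 exec_neg o U exec_Num) (simp_all add: le)
    ultimately show ?thesis unfolding list_prog_def by (auto intro!: exec_Fork0 exec_Null)
  qed
  have tr: "t \<in> set (transp n vs) \<Longrightarrow> length t \<le> M" "u \<in> set (unit_rows n) \<Longrightarrow> length u \<le> M" for t u
    using le by auto
  have r4: "exec (zip_of (var 6) (var 5) (Fork (append_of (var 0) (append_of (neg_of (var 1)) (var 2))) (MkNum 0))) ?e
     (encl enc_row (map2 (\<lambda>t e. (t @ map uminus e @ T, 0)) (transp n vs) (unit_rows n))) 0"
  proof (rule exec_zip[OF U(3,2)])
    fix t u assume "t \<in> set (transp n vs)" "u \<in> set (unit_rows n)"
    note tu = tr(1)[OF this(1)] tr(2)[OF this(2)]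
    show "exec (Fork (append_of (var 0) (append_of (neg_of (var 1)) (var 2))) (MkNum 0)) (Node (encl Num t) (Node (encl Num u) ?e))
        (enc_row (t @ map uminus u @ T, 0)) 0"
      by (rule enc exec_append0 exec_neg exec_rules | (simp add: le tu; fail))+
  qed (simp_all add: le)
  have r5: "exec (zip_of (var 6) (var 5) (Fork (append_of (neg_of (var 0)) (append_of (var 1) (var 2))) (MkNum 0))) ?e
     (encl enc_row (map2 (\<lambda>t e. (map uminus t @ e @ T, 0)) (transp n vs) (unit_rows n))) 0"
  proof (rule exec_zip[OF U(3,2)])
    fix t u assume "t \<in> set (transp n vs)" "u \<in> set (unit_rows n)"
    note tu = tr(1)[OF this(1)] tr(2)[OF this(2)]
    show "exec (Fork (append_of (neg_of (var 0)) (append_of (var 1) (var 2))) (MkNum 0)) (Node (encl Num t) (Node (encl Num u) ?e))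
        (enc_row (map uminus t @ u @ T, 0)) 0"
      by (rule enc exec_append0 exec_neg exec_rules | (simp add: le tu; fail))+
  qed (simp_all add: le)
  have con: "exec (con_prog i) ?e (encl enc_row (if 0 < I ! (i - 1) then con_rows Z i else [])) 0" if i: "i \<in> {1, 2, 3}" for i
    unfolding con_prog_def
  proof (rule exec_Branch0)
    show "exec (nth_prog (i - 1) (var 2)) ?e (Num (I ! (i - 1))) 0" by (rule exec_nth[OF U(5)]) (use i F in auto)
  next
    assume "\<not> is_pos (Num (I ! (i - 1)))"
    then show "exec MkNull ?e (encl enc_row (if 0 < I ! (i - 1) then con_rows Z i else [])) 0" by (simp add: exec_Null)
  next
    assume pos: "is_pos (Num (I ! (i - 1)))"
    let ?b = "Fork
        (append_of (var 8) (append_of (neg_of (Seq (Seq (Seq (var 0) GetR) GetR) GetL))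
           (append_of (var 4) (base_row_prog i (Seq (var 0) GetL) (Seq (Seq (var 0) GetR) GetL) 0 (var 11)))))
        (Seq (Seq (Seq (var 0) GetR) GetR) GetR)"
    have "exec (map_in (var 12) ?b) ?e (encl enc_row (con_rows Z i)) 0"
      unfolding con_rows_def
    proof (rule exec_map0[OF U(8)])
      show "length row_data \<le> M" using row_data_nth le by simp
      fix q assume q: "q \<in> set row_data"
      obtain a b l r where qe: "q = (a, b, l, r)" by (cases q)
      note len = row_data_len[OF q[unfolded qe] ne]
      let ?e' = "Node (enc_data q) ?e"
      have ab: "exec (Seq (var 0) GetL) ?e' (encl Num a) 0" "exec (Seq (Seq (var 0) GetR) GetL) ?e' (encl Num b) 0"
        "exec (Seq (Seq (Seq (var 0) GetR) GetR) GetL) ?e' (encl Num l) 0" "exec (Seq (Seq (Seq (var 0) GetR) GetR) GetR) ?e' (Num r) 0"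
        "exec (var 11) ?e' (encl Num (replicate (length d) 0)) 0" "exec (var 8) ?e' (encl Num (replicate (length vs) 0)) 0"
        "exec (var 4) ?e' (encl Num Z) 0"
        unfolding qe enc_data_def prod.case data_env_def by ((rule exec_rules)+)
      have "exec ?b ?e' (enc_row (replicate (length vs) 0 @ map uminus l @ Z @ base_row i a b 0, r)) 0"
        by (intro enc exec_append0 exec_neg exec_base_row ab exec_Num) (simp_all add: le len)
      then show "exec ?b ?e' (enc_row (case q of (a, b, l, r) \<Rightarrow> (replicate (length vs) 0 @ map uminus l @ Z @ base_row i a b 0, r))) 0"
        by (simp add: qe)
    qed
    then show "exec (map_in (var 12) ?b) ?e (encl enc_row (if 0 < I ! (i - 1) then con_rows Z i else [])) 0"
      using pos by simp
  qed
  have eq: "block_rows F I Z = map (\<lambda>e. (map uminus e @ replicate n 0 @ T, 0)) (unit_rows (length vs)) @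
     map2 (\<lambda>e f. (e @ replicate n 0 @ T, f)) (unit_rows (length vs)) F @
     [(replicate (length vs) 1 @ replicate n 0 @ T, 1), (map uminus (replicate (length vs) 1) @ replicate n 0 @ T, -1)] @
     map2 (\<lambda>t e. (t @ map uminus e @ T, 0)) (transp n vs) (unit_rows n) @
     map2 (\<lambda>t e. (map uminus t @ e @ T, 0)) (transp n vs) (unit_rows n) @
     (if 0 < I ! (1 - 1) then con_rows Z 1 else []) @ (if 0 < I ! (2 - 1) then con_rows Z 2 else []) @
     (if 0 < I ! (3 - 1) then con_rows Z 3 else [])"
    by (simp add: block_rows_def Let_def T_def)
  have cl: "length (if 0 < I ! (i - 1) then con_rows Z i else []) \<le> M" for i
    using block_lengths(2)[OF F(1), of Z i] le by simp
  show ?thesis unfolding block_prog_def eq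
    by (intro exec_let0[OF T] exec_append0 r1 r2 r3 r4 r5 con cl) (use le F in simp_all)
qed

end

section \<open>Solving the program of one guess and comparing outcomes\<close>

definition enc_req :: "real list \<times> real list \<Rightarrow> val" where
  "enc_req q = Node (encl Num (fst q)) (encl Num (snd q))"

definition build_prog :: prog where
  "build_prog = fold_in (Fork (var 10) MkNull) (var 0)
     (Fork (append_of (Seq (Fork (Seq (var 0) GetL) (Fork (Seq (var 0) GetR) (Fork (Seq (var 1) GetR) (skip_env 3)))) block_prog)
        (map_in (Seq (var 1) GetL) (Fork (append_of (append_of (var 7) (var 8)) (Seq (var 0) GetL)) (Seq (var 0) GetR))))
      (append_of (append_of (var 6) (var 7)) (Seq (var 1) GetR)))"

definition sub_of :: "prog \<Rightarrow> prog \<Rightarrow> prog" where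
  "sub_of a b = Seq (Fork a (Seq b Uminus)) Plus"

definition solution_prog :: prog where
  "solution_prog = let_in (drop_of (var 1) (var 0))
     (Fork (take_of (var 2) (var 1)) (Fork (take_of (var 3) (var 0))
       (let_in (drop_of (var 3) (var 0)) (Fork (take_of (var 4) (var 0))
         (let_in (drop_of (var 4) (var 0)) (list_prog [take_of (var 5) (var 0)]))))))"

text \<open>Positivity is the only test of the machine, so the tags 0 to 3 are told apart by
  \<open>tag - 2\<close> and \<open>tag - 1\<close>. The value is stored next to the tag to make
  outcomes of different guesses comparable.\<close>

definition record_prog :: prog where
  "record_prog = Branch (sub_of (Seq (var 0) GetL) (MkNum 2))
     (let_in (drop_of (var 1) (Seq (var 0) GetR))
       (Fork (MkNum 3) (Fork (dot_of (var 3) (var 0)) (Seq (Fork (var 0) (Fork (var 4) (Fork (var 5) MkNull))) solution_prog))))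
     (Branch (sub_of (Seq (var 0) GetL) (MkNum 1))
       (Fork (MkNum 2) (Fork (Seq (var 0) GetR) (Seq (var 0) GetR)))
       (Fork (Seq (var 0) GetL) (Fork (MkNum 0) MkNull)))"

definition solve_prog :: prog where
  "solve_prog = let_in build_prog
     (let_in (Seq (Seq (Fork (append_of (Seq (var 0) GetR) (var 12)) (Fork (Seq (var 0) GetL) (Fork (append_of (Seq (var 0) GetR) (var 13)) MkNull))) lp_prog) Solve)
       (Seq (Fork (var 0) (Fork (Seq (var 1) GetR) (Fork (var 13) (Fork (var 15) (Fork (var 16) MkNull))))) record_prog))"

definition better_prog :: prog where
  "better_prog =
     Branch (Seq (var 0) GetL) (Branch (Seq (var 1) GetL)
       (Branch (sub_of (Seq (var 1) GetL) (MkNum 1)) (Branch (sub_of (Seq (var 0) GetL) (MkNum 1))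
         (Branch (sub_of (Seq (Seq (var 0) GetR) GetL) (Seq (Seq (var 1) GetR) GetL)) (var 1)
           (Branch (sub_of (Seq (Seq (var 1) GetR) GetL) (Seq (Seq (var 0) GetR) GetL)) (var 0)
             (Branch (sub_of (Seq (var 0) GetL) (MkNum 2)) (var 0) (var 1))))
         (var 0)) (var 1)) (var 0)) (var 1)"

text \<open>The tag of \<open>enc_outcome\<close>, the value (\<open>0\<close> if there is none), and the data of \<open>enc_outcome\<close>.\<close>

fun enc_record :: "('s \<Rightarrow> real) \<Rightarrow> ('s \<Rightarrow> val) \<Rightarrow> 's outcome \<Rightarrow> val" where
  "enc_record f e Infeasible = Node (Num 0) (Node (Num 0) Null)"
| "enc_record f e Unbounded = Node (Num 1) (Node (Num 0) Null)"
| "enc_record f e (Unattained r) = Node (Num 2) (Node (Num r) (Num r))"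
| "enc_record f e (Optimal s) = Node (Num 3) (Node (Num (f s)) (e s))"

definition enc_base :: "nat \<Rightarrow> nat \<Rightarrow> real list \<Rightarrow> val" where
  "enc_base nx ny z = Node (encl Num (take nx z)) (encl (encl Num)
     [take ny (drop nx z), take ny (drop ny (drop nx z)), take ny (drop ny (drop ny (drop nx z)))])"

context machine
begin

lemma exec_sub: "exec a e (Num x) 0 \<Longrightarrow> exec b e (Num y) 0 \<Longrightarrow> exec (sub_of a b) e (Num (x - y)) 0"
  unfolding sub_of_def diff_conv_add_uminus by (rule exec_Seq0, rule exec_Fork0, assumption, rule exec_Seq0, assumption, (rule exec_atoms)+)

lemma exec_Num2: "exec (MkNum 2) e (Num 2) 0" "exec (MkNum 3) e (Num 3) 0"
  using exec_atoms(3)[of 2 e] exec_atoms(3)[of 3 e] by auto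

lemma exec_skip3: "exec (skip_env 3) (Node a (Node b (Node c e))) e 0"
    "exec (skip_env 4) (Node a (Node b (Node c (Node d e)))) e 0"
  by (rule exec_eq[OF exec_skip_env], simp add: numeral_eq_Suc)+

lemma exec_Branch_if:
  assumes "exec b e (Num x) 0" "exec p e r 0" "exec p' e r' 0"
  shows "exec (Branch b p p') e (if 0 < x then r else r') 0"
  by (rule exec_Branch0[OF assms(1)]) (use assms in auto)

lemma exec_better: "exec better_prog (Node (enc_record f X r') (Node (enc_record f X r) e)) (enc_record f X (better f r r')) 0"
proof -
  define s where "s = enc_record f X r"
  define s' where "s' = enc_record f X r'"
  let ?e = "Node s' (Node s e)"
  have v: "exec (var 0) ?e s' 0" "exec (var 1) ?e s 0" by ((rule exec_rules)+)
  obtain k v1 p1 where s: "s = Node (Num k) (Node (Num v1) p1)" unfolding s_def by (cases r) auto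
  obtain k' v1' p1' where s': "s' = Node (Num k') (Node (Num v1') p1')" unfolding s'_def by (cases r') auto
  have c: "exec (Seq (var 0) GetL) ?e (Num k') 0" "exec (Seq (var 1) GetL) ?e (Num k) 0"
    "exec (Seq (Seq (var 0) GetR) GetL) ?e (Num v1') 0" "exec (Seq (Seq (var 1) GetR) GetL) ?e (Num v1) 0"
    unfolding s s' by ((rule exec_rules)+)
  \<comment> \<open>The decision tree of the program on two records; it agrees with
    \<open>better\<close> in each of the sixteen cases.\<close>
  define res where "res = (if 0 < k' then if 0 < k then if 0 < k - 1 then if 0 < k' - 1 then
      if 0 < v1' - v1 then s else if 0 < v1 - v1' then s' else if 0 < k' - 2 then s' else s
      else s' else s else s' else s)"
  have "exec better_prog ?e res 0" unfolding better_prog_def res_def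
    by (rule exec_Branch_if c exec_sub exec_Num exec_Num2 v)+
  moreover have "res = enc_record f X (better f r r')"
    using s s' unfolding res_def s_def s'_def by (cases r; cases r') (auto split: outcome.splits)
  ultimately show ?thesis unfolding s_def s'_def by simp
qed

lemma exec_solution:
  assumes len: "length z = length c + 3 * length d + 1" "length c \<le> M" "length d \<le> M"
  shows "exec solution_prog (Node (encl Num z) (Node (encl Num c) (Node (encl Num d) e))) (enc_base (length c) (length d) z) 0"
proof -
  let ?f = "Node (encl Num z) (Node (encl Num c) (Node (encl Num d) e))"
  define z1 where "z1 = drop (length c) z"
  define z2 where "z2 = drop (length d) z1"
  define z3 where "z3 = drop (length d) z2"
  have l: "length c \<le> length z" "length d \<le> length z1" "length d \<le> length z2" "length d \<le> length z3"
    using len by (auto simp: z1_def z2_def z3_def)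
  have 1: "exec (drop_of (var 1) (var 0)) ?f (encl Num z1) 0" unfolding z1_def
    by (rule exec_drop[OF _ _ l(1) len(2)]) (rule exec_rules)+
  let ?g = "Node (encl Num z1) ?f"
  have 2: "exec (take_of (var 2) (var 1)) ?g (encl Num (take (length c) z)) 0"
    by (rule exec_take[OF _ _ l(1) len(2)]) (rule exec_rules)+
  have 3: "exec (take_of (var 3) (var 0)) ?g (encl Num (take (length d) z1)) 0"
    by (rule exec_take[OF _ _ l(2) len(3)]) (rule exec_rules)+
  have 4: "exec (drop_of (var 3) (var 0)) ?g (encl Num z2) 0" unfolding z2_def
    by (rule exec_drop[OF _ _ l(2) len(3)]) (rule exec_rules)+
  let ?h = "Node (encl Num z2) ?g"
  have 5: "exec (take_of (var 4) (var 0)) ?h (encl Num (take (length d) z2)) 0"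
    by (rule exec_take[OF _ _ l(3) len(3)]) (rule exec_rules)+
  have 6: "exec (drop_of (var 4) (var 0)) ?h (encl Num z3) 0" unfolding z3_def
    by (rule exec_drop[OF _ _ l(3) len(3)]) (rule exec_rules)+
  let ?k = "Node (encl Num z3) ?h"
  have 7: "exec (take_of (var 5) (var 0)) ?k (encl Num (take (length d) z3)) 0"
    by (rule exec_take[OF _ _ l(4) len(3)]) (rule exec_rules)+
  have 8: "exec (list_prog [take_of (var 5) (var 0)]) ?k (encl (encl Num) [take (length d) z3]) 0"
    using exec_single[of _ _ "encl Num", OF 7] .
  show ?thesis unfolding solution_prog_def enc_base_def z1_def[symmetric] z2_def[symmetric] z3_def[symmetric] encl_simps(2)[of "encl Num"]
    using 1 2 3 4 5 6 8 by (simp only: encl_simps) (intro exec_let0 exec_Fork0)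
qed

lemma exec_record:
  assumes len: "\<And>z. r = Optimal z \<Longrightarrow> length z = length Z + length ob" "length ob = length c + 3 * length d + 1"
    and M: "length Z \<le> M" "length ob \<le> M"
  shows "exec record_prog (Node (enc_outcome (encl Num) r) (Node (encl Num Z) (Node (encl Num ob) (Node (encl Num c) (Node (encl Num d) e)))))
     (enc_record (dot ob) (enc_base (length c) (length d)) (map_outcome (drop (length Z)) r)) 0"
proof -
  define v where "v = enc_outcome (encl Num) r"
  let ?f = "Node v (Node (encl Num Z) (Node (encl Num ob) (Node (encl Num c) (Node (encl Num d) e))))"
  obtain k p where v: "v = Node (Num k) p" unfolding v_def by (cases r) auto
  have lk: "exec (Seq (var 0) GetL) ?f (Num k) 0" "exec (Seq (var 0) GetR) ?f p 0" unfolding v by ((rule exec_rules)+)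
  define res where "res = enc_record (dot ob) (enc_base (length c) (length d)) (map_outcome (drop (length Z)) r)"
  have "exec record_prog ?f res 0" unfolding record_prog_def
  proof (rule exec_Branch0[OF exec_sub[OF lk(1) exec_Num2(1)]])
    assume "is_pos (Num (k - 2))"
    then obtain z where r: "r = Optimal z" using v unfolding v_def by (cases r) auto
    have p: "p = encl Num z" using v r by (simp add: v_def)
    define b where "b = drop (length Z) z"
    have lb: "length b = length ob" using len(1)[OF r] by (simp add: b_def)
    have 1: "exec (drop_of (var 1) (Seq (var 0) GetR)) ?f (encl Num b) 0" unfolding b_def
      by (rule exec_drop) (rule exec_rules, rule exec_rules, use lk(2) p len(1)[OF r] M in auto)
    let ?g = "Node (encl Num b) ?f"
    have 2: "exec (dot_of (var 3) (var 0)) ?g (Num (dot ob b)) 0"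
      by (rule exec_dot) ((rule exec_rules)+, use lb M in auto)
    have 3: "exec solution_prog (Node (encl Num b) (Node (encl Num c) (Node (encl Num d) Null))) (enc_base (length c) (length d) b) 0"
      by (rule exec_solution) (use lb len M in auto)
    have 4: "exec (Fork (var 0) (Fork (var 4) (Fork (var 5) MkNull))) ?g (Node (encl Num b) (Node (encl Num c) (Node (encl Num d) Null))) 0"
      by (rule exec_rules)+
    have "res = Node (Num 3) (Node (Num (dot ob b)) (enc_base (length c) (length d) b))"
      by (simp add: res_def r b_def)
    then show "exec (let_in (drop_of (var 1) (Seq (var 0) GetR))
       (Fork (MkNum 3) (Fork (dot_of (var 3) (var 0)) (Seq (Fork (var 0) (Fork (var 4) (Fork (var 5) MkNull))) solution_prog)))) ?f res 0"
      by (simp only:) (intro exec_let0[OF 1] exec_Fork0 exec_Num2 2 exec_Seq0[OF 4 3])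
  next
    assume n2: "\<not> is_pos (Num (k - 2))"
    show "exec (Branch (sub_of (Seq (var 0) GetL) (MkNum 1)) (Fork (MkNum 2) (Fork (Seq (var 0) GetR) (Seq (var 0) GetR)))
       (Fork (Seq (var 0) GetL) (Fork (MkNum 0) MkNull))) ?f res 0"
    proof (rule exec_Branch0[OF exec_sub[OF lk(1) exec_Num(2)]])
      assume "is_pos (Num (k - 1))"
      then obtain x where r: "r = Unattained x" using v n2 unfolding v_def by (cases r) auto
      have "p = Num x" "res = Node (Num 2) (Node (Num x) (Num x))" using v r by (auto simp: v_def res_def)
      then show "exec (Fork (MkNum 2) (Fork (Seq (var 0) GetR) (Seq (var 0) GetR))) ?f res 0"
        using lk(2) by (auto intro!: exec_Fork0 exec_Num2)
    next
      assume "\<not> is_pos (Num (k - 1))"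
      then have "r = Infeasible \<or> r = Unbounded" using v n2 unfolding v_def by (cases r) auto
      then have "res = Node (Num k) (Node (Num 0) Null)" using v by (auto simp: v_def res_def)
      then show "exec (Fork (Seq (var 0) GetL) (Fork (MkNum 0) MkNull)) ?f res 0"
        using lk(1) by (auto intro!: exec_Fork0 exec_Num exec_Null)
    qed
  qed
  then show ?thesis unfolding v_def res_def .
qed

end

context adapt_machine
begin

lemma length_build: "(\<And>q. q \<in> set qs \<Longrightarrow> length (fst q) = length vs) \<Longrightarrow> length (fst (build qs)) \<le> 3 + length qs * width"
proof (induction qs rule: rev_induct)
  case Nil then show ?case by (simp add: build_def base_rows_def)
next
  case (snoc q qs)
  have "length (block_rows (fst q) (snd q) (snd (build qs))) \<le> width" by (rule block_lengths) (use snoc in auto)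
  then show ?case using snoc by (simp add: build_snoc step_rows_def Let_def)
qed

lemma exec_build:
  assumes q: "\<And>q. q \<in> set qs \<Longrightarrow> length (fst q) = length vs \<and> length (snd q) = 3" and ne: "vs = [] \<Longrightarrow> qs = []"
    and M: "(length qs + 2) * width \<le> M"
  shows "exec build_prog (Node (encl enc_req qs) data_env) (Node (encl enc_row (fst (build qs))) (encl Num (snd (build qs)))) 0"
proof -
  define A where "A st = Node (encl enc_row (fst st)) (encl Num (snd st))" for st
  let ?f = "Node (encl enc_req qs) data_env"
  have w: "1 \<le> width" "width \<le> M" using M by (auto simp: width_def)
  have lq: "length qs \<le> M"
  proof -
    have "length qs * 1 \<le> length qs * width" by (rule mult_le_mono2[OF w(1)])
    also have "\<dots> \<le> (length qs + 2) * width" by (rule mult_le_mono1) simp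
    finally show ?thesis using M by simp
  qed
  let ?b = "(Fork (append_of (Seq (Fork (Seq (var 0) GetL) (Fork (Seq (var 0) GetR) (Fork (Seq (var 1) GetR) (skip_env 3)))) block_prog)
        (map_in (Seq (var 1) GetL) (Fork (append_of (append_of (var 7) (var 8)) (Seq (var 0) GetL)) (Seq (var 0) GetR))))
      (append_of (append_of (var 6) (var 7)) (Seq (var 1) GetR)))"
  have "exec (fold_in (Fork (var 10) MkNull) (var 0) ?b) ?f (A (foldl step_rows (base_rows, []) qs)) 0"
  proof (rule exec_fold_prefix0[of _ _ A, where X = enc_req])
    show "exec (Fork (var 10) MkNull) ?f (A (base_rows, [])) 0"
      unfolding A_def data_env_def fst_conv snd_conv encl_simps(1) by (rule exec_rules)+
    show "exec (var 0) ?f (encl enc_req qs) 0" by (rule exec_rules)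
    show "length qs \<le> M" by (rule lq)
    fix us x ws assume qs: "qs = us @ x # ws"
    then have vs: "vs \<noteq> []" using ne by auto
    let ?st = "foldl step_rows (base_rows, []) us"
    obtain R Z where st: "?st = (R, Z)" by (cases ?st)
    have bu: "build us = (R, Z)" using st by (simp add: build_def)
    have us: "Suc (length us) \<le> length qs" using qs by simp
    have "(length us + 3) * width \<le> (length qs + 2) * width" using us by (intro mult_le_mono1) simp
    then have uw: "length us * width + 3 * width \<le> M" using M by (simp add: algebra_simps)
    have lZ: "length Z = length us * (length vs + n)" using snd_build[of us] bu by simp
    have "length vs + n \<le> width" by (simp add: width_def)
    then have "length Z \<le> length us * width" unfolding lZ by (rule mult_le_mono2)
    then have Zw: "length Z + width \<le> M" using uw by simp
    have "length R \<le> 3 + length us * width" using length_build[of us] bu q qs by auto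
    then have lR: "length R \<le> M" using uw w by linarith
    obtain F I where x: "x = (F, I)" by (cases x)
    have FI: "length F = length vs" "length I = 3" using q[of x] qs x by auto
    let ?e = "Node (enc_req x) (Node (A (R, Z)) ?f)"
    have le: "length vs \<le> M" "n \<le> M" "length vs + n \<le> M" using w by (auto simp: width_def)
    have blk: "exec (Seq (Fork (Seq (var 0) GetL) (Fork (Seq (var 0) GetR) (Fork (Seq (var 1) GetR) (skip_env 3)))) block_prog) ?e
        (encl enc_row (block_rows F I Z)) 0"
    proof (rule exec_Seq0[OF _ exec_block[OF FI Zw vs]])
      show "exec (Fork (Seq (var 0) GetL) (Fork (Seq (var 0) GetR) (Fork (Seq (var 1) GetR) (skip_env 3)))) ?e
          (Node (encl Num F) (Node (encl Num I) (Node (encl Num Z) data_env))) 0"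
        unfolding x enc_req_def A_def fst_conv snd_conv by (rule exec_rules exec_skip3)+
    qed
    let ?zb = "replicate (length vs) (0::real) @ replicate n 0"
    have mp: "exec (map_in (Seq (var 1) GetL) (Fork (append_of (append_of (var 7) (var 8)) (Seq (var 0) GetL)) (Seq (var 0) GetR))) ?e
        (encl enc_row (map (\<lambda>r. (?zb @ fst r, snd r)) R)) 0"
    proof (rule exec_map0[where X = enc_row])
      show "exec (Seq (var 1) GetL) ?e (encl enc_row R) 0" unfolding A_def fst_conv snd_conv by (rule exec_rules)+
      fix r
      show "exec (Fork (append_of (append_of (var 7) (var 8)) (Seq (var 0) GetL)) (Seq (var 0) GetR)) (Node (enc_row r) ?e)
          (enc_row (?zb @ fst r, snd r)) 0"
        unfolding enc_row_def[of "(?zb @ fst r, snd r)"] fst_conv snd_conv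
      proof (intro exec_Fork0 exec_append0)
        show "exec (var 7) (Node (enc_row r) ?e) (encl Num (replicate (length vs) 0)) 0"
          "exec (var 8) (Node (enc_row r) ?e) (encl Num (replicate n 0)) 0"
          unfolding data_env_def by ((rule exec_rules)+)
        show "exec (Seq (var 0) GetL) (Node (enc_row r) ?e) (encl Num (fst r)) 0"
          "exec (Seq (var 0) GetR) (Node (enc_row r) ?e) (Num (snd r)) 0"
          unfolding enc_row_def by ((rule exec_rules)+)
      qed (use le in auto)
    qed (rule lR)
    have z: "exec (append_of (append_of (var 6) (var 7)) (Seq (var 1) GetR)) ?e (encl Num (?zb @ Z)) 0"
    proof (intro exec_append0)
      show "exec (var 6) ?e (encl Num (replicate (length vs) 0)) 0" "exec (var 7) ?e (encl Num (replicate n 0)) 0"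
        unfolding data_env_def by ((rule exec_rules)+)
      show "exec (Seq (var 1) GetR) ?e (encl Num Z) 0" unfolding A_def snd_conv by (rule exec_rules)+
    qed (use le in auto)
    have lb: "length (block_rows F I Z) \<le> M" using block_lengths(1)[OF FI(1), of I Z] w by simp
    show "exec ?b (Node (enc_req x) (Node (A ?st) ?f)) (A (step_rows ?st x)) 0"
      unfolding st step_rows_def Let_def x fst_conv snd_conv A_def[of "(_ @ _, _)"]
      using exec_Fork0[OF exec_append0[OF blk mp lb] z] unfolding x .
  qed
  then show ?thesis unfolding build_prog_def build_def A_def .
qed

end

section \<open>Detection of edges and smallest faces by feasibility programs\<close>

definition face_lp_prog :: prog where
  "face_lp_prog = let_in (transpose_of (var 1))
     (Seq (Fork (zeros_of (var 2)) (Fork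
        (append_of (map_in (var 0) (Fork (var 0) (MkNum 0))) (append_of (map_in (var 0) (Fork (neg_of (var 0)) (MkNum 0)))
          (append_of (map_in (unit_rows_of (var 2)) (Fork (neg_of (var 0)) (MkNum 0)))
            (list_prog [Fork (neg_of (append_of (var 1) (list_prog [MkNum 0, MkNum 0, MkNum 0]))) (MkNum (-1))]))))
        (Fork (zeros_of (var 2)) MkNull))) lp_prog)"

definition face_flags_prog :: prog where
  "face_flags_prog = let_in
     (append_of (map_in (var 3) (Fork (MkNum 1) (var 0)))
        (map_in (Fork (var 0) (Fork (var 1) (Fork (var 2) MkNull))) (neg_of (Fork (MkNum 1) (var 0)))))
     (map_in (unit_rows_of (var 4)) (Branch (Seq (Seq face_lp_prog Solve) GetL) (MkNum 1) (MkNum 0)))"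

definition pairs_prog :: prog where
  "pairs_prog = Seq (fold_in (Fork MkNull MkNull) (var 0)
     (Fork (Fork (var 0) (Seq (var 1) GetL))
        (append_of (map_in (Seq (var 1) GetL) (Fork (var 0) (var 1))) (Seq (var 1) GetR)))) GetR"

text \<open>For a 0/1 vector \<open>F\<close>, \<open>dot F F\<close> is the number of vertices of
  the face; the smallest face of a pair is kept if it has no further vertex.\<close>

definition edges_prog :: prog where
  "edges_prog = fold_in MkNull (var 0)
     (let_in (Seq (Fork (Seq (var 0) GetL) (Fork (Seq (var 0) GetR) (Fork (Seq (var 0) GetR) (Fork (var 3) MkNull)))) face_flags_prog)
       (Branch (sub_of (dot_of (var 0) (var 0)) (MkNum 2)) (var 2) (Fork (var 0) (var 2))))"

text \<open>Flags of one face take one call for each vertex. With \<open>V\<close> singletons and at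
  most \<open>V^2\<close> pairs here and \<open>V^3\<close> triples in \<open>triples_prog\<close>,
  this is the origin of the budget \<open>V^2 + V^3 + V^4\<close>.\<close>

definition items_prog :: prog where
  "items_prog = append_of
     (map_in (var 0) (Seq (Fork (var 0) (Fork (var 0) (Fork (var 0) (Fork (var 1) MkNull)))) face_flags_prog))
     (Seq (Fork pairs_prog (Fork (var 0) MkNull)) edges_prog)"

definition triples_prog :: prog where
  "triples_prog = concat_map_in (var 0) (concat_map_in (var 1) (map_in (var 2)
     (Seq (Fork (var 2) (Fork (var 1) (Fork (var 0) (Fork (var 3) MkNull)))) face_flags_prog)))"

definition reqs_prog :: prog where
  "reqs_prog = concat_map_in (var 0) (zip_of (Seq (var 0) GetL) (var 1)
     (Fork (Seq (var 2) GetL) (zip_of (Seq (var 2) GetR) (Seq (var 1) GetR)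
        (Seq (Fork (var 0) (Seq (Fork (var 2) (var 1)) Times)) Plus))))"

definition switch_prog :: "nat \<Rightarrow> nat \<Rightarrow> prog" where
  "switch_prog i j = fold_in (MkNum 0) (var 1)
     (Branch (dot_of (Seq (var 0) GetL) (var 2)) (var 1)
       (Seq (Fork (var 1) (Seq (Fork (nth_prog i (Seq (var 0) GetR)) (nth_prog j (Seq (var 0) GetR))) Times)) Plus))"

definition triple_req_prog :: prog where
  "triple_req_prog = let_in (map_in (var 1) (sub_of (MkNum 1) (var 0)))
     (let_in (Seq (Fork (switch_prog 0 1) (Seq (Fork (switch_prog 0 2) (switch_prog 1 2)) Times)) Times)
       (Fork (var 3) (Fork (var 0) (Fork (var 0) (Fork (var 0) MkNull)))))"

definition eval_prog :: prog where
  "eval_prog = let_in (Seq (Fork (var 0) MkNull) reqs_prog)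
     (Seq (Fork (append_of (var 0) (map_in (var 2) (Seq (Fork (var 1) (Fork (var 0) MkNull)) triple_req_prog))) (skip_env 3)) solve_prog)"

definition pairs :: "'a list \<Rightarrow> ('a \<times> 'a) list" where
  "pairs vs = snd (foldl (\<lambda>st b. (b # fst st, map (\<lambda>a. (a, b)) (fst st) @ snd st)) ([], []) vs)"

text \<open>The vertices come first in a guess and in their given order, so zipping the flags of an
  item with the guess itself matches each flag with the label of its vertex. A flag 0 leaves just
  the label of the item.\<close>

definition reqs_of :: "(real list \<times> real list) list \<Rightarrow> (real list \<times> real list) list" where
  "reqs_of g = concat (map (\<lambda>q. map2 (\<lambda>w it. (fst q, map2 (\<lambda>x y. x + w * y) (snd q) (snd it))) (fst q) g) g)"

text \<open>The scalar product with the complement of \<open>W\<close> is positive for items not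
  inside \<open>W\<close>, which are skipped. A product of two entries is positive if a requirement
  contains both indices, so the sum detects a change between them.\<close>

definition switch_sum :: "(real list \<times> real list) list \<Rightarrow> real list \<Rightarrow> nat \<Rightarrow> nat \<Rightarrow> real" where
  "switch_sum rq W i j = foldl (\<lambda>s q. if 0 < dot (fst q) (map (\<lambda>w. 1 - w) W) then s else s + snd q ! i * snd q ! j) 0 rq"

text \<open>The entries are positive if all three kinds of switches occur in \<open>W\<close>. Otherwise no index is
  required and the condition is trivial.\<close>

definition triple_req :: "(real list \<times> real list) list \<Rightarrow> real list \<Rightarrow> real list \<times> real list" where
  "triple_req rq W = (let p = switch_sum rq W 0 1 * (switch_sum rq W 0 2 * switch_sum rq W 1 2) in (W, [p, p, p]))"

definition all_reqs :: "real list list \<Rightarrow> (real list \<times> real list) list \<Rightarrow> (real list \<times> real list) list" where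
  "all_reqs tris g = reqs_of g @ map (triple_req (reqs_of g)) tris"

lemma pairs_snoc: "pairs (vs @ [b]) = map (\<lambda>a. (a, b)) (rev vs) @ pairs vs"
proof -
  have "fst (foldl (\<lambda>st b. (b # fst st, map (\<lambda>a. (a, b)) (fst st) @ snd st)) ([], []) vs) = rev vs" for vs :: "'a list"
    by (induction vs rule: rev_induct) auto
  then show ?thesis by (simp add: pairs_def)
qed

lemma length_pairs: "length (pairs vs) \<le> length vs * length vs"
  by (induction vs rule: rev_induct) (auto simp: pairs_snoc, simp add: pairs_def)

lemma set_pairs: "set (pairs vs) \<subseteq> set vs \<times> set vs"
  by (induction vs rule: rev_induct) (auto simp: pairs_snoc, simp add: pairs_def)

context machine
begin

lemma exec_reqs:
  assumes g: "\<And>q. q \<in> set g \<Longrightarrow> length (fst q) \<le> length g \<and> length (snd q) = 3" and M: "length g \<le> M" "3 \<le> M"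
  shows "exec reqs_prog (Node (encl enc_req g) e) (encl enc_req (reqs_of g)) 0"
  unfolding reqs_prog_def reqs_of_def
proof (rule exec_concat_map0[where X = enc_req])
  let ?e = "Node (encl enc_req g) e"
  show "exec (var 0) ?e (encl enc_req g) 0" by (rule exec_rules)
  fix q assume q: "q \<in> set g"
  show "exec (zip_of (Seq (var 0) GetL) (var 1)
     (Fork (Seq (var 2) GetL) (zip_of (Seq (var 2) GetR) (Seq (var 1) GetR)
        (Seq (Fork (var 0) (Seq (Fork (var 2) (var 1)) Times)) Plus)))) (Node (enc_req q) ?e)
     (encl enc_req (map2 (\<lambda>w it. (fst q, map2 (\<lambda>x y. x + w * y) (snd q) (snd it))) (fst q) g)) 0"
  proof (rule exec_zip[where X = Num and Y = enc_req])
    show "exec (Seq (var 0) GetL) (Node (enc_req q) ?e) (encl Num (fst q)) 0" unfolding enc_req_def by (rule exec_rules)+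
    show "exec (var 1) (Node (enc_req q) ?e) (encl enc_req g) 0" by (rule exec_rules)+
    fix w it assume it: "it \<in> set g"
    let ?f = "Node (Num w) (Node (enc_req it) (Node (enc_req q) ?e))"
    have z: "exec (zip_of (Seq (var 2) GetR) (Seq (var 1) GetR) (Seq (Fork (var 0) (Seq (Fork (var 2) (var 1)) Times)) Plus)) ?f
       (encl Num (map2 (\<lambda>x y. x + w * y) (snd q) (snd it))) 0"
    proof (rule exec_zip[where X = Num and Y = Num])
      show "exec (Seq (var 2) GetR) ?f (encl Num (snd q)) 0" "exec (Seq (var 1) GetR) ?f (encl Num (snd it)) 0"
        unfolding enc_req_def by ((rule exec_rules)+)
      fix x y
      show "exec (Seq (Fork (var 0) (Seq (Fork (var 2) (var 1)) Times)) Plus) (Node (Num x) (Node (Num y) ?f)) (Num (x + w * y)) 0"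
        by (rule exec_rules)+
    qed (use g[OF it] g[OF q] M in auto)
    have "exec (Seq (var 2) GetL) ?f (encl Num (fst q)) 0" unfolding enc_req_def by (rule exec_rules)+
    from exec_Fork0[OF this z]
    show "exec (Fork (Seq (var 2) GetL) (zip_of (Seq (var 2) GetR) (Seq (var 1) GetR)
        (Seq (Fork (var 0) (Seq (Fork (var 2) (var 1)) Times)) Plus))) ?f
        (enc_req (fst q, map2 (\<lambda>x y. x + w * y) (snd q) (snd it))) 0"
      unfolding enc_req_def[of "(fst q, _)"] fst_conv snd_conv .
  qed (use g[OF q] M in auto)
  show "length (map2 (\<lambda>w it. (fst q, map2 (\<lambda>x y. x + w * y) (snd q) (snd it))) (fst q) g) \<le> M" using M by simp
qed (rule M)

lemma exec_triple_req:
  assumes rq: "\<And>q. q \<in> set rq \<Longrightarrow> length (fst q) = length W \<and> length (snd q) = 3" and M: "length rq \<le> M" "length W \<le> M"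
  shows "exec triple_req_prog (Node (encl enc_req rq) (Node (encl Num W) e)) (enc_req (triple_req rq W)) 0"
proof -
  define cW where "cW = map (\<lambda>w. 1 - w) W"
  let ?f = "Node (encl enc_req rq) (Node (encl Num W) e)"
  let ?g = "Node (encl Num cW) ?f"
  have 1: "exec (map_in (var 1) (sub_of (MkNum 1) (var 0))) ?f (encl Num cW) 0" unfolding cW_def
  proof (rule exec_map0[where X = Num])
    show "exec (var 1) ?f (encl Num W) 0" by (rule exec_rules)+
  qed (rule M, intro exec_sub exec_Num exec_vars)
  have s: "exec (switch_prog i j) ?g (Num (switch_sum rq W i j)) 0" if ij: "i < 3" "j < 3" for i j
    unfolding switch_prog_def switch_sum_def cW_def[symmetric]
  proof (rule exec_fold0[where A = Num and X = enc_req])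
    show "exec (MkNum 0) ?g (Num 0) 0" by (rule exec_Num)
    show "exec (var 1) ?g (encl enc_req rq) 0" by (rule exec_rules)+
    show "length rq \<le> M" by (rule M)
    fix s q assume q: "q \<in> set rq"
    let ?h = "Node (enc_req q) (Node (Num s) ?g)"
    have p: "exec (Seq (var 0) GetL) ?h (encl Num (fst q)) 0" "exec (Seq (var 0) GetR) ?h (encl Num (snd q)) 0"
      "exec (var 2) ?h (encl Num cW) 0" "exec (var 1) ?h (Num s) 0"
      unfolding enc_req_def by ((rule exec_rules)+)
    have d: "exec (dot_of (Seq (var 0) GetL) (var 2)) ?h (Num (dot (fst q) cW)) 0"
      by (rule exec_dot[OF p(1,3)]) (use rq[OF q] M in \<open>auto simp: cW_def\<close>)
    have n: "exec (nth_prog i (Seq (var 0) GetR)) ?h (Num (snd q ! i)) 0" "exec (nth_prog j (Seq (var 0) GetR)) ?h (Num (snd q ! j)) 0"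
      using rq[OF q] ij by (auto intro!: exec_nth[OF p(2)])
    have "exec (Seq (Fork (var 1) (Seq (Fork (nth_prog i (Seq (var 0) GetR)) (nth_prog j (Seq (var 0) GetR))) Times)) Plus) ?h
        (Num (s + snd q ! i * snd q ! j)) 0"
      by (rule p n exec_Fork0 exec_atoms exec_Seq0)+
    from exec_Branch_if[OF d p(4) this]
    show "exec (Branch (dot_of (Seq (var 0) GetL) (var 2)) (var 1)
       (Seq (Fork (var 1) (Seq (Fork (nth_prog i (Seq (var 0) GetR)) (nth_prog j (Seq (var 0) GetR))) Times)) Plus)) ?h
       (Num (if 0 < dot (fst q) cW then s else s + snd q ! i * snd q ! j)) 0" by (simp split: if_splits)
  qed
  define p where "p = switch_sum rq W 0 1 * (switch_sum rq W 0 2 * switch_sum rq W 1 2)"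
  have s': "exec (switch_prog 0 1) ?g (Num (switch_sum rq W 0 1)) 0" "exec (switch_prog 0 2) ?g (Num (switch_sum rq W 0 2)) 0"
    "exec (switch_prog 1 2) ?g (Num (switch_sum rq W 1 2)) 0" by (rule s; simp)+
  have 2: "exec (Seq (Fork (switch_prog 0 1) (Seq (Fork (switch_prog 0 2) (switch_prog 1 2)) Times)) Times) ?g (Num p) 0"
    unfolding p_def by (rule s' exec_Fork0 exec_atoms exec_Seq0)+
  have 3: "exec (Fork (var 3) (Fork (var 0) (Fork (var 0) (Fork (var 0) MkNull)))) (Node (Num p) ?g) (enc_req (W, [p, p, p])) 0"
    unfolding enc_req_def fst_conv snd_conv encl_simps by (rule exec_rules)+
  show ?thesis unfolding triple_req_prog_def triple_req_def Let_def p_def[symmetric]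
    by (rule exec_let0[OF 1 exec_let0[OF 2 3]])
qed

text \<open>The solver may return any correct outcome, so that only the existence of some
  \<open>r\<close> is available.\<close>

lemma exec_Solve_list:
  assumes slv: "lp_solver slv" and good: "good (lp_val ob rs I)"
    and len: "\<And>q. q \<in> set rs \<Longrightarrow> length (fst q) = length ob" "length I = length ob" "set I \<subseteq> {0, 1}"
  shows "\<exists>r. is_outcome (lp_set (length ob) rs I) (dot ob) r \<and> exec Solve (lp_val ob rs I) (enc_outcome (encl Num) r) 1"
proof -
  obtain r where r: "lp_outcome (list_lp ob rs I) r" "slv (enc_lp (list_lp ob rs I)) = enc_outcome enc_vec r"
    using slv lp_ok_list_lp unfolding lp_solver_def by blast
  have e: "enc_lp (list_lp ob rs I) = lp_val ob rs I" by (rule enc_list_lp[OF len])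
  have "enc_outcome enc_vec r = enc_outcome (encl Num) (map_outcome list_of_vec r)"
    by (cases r) (auto simp: enc_vec_def encl_def)
  then have "exec Solve (lp_val ob rs I) (enc_outcome (encl Num) (map_outcome list_of_vec r)) 1"
    using exec_Solve[OF good] r(2) e by simp
  then show ?thesis using lp_outcome_list[OF r(1) len(1)] by blast
qed

end

context adapt_machine
begin

text \<open>Defined by feasibility alone, which keeps the analysis of the machine free of geometry;
  \<open>face_flags_eq\<close> later identifies the flags with those of a smallest face.\<close>

definition face_flags :: "real list list \<Rightarrow> real list" where
  "face_flags T = map (\<lambda>e. if lp_set (length vs + 3) (face_rows (n + 1) (face_gens vs T) e) (replicate (length vs + 3) 0) = {} then 0 else 1)
     (unit_rows (length vs))"

lemma length_face_flags [simp]: "length (face_flags T) = length vs"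
  by (simp add: face_flags_def)

lemma exec_face_flags:
  assumes slv: "lp_solver slv" and T: "a \<in> set vs" "b \<in> set vs" "c' \<in> set vs"
    and good: "\<And>e. e \<in> set (unit_rows (length vs)) \<Longrightarrow>
      good (lp_val (replicate (length vs + 3) 0) (face_rows (n + 1) (face_gens vs [a, b, c']) e) (replicate (length vs + 3) 0))"
    and big: "2 * n + length vs + 10 \<le> M"
  shows "exec face_flags_prog (Node (encl Num a) (Node (encl Num b) (Node (encl Num c') (Node (encl (encl Num) vs) e))))
     (encl Num (face_flags [a, b, c'])) (length vs)"
proof -
  let ?f = "Node (encl Num a) (Node (encl Num b) (Node (encl Num c') (Node (encl (encl Num) vs) e)))"
  have M: "length vs + 3 \<le> M" "n + 1 \<le> M" using big by auto
  define G where "G = face_gens vs [a, b, c']"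
  have lG: "length G = length vs + 3" by (simp add: G_def face_gens_def)
  have vG: "v \<in> set G \<Longrightarrow> length v = n + 1" for v using T vs_len by (auto simp: G_def face_gens_def)
  have gens: "exec (append_of (map_in (var 3) (Fork (MkNum 1) (var 0)))
        (map_in (Fork (var 0) (Fork (var 1) (Fork (var 2) MkNull))) (neg_of (Fork (MkNum 1) (var 0))))) ?f (encl (encl Num) G) 0"
    unfolding G_def face_gens_def
  proof (rule exec_append0)
    show "exec (map_in (var 3) (Fork (MkNum 1) (var 0))) ?f (encl (encl Num) (map ((#) 1) vs)) 0"
    proof (rule exec_map0[where X = "encl Num"])
      show "exec (var 3) ?f (encl (encl Num) vs) 0" by (rule exec_rules)+
      fix x show "exec (Fork (MkNum 1) (var 0)) (Node (encl Num x) ?f) (encl Num (1 # x)) 0"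
        unfolding encl_simps by (rule exec_rules)+
    qed (use M in simp)
    show "exec (map_in (Fork (var 0) (Fork (var 1) (Fork (var 2) MkNull))) (neg_of (Fork (MkNum 1) (var 0)))) ?f
        (encl (encl Num) (map (\<lambda>t. map uminus (1 # t)) [a, b, c'])) 0"
    proof (rule exec_map0[where X = "encl Num"])
      show "exec (Fork (var 0) (Fork (var 1) (Fork (var 2) MkNull))) ?f (encl (encl Num) [a, b, c']) 0"
        unfolding encl_simps by (rule exec_rules)+
      fix x assume x: "x \<in> set [a, b, c']"
      show "exec (neg_of (Fork (MkNum 1) (var 0))) (Node (encl Num x) ?f) (encl Num (map uminus (1 # x))) 0"
      proof (rule exec_neg)
        show "exec (Fork (MkNum 1) (var 0)) (Node (encl Num x) ?f) (encl Num (1 # x)) 0"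
          unfolding encl_simps by (rule exec_rules)+
      qed (use x T vs_len M in auto)
    qed (use M in simp)
  qed (use M in simp)
  let ?g = "Node (encl (encl Num) G) ?f"
  let ?zs = "replicate (length vs + 3) (0::real)"
  have flag: "exec (Branch (Seq (Seq face_lp_prog Solve) GetL) (MkNum 1) (MkNum 0)) (Node (encl Num u) ?g)
     (Num (if lp_set (length vs + 3) (face_rows (n + 1) G u) ?zs = {} then 0 else 1)) 1" if u: "u \<in> set (unit_rows (length vs))" for u
  proof -
    let ?h = "Node (encl Num u) ?g"
    define TG where "TG = transp (n + 1) G"
    have TG: "exec (transpose_of (var 1)) ?h (encl (encl Num) TG) 0" unfolding TG_def
    proof (rule exec_transpose)
      show "exec (var 1) ?h (encl (encl Num) G) 0" by (rule exec_rules)+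
    qed (use lG vG M in auto)
    let ?k = "Node (encl (encl Num) TG) ?h"
    have lTG: "length TG \<le> M" "\<And>t. t \<in> set TG \<Longrightarrow> length t \<le> M" using M lG by (auto simp: TG_def)
    have lu: "length u = length vs" using u by simp
    have vars: "exec (var 0) ?k (encl (encl Num) TG) 0" "exec (var 1) ?k (encl Num u) 0" "exec (var 2) ?k (encl (encl Num) G) 0"
      by ((rule exec_rules)+)
    have z: "exec (zeros_of (var 2)) ?k (encl Num ?zs) 0" using exec_zeros[OF vars(3)] lG M by simp
    have r1: "exec (map_in (var 0) (Fork (var 0) (MkNum 0))) ?k (encl enc_row (map (\<lambda>t. (t, 0)) TG)) 0"
      by (rule exec_map0[OF vars(1) lTG(1)]) (simp only: enc_row_def fst_conv snd_conv, (rule exec_rules)+)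
    have r2: "exec (map_in (var 0) (Fork (neg_of (var 0)) (MkNum 0))) ?k (encl enc_row (map (\<lambda>t. (map uminus t, 0)) TG)) 0"
      by (rule exec_map0[OF vars(1) lTG(1)]) (simp only: enc_row_def fst_conv snd_conv, intro exec_Fork0 exec_neg exec_vars exec_Num lTG(2))
    have r3: "exec (map_in (unit_rows_of (var 2)) (Fork (neg_of (var 0)) (MkNum 0))) ?k
        (encl enc_row (map (\<lambda>t. (map uminus t, 0)) (unit_rows (length G)))) 0"
    proof (rule exec_map0[where X = "encl Num"])
      show "exec (unit_rows_of (var 2)) ?k (encl (encl Num) (unit_rows (length G))) 0"
        by (rule exec_unit_rows[OF vars(3)]) (use lG M in simp)
      fix t assume "t \<in> set (unit_rows (length G))"
      then have "length t \<le> M" using lG M by simp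
      then show "exec (Fork (neg_of (var 0)) (MkNum 0)) (Node (encl Num t) ?k) (enc_row (map uminus t, 0)) 0"
        unfolding enc_row_def fst_conv snd_conv by (intro exec_Fork0 exec_neg exec_vars exec_Num)
    qed (use lG M in simp)
    have r4: "exec (list_prog [Fork (neg_of (append_of (var 1) (list_prog [MkNum 0, MkNum 0, MkNum 0]))) (MkNum (-1))]) ?k
        (encl enc_row [(map uminus (u @ [0, 0, 0]), -1)]) 0"
    proof -
      have "exec (list_prog [MkNum 0, MkNum 0, MkNum 0]) ?k (encl Num [0, 0, 0]) 0"
        unfolding list_prog_def encl_simps by (simp, intro exec_Fork0 exec_Num exec_Null)
      then have "exec (neg_of (append_of (var 1) (list_prog [MkNum 0, MkNum 0, MkNum 0]))) ?k (encl Num (map uminus (u @ [0, 0, 0]))) 0"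
        by (intro exec_neg exec_append0 vars) (use lu M in auto)
      then have "exec (Fork (neg_of (append_of (var 1) (list_prog [MkNum 0, MkNum 0, MkNum 0]))) (MkNum (-1))) ?k (enc_row (map uminus (u @ [0, 0, 0]), -1)) 0"
        unfolding enc_row_def fst_conv snd_conv by (intro exec_Fork0 exec_Num)
      then show ?thesis using exec_single[of _ _ enc_row] by blast
    qed
    define rs where "rs = face_rows (n + 1) G u"
    have rs: "rs = map (\<lambda>t. (t, 0)) TG @ map (\<lambda>t. (map uminus t, 0)) TG @ map (\<lambda>t. (map uminus t, 0)) (unit_rows (length G)) @
       [(map uminus (u @ [0, 0, 0]), -1)]" unfolding rs_def face_rows_def TG_def ..
    have "length TG = n + 1" by (simp add: TG_def)
    have R: "exec (append_of (map_in (var 0) (Fork (var 0) (MkNum 0))) (append_of (map_in (var 0) (Fork (neg_of (var 0)) (MkNum 0)))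
          (append_of (map_in (unit_rows_of (var 2)) (Fork (neg_of (var 0)) (MkNum 0)))
            (list_prog [Fork (neg_of (append_of (var 1) (list_prog [MkNum 0, MkNum 0, MkNum 0]))) (MkNum (-1))])))) ?k (encl enc_row rs) 0"
      unfolding rs by (intro exec_append0 r1 r2 r3 r4) (use lTG lG M in auto)
    have lrs: "length rs \<le> M" using lG big by (simp add: rs TG_def)
    have "exec (Fork (zeros_of (var 2)) (Fork (append_of (map_in (var 0) (Fork (var 0) (MkNum 0))) (append_of (map_in (var 0) (Fork (neg_of (var 0)) (MkNum 0)))
          (append_of (map_in (unit_rows_of (var 2)) (Fork (neg_of (var 0)) (MkNum 0)))
            (list_prog [Fork (neg_of (append_of (var 1) (list_prog [MkNum 0, MkNum 0, MkNum 0]))) (MkNum (-1))])))) (Fork (zeros_of (var 2)) MkNull))) ?k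
        (Node (encl Num ?zs) (Node (encl enc_row rs) (Node (encl Num ?zs) Null))) 0"
      by (intro exec_Fork0 z R exec_Null)
    from exec_Seq0[OF this exec_lp_prog[OF lrs]]
    have lp: "exec face_lp_prog ?h (lp_val ?zs rs ?zs) 0" unfolding face_lp_prog_def by (rule exec_let0[OF TG])
    have len: "length (fst q) = length ?zs" if "q \<in> set rs" for q
      using that lG lu by (auto simp: rs TG_def)
    have g: "good (lp_val ?zs rs ?zs)" using good[OF u] by (simp only: rs_def G_def)
    have z01: "set ?zs \<subseteq> {0, 1}" by auto
    obtain r where r: "is_outcome (lp_set (length ?zs) rs ?zs) (dot ?zs) r" "exec Solve (lp_val ?zs rs ?zs) (enc_outcome (encl Num) r) 1"
      using exec_Solve_list[OF slv g len refl z01] by blast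
    obtain k p where k: "enc_outcome (encl Num) r = Node (Num k) p" by (cases r) auto
    \<comment> \<open>\<open>Infeasible\<close> is the only outcome with tag 0.\<close>
    have pos: "0 < k \<longleftrightarrow> lp_set (length vs + 3) rs ?zs \<noteq> {}" using r(1) k by (cases r) auto
    have b: "exec (Seq (Seq face_lp_prog Solve) GetL) ?h (Num k) 1"
      using exec_Seq[OF exec_Seq[OF lp r(2)[unfolded k]] exec_atoms(4)] by simp
    have "exec (Branch (Seq (Seq face_lp_prog Solve) GetL) (MkNum 1) (MkNum 0)) ?h (Num (if lp_set (length vs + 3) rs ?zs = {} then 0 else 1)) (1 + 0)"
      by (rule exec_Branch[OF b]) (use pos in \<open>auto intro: exec_Num\<close>)
    then show ?thesis by (simp add: rs_def)
  qed
  have "exec (map_in (unit_rows_of (var 4)) (Branch (Seq (Seq face_lp_prog Solve) GetL) (MkNum 1) (MkNum 0))) ?g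
     (encl Num (face_flags [a, b, c'])) (0 + length (unit_rows (length vs)) * 1)"
    unfolding face_flags_def G_def[symmetric]
  proof (rule exec_map[where X = "encl Num"])
    have v: "exec (var 4) ?g (encl (encl Num) vs) 0" by (rule exec_rules)+
    show "exec (unit_rows_of (var 4)) ?g (encl (encl Num) (unit_rows (length vs))) 0"
      by (rule exec_unit_rows[OF v]) (use M in simp)
  qed (use M flag in auto)
  then show ?thesis unfolding face_flags_prog_def using exec_let[OF gens] by fastforce
qed

definition vertex_items :: "real list list" where
  "vertex_items = map (\<lambda>v. face_flags [v, v, v]) vs"

definition edge_items :: "real list list" where
  "edge_items = foldl (\<lambda>acc p. let F = face_flags [fst p, snd p, snd p] in if 0 < dot F F - 2 then acc else F # acc) [] (pairs vs)"

definition triples :: "real list list" where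
  "triples = concat (map (\<lambda>a. concat (map (\<lambda>b. map (\<lambda>c'. face_flags [a, b, c']) vs) vs)) vs)"

definition face_good :: bool where
  "face_good \<longleftrightarrow> (\<forall>a\<in>set vs. \<forall>b\<in>set vs. \<forall>c'\<in>set vs. \<forall>e\<in>set (unit_rows (length vs)).
      good (lp_val (replicate (length vs + 3) 0) (face_rows (n + 1) (face_gens vs [a, b, c']) e) (replicate (length vs + 3) 0)))"

lemma exec_items:
  assumes slv: "lp_solver slv" and good: face_good and big: "2 * n + length vs * length vs + length vs + 10 \<le> M"
  shows "exec items_prog (Node (encl (encl Num) vs) e) (encl (encl Num) (vertex_items @ edge_items))
     (length vs * length vs + length vs * length vs * length vs)"
proof -
  let ?f = "Node (encl (encl Num) vs) e"
  have M: "length vs \<le> M" "2 * n + length vs + 10 \<le> M" "length (pairs vs) \<le> M" using big length_pairs[of vs] by auto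
  have ff: "exec face_flags_prog (Node (encl Num a) (Node (encl Num b) (Node (encl Num c') (Node (encl (encl Num) vs) e'))))
     (encl Num (face_flags [a, b, c'])) (length vs)" if "a \<in> set vs" "b \<in> set vs" "c' \<in> set vs" for a b c' e'
    by (rule exec_face_flags[OF slv that _ M(2)]) (use good that in \<open>auto simp: face_good_def\<close>)
  have v: "exec (var 0) ?f (encl (encl Num) vs) 0" by (rule exec_rules)
  have 1: "exec (map_in (var 0) (Seq (Fork (var 0) (Fork (var 0) (Fork (var 0) (Fork (var 1) MkNull)))) face_flags_prog)) ?f
     (encl (encl Num) vertex_items) (0 + length vs * (0 + length vs))"
    unfolding vertex_items_def
  proof (rule exec_map[OF v M(1)])
    fix x assume x: "x \<in> set vs"
    have "exec (Fork (var 0) (Fork (var 0) (Fork (var 0) (Fork (var 1) MkNull)))) (Node (encl Num x) ?f)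
      (Node (encl Num x) (Node (encl Num x) (Node (encl Num x) (Node (encl (encl Num) vs) Null)))) 0" by (rule exec_rules)+
    from exec_Seq[OF this ff[OF x x x]]
    show "exec (Seq (Fork (var 0) (Fork (var 0) (Fork (var 0) (Fork (var 1) MkNull)))) face_flags_prog) (Node (encl Num x) ?f)
      (encl Num (face_flags [x, x, x])) (0 + length vs)" .
  qed
  define enc_pair where "enc_pair p = Node (encl Num (fst p)) (encl Num (snd p))" for p
  have 2: "exec pairs_prog ?f (encl enc_pair (pairs vs)) 0"
  proof -
    define A where "A st = Node (encl (encl Num) (fst st)) (encl enc_pair (snd st))" for st
    let ?g = "\<lambda>st b. (b # fst st, map (\<lambda>a. (a, b)) (fst st) @ snd st)"
    have "exec (fold_in (Fork MkNull MkNull) (var 0) (Fork (Fork (var 0) (Seq (var 1) GetL))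
        (append_of (map_in (Seq (var 1) GetL) (Fork (var 0) (var 1))) (Seq (var 1) GetR)))) ?f (A (foldl ?g ([], []) vs)) 0"
    proof (rule exec_fold_prefix0[of _ _ A, OF _ v M(1)])
      show "exec (Fork MkNull MkNull) ?f (A ([], []))  0" unfolding A_def by (auto intro: exec_Fork0 exec_Null)
      fix us b ws assume vs: "vs = us @ b # ws"
      have fr: "fst (foldl ?g ([], []) us) = rev us" for us :: "real list list"
        by (induction us rule: rev_induct) auto
      obtain P L where st: "foldl ?g ([], []) us = (P, L)" by (cases "foldl ?g ([], []) us")
      have "length P \<le> M" using fr[of us] st vs M by simp
      let ?h = "Node (encl Num b) (Node (A (P, L)) ?f)"
      have "exec (map_in (Seq (var 1) GetL) (Fork (var 0) (var 1))) ?h (encl enc_pair (map (\<lambda>a. (a, b)) P)) 0"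
      proof (rule exec_map0[where X = "encl Num"])
        show "exec (Seq (var 1) GetL) ?h (encl (encl Num) P) 0" unfolding A_def fst_conv by (rule exec_rules)+
        fix a show "exec (Fork (var 0) (var 1)) (Node (encl Num a) ?h) (enc_pair (a, b)) 0"
          unfolding enc_pair_def fst_conv snd_conv by (rule exec_rules)+
      qed (rule \<open>length P \<le> M\<close>)
      moreover have "exec (Seq (var 1) GetR) ?h (encl enc_pair L) 0" unfolding A_def snd_conv by (rule exec_rules)+
      ultimately have "exec (append_of (map_in (Seq (var 1) GetL) (Fork (var 0) (var 1))) (Seq (var 1) GetR)) ?h
         (encl enc_pair (map (\<lambda>a. (a, b)) P @ L)) 0" using \<open>length P \<le> M\<close> by (intro exec_append0) auto
      moreover have "exec (Fork (var 0) (Seq (var 1) GetL)) ?h (encl (encl Num) (b # P)) 0"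
        unfolding A_def fst_conv encl_simps by (rule exec_rules)+
      ultimately show "exec (Fork (Fork (var 0) (Seq (var 1) GetL))
        (append_of (map_in (Seq (var 1) GetL) (Fork (var 0) (var 1))) (Seq (var 1) GetR)))
        (Node (encl Num b) (Node (A (foldl ?g ([], []) us)) ?f)) (A (?g (foldl ?g ([], []) us) b)) 0"
        unfolding st A_def[of "(_ # _, _)"] fst_conv snd_conv by (intro exec_Fork0)
    qed
    then show ?thesis unfolding pairs_prog_def pairs_def A_def by (rule exec_SeqR)
  qed
  have 3: "exec edges_prog (Node (encl enc_pair (pairs vs)) (Node (encl (encl Num) vs) Null)) (encl (encl Num) edge_items)
     (0 + 0 + length (pairs vs) * (0 + length vs))" unfolding edges_prog_def edge_items_def
  proof (rule exec_fold[where A = "encl (encl Num)" and X = enc_pair])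
    let ?k = "Node (encl enc_pair (pairs vs)) (Node (encl (encl Num) vs) Null)"
    show "exec MkNull ?k (encl (encl Num) []) 0" by (simp add: exec_Null)
    show "exec (var 0) ?k (encl enc_pair (pairs vs)) 0" by (rule exec_rules)
    fix acc p assume p: "p \<in> set (pairs vs)"
    obtain a b where pe: "p = (a, b)" by (cases p)
    have ab: "a \<in> set vs" "b \<in> set vs" using set_pairs[of vs] p pe by auto
    let ?h = "Node (enc_pair p) (Node (encl (encl Num) acc) ?k)"
    define F where "F = face_flags [a, b, b]"
    have "exec (Fork (Seq (var 0) GetL) (Fork (Seq (var 0) GetR) (Fork (Seq (var 0) GetR) (Fork (var 3) MkNull)))) ?h
       (Node (encl Num a) (Node (encl Num b) (Node (encl Num b) (Node (encl (encl Num) vs) Null)))) 0"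
      unfolding pe enc_pair_def fst_conv snd_conv by (rule exec_rules)+
    from exec_Seq[OF this ff[OF ab ab(2)]]
    have 1: "exec (Seq (Fork (Seq (var 0) GetL) (Fork (Seq (var 0) GetR) (Fork (Seq (var 0) GetR) (Fork (var 3) MkNull)))) face_flags_prog) ?h
       (encl Num F) (0 + length vs)" unfolding F_def .
    let ?m = "Node (encl Num F) ?h"
    have Fv: "exec (var 0) ?m (encl Num F) 0" by (rule exec_rules)
    have d: "exec (dot_of (var 0) (var 0)) ?m (Num (dot F F)) 0"
      by (rule exec_dot[OF Fv Fv]) (use M in \<open>auto simp: F_def\<close>)
    have "exec (var 2) ?m (encl (encl Num) acc) 0" "exec (Fork (var 0) (var 2)) ?m (encl (encl Num) (F # acc)) 0"
      unfolding encl_simps(2) by ((rule exec_rules)+)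
    from exec_Branch_if[OF exec_sub[OF d exec_Num2(1)] this]
    have 2: "exec (Branch (sub_of (dot_of (var 0) (var 0)) (MkNum 2)) (var 2) (Fork (var 0) (var 2))) ?m
       (encl (encl Num) (if 0 < dot F F - 2 then acc else F # acc)) 0" by (simp split: if_splits)
    show "exec (let_in (Seq (Fork (Seq (var 0) GetL) (Fork (Seq (var 0) GetR) (Fork (Seq (var 0) GetR) (Fork (var 3) MkNull)))) face_flags_prog)
       (Branch (sub_of (dot_of (var 0) (var 0)) (MkNum 2)) (var 2) (Fork (var 0) (var 2)))) ?h
       (encl (encl Num) (let F = face_flags [fst p, snd p, snd p] in if 0 < dot F F - 2 then acc else F # acc)) (0 + length vs)"
      using exec_let[OF 1 2] unfolding pe Let_def fst_conv snd_conv F_def[symmetric] by simp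
  qed (rule M)
  have "exec (Seq (Fork pairs_prog (Fork (var 0) MkNull)) edges_prog) ?f (encl (encl Num) edge_items) (0 + (0 + 0 + length (pairs vs) * (0 + length vs)))"
    by (rule exec_Seq[OF _ 3]) (intro exec_Fork0 2 v exec_Null)
  from exec_append[OF 1 this] have "exec items_prog ?f (encl (encl Num) (vertex_items @ edge_items))
      (length vs * length vs + length (pairs vs) * length vs)" unfolding items_prog_def using M by (simp add: vertex_items_def)
  then show ?thesis by (rule exec_mono) (use length_pairs[of vs] in simp)
qed

lemma exec_triples:
  assumes slv: "lp_solver slv" and good: face_good and big: "2 * n + length vs * length vs + length vs + 10 \<le> M"
  shows "exec triples_prog (Node (encl (encl Num) vs) e) (encl (encl Num) triples)
     (length vs * length vs * length vs * length vs)"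
proof -
  let ?f = "Node (encl (encl Num) vs) e"
  have M: "length vs \<le> M" "2 * n + length vs + 10 \<le> M" "length vs * length vs \<le> M" using big by auto
  have ff: "exec face_flags_prog (Node (encl Num a) (Node (encl Num b) (Node (encl Num c') (Node (encl (encl Num) vs) e'))))
     (encl Num (face_flags [a, b, c'])) (length vs)" if "a \<in> set vs" "b \<in> set vs" "c' \<in> set vs" for a b c' e'
    by (rule exec_face_flags[OF slv that _ M(2)]) (use good that in \<open>auto simp: face_good_def\<close>)
  have len: "length (concat (map (\<lambda>b. map (g b) us) ws)) = length ws * length us" for g :: "real list \<Rightarrow> real list \<Rightarrow> real list" and us ws
    by (induction ws) auto
  have "exec triples_prog ?f (encl (encl Num) triples) (0 + length vs * (0 + length vs * (0 + length vs * (0 + length vs))))"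
    unfolding triples_prog_def triples_def
  proof (rule exec_concat_map[where X = "encl Num"], goal_cases)
    case 1 show ?case by (rule exec_rules)
  next
    case (3 a)
    note a = 3
    let ?g = "Node (encl Num a) ?f"
    show ?case
    proof (rule exec_concat_map[where X = "encl Num"], goal_cases)
      case 1 show ?case by (rule exec_rules)+
    next
      case (3 b)
      note b = 3
      let ?h = "Node (encl Num b) ?g"
      show ?case
      proof (rule exec_map[where X = "encl Num"], goal_cases)
        case 1 show ?case by (rule exec_rules)+
      next
        case (3 c')
        have "exec (Fork (var 2) (Fork (var 1) (Fork (var 0) (Fork (var 3) MkNull)))) (Node (encl Num c') ?h)
          (Node (encl Num a) (Node (encl Num b) (Node (encl Num c') (Node (encl (encl Num) vs) Null)))) 0" by (rule exec_rules)+
        from exec_Seq[OF this ff[OF a b 3]] show ?case .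
      qed (rule M)
    qed (use M in auto)
  qed (use M len in auto)
  then show ?thesis by (simp add: algebra_simps)
qed

end

section \<open>Enumeration of the guesses and the main loop\<close>

definition pair_prog :: prog where
  "pair_prog = Fork (var 0) (var 1)"

text \<open>\<open>Seq (var 0) GetL\<close> is the first vertex, whose length stands for the
  dimension; without vertices it is empty.\<close>

definition prep_prog :: prog where
  "prep_prog = Fork (unit_rows_of (var 0)) (Fork (unit_rows_of (Seq (var 0) GetL)) (Fork (transpose_of (var 0))
     (Fork (zeros_of (var 0)) (Fork (zeros_of (Seq (var 0) GetL)) (Fork (zeros_of (var 5)) (Fork (zeros_of (var 6))
     (Fork (append_of (zeros_of (var 5)) (append_of (zeros_of (var 6)) (append_of (zeros_of (var 6)) (append_of (zeros_of (var 6)) (list_prog [MkNum 0])))))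
     (Fork (zip_of (var 1) (zip_of (var 2) (zip_of (var 4) (var 3) pair_prog) pair_prog) pair_prog)
     (Fork (list_prog (map (\<lambda>i. Fork (base_row_prog i (zeros_of (var 5)) (var 6) (-1) (zeros_of (var 6))) (MkNum 0)) [1, 2, 3]))
     (Fork (base_row_prog 0 (var 5) MkNull 1 (zeros_of (var 6)))
     (Fork (append_of (var 7) (append_of (var 8) (append_of (var 8) (append_of (var 8) (list_prog [MkNum 0])))))
     (Fork (var 5) (Fork (var 6) MkNull)))))))))))))"

definition label_prog :: "int \<Rightarrow> int \<Rightarrow> int \<Rightarrow> prog" where
  "label_prog i j k = list_prog [MkNum i, MkNum j, MkNum k]"

definition guess_step_prog :: prog where
  "guess_step_prog = fold_in MkNull (var 1)
     (Fork (Fork (Fork (var 2) (label_prog 1 0 0)) (var 0)) (Fork (Fork (Fork (var 2) (label_prog 0 1 0)) (var 0))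
        (Fork (Fork (Fork (var 2) (label_prog 0 0 1)) (var 0)) (var 1))))"

definition guesses_prog :: prog where
  "guesses_prog = fold_in (Fork MkNull MkNull) (rev_of (var 0)) guess_step_prog"

definition best_prog :: prog where
  "best_prog = Seq (Fork (Seq (Fork (var 0) (Fork (var 4) (skip_env 5))) eval_prog) (Fork (var 1) MkNull)) better_prog"

definition loop_prog :: prog where
  "loop_prog = fold_in (Fork (MkNum 0) (Fork (MkNum 0) MkNull)) (var 0) best_prog"

text \<open>The last \<open>Fork\<close> removes the value that a record carries for comparisons and
  leaves the tag and the data of \<open>enc_outcome\<close>.\<close>

definition main_prog :: prog where
  "main_prog = Seq (Seq (Fork items_prog (Fork triples_prog prep_prog)) (let_in guesses_prog loop_prog)) (Fork GetL (Seq GetR GetR))"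

definition guess_step :: "(real list \<times> real list) list list \<Rightarrow> real list \<Rightarrow> (real list \<times> real list) list list" where
  "guess_step gs F = foldl (\<lambda>acc g. ((F, [1, 0, 0]) # g) # ((F, [0, 1, 0]) # g) # ((F, [0, 0, 1]) # g) # acc) [] gs"

definition guesses :: "real list list \<Rightarrow> (real list \<times> real list) list list" where
  "guesses items = foldl guess_step [[]] (rev items)"

lemma foldl_guess:
  "set (foldl (\<lambda>acc g. a g # b g # c g # acc) acc gs) = set acc \<union> a ` set gs \<union> b ` set gs \<union> c ` set gs"
  "length (foldl (\<lambda>acc g. a g # b g # c g # acc) acc gs) = length acc + 3 * length gs"
  by (induction gs arbitrary: acc) auto

lemma guesses_Cons: "guesses (F # Fs) = guess_step (guesses Fs) F"
  by (simp add: guesses_def)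

lemma length_guesses: "length (guesses items) = 3 ^ length items"
  by (induction items) (simp_all add: guesses_Cons guess_step_def foldl_guess(2), simp add: guesses_def)

lemma set_guesses:
  "set (guesses items) = {zip items ls |ls. length ls = length items \<and> set ls \<subseteq> {[1, 0, 0], [0, 1, 0], [0, 0, 1]}}"
proof (induction items)
  case Nil then show ?case by (auto simp: guesses_def)
next
  case (Cons F Fs)
  show ?case (is "?l = ?r")
  proof
    show "?l \<subseteq> ?r"
    proof
      fix g assume "g \<in> ?l"
      then obtain l ls where *: "g = (F, l) # zip Fs ls" "l \<in> {[1, 0, 0], [0, 1, 0], [0, 0, 1]}" "length ls = length Fs"
        "set ls \<subseteq> {[1, 0, 0], [0, 1, 0], [0, 0, 1]}"
        using Cons by (auto simp: guesses_Cons guess_step_def foldl_guess(1))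
      then have "g = zip (F # Fs) (l # ls)" "length (l # ls) = length (F # Fs)"
        "set (l # ls) \<subseteq> {[1, 0, 0], [0, 1, 0], [0, 0, 1]}" by auto
      then show "g \<in> ?r" by blast
    qed
    show "?r \<subseteq> ?l"
    proof
      fix g assume "g \<in> ?r"
      then obtain ls' where *: "g = zip (F # Fs) ls'" "length ls' = length (F # Fs)" "set ls' \<subseteq> {[1, 0, 0], [0, 1, 0], [0, 0, 1]}" by auto
      then obtain l ls where ls: "ls' = l # ls" by (cases ls') auto
      then have "zip Fs ls \<in> set (guesses Fs)" using * unfolding Cons by auto
      then show "g \<in> ?l" using * ls by (auto simp: guesses_Cons guess_step_def foldl_guess(1))
    qed
  qed
qed

context machine
begin

lemma exec_label:
  "exec (label_prog 1 0 0) e (encl Num [1, 0, 0]) 0" "exec (label_prog 0 1 0) e (encl Num [0, 1, 0]) 0"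
  "exec (label_prog 0 0 1) e (encl Num [0, 0, 1]) 0"
  unfolding label_prog_def list_prog_def encl_simps by (simp_all, (intro exec_Fork0 exec_Num exec_Null)+)

lemma exec_guess_step:
  assumes "length gs \<le> M"
  shows "exec guess_step_prog (Node (encl Num F) (Node (encl (encl enc_req) gs) e)) (encl (encl enc_req) (guess_step gs F)) 0"
  unfolding guess_step_prog_def guess_step_def
proof (rule exec_fold0[where A = "encl (encl enc_req)" and X = "encl enc_req"])
  let ?f = "Node (encl Num F) (Node (encl (encl enc_req) gs) e)"
  show "exec MkNull ?f (encl (encl enc_req) []) 0" by (simp add: exec_Null)
  show "exec (var 1) ?f (encl (encl enc_req) gs) 0" by (rule exec_rules)+
  fix acc g
  show "exec (Fork (Fork (Fork (var 2) (label_prog 1 0 0)) (var 0)) (Fork (Fork (Fork (var 2) (label_prog 0 1 0)) (var 0))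
        (Fork (Fork (Fork (var 2) (label_prog 0 0 1)) (var 0)) (var 1)))) (Node (encl enc_req g) (Node (encl (encl enc_req) acc) ?f))
     (encl (encl enc_req) (((F, [1, 0, 0]) # g) # ((F, [0, 1, 0]) # g) # ((F, [0, 0, 1]) # g) # acc)) 0"
    unfolding encl_simps(2)[of "encl enc_req"] encl_simps(2)[of enc_req] enc_req_def[of "(F, _)"] fst_conv snd_conv
    by (rule exec_label exec_rules)+
qed (rule assms)

end

lemma run_guesses:
  assumes "length items \<le> M"
  shows "\<exists>t. run slv guesses_prog (Node (encl (encl Num) items) e) = (encl (encl enc_req) (guesses items), t, []) \<and>
    t \<le> 7 + cost M (Fork MkNull MkNull) + cost M (rev_of (var 0)) + length items * (9 + cost (3 ^ length items) guess_step_prog)"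
proof -
  interpret m: machine slv "\<lambda>_. True" M .
  interpret k: machine slv "\<lambda>_. True" "3 ^ length items" .
  let ?f = "Node (encl (encl Num) items) e"
  have l: "m.exec (rev_of (var 0)) ?f (encl (encl Num) (rev items)) 0"
    by (rule m.exec_rev[OF _ assms]) (rule m.exec_rules)
  obtain t1 where 1: "run slv (rev_of (var 0)) ?f = (encl (encl Num) (rev items), t1, [])" "t1 \<le> cost M (rev_of (var 0))"
    using l by (auto simp: m.exec_def)
  \<comment> \<open>the fold is analysed with the exponential length bound, the list it runs along with the polynomial one\<close>
  let ?p = "Seq (Fork GetR GetL) (Fork guess_step_prog (Seq GetR GetR))"
  have "\<exists>t Q. fold_run (run slv ?p) (Node (encl (encl enc_req) [[]]) e') (encl (encl Num) (rev items)) =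
      (Node (encl (encl enc_req) (foldl guess_step [[]] (rev items))) e', t, Q) \<and>
      t \<le> 1 + length (rev items) * (1 + cost (3 ^ length items) ?p) \<and> length Q \<le> length (rev items) * 0 \<and> (\<forall>x\<in>set Q. True)" for e'
  proof (rule k.fold_run_exec)
    fix us F ws assume "rev items = us @ F # ws"
    then have items: "items = rev ws @ F # rev us" by (simp add: rev_swap)
    have fu: "foldl guess_step [[]] us = guesses (rev us)" by (simp add: guesses_def)
    have "length (guesses (rev us)) \<le> 3 ^ length items" unfolding length_guesses items by (intro power_increasing) auto
    note s = k.exec_guess_step[OF this, of F e']
    have "k.exec (Fork GetR GetL) (Node (Node (encl (encl enc_req) (guesses (rev us))) e') (encl Num F))
        (Node (encl Num F) (Node (encl (encl enc_req) (guesses (rev us))) e')) 0"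
      by (rule k.exec_rules)+
    moreover have "k.exec (Seq GetR GetR) (Node (encl Num F) (Node (encl (encl enc_req) (guesses (rev us))) e')) e' 0"
      by (rule k.exec_rules)+
    ultimately show "k.exec ?p (Node (Node (encl (encl enc_req) (foldl guess_step [[]] us)) e') (encl Num F))
        (Node (encl (encl enc_req) (guess_step (foldl guess_step [[]] us) F)) e') 0"
      unfolding fu using s by (intro k.exec_Seq0[OF _ k.exec_Fork0])
  qed
  then obtain t Q where f: "fold_run (run slv ?p) (Node (encl (encl enc_req) [[]]) ?f) (encl (encl Num) (rev items)) =
      (Node (encl (encl enc_req) (foldl guess_step [[]] (rev items))) ?f, t, Q)"
      "t \<le> 1 + length (rev items) * (1 + cost (3 ^ length items) ?p)" "length Q \<le> length (rev items) * 0" by blast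
  have f': "run slv (Fold ?p) (Node (Node (encl (encl enc_req) [[]]) ?f) (encl (encl Num) (rev items))) =
      (Node (encl (encl enc_req) (guesses items)) ?f, t, [])" using f(1,3) by (simp add: guesses_def)
  have r: "run slv guesses_prog ?f = (encl (encl enc_req) (guesses items), 9 + t1 + t, [])"
    unfolding guesses_prog_def fold_in_def using 1(1) f' by (simp del: run.simps(5))
  have "1 + cost (3 ^ length items) ?p = 9 + cost (3 ^ length items) guess_step_prog" by simp
  then have "t \<le> 1 + length items * (9 + cost (3 ^ length items) guess_step_prog)" using f(2) by (simp only: length_rev)
  moreover have "cost M (Fork MkNull MkNull) = 3" by simp
  ultimately have "9 + t1 + t \<le> 7 + cost M (Fork MkNull MkNull) + cost M (rev_of (var 0)) + length items * (9 + cost (3 ^ length items) guess_step_prog)"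
    using 1(2) by linarith
  then show ?thesis using r by blast
qed

context adapt_machine
begin

text \<open>Projecting out the block variables puts the feasible sets of all guesses into one space,
  where their union makes sense.\<close>

definition base_set :: "(real list \<times> real list) list \<Rightarrow> real list set" where
  "base_set qs = {z. length z = base_dim \<and> (\<forall>i<base_dim. base_ints ! i = 1 \<longrightarrow> z ! i \<in> \<int>) \<and>
     (\<exists>w. length w = length (snd (build qs)) \<and> sat (fst (build qs)) (w @ z))}"

definition build_lp :: "(real list \<times> real list) list \<Rightarrow> val" where
  "build_lp qs = lp_val (snd (build qs) @ base_obj) (fst (build qs)) (snd (build qs) @ base_ints)"

lemma length_base_obj: "length base_obj = base_dim" and length_base_ints: "length base_ints = base_dim"
  using ints_len by (auto simp: base_obj_def base_row_def slot_def base_dim_def base_ints_def)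

lemma base_set_outcome:
  assumes "is_outcome (lp_set (length (snd (build qs) @ base_obj)) (fst (build qs)) (snd (build qs) @ base_ints))
     (dot (snd (build qs) @ base_obj)) r"
  shows "is_outcome (base_set qs) (dot base_obj) (map_outcome (drop (length (snd (build qs)))) r)"
proof (rule map_outcome_correct[OF assms])
  let ?Z = "snd (build qs)" and ?R = "fst (build qs)"
  have Z0: "?Z ! i \<noteq> 1" if "i < length ?Z" for i using that by (subst snd_build) (simp add: snd_build)
  have Zd: "dot ?Z w = 0" for w by (subst snd_build) simp
  {
    fix s assume s: "s \<in> lp_set (length (?Z @ base_obj)) ?R (?Z @ base_ints)"
    then have len: "length s = length ?Z + base_dim" by (simp add: lp_set_def length_base_obj)
    have "drop (length ?Z) s ! i \<in> \<int>" if "i < base_dim" "base_ints ! i = 1" for i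
      using s that len by (auto simp: lp_set_def length_base_obj nth_append dest!: spec[of _ "length ?Z + i"])
    moreover have "sat ?R (take (length ?Z) s @ drop (length ?Z) s)" using s by (simp add: lp_set_def)
    ultimately have "drop (length ?Z) s \<in> base_set qs"
      unfolding base_set_def using len by (intro CollectI conjI exI[of _ "take (length ?Z) s"]) auto
    moreover have "dot (?Z @ base_obj) (take (length ?Z) s @ drop (length ?Z) s) = dot base_obj (drop (length ?Z) s)"
      using len by (subst dot_append) (auto simp: Zd)
    ultimately show "drop (length ?Z) s \<in> base_set qs \<and> dot base_obj (drop (length ?Z) s) \<le> dot (?Z @ base_obj) s" by simp
  }
  fix t assume "t \<in> base_set qs"
  then obtain w where t: "length t = base_dim" "\<forall>i<base_dim. base_ints ! i = 1 \<longrightarrow> t ! i \<in> \<int>"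
    "length w = length ?Z" "sat ?R (w @ t)" by (auto simp: base_set_def)
  have "(w @ t) ! i \<in> \<int>" if i: "i < length ?Z + base_dim" "(?Z @ base_ints) ! i = 1" for i
  proof (cases "i < length ?Z")
    case True then show ?thesis using i Z0 by (simp add: nth_append)
  next
    case False then show ?thesis using i t by (simp add: nth_append)
  qed
  then have "w @ t \<in> lp_set (length (?Z @ base_obj)) ?R (?Z @ base_ints)"
    using t by (auto simp: lp_set_def length_base_obj)
  then show "\<exists>s\<in>lp_set (length (?Z @ base_obj)) ?R (?Z @ base_ints). dot (?Z @ base_obj) s = dot base_obj t"
    using t by (intro bexI[of _ "w @ t"]) (simp_all add: Zd)
qed

lemma exec_solve:
  assumes slv: "lp_solver slv"
    and q: "\<And>q. q \<in> set qs \<Longrightarrow> length (fst q) = length vs \<and> length (snd q) = 3" and ne: "vs = [] \<Longrightarrow> qs = []"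
    and M: "(length qs + 2) * width \<le> M" and good: "good (build_lp qs)"
  shows "\<exists>r. is_outcome (base_set qs) (dot base_obj) r \<and>
    exec solve_prog (Node (encl enc_req qs) data_env) (enc_record (dot base_obj) (enc_base (length c) (length d)) r) 1"
proof -
  define R where "R = fst (build qs)"
  define Z where "Z = snd (build qs)"
  let ?f = "Node (encl enc_req qs) data_env"
  have 1: "exec build_prog ?f (Node (encl enc_row R) (encl Num Z)) 0" unfolding R_def Z_def by (rule exec_build[OF q ne M])
  let ?g = "Node (Node (encl enc_row R) (encl Num Z)) ?f"
  have "length vs + n \<le> width" by (simp add: width_def)
  then have "length Z \<le> length qs * width" unfolding Z_def snd_build by simp
  moreover have "length R \<le> 3 + length qs * width" unfolding R_def by (rule length_build) (use q in auto)
  moreover have "3 \<le> width" "base_dim \<le> width" by (auto simp: width_def)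
  ultimately have le: "length Z \<le> M" "length R \<le> M" "base_dim \<le> M" using M by (auto simp: algebra_simps)
  have g: "exec (Seq (var 0) GetR) ?g (encl Num Z) 0" "exec (Seq (var 0) GetL) ?g (encl enc_row R) 0"
    "exec (var 12) ?g (encl Num base_obj) 0" "exec (var 13) ?g (encl Num base_ints) 0"
    unfolding data_env_def by ((rule exec_rules)+)
  have "exec (Fork (append_of (Seq (var 0) GetR) (var 12)) (Fork (Seq (var 0) GetL) (Fork (append_of (Seq (var 0) GetR) (var 13)) MkNull))) ?g
     (Node (encl Num (Z @ base_obj)) (Node (encl enc_row R) (Node (encl Num (Z @ base_ints)) Null))) 0"
    by (intro exec_Fork0 exec_append0 g le exec_Null)
  from exec_Seq0[OF this exec_lp_prog[OF le(2)]]
  have lp: "exec (Seq (Fork (append_of (Seq (var 0) GetR) (var 12)) (Fork (Seq (var 0) GetL) (Fork (append_of (Seq (var 0) GetR) (var 13)) MkNull))) lp_prog) ?g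
     (lp_val (Z @ base_obj) R (Z @ base_ints)) 0" .
  have len: "length (fst r) = length (Z @ base_obj)" if "r \<in> set R" for r
    using build_row_length[OF ne] that by (auto simp: R_def Z_def length_base_obj)
  have bi: "length (Z @ base_ints) = length (Z @ base_obj)" by (simp add: length_base_obj length_base_ints)
  have "set (Z @ base_ints) \<subseteq> {0, 1}" using ints_len(3,4) by (auto simp: base_ints_def Z_def snd_build)
  from exec_Solve_list[OF slv good[unfolded build_lp_def, folded R_def Z_def] len bi this]
  obtain r where r: "is_outcome (lp_set (length (Z @ base_obj)) R (Z @ base_ints)) (dot (Z @ base_obj)) r"
    "exec Solve (lp_val (Z @ base_obj) R (Z @ base_ints)) (enc_outcome (encl Num) r) 1" by blast
  define v where "v = enc_outcome (encl Num) r"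
  let ?h = "Node v ?g"
  have 3: "exec (Fork (var 0) (Fork (Seq (var 1) GetR) (Fork (var 13) (Fork (var 15) (Fork (var 16) MkNull))))) ?h
     (Node v (Node (encl Num Z) (Node (encl Num base_obj) (Node (encl Num c) (Node (encl Num d) Null))))) 0"
    unfolding data_env_def by (rule exec_rules)+
  have "length z = length Z + length base_obj" if "r = Optimal z" for z
    using r(1) that by (auto simp: lp_set_def length_base_obj)
  then have 4: "exec record_prog (Node v (Node (encl Num Z) (Node (encl Num base_obj) (Node (encl Num c) (Node (encl Num d) Null)))))
     (enc_record (dot base_obj) (enc_base (length c) (length d)) (map_outcome (drop (length Z)) r)) 0"
    unfolding v_def by (rule exec_record) (use le in \<open>auto simp: length_base_obj base_dim_def\<close>)
  have "exec solve_prog ?f (enc_record (dot base_obj) (enc_base (length c) (length d)) (map_outcome (drop (length Z)) r)) 1"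
    using exec_let[OF 1 exec_let[OF exec_Seq[OF lp r(2)] exec_Seq[OF 3 4, unfolded v_def]]] unfolding solve_prog_def by simp
  moreover have "is_outcome (base_set qs) (dot base_obj) (map_outcome (drop (length Z)) r)"
    using base_set_outcome r(1) unfolding Z_def R_def by blast
  ultimately show ?thesis by blast
qed

lemma reqs_of_len:
  assumes "\<And>q. q \<in> set g \<Longrightarrow> length (fst q) = k \<and> length (snd q) = 3" "q \<in> set (reqs_of g)"
  shows "length (fst q) = k" "length (snd q) = 3"
  using assms by (auto simp: reqs_of_def dest!: set_zip_rightD)

lemma length_reqs_of: "(\<And>q. q \<in> set g \<Longrightarrow> length (fst q) \<le> k) \<Longrightarrow> length (reqs_of g) \<le> length g * k"
proof -
  assume "\<And>q. q \<in> set g \<Longrightarrow> length (fst q) \<le> k"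
  then have *: "length (concat (map (\<lambda>q. map2 (h q) (fst q) g') g)) \<le> length g * k"
    for h :: "real list \<times> real list \<Rightarrow> real \<Rightarrow> real list \<times> real list \<Rightarrow> real list \<times> real list" and g'
    by (induction g) (auto simp: min.coboundedI1 add_mono)
  show ?thesis unfolding reqs_of_def by (rule *)
qed

lemma exec_eval:
  assumes slv: "lp_solver slv"
    and g: "\<And>q. q \<in> set g \<Longrightarrow> length (fst q) = length vs \<and> length (snd q) = 3" "length vs \<le> length g"
    and tris: "\<And>W. W \<in> set tris \<Longrightarrow> length W = length vs" and ne: "vs = [] \<Longrightarrow> g = [] \<and> tris = []"
    and M: "(length g * length vs + length g + length tris + 2) * width \<le> M" and good: "good (build_lp (all_reqs tris g))"
  shows "\<exists>r. is_outcome (base_set (all_reqs tris g)) (dot base_obj) r \<and>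
    exec eval_prog (Node (encl enc_req g) (Node (encl (encl Num) tris) data_env))
      (enc_record (dot base_obj) (enc_base (length c) (length d)) r) 1"
proof -
  let ?rq = "reqs_of g"
  let ?f = "Node (encl enc_req g) (Node (encl (encl Num) tris) data_env)"
  have w: "1 \<le> width" "3 \<le> width" by (auto simp: width_def)
  have lr: "length ?rq \<le> length g * length vs" by (rule length_reqs_of) (use g in auto)
  define K where "K = length g * length vs + length g + length tris + 2"
  have KM: "K * width \<le> M" using M by (simp only: K_def)
  have "K * 1 \<le> M" by (rule order_trans[OF mult_le_mono2[OF w(1)] KM])
  moreover have "1 * width \<le> M" by (rule order_trans[OF mult_le_mono1 KM]) (simp add: K_def)
  moreover have "length g \<le> K" "length tris \<le> K" "length ?rq \<le> K" using lr by (simp_all add: K_def)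
  ultimately have le: "length g \<le> M" "3 \<le> M" "length ?rq \<le> M" "length tris \<le> M" "width \<le> M" "length vs \<le> M"
    using w g(2) by auto
  have rq: "length (fst q) = length vs \<and> length (snd q) = 3" if "q \<in> set ?rq" for q
    using reqs_of_len[of g "length vs" q] g(1) that by blast
  have "exec (Fork (var 0) MkNull) ?f (Node (encl enc_req g) Null) 0" by (rule exec_rules)+
  from exec_Seq0[OF this exec_reqs[OF _ le(1,2)]]
  have 1: "exec (Seq (Fork (var 0) MkNull) reqs_prog) ?f (encl enc_req ?rq) 0" using g by auto
  let ?g = "Node (encl enc_req ?rq) ?f"
  have 2: "exec (map_in (var 2) (Seq (Fork (var 1) (Fork (var 0) MkNull)) triple_req_prog)) ?g (encl enc_req (map (triple_req ?rq) tris)) 0"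
  proof (rule exec_map0[where X = "encl Num"])
    show "exec (var 2) ?g (encl (encl Num) tris) 0" by (rule exec_rules)+
    show "length tris \<le> M" by (rule le)
    fix W assume W: "W \<in> set tris"
    have "exec (Fork (var 1) (Fork (var 0) MkNull)) (Node (encl Num W) ?g) (Node (encl enc_req ?rq) (Node (encl Num W) Null)) 0"
      by (rule exec_rules)+
    from exec_Seq0[OF this exec_triple_req]
    show "exec (Seq (Fork (var 1) (Fork (var 0) MkNull)) triple_req_prog) (Node (encl Num W) ?g) (enc_req (triple_req ?rq W)) 0"
      using rq tris[OF W] le by auto
  qed
  have v: "exec (var 0) ?g (encl enc_req ?rq) 0" by (rule exec_rules)
  have 3: "exec (Fork (append_of (var 0) (map_in (var 2) (Seq (Fork (var 1) (Fork (var 0) MkNull)) triple_req_prog))) (skip_env 3)) ?g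
      (Node (encl enc_req (all_reqs tris g)) data_env) 0"
    unfolding all_reqs_def by (intro exec_Fork0 exec_append0 v 2 le exec_skip3)
  have "\<exists>r. is_outcome (base_set (all_reqs tris g)) (dot base_obj) r \<and>
    exec solve_prog (Node (encl enc_req (all_reqs tris g)) data_env) (enc_record (dot base_obj) (enc_base (length c) (length d)) r) 1"
  proof (rule exec_solve[OF slv _ _ _ good])
    show "vs = [] \<Longrightarrow> all_reqs tris g = []" using ne by (auto simp: all_reqs_def reqs_of_def)
    show "length (fst q) = length vs \<and> length (snd q) = 3" if "q \<in> set (all_reqs tris g)" for q
    proof -
      from that consider "q \<in> set ?rq" | W where "W \<in> set tris" "q = triple_req ?rq W" unfolding all_reqs_def by auto
      then show ?thesis using rq tris by cases (auto simp: triple_req_def Let_def)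
    qed
    have "(length (all_reqs tris g) + 2) * width \<le> (length g * length vs + length g + length tris + 2) * width"
      using lr by (intro mult_le_mono1) (simp add: all_reqs_def)
    then show "(length (all_reqs tris g) + 2) * width \<le> M" using M by (rule order_trans)
  qed
  then obtain r where r: "is_outcome (base_set (all_reqs tris g)) (dot base_obj) r"
    "exec solve_prog (Node (encl enc_req (all_reqs tris g)) data_env) (enc_record (dot base_obj) (enc_base (length c) (length d)) r) 1" by blast
  have "exec eval_prog ?f (enc_record (dot base_obj) (enc_base (length c) (length d)) r) 1"
    unfolding eval_prog_def using exec_let[OF 1 exec_Seq[OF 3 r(2)]] by simp
  then show ?thesis using r(1) by blast
qed

end

context machine
begin

lemma exec_pairs:
  assumes "exec a e (encl X xs) 0" "exec b e (encl Y ys) 0" "length xs = length ys" "length xs \<le> M"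
    and Z: "\<And>x y. Z (x, y) = Node (X x) (Y y)"
  shows "exec (zip_of a b pair_prog) e (encl Z (zip xs ys)) 0"
proof -
  have "exec (zip_of a b pair_prog) e (encl Z (map2 Pair xs ys)) 0"
    by (rule exec_zip[OF assms(1,2)]) (use assms in \<open>auto simp: pair_prog_def Z intro!: exec_Fork0 exec_vars exec_var1[simplified]\<close>)
  then show ?thesis by simp
qed

end

context adapt_machine
begin

definition input_env :: val where
  "input_env = Node (encl (encl Num) vs) (Node (encl (encl Num) A) (Node (encl (encl Num) B) (Node (encl Num bc)
     (Node (encl (encl Num) bl) (Node (encl Num c) (Node (encl Num d) (Node (encl Num xi) (Node (encl Num yi) Null))))))))"

lemma exec_prep:
  assumes M: "width \<le> M" and ne: "vs = [] \<Longrightarrow> n = 0"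
  shows "exec prep_prog input_env data_env 0"
proof -
  have le: "length vs \<le> M" "n \<le> M" "length c \<le> M" "length d \<le> M" "length bc \<le> M" "base_dim \<le> M"
    using M by (auto simp: width_def base_dim_def)
  have hn: "length (head vs) = n" using vs_len ne by (cases vs) (auto simp: head_def)
  have v: "exec (var 0) input_env (encl (encl Num) vs) 0" "exec (var 1) input_env (encl (encl Num) A) 0"
    "exec (var 2) input_env (encl (encl Num) B) 0" "exec (var 3) input_env (encl Num bc) 0"
    "exec (var 4) input_env (encl (encl Num) bl) 0" "exec (var 5) input_env (encl Num c) 0"
    "exec (var 6) input_env (encl Num d) 0" "exec (var 7) input_env (encl Num xi) 0" "exec (var 8) input_env (encl Num yi) 0"
    unfolding input_env_def by ((rule exec_rules)+)
  note h = exec_head[OF v(1)]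
  have z: "exec (zeros_of (var 0)) input_env (encl Num (replicate (length vs) 0)) 0"
    "exec (zeros_of (Seq (var 0) GetL)) input_env (encl Num (replicate n 0)) 0"
    "exec (zeros_of (var 5)) input_env (encl Num (replicate (length c) 0)) 0"
    "exec (zeros_of (var 6)) input_env (encl Num (replicate (length d) 0)) 0"
    using exec_zeros[OF v(1)] exec_zeros[OF h] exec_zeros[OF v(6)] exec_zeros[OF v(7)] le hn by simp_all
  have u: "exec (unit_rows_of (var 0)) input_env (encl (encl Num) (unit_rows (length vs))) 0"
    "exec (unit_rows_of (Seq (var 0) GetL)) input_env (encl (encl Num) (unit_rows n)) 0"
    using exec_unit_rows[OF v(1)] exec_unit_rows[OF h] le hn by simp_all
  have t: "exec (transpose_of (var 0)) input_env (encl (encl Num) (transp n vs)) 0"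
    by (rule exec_transpose[OF v(1) ne vs_len]) (use le in auto)
  have s: "exec (list_prog [MkNum 0]) input_env (encl Num [0]) 0" by (rule exec_single[of "MkNum 0" input_env Num 0, OF exec_Num(1)])
  have zb: "replicate base_dim 0 = replicate (length c) 0 @ replicate (length d) 0 @ replicate (length d) 0 @ replicate (length d) 0 @ [0::real]"
  proof -
    have "[0::real] = replicate 1 0" by simp
    then show ?thesis by (simp only: replicate_add[symmetric]) (simp add: base_dim_def algebra_simps numeral_3_eq_3)
  qed
  have b: "exec (append_of (zeros_of (var 5)) (append_of (zeros_of (var 6)) (append_of (zeros_of (var 6)) (append_of (zeros_of (var 6)) (list_prog [MkNum 0])))))
     input_env (encl Num (replicate base_dim 0)) 0" unfolding zb
    by (intro exec_append0 z s) (use le in simp_all)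
  define Z1 where "Z1 p = Node (encl Num (fst p)) (Num (snd p))" for p :: "real list \<times> real"
  define Z2 where "Z2 p = Node (encl Num (fst p)) (Z1 (snd p))" for p :: "real list \<times> real list \<times> real"
  have r1: "exec (zip_of (var 4) (var 3) pair_prog) input_env (encl Z1 (zip bl bc)) 0"
    by (rule exec_pairs[OF v(5) v(4)]) (use bl_len le in \<open>simp_all add: Z1_def\<close>)
  have r2: "exec (zip_of (var 2) (zip_of (var 4) (var 3) pair_prog) pair_prog) input_env (encl Z2 (zip B (zip bl bc))) 0"
    by (rule exec_pairs[OF v(3) r1]) (use bl_len B_len le in \<open>simp_all add: Z2_def\<close>)
  have r: "exec (zip_of (var 1) (zip_of (var 2) (zip_of (var 4) (var 3) pair_prog) pair_prog) pair_prog) input_env (encl enc_data row_data) 0"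
    unfolding row_data_def
    by (rule exec_pairs[OF v(2) r2]) (use bl_len B_len A_len le in \<open>simp_all add: enc_data_def Z2_def Z1_def case_prod_beta\<close>)
  have br: "exec (Fork (base_row_prog i (zeros_of (var 5)) (var 6) (-1) (zeros_of (var 6))) (MkNum 0)) input_env
     (enc_row (base_row i (replicate (length c) 0) d (-1), 0)) 0" for i
    unfolding enc_row_def fst_conv snd_conv
    by (intro exec_Fork0 exec_base_row z v exec_Num) (use le in simp_all)
  then have brs: "exec (list_prog (map (\<lambda>i. Fork (base_row_prog i (zeros_of (var 5)) (var 6) (-1) (zeros_of (var 6))) (MkNum 0)) [1, 2, 3]))
     input_env (encl enc_row base_rows) 0"
    unfolding list_prog_def base_rows_def by (auto intro!: exec_Fork0 exec_Null)
  have bo: "exec (base_row_prog 0 (var 5) MkNull 1 (zeros_of (var 6))) input_env (encl Num base_obj) 0"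
    unfolding base_obj_def by (rule exec_base_row[OF v(6) _ _ _ z(4)]) (use le in \<open>auto intro: exec_Null exec_Num\<close>)
  have bi: "exec (append_of (var 7) (append_of (var 8) (append_of (var 8) (append_of (var 8) (list_prog [MkNum 0])))))
     input_env (encl Num base_ints) 0"
    unfolding base_ints_def by (intro exec_append0 v s) (use le ints_len in simp_all)
  show ?thesis unfolding prep_prog_def data_env_def
    by (intro exec_Fork0 u t z b r brs bo bi v exec_Null)
qed

definition items :: "real list list" where
  "items = vertex_items @ edge_items"

text \<open>A coarse description as some selection of pairs, sufficient for lengths and 0/1 entries
  before any geometry is used.\<close>

lemma edge_items_rec: "\<exists>Ps. edge_items = map (\<lambda>p. face_flags [fst p, snd p, snd p]) Ps \<and> length Ps \<le> length (pairs vs)"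
proof -
  have "\<exists>Ps. foldl (\<lambda>acc p. let F = face_flags [fst p, snd p, snd p] in if 0 < dot F F - 2 then acc else F # acc) [] us =
     map (\<lambda>p. face_flags [fst p, snd p, snd p]) Ps \<and> length Ps \<le> length us" for us
  proof (induction us rule: rev_induct)
    case (snoc p us)
    then obtain Ps where *: "foldl (\<lambda>acc p. let F = face_flags [fst p, snd p, snd p] in if 0 < dot F F - 2 then acc else F # acc) [] us =
      map (\<lambda>p. face_flags [fst p, snd p, snd p]) Ps" "length Ps \<le> length us" by blast
    show ?case
    proof (cases "0 < dot (face_flags [fst p, snd p, snd p]) (face_flags [fst p, snd p, snd p]) - 2")
      case True then show ?thesis using * by (intro exI[of _ Ps]) (simp add: Let_def)
    next
      case False then show ?thesis using * by (intro exI[of _ "p # Ps"]) (simp add: Let_def)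
    qed
  qed simp
  then show ?thesis unfolding edge_items_def by blast
qed

lemma items_length: "F \<in> set items \<Longrightarrow> length F = length vs" "length items \<le> length vs + length vs * length vs"
    "length vs \<le> length items"
proof -
  obtain Ps where Ps: "edge_items = map (\<lambda>p. face_flags [fst p, snd p, snd p]) Ps" "length Ps \<le> length (pairs vs)"
    using edge_items_rec by blast
  show "F \<in> set items \<Longrightarrow> length F = length vs" using Ps by (auto simp: items_def vertex_items_def)
  show "length items \<le> length vs + length vs * length vs" using Ps length_pairs[of vs] by (simp add: items_def vertex_items_def)
  show "length vs \<le> length items" by (simp add: items_def vertex_items_def)
qed

lemma triples_length: "W \<in> set triples \<Longrightarrow> length W = length vs" "length triples = length vs * length vs * length vs"
proof -
  show "W \<in> set triples \<Longrightarrow> length W = length vs" by (auto simp: triples_def)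
  have "length (concat (map (\<lambda>b. map (g b) us) ws)) = length ws * length us" for g :: "real list \<Rightarrow> real list \<Rightarrow> real list" and us ws
    by (induction ws) auto
  then have "length (concat (map (\<lambda>a. concat (map (\<lambda>b. map (\<lambda>c'. face_flags [a, b, c']) vs) vs)) ws)) = length ws * (length vs * length vs)" for ws
    by (induction ws) auto
  then show "length triples = length vs * length vs * length vs" by (simp add: triples_def)
qed

lemma guess_props:
  assumes "g \<in> set (guesses items)"
  shows "length g = length items" "q \<in> set g \<Longrightarrow> length (fst q) = length vs \<and> length (snd q) = 3"
proof -
  obtain ls where g: "g = zip items ls" "length ls = length items" "set ls \<subseteq> {[1, 0, 0], [0, 1, 0], [0, 0, 1]}"
    using assms unfolding set_guesses by blast
  then show "length g = length items" by simp
  show "length (fst q) = length vs \<and> length (snd q) = 3" if "q \<in> set g"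
  proof -
    obtain F l where q: "q = (F, l)" by (cases q)
    then have "F \<in> set items" "l \<in> set ls" using that g by (auto dest: set_zip_leftD set_zip_rightD)
    then show ?thesis using items_length(1) g(3) q by auto
  qed
qed

text \<open>Everything that concerns the machine is collected here. What the union of the sets
  \<open>base_set\<close> means and how long the calls are is settled separately.\<close>

lemma run_main:
  assumes slv: "lp_solver slv" and fg: face_good and gg: "\<And>g. g \<in> set (guesses items) \<Longrightarrow> good (build_lp (all_reqs triples g))"
    and ne: "vs = [] \<Longrightarrow> n = 0"
    and M: "(length items * length vs + length items + length vs * length vs * length vs + 2) * width \<le> M"
      "2 * n + length vs * length vs + length vs + 10 \<le> M"
  shows "\<exists>r t Q. run slv main_prog input_env = (enc_outcome (enc_base (length c) (length d)) r, t, Q) \<and>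
    is_outcome (\<Union>g\<in>set (guesses items). base_set (all_reqs triples g)) (dot base_obj) r \<and>
    t \<le> 50 + cost M (Fork items_prog (Fork triples_prog (Fork prep_prog (rev_of (var 0))))) +
       length items * (9 + cost (3 ^ length items) guess_step_prog) + 3 ^ length items * (9 + cost M best_prog) \<and>
    length Q \<le> length vs * length vs + length vs * length vs * length vs + length vs * length vs * length vs * length vs + 3 ^ length items \<and>
    (\<forall>x\<in>set Q. good x)"
proof -
  define f where "f = dot base_obj"
  define X where "X = enc_base (length c) (length d)"
  define S where "S g = base_set (all_reqs triples g)" for g
  define K where "K = length items * length vs + length items + length vs * length vs * length vs + 2"
  have KM: "K * width \<le> M" using M(1) by (simp only: K_def)
  have "1 \<le> width" by (simp add: width_def)
  then have "K * 1 \<le> M" by (intro order_trans[OF mult_le_mono2 KM])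
  moreover have "1 * width \<le> M" by (rule order_trans[OF mult_le_mono1 KM]) (simp add: K_def)
  ultimately have le: "width \<le> M" "length items \<le> M" by (simp_all add: K_def)
  have eval: "\<exists>r. is_outcome (S g) f r \<and>
    exec eval_prog (Node (encl enc_req g) (Node (encl (encl Num) triples) data_env)) (enc_record f X r) 1" if g: "g \<in> set (guesses items)" for g
    unfolding S_def f_def X_def
  proof (rule exec_eval[OF slv])
    show "length (fst q) = length vs \<and> length (snd q) = 3" if "q \<in> set g" for q using guess_props[OF g] that by blast
    show "length vs \<le> length g" using guess_props(1)[OF g] items_length(3) by simp
    show "length W = length vs" if "W \<in> set triples" for W by (rule triples_length(1)[OF that])
    show "vs = [] \<Longrightarrow> g = [] \<and> triples = []"
      using guess_props(1)[OF g] items_length(2) triples_length(2) by auto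
    show "(length g * length vs + length g + length triples + 2) * width \<le> M"
      using M(1) guess_props(1)[OF g] triples_length(2) by simp
    show "good (build_lp (all_reqs triples g))" by (rule gg[OF g])
  qed
  then obtain res where res: "\<And>g. g \<in> set (guesses items) \<Longrightarrow> is_outcome (S g) f (res g)"
    "\<And>g. g \<in> set (guesses items) \<Longrightarrow> exec eval_prog (Node (encl enc_req g) (Node (encl (encl Num) triples) data_env)) (enc_record f X (res g)) 1"
    by metis
  define best where "best = foldl (\<lambda>b g. better f b (res g)) Infeasible (guesses items)"
  \<comment> \<open>\<open>Infeasible\<close> is the right start, being the outcome of the empty
    union.\<close>
  have best: "is_outcome (\<Union>g\<in>set gs. S g) f (foldl (\<lambda>b g. better f b (res g)) Infeasible gs)" if "set gs \<subseteq> set (guesses items)" for gs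
    using that
  proof (induction gs rule: rev_induct)
    case (snoc g gs)
    then have "is_outcome ((\<Union>g\<in>set gs. S g) \<union> S g) f (better f (foldl (\<lambda>b g. better f b (res g)) Infeasible gs) (res g))"
      using res(1) by (intro better_correct) auto
    then show ?case by (simp add: Un_commute del: better.simps)
  qed simp
  let ?T = "Node (encl (encl Num) triples) data_env"
  let ?f = "Node (encl (encl Num) items) ?T"
  let ?g = "Node (encl (encl enc_req) (guesses items)) ?f"
  have "exec (Fork items_prog (Fork triples_prog prep_prog)) input_env ?f
     ((length vs * length vs + length vs * length vs * length vs) + (length vs * length vs * length vs * length vs + 0))"
    unfolding items_def
  proof (intro exec_Fork)
    show "exec items_prog input_env (encl (encl Num) (vertex_items @ edge_items)) (length vs * length vs + length vs * length vs * length vs)"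
      unfolding input_env_def by (rule exec_items[OF slv fg M(2)])
    show "exec triples_prog input_env (encl (encl Num) triples) (length vs * length vs * length vs * length vs)"
      unfolding input_env_def by (rule exec_triples[OF slv fg M(2)])
    show "exec prep_prog input_env data_env 0" by (rule exec_prep[OF le(1) ne])
  qed
  then obtain t1 Q1 where 1: "run slv (Fork items_prog (Fork triples_prog prep_prog)) input_env = (?f, t1, Q1)"
    "t1 \<le> cost M (Fork items_prog (Fork triples_prog prep_prog))"
    "length Q1 \<le> (length vs * length vs + length vs * length vs * length vs) + (length vs * length vs * length vs * length vs + 0)"
    "\<forall>x\<in>set Q1. good x" by (auto simp: exec_def simp del: run.simps(3))
  obtain t2 where 2: "run slv guesses_prog ?f = (encl (encl enc_req) (guesses items), t2, [])"
    "t2 \<le> 7 + cost M (Fork MkNull MkNull) + cost M (rev_of (var 0)) + length items * (9 + cost (3 ^ length items) guess_step_prog)"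
    using run_guesses[OF le(2), of slv ?T] by blast
  have body: "exec best_prog (Node (encl enc_req g) (Node (enc_record f X b) ?g)) (enc_record f X (better f b (res g))) 1"
    if g: "g \<in> set (guesses items)" for g b
  proof -
    let ?h = "Node (encl enc_req g) (Node (enc_record f X b) ?g)"
    have s5: "exec (skip_env 5) (Node x1 (Node x2 (Node x3 (Node x4 (Node x5 e))))) e 0" for x1 x2 x3 x4 x5 e
      by (rule exec_eq[OF exec_skip_env], simp add: numeral_eq_Suc)
    have "exec (Fork (var 0) (Fork (var 4) (skip_env 5))) ?h (Node (encl enc_req g) ?T) 0" by (rule exec_rules s5)+
    from exec_Seq[OF this res(2)[OF g]]
    have "exec (Fork (Seq (Fork (var 0) (Fork (var 4) (skip_env 5))) eval_prog) (Fork (var 1) MkNull)) ?h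
       (Node (enc_record f X (res g)) (Node (enc_record f X b) Null)) (0 + 1 + 0)"
      by (rule exec_Fork) (rule exec_rules)+
    from exec_Seq[OF this exec_better] show ?thesis unfolding best_prog_def by simp
  qed
  have "\<exists>t Q. run slv loop_prog ?g = (enc_record f X best, t, Q) \<and>
    t \<le> 7 + cost M (Fork (MkNum 0) (Fork (MkNum 0) MkNull)) + cost M (var 0) + length (guesses items) * (9 + cost M best_prog) \<and>
    length Q \<le> 0 + 0 + length (guesses items) * 1 \<and> (\<forall>x\<in>set Q. good x)"
    unfolding loop_prog_def best_def
  proof (rule run_fold[where A = "enc_record f X" and X = "encl enc_req"])
    show "exec (Fork (MkNum 0) (Fork (MkNum 0) MkNull)) ?g (enc_record f X Infeasible) 0"
      by (simp, intro exec_Fork0 exec_Num exec_Null)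
    show "exec (var 0) ?g (encl (encl enc_req) (guesses items)) 0" by (rule exec_rules)
  qed (rule body, simp)
  then obtain t3 Q3 where 3: "run slv loop_prog ?g = (enc_record f X best, t3, Q3)"
    "t3 \<le> 7 + cost M (Fork (MkNum 0) (Fork (MkNum 0) MkNull)) + cost M (var 0) + 3 ^ length items * (9 + cost M best_prog)"
    "length Q3 \<le> 3 ^ length items" "\<forall>x\<in>set Q3. good x" unfolding length_guesses by auto
  have out: "Node (get_left (enc_record f X best)) (get_right (get_right (enc_record f X best))) = enc_outcome X best"
    by (cases best; simp)
  have c: "cost M (var 0) = 3" "cost M (Fork (MkNum 0) (Fork (MkNum 0) MkNull)) = 5" "cost M (Fork MkNull MkNull) = 3"
    by (simp_all add: var_def)
  have "run slv main_prog input_env = (enc_outcome X best, t1 + t2 + t3 + 10, Q1 @ Q3)"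
    unfolding main_prog_def let_in_def using 1(1) 2(1) 3(1) out by (simp add: add.assoc)
  \<comment> \<open>The instructions that join the stages are generously covered by 50. Listing
    \<open>rev_of\<close> among the forked programs gathers the costs outside the loops in one
    term.\<close>
  moreover have "t1 + t2 + t3 + 10 \<le> 50 + cost M (Fork items_prog (Fork triples_prog (Fork prep_prog (rev_of (var 0))))) +
       length items * (9 + cost (3 ^ length items) guess_step_prog) + 3 ^ length items * (9 + cost M best_prog)"
    using 1(2) 2(2) 3(2) unfolding c by simp
  moreover have "is_outcome (\<Union>g\<in>set (guesses items). base_set (all_reqs triples g)) (dot base_obj) best"
    using best[of "guesses items"] unfolding best_def S_def f_def by simp
  ultimately show ?thesis unfolding X_def
    by (intro exI[of _ best] exI[of _ "t1 + t2 + t3 + 10"] exI[of _ "Q1 @ Q3"] conjI) (use 1(3,4) 3(3,4) in auto)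
qed

end

section \<open>Correctness of the algorithm\<close>

text \<open>The weights on the three points become multipliers; coinciding points get their whole
  weight at the first occurrence only. Scaling by \<open>1 / a x\<close> turns the strict inequality
  into one that a linear program can express.\<close>

lemma minface_triple:
  assumes V: "finite V" and T: "a1 \<in> V" "a2 \<in> V" "a3 \<in> V"
  shows "x \<in> minface V {a1, a2, a3} \<longleftrightarrow> x \<in> V \<and> (\<exists>a m1 m2 m3. (\<forall>v\<in>V. 0 \<le> a v) \<and> 0 \<le> m1 \<and> 0 \<le> m2 \<and> 0 \<le> m3 \<and>
    sum a V = m1 + m2 + m3 \<and> (\<Sum>v\<in>V. a v *\<^sub>R v) = m1 *\<^sub>R a1 + m2 *\<^sub>R a2 + m3 *\<^sub>R a3 \<and> 1 \<le> a x)"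
proof
  assume "x \<in> minface V {a1, a2, a3}"
  then obtain a b where x: "x \<in> V" and a: "\<forall>v\<in>V. 0 \<le> a v" and b: "\<forall>v\<in>V. 0 \<le> b v" "\<forall>v\<in>V - {a1, a2, a3}. b v = 0"
     and eq: "sum a V = sum b V" "(\<Sum>v\<in>V. a v *\<^sub>R v) = (\<Sum>v\<in>V. b v *\<^sub>R v)" and ax: "0 < a x" unfolding minface_def by blast
  define m1 where "m1 = b a1"
  define m2 where "m2 = (if a2 = a1 then 0 else b a2)"
  define m3 where "m3 = (if a3 = a1 \<or> a3 = a2 then 0 else b a3)"
  have s1: "sum b V = m1 + m2 + m3"
    using b(2) by (subst sum.mono_neutral_right[OF V, of "{a1, a2, a3}"]) (use T in \<open>auto simp: m1_def m2_def m3_def insert_commute\<close>)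
  have s2: "(\<Sum>v\<in>V. b v *\<^sub>R v) = m1 *\<^sub>R a1 + m2 *\<^sub>R a2 + m3 *\<^sub>R a3"
    using b(2) by (subst sum.mono_neutral_right[OF V, of "{a1, a2, a3}"]) (use T in \<open>auto simp: m1_def m2_def m3_def insert_commute\<close>)
  define k where "k = 1 / a x"
  have k: "k > 0" using ax by (simp add: k_def)
  show "x \<in> V \<and> (\<exists>a m1 m2 m3. (\<forall>v\<in>V. 0 \<le> a v) \<and> 0 \<le> m1 \<and> 0 \<le> m2 \<and> 0 \<le> m3 \<and>
    sum a V = m1 + m2 + m3 \<and> (\<Sum>v\<in>V. a v *\<^sub>R v) = m1 *\<^sub>R a1 + m2 *\<^sub>R a2 + m3 *\<^sub>R a3 \<and> 1 \<le> a x)"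
  proof (intro conjI exI)
    show "x \<in> V" by (rule x)
    show "\<forall>v\<in>V. 0 \<le> k * a v" using a k by auto
    show "0 \<le> k * m1" "0 \<le> k * m2" "0 \<le> k * m3" using b T k by (auto simp: m1_def m2_def m3_def)
    show "(\<Sum>v\<in>V. k * a v) = k * m1 + k * m2 + k * m3"
      using s1 eq by (simp add: distrib_left flip: sum_distrib_left)
    have "(\<Sum>v\<in>V. (k * a v) *\<^sub>R v) = k *\<^sub>R (\<Sum>v\<in>V. a v *\<^sub>R v)" by (simp add: scaleR_sum_right)
    then show "(\<Sum>v\<in>V. (k * a v) *\<^sub>R v) = (k * m1) *\<^sub>R a1 + (k * m2) *\<^sub>R a2 + (k * m3) *\<^sub>R a3"
      using s2 eq by (simp add: scaleR_add_right)
    show "1 \<le> k * a x" using ax by (simp add: k_def)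
  qed
next
  assume *: "x \<in> V \<and> (\<exists>a m1 m2 m3. (\<forall>v\<in>V. 0 \<le> a v) \<and> 0 \<le> m1 \<and> 0 \<le> m2 \<and> 0 \<le> m3 \<and>
    sum a V = m1 + m2 + m3 \<and> (\<Sum>v\<in>V. a v *\<^sub>R v) = m1 *\<^sub>R a1 + m2 *\<^sub>R a2 + m3 *\<^sub>R a3 \<and> 1 \<le> a x)"
  then obtain a m1 m2 m3 where a: "\<forall>v\<in>V. 0 \<le> a v" "0 \<le> m1" "0 \<le> m2" "0 \<le> m3"
    "sum a V = m1 + m2 + m3" "(\<Sum>v\<in>V. a v *\<^sub>R v) = m1 *\<^sub>R a1 + m2 *\<^sub>R a2 + m3 *\<^sub>R a3" "1 \<le> a x" by blast
  let ?b = "\<lambda>v. (if v = a1 then m1 else 0) + (if v = a2 then m2 else 0) + (if v = a3 then m3 else 0)"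
  show "x \<in> minface V {a1, a2, a3}"
  proof (rule minfaceI[of x V a ?b])
    show "sum a V = sum ?b V" using a V T by (simp add: sum.distrib)
    show "(\<Sum>v\<in>V. a v *\<^sub>R v) = (\<Sum>v\<in>V. ?b v *\<^sub>R v)"
      using a V T by (simp add: scaleR_add_left sum.distrib if_distrib[of "\<lambda>r. r *\<^sub>R _"] cong: if_cong)
  qed (use * a in auto)
qed

lemma lookup_scaleR: "Poly_Mapping.lookup (r *\<^sub>R w) l = r * Poly_Mapping.lookup w l" for w :: point
proof -
  have "finite {i. r * Poly_Mapping.lookup w i \<noteq> 0}"
    by (rule finite_subset[OF _ finite_keys[of w]]) (auto simp: in_keys_iff)
  then show ?thesis by (simp add: scaleR_poly_mapping_def Abs_poly_mapping_inverse)
qed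

lemma lookup_sum_scaleR: "Poly_Mapping.lookup (\<Sum>v\<in>V. a v *\<^sub>R v) l = (\<Sum>v\<in>V. a v * Poly_Mapping.lookup v l)"
  for V :: "point set"
  by (induction V rule: infinite_finite_induct) (simp_all add: lookup_add lookup_scaleR)

section \<open>A fixed instance: lists of numbers against points and faces\<close>

locale adapt_instance =
  fixes D :: adapt_input and slv :: "val \<Rightarrow> val" and good :: "val \<Rightarrow> bool" and M :: nat
  assumes ok: "adapt_input_ok D"
begin

definition pts :: "point list" where "pts = u_verts D"
definition V :: "point set" where "V = set pts"
definition dim :: nat where "dim = (if pts = [] then 0 else u_dim D)"
definition pt :: "point \<Rightarrow> real list" where "pt w = list_of_vec (coords (u_dim D) w)"
definition mat_list :: "real mat \<Rightarrow> real list list" where "mat_list X = map list_of_vec (Matrix.rows X)"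
definition bools :: "nat \<Rightarrow> nat set \<Rightarrow> real list" where "bools k I = map (\<lambda>i. of_bool (i \<in> I)) [0..<k]"

abbreviation "nx \<equiv> dim_vec (c_vec D)"
abbreviation "ny \<equiv> dim_vec (d_vec D)"
abbreviation "mrows \<equiv> dim_vec (b_const D)"

lemma length_pt [simp]: "length (pt w) = u_dim D"
  by (simp add: pt_def coords_def)

lemma nth_pt: "l < u_dim D \<Longrightarrow> pt w ! l = Poly_Mapping.lookup w l"
  by (simp add: pt_def coords_def)

lemma okD: "polytope (u_set D)" "\<And>w. w \<in> u_set D \<Longrightarrow> Poly_Mapping.keys w \<subseteq> {..<u_dim D}"
  "distinct pts" "V = vertices (u_set D)" "A_mat D \<in> carrier_mat mrows nx" "B_mat D \<in> carrier_mat mrows ny"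
  "b_lin D \<in> carrier_mat mrows (u_dim D)" "x_ints D \<subseteq> {..<nx}" "y_ints D \<subseteq> {..<ny}"
  using ok by (auto simp: adapt_input_ok_def pts_def V_def)

lemma mat_list_props:
  assumes "X \<in> carrier_mat k l"
  shows "length (mat_list X) = k" "r \<in> set (mat_list X) \<Longrightarrow> length r = l" "i < k \<Longrightarrow> mat_list X ! i = list_of_vec (Matrix.row X i)"
  using assms by (auto simp: mat_list_def Matrix.rows_def)

sublocale adapt_machine "map pt pts" "mat_list (A_mat D)" "mat_list (B_mat D)" "mat_list (b_lin D)" "list_of_vec (b_const D)"
  "list_of_vec (c_vec D)" "list_of_vec (d_vec D)" "bools nx (x_ints D)" "bools ny (y_ints D)" dim slv good M
proof unfold_locales
  show "set (bools nx (x_ints D)) \<subseteq> {0, 1}" "set (bools ny (y_ints D)) \<subseteq> {0, 1}" by (auto simp: bools_def)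
qed (use mat_list_props[OF okD(5)] mat_list_props[OF okD(6)] mat_list_props[OF okD(7)] in \<open>auto simp: dim_def bools_def\<close>)

lemma input_env_eq: "input_env = enc_adapt_input D"
proof -
  have v: "enc_vec = (\<lambda>z. encl Num (list_of_vec z))" by (rule ext) (simp add: enc_vec_def encl_def)
  have m: "enc_mat X = encl (encl Num) (mat_list X)" for X by (simp add: enc_mat_def mat_list_def encl_def v comp_def)
  have i: "enc_ints k I = encl Num (bools k I)" for k I by (simp add: enc_ints_def bools_def encl_def comp_def)
  have p: "enc_list (map (\<lambda>v. enc_vec (coords (u_dim D) v)) (u_verts D)) = encl (encl Num) (map pt pts)"
    by (simp add: encl_def pts_def pt_def v comp_def)
  show ?thesis unfolding input_env_def enc_adapt_input_def p m i by (simp add: v)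
qed

lemma finite_V: "finite V" by (simp add: V_def)

lemma hull_V: "u_set D = convex hull V"
proof -
  obtain S where "finite S" "u_set D = convex hull S" using okD(1) by (auto simp: polytope_def)
  then show ?thesis using convex_hull_vertices[of S] okD(4) by (simp add: vertices_def)
qed

lemma V_extreme: "v \<in> V \<Longrightarrow> v extreme_point_of (convex hull V)"
  unfolding hull_V[symmetric] using okD(4) by (metis mem_Collect_eq vertices_def)

lemma V_single: "v \<in> V \<Longrightarrow> cface V {v}"
  by (rule cface_singleton_if_extreme[OF finite_V _ V_extreme])

lemma keys_V: "v \<in> V \<Longrightarrow> \<not> l < u_dim D \<Longrightarrow> Poly_Mapping.lookup v l = 0"
proof -
  assume v: "v \<in> V" and l: "\<not> l < u_dim D"
  have "v \<in> u_set D" unfolding hull_V by (rule hull_inc[OF v])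
  from okD(2)[OF this] l have "l \<notin> Poly_Mapping.keys v" by blast
  then show ?thesis by (simp add: in_keys_iff)
qed

lemma sum_V: "(\<Sum>v\<in>V. h v) = (\<Sum>i<length pts. h (pts ! i))" for h :: "point \<Rightarrow> 'c::comm_monoid_add"
  unfolding V_def using sum.reindex_bij_betw[OF bij_betw_nth[OF okD(3) refl refl], of h] by (simp add: lessThan_atLeast0)

lemma pts_V: "i < length pts \<Longrightarrow> pts ! i \<in> V"
  by (simp add: V_def)

text \<open>Linear programs index weights by positions, faces by points; as \<open>pts\<close> is
  distinct, the position of a vertex is unique.\<close>

definition weight :: "real list \<Rightarrow> point \<Rightarrow> real" where
  "weight z p = z ! (SOME i. i < length pts \<and> pts ! i = p)"

lemma weight_nth: "i < length pts \<Longrightarrow> weight z (pts ! i) = z ! i"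
proof -
  assume i: "i < length pts"
  have "(SOME j. j < length pts \<and> pts ! j = pts ! i) = i"
    by (rule some_equality) (use i okD(3) nth_eq_iff_index_eq in auto)
  then show ?thesis by (simp add: weight_def)
qed

definition flags :: "point set \<Rightarrow> real list" where
  "flags W = map (\<lambda>p. if p \<in> W then 1 else 0) pts"

text \<open>Row 0 of the system compares the total weights and row \<open>Suc l\<close> the
  coordinate \<open>l\<close>. Coordinates beyond \<open>u_dim D\<close> vanish at all vertices, so
  agreement in the listed coordinates is equality of points.\<close>

lemma face_lp_feasible:
  assumes T: "a1 \<in> V" "a2 \<in> V" "a3 \<in> V" and i: "i < length pts"
  shows "lp_set (length pts + 3) (face_rows (dim + 1) (face_gens (map pt pts) [pt a1, pt a2, pt a3]) (unit_rows (length pts) ! i))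
      (replicate (length pts + 3) 0) \<noteq> {} \<longleftrightarrow> pts ! i \<in> minface V {a1, a2, a3}"
proof -
  define G where "G = face_gens (map pt pts) [pt a1, pt a2, pt a3]"
  have dim: "dim = u_dim D" using i by (auto simp: dim_def)
  have lG: "length G = length pts + 3" by (simp add: G_def face_gens_def)
  have G1: "G ! v = 1 # pt (pts ! v)" if "v < length pts" for v
    using that by (simp add: G_def face_gens_def nth_append)
  have G2: "G ! (length pts) = map uminus (1 # pt a1)" "G ! (Suc (length pts)) = map uminus (1 # pt a2)"
      "G ! (Suc (Suc (length pts))) = map uminus (1 # pt a3)"
    by (simp_all add: G_def face_gens_def nth_append)
  have ls: "{..<length pts + 3} = insert (Suc (Suc (length pts))) (insert (Suc (length pts)) (insert (length pts) {..<length pts}))" by auto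
  have S: "(\<Sum>v<length G. z ! v * G ! v ! l) = (\<Sum>v<length pts. z ! v * (1 # pt (pts ! v)) ! l)
      + z ! length pts * (map uminus (1 # pt a1)) ! l + z ! Suc (length pts) * (map uminus (1 # pt a2)) ! l + z ! Suc (Suc (length pts)) * (map uminus (1 # pt a3)) ! l" for z l
    unfolding lG ls by (simp add: G1 G2)
  have key: "(\<forall>l<dim + 1. (\<Sum>v<length G. z ! v * G ! v ! l) = 0) \<longleftrightarrow>
      (\<Sum>v<length pts. z ! v) = z ! length pts + z ! Suc (length pts) + z ! Suc (Suc (length pts)) \<and>
      (\<Sum>v\<in>V. weight z v *\<^sub>R v) = z ! length pts *\<^sub>R a1 + z ! Suc (length pts) *\<^sub>R a2 + z ! Suc (Suc (length pts)) *\<^sub>R a3" for z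
  proof -
    let ?m1 = "z ! length pts" and ?m2 = "z ! Suc (length pts)" and ?m3 = "z ! Suc (Suc (length pts))"
    have "(\<forall>l<dim + 1. (\<Sum>v<length G. z ! v * G ! v ! l) = 0) \<longleftrightarrow>
        (\<Sum>v<length G. z ! v * G ! v ! 0) = 0 \<and> (\<forall>l<u_dim D. (\<Sum>v<length G. z ! v * G ! v ! Suc l) = 0)"
      unfolding dim by (auto simp: less_Suc_eq_0_disj)
    also have "(\<Sum>v<length G. z ! v * G ! v ! 0) = 0 \<longleftrightarrow> (\<Sum>v<length pts. z ! v) = ?m1 + ?m2 + ?m3"
      unfolding S by (simp add: algebra_simps eq_diff_eq)
    also have "(\<forall>l<u_dim D. (\<Sum>v<length G. z ! v * G ! v ! Suc l) = 0) \<longleftrightarrow>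
        (\<forall>l<u_dim D. (\<Sum>v<length pts. z ! v * Poly_Mapping.lookup (pts ! v) l) =
          ?m1 * Poly_Mapping.lookup a1 l + ?m2 * Poly_Mapping.lookup a2 l + ?m3 * Poly_Mapping.lookup a3 l)"
      unfolding S by (intro all_cong1 imp_cong refl) (auto simp: nth_pt)
    also have "\<dots> \<longleftrightarrow> (\<Sum>v\<in>V. weight z v *\<^sub>R v) = ?m1 *\<^sub>R a1 + ?m2 *\<^sub>R a2 + ?m3 *\<^sub>R a3"
    proof -
      have L: "Poly_Mapping.lookup (\<Sum>v\<in>V. weight z v *\<^sub>R v) l = (\<Sum>v<length pts. z ! v * Poly_Mapping.lookup (pts ! v) l)" for l
        unfolding lookup_sum_scaleR by (subst sum_V) (simp add: weight_nth)
      have R: "Poly_Mapping.lookup (?m1 *\<^sub>R a1 + ?m2 *\<^sub>R a2 + ?m3 *\<^sub>R a3) l =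
          ?m1 * Poly_Mapping.lookup a1 l + ?m2 * Poly_Mapping.lookup a2 l + ?m3 * Poly_Mapping.lookup a3 l" for l
        by (simp add: lookup_add lookup_scaleR)
      have out: "(\<Sum>v<length pts. z ! v * Poly_Mapping.lookup (pts ! v) l) =
          ?m1 * Poly_Mapping.lookup a1 l + ?m2 * Poly_Mapping.lookup a2 l + ?m3 * Poly_Mapping.lookup a3 l" if "\<not> l < u_dim D" for l
        using keys_V[OF _ that] T pts_V by simp
      show ?thesis unfolding poly_mapping_eq_iff fun_eq_iff L R using out by blast
    qed
    finally show ?thesis .
  qed
  show ?thesis
  proof
    assume "lp_set (length pts + 3) (face_rows (dim + 1) (face_gens (map pt pts) [pt a1, pt a2, pt a3]) (unit_rows (length pts) ! i))
      (replicate (length pts + 3) 0) \<noteq> {}"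
    then obtain z where z: "length z = length pts + 3" "sat (face_rows (dim + 1) G (unit_rows (length pts) ! i)) z"
      unfolding lp_set_def G_def by blast
    have z': "length z = length G" using z lG by simp
    have *: "(\<forall>l<dim + 1. (\<Sum>v<length G. z ! v * G ! v ! l) = 0)" "\<forall>v<length G. 0 \<le> z ! v" "1 \<le> z ! i"
      using z(2) sat_face_rows[OF z' i lG] by auto
    show "pts ! i \<in> minface V {a1, a2, a3}"
      unfolding minface_triple[OF finite_V T]
    proof (intro conjI exI)
      show "pts ! i \<in> V" by (rule pts_V[OF i])
      show "\<forall>v\<in>V. 0 \<le> weight z v"
        unfolding V_def all_set_conv_all_nth using *(2) lG weight_nth by simp
      show "0 \<le> z ! length pts" "0 \<le> z ! Suc (length pts)" "0 \<le> z ! Suc (Suc (length pts))" using *(2) lG by auto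
      show "sum (weight z) V = z ! length pts + z ! Suc (length pts) + z ! Suc (Suc (length pts))"
        unfolding sum_V using *(1) key[of z] by (simp add: weight_nth)
      show "(\<Sum>v\<in>V. weight z v *\<^sub>R v) = z ! length pts *\<^sub>R a1 + z ! Suc (length pts) *\<^sub>R a2 + z ! Suc (Suc (length pts)) *\<^sub>R a3"
        using *(1) key[of z] by blast
      show "1 \<le> weight z (pts ! i)" using *(3) weight_nth[OF i] by simp
    qed
  next
    assume "pts ! i \<in> minface V {a1, a2, a3}"
    then obtain a m1 m2 m3 where a: "\<forall>v\<in>V. 0 \<le> a v" "0 \<le> m1" "0 \<le> m2" "0 \<le> m3"
      "sum a V = m1 + m2 + m3" "(\<Sum>v\<in>V. a v *\<^sub>R v) = m1 *\<^sub>R a1 + m2 *\<^sub>R a2 + m3 *\<^sub>R a3" "1 \<le> a (pts ! i)"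
      unfolding minface_triple[OF finite_V T] by blast
    define z where "z = map a pts @ [m1, m2, m3]"
    have z': "length z = length G" by (simp add: z_def lG)
    have zn: "z ! v = a (pts ! v)" if "v < length pts" for v using that by (simp add: z_def nth_append)
    have zm: "z ! length pts = m1" "z ! Suc (length pts) = m2" "z ! Suc (Suc (length pts)) = m3" by (simp_all add: z_def nth_append)
    have "(\<Sum>v\<in>V. weight z v *\<^sub>R v) = (\<Sum>v\<in>V. a v *\<^sub>R v)" unfolding sum_V by (simp add: weight_nth zn)
    moreover have "(\<Sum>v<length pts. z ! v) = sum a V" unfolding sum_V by (simp add: zn)
    ultimately have "\<forall>l<dim + 1. (\<Sum>v<length G. z ! v * G ! v ! l) = 0" unfolding key zm using a by simp
    moreover have "\<forall>v<length G. 0 \<le> z ! v"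
    proof (intro allI impI)
      fix v assume "v < length G"
      then consider "v < length pts" | "v = length pts" | "v = Suc (length pts)" | "v = Suc (Suc (length pts))" using lG by linarith
      then show "0 \<le> z ! v" using a zn zm pts_V by cases auto
    qed
    moreover have "1 \<le> z ! i" using a zn[OF i] by simp
    ultimately have "sat (face_rows (dim + 1) G (unit_rows (length pts) ! i)) z" using sat_face_rows[OF z' i lG] by blast
    then have "z \<in> lp_set (length pts + 3) (face_rows (dim + 1) G (unit_rows (length pts) ! i)) (replicate (length pts + 3) 0)"
      using z' lG by (simp add: lp_set_def)
    then show "lp_set (length pts + 3) (face_rows (dim + 1) (face_gens (map pt pts) [pt a1, pt a2, pt a3]) (unit_rows (length pts) ! i))
      (replicate (length pts + 3) 0) \<noteq> {}" unfolding G_def by blast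
  qed
qed

lemma face_flags_eq:
  assumes "a1 \<in> V" "a2 \<in> V" "a3 \<in> V"
  shows "face_flags [pt a1, pt a2, pt a3] = flags (minface V {a1, a2, a3})"
proof (rule nth_equalityI)
  fix i assume "i < length (face_flags [pt a1, pt a2, pt a3])"
  then have i: "i < length pts" by simp
  then show "face_flags [pt a1, pt a2, pt a3] ! i = flags (minface V {a1, a2, a3}) ! i"
    using face_lp_feasible[OF assms i] by (auto simp: face_flags_def flags_def)
qed (simp add: flags_def)

lemma length_flags [simp]: "length (flags W) = length pts"
  by (simp add: flags_def)

lemma flags_nth: "i < length pts \<Longrightarrow> flags W ! i = (if pts ! i \<in> W then 1 else 0)"
  by (simp add: flags_def)

lemma dot_flags: "dot (flags W) (map h pts) = (\<Sum>p\<in>W \<inter> V. h p)"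
proof -
  have "dot (flags W) (map h pts) = (\<Sum>i<length pts. (if pts ! i \<in> W then h (pts ! i) else 0))"
    by (simp add: dot_sum flags_nth if_distrib[of "\<lambda>r. r * _"] cong: if_cong)
  also have "\<dots> = (\<Sum>p\<in>V. if p \<in> W then h p else 0)" by (subst sum_V) simp
  also have "\<dots> = (\<Sum>p\<in>W \<inter> V. h p)" by (simp add: sum.inter_restrict[OF finite_V, of h W, symmetric] Int_commute)
  finally show ?thesis .
qed

lemma dot_flags_flags: "dot (flags W) (flags W) = card (W \<inter> V)"
  using dot_flags[of W "\<lambda>p. if p \<in> W then 1 else 0"] by (simp add: flags_def)

definition edge_list :: "point set list" where
  "edge_list = filter (cface V) (map (\<lambda>(a, b). {a, b}) (pairs pts))"

text \<open>The fold of \<open>edges_prog\<close> pushes the edges that it finds in front, whence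
  the reversed order.\<close>

definition face_list :: "point set list" where
  "face_list = map (\<lambda>p. {p}) pts @ rev edge_list"

text \<open>Each two-element set is produced exactly once; otherwise an edge would be labelled
  repeatedly and the exponent could exceed the number of vertices and edges.\<close>

lemma pair_sets: "distinct ps \<Longrightarrow> distinct (map (\<lambda>(a, b). {a, b}) (pairs ps)) \<and>
  set (map (\<lambda>(a, b). {a, b}) (pairs ps)) = {{a, b} |a b. a \<in> set ps \<and> b \<in> set ps \<and> a \<noteq> b}"
proof (induction ps rule: rev_induct)
  case Nil then show ?case by (simp add: pairs_def)
next
  case (snoc b ps)
  then have IH: "distinct (map (\<lambda>(a, b). {a, b}) (pairs ps))"
    "set (map (\<lambda>(a, b). {a, b}) (pairs ps)) = {{a, b} |a b. a \<in> set ps \<and> b \<in> set ps \<and> a \<noteq> b}"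
    and b: "b \<notin> set ps" and ps: "distinct ps" by auto
  have e: "map (\<lambda>(a, b). {a, b}) (pairs (ps @ [b])) = map (\<lambda>a. {a, b}) (rev ps) @ map (\<lambda>(a, b). {a, b}) (pairs ps)"
    by (simp add: pairs_snoc comp_def)
  have inj: "inj_on (\<lambda>a. {a, b}) (set (rev ps))" using b by (auto simp: inj_on_def doubleton_eq_iff)
  have "distinct (map (\<lambda>a. {a, b}) (rev ps))" using inj ps by (simp add: distinct_map)
  moreover have "set (map (\<lambda>a. {a, b}) (rev ps)) \<inter> set (map (\<lambda>(a, b). {a, b}) (pairs ps)) = {}"
    unfolding IH(2) using b by (auto simp: doubleton_eq_iff)
  moreover have "set (map (\<lambda>a. {a, b}) (rev ps)) \<union> set (map (\<lambda>(a, b). {a, b}) (pairs ps)) =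
      {{a, c} |a c. a \<in> set (ps @ [b]) \<and> c \<in> set (ps @ [b]) \<and> a \<noteq> c}"
    unfolding IH(2) using b by (auto simp: insert_commute)
  ultimately show ?case unfolding e using IH(1) by (simp only: distinct_append set_append)
qed

lemma pairs_map: "pairs (map f ps) = map (\<lambda>(a, b). (f a, f b)) (pairs ps)"
proof (induction ps rule: rev_induct)
  case (snoc b ps)
  then show ?case by (simp add: pairs_snoc rev_map comp_def)
qed (simp add: pairs_def)

text \<open>The smallest face around a pair contains the pair, so it has at most two members only if
  it equals the pair. This justifies the counting test of \<open>edges_prog\<close>.\<close>

lemma minface_pair:
  assumes "a \<in> V" "b \<in> V" "a \<noteq> b"
  shows "card (minface V {a, b}) \<le> 2 \<longleftrightarrow> cface V {a, b}" "cface V {a, b} \<Longrightarrow> minface V {a, b} = {a, b}"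
proof -
  have sub: "{a, b} \<subseteq> minface V {a, b}" by (rule subset_minface[OF finite_V]) (use assms in auto)
  have fin: "finite (minface V {a, b})" by (rule finite_subset[OF _ finite_V]) (auto simp: minface_def)
  show *: "cface V {a, b} \<Longrightarrow> minface V {a, b} = {a, b}"
    using minface_subset_cface[of V "{a, b}" "{a, b}"] sub by auto
  show "card (minface V {a, b}) \<le> 2 \<longleftrightarrow> cface V {a, b}"
  proof
    assume "card (minface V {a, b}) \<le> 2"
    then have "minface V {a, b} = {a, b}" using card_seteq[OF fin sub] assms by simp
    then show "cface V {a, b}" using cface_minface[OF finite_V, of "{a, b}"] by simp
  next
    assume "cface V {a, b}" then show "card (minface V {a, b}) \<le> 2" using * assms by simp
  qed
qed

lemma minface_single: "v \<in> V \<Longrightarrow> minface V {v} = {v}"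
  using minface_subset_cface[OF V_single, of v "{v}"] subset_minface[OF finite_V, of "{v}"] by auto

lemma items_eq: "items = map flags face_list"
proof -
  have v: "vertex_items = map flags (map (\<lambda>p. {p}) pts)"
    unfolding vertex_items_def using face_flags_eq minface_single by (auto simp: V_def)
  have pp: "\<And>a b. (a, b) \<in> set (pairs pts) \<Longrightarrow> a \<in> V \<and> b \<in> V \<and> a \<noteq> b"
  proof -
    fix a b assume ab: "(a, b) \<in> set (pairs pts)"
    then have "{a, b} \<in> set (map (\<lambda>(a, b). {a, b}) (pairs pts))" by force
    then have "\<exists>c d. {a, b} = {c, d} \<and> c \<noteq> d" using pair_sets[OF okD(3)] by blast
    then show "a \<in> V \<and> b \<in> V \<and> a \<noteq> b" using set_pairs[of pts] ab by (auto simp: V_def doubleton_eq_iff)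
  qed
  have "foldl (\<lambda>acc p. let F = face_flags [fst p, snd p, snd p] in if 0 < dot F F - 2 then acc else F # acc) [] (map (\<lambda>(a, b). (pt a, pt b)) ps) =
      map flags (rev (filter (cface V) (map (\<lambda>(a, b). {a, b}) ps)))" if "set ps \<subseteq> set (pairs pts)" for ps
    using that
  proof (induction ps rule: rev_induct)
    case (snoc p ps)
    obtain a b where p: "p = (a, b)" by (cases p)
    then have ab: "a \<in> V" "b \<in> V" "a \<noteq> b" using pp snoc.prems by auto
    have F: "face_flags [pt a, pt b, pt b] = flags (minface V {a, b})" using face_flags_eq[OF ab(1,2,2)] by simp
    have "minface V {a, b} \<inter> V = minface V {a, b}" by (auto simp: minface_def)
    then have "dot (flags (minface V {a, b})) (flags (minface V {a, b})) - 2 \<le> 0 \<longleftrightarrow> cface V {a, b}"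
      using minface_pair(1)[OF ab] by (simp add: dot_flags_flags)
    then show ?case using snoc F minface_pair(2)[OF ab] p by (auto simp: Let_def)
  qed simp
  from this[of "pairs pts"] have "edge_items = map flags (rev edge_list)"
    unfolding edge_items_def edge_list_def pairs_map by simp
  then show ?thesis unfolding items_def v face_list_def by simp
qed

lemma set_face_list: "set face_list = {E. \<exists>u\<in>V. \<exists>v\<in>V. E = {u, v} \<and> cface V {u, v}}"
proof -
  have 1: "set edge_list = {E. \<exists>u\<in>V. \<exists>v\<in>V. u \<noteq> v \<and> E = {u, v} \<and> cface V {u, v}}"
    unfolding edge_list_def using pair_sets[OF okD(3)] by (auto simp: V_def)
  have 2: "set (map (\<lambda>p. {p}) pts) = {E. \<exists>u\<in>V. E = {u, u} \<and> cface V {u, u}}"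
    using V_single by (auto simp: V_def)
  have 3: "(\<exists>u\<in>V. P u u) \<or> (\<exists>u\<in>V. \<exists>v\<in>V. u \<noteq> v \<and> P u v) \<longleftrightarrow> (\<exists>u\<in>V. \<exists>v\<in>V. P u v)" for P :: "point \<Rightarrow> point \<Rightarrow> bool"
    by metis
  have "E \<in> set face_list \<longleftrightarrow> (\<exists>u\<in>V. \<exists>v\<in>V. E = {u, v} \<and> cface V {u, v})" for E
    unfolding face_list_def set_append set_rev 1 2 Un_iff mem_Collect_eq by (rule 3)
  then show ?thesis by blast
qed

lemma distinct_face_list: "distinct face_list"
proof -
  have 1: "distinct (map (\<lambda>p. {p}) pts)" using okD(3) by (auto simp: distinct_map inj_on_def)
  have 2: "distinct edge_list" unfolding edge_list_def using pair_sets[OF okD(3)] by simp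
  have "{p} \<notin> set edge_list" for p
  proof
    assume "{p} \<in> set edge_list"
    then have "{p} \<in> set (map (\<lambda>(a, b). {a, b}) (pairs pts))" unfolding edge_list_def by auto
    then have "\<exists>a b. {p} = {a, b} \<and> a \<noteq> b" using pair_sets[OF okD(3)] by blast
    then show False by (auto simp: doubleton_eq_iff)
  qed
  then show ?thesis using 1 2 unfolding face_list_def by auto
qed

lemma length_items: "length items \<le> card (vertices (u_set D)) + card (edges (u_set D))"
proof -
  have v: "length pts = card (vertices (u_set D))" using okD(3,4) by (simp add: V_def distinct_card[symmetric])
  have "length edge_list = card (set edge_list)"
    using distinct_face_list by (simp add: face_list_def distinct_card)
  also have "\<dots> \<le> card {E. card E = 2 \<and> cface V E}"
  proof (rule card_mono)
    have "{E. card E = 2 \<and> cface V E} \<subseteq> Pow V" by (auto simp: cface_def)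
    then show "finite {E. card E = 2 \<and> cface V E}" using finite_V finite_subset by blast
    show "set edge_list \<subseteq> {E. card E = 2 \<and> cface V E}"
      unfolding edge_list_def using pair_sets[OF okD(3)] by auto
  qed
  also have "\<dots> \<le> card (edges (u_set D))" unfolding hull_V by (rule card_pair_faces_le_edges[OF finite_V V_extreme])
  finally show ?thesis using v by (simp add: items_eq face_list_def)
qed

section \<open>Guesses as labellings and requirements as incidences\<close>

definition lab :: "nat \<Rightarrow> real list" where
  "lab i = [of_bool (i = 1), of_bool (i = 2), of_bool (i = 3)]"

definition guess_of :: "(point set \<Rightarrow> nat) \<Rightarrow> (real list \<times> real list) list" where
  "guess_of l = map (\<lambda>E. (flags E, lab (l E))) face_list"

text \<open>Labels are chosen for positions; since \<open>face_list\<close> has no repetitions, they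
  define a function of the set, which gets the value 1 on all other sets.\<close>

lemma guesses_eq: "set (guesses items) = {guess_of l |l. \<forall>E. l E \<in> {1, 2, 3}}"
proof
  have lab: "lab 1 = [1, 0, 0]" "lab 2 = [0, 1, 0]" "lab 3 = [0, 0, 1]" by (simp_all add: lab_def)
  show "set (guesses items) \<subseteq> {guess_of l |l. \<forall>E. l E \<in> {1, 2, 3}}"
  proof
    fix g assume "g \<in> set (guesses items)"
    then obtain ls where g: "g = zip items ls" "length ls = length items" "set ls \<subseteq> {[1, 0, 0], [0, 1, 0], [0, 0, 1]}"
      unfolding set_guesses by blast
    have len: "length ls = length face_list" using g(2) items_eq by simp
    have "\<exists>l. l \<in> {1, 2, 3} \<and> (\<forall>k<length face_list. face_list ! k = E \<longrightarrow> ls ! k = lab l)" for E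
    proof (cases "E \<in> set face_list")
      case True
      then obtain k where k: "k < length face_list" "face_list ! k = E" by (auto simp: in_set_conv_nth)
      have "ls ! k \<in> {[1, 0, 0], [0, 1, 0], [0, 0, 1]}" using g(3) nth_mem[of k ls] len k(1) by (metis subsetD)
      then have "\<exists>l\<in>{1, 2, 3}. ls ! k = lab l" using lab by auto
      then obtain l where "l \<in> {1, 2, 3}" "ls ! k = lab l" by blast
      moreover have "k' = k" if "k' < length face_list" "face_list ! k' = E" for k'
        using distinct_face_list k that nth_eq_iff_index_eq by blast
      ultimately show ?thesis by blast
    next
      case False then show ?thesis by (intro exI[of _ 1]) auto
    qed
    then obtain l where l: "\<And>E. l E \<in> {1, 2, 3}" "\<And>E k. k < length face_list \<Longrightarrow> face_list ! k = E \<Longrightarrow> ls ! k = lab (l E)" by metis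
    have "g = guess_of l" unfolding g(1) guess_of_def items_eq
      by (rule nth_equalityI) (use len l(2) in auto)
    then show "g \<in> {guess_of l |l. \<forall>E. l E \<in> {1, 2, 3}}" using l(1) by blast
  qed
  show "{guess_of l |l. \<forall>E. l E \<in> {1, 2, 3}} \<subseteq> set (guesses items)"
  proof
    fix g assume "g \<in> {guess_of l |l. \<forall>E. l E \<in> {1, 2, 3}}"
    then obtain l where l: "\<forall>E. l E \<in> {1, 2, 3}" "g = guess_of l" by blast
    have "g = zip items (map (\<lambda>E. lab (l E)) face_list)"
      unfolding l(2) guess_of_def items_eq by (rule nth_equalityI) auto
    moreover have "lab (l E) \<in> {[1, 0, 0], [0, 1, 0], [0, 0, 1]}" for E
      using l(1)[rule_format, of E] lab by auto
    ultimately show "g \<in> set (guesses items)" unfolding set_guesses items_eq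
      by (intro CollectI exI[of _ "map (\<lambda>E. lab (l E)) face_list"]) auto
  qed
qed

lemma reqs_guess: "set (reqs_of (guess_of l)) = {(flags E, map2 (\<lambda>x y. x + flags E ! w * y) (lab (l E)) (lab (l {pts ! w}))) |E w.
    E \<in> set face_list \<and> w < length pts}"
proof -
  have nth: "guess_of l ! w = (flags {pts ! w}, lab (l {pts ! w}))" if "w < length pts" for w
    using that by (simp add: guess_of_def face_list_def nth_append)
  have lg: "length pts \<le> length (guess_of l)" by (simp add: guess_of_def face_list_def)
  have z: "set (zip (flags E) (guess_of l)) = (\<lambda>w. (flags E ! w, (flags {pts ! w}, lab (l {pts ! w})))) ` {..<length pts}" for E
    using lg nth by (auto simp: set_zip image_iff)
  have "set (reqs_of (guess_of l)) = (\<Union>q\<in>set (guess_of l). (\<lambda>(w, it). (fst q, map2 (\<lambda>x y. x + w * y) (snd q) (snd it))) ` set (zip (fst q) (guess_of l)))"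
    by (simp add: reqs_of_def)
  also have "\<dots> = (\<Union>E\<in>set face_list. (\<lambda>(w, it). (flags E, map2 (\<lambda>x y. x + w * y) (lab (l E)) (snd it))) ` set (zip (flags E) (guess_of l)))"
    by (simp add: guess_of_def)
  also have "\<dots> = (\<Union>E\<in>set face_list. (\<lambda>w. (flags E, map2 (\<lambda>x y. x + flags E ! w * y) (lab (l E)) (lab (l {pts ! w})))) ` {..<length pts})"
    unfolding z image_image prod.case snd_conv ..
  finally show ?thesis by blast
qed

lemma lab_nth:
  assumes "i \<in> {1, 2, 3}"
  shows "lab a ! (i - 1) = of_bool (a = i)"
proof -
  have "[p, q, r] ! (3 - 1) = r" "[p, q, r] ! (2 - 1) = q" for p q r :: real by simp_all
  then show ?thesis using assms by (auto simp only: lab_def insert_iff empty_iff) simp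
qed

lemma req_entry:
  assumes "i \<in> {1, 2, 3}" "w < length pts"
  shows "map2 (\<lambda>x y. x + flags E ! w * y) (lab a) (lab b) ! (i - 1) = of_bool (a = i) + (if pts ! w \<in> E then of_bool (b = i) else 0)"
proof -
  have "length (lab a) = 3" "length (lab b) = 3" "i - 1 < 3" using assms by (auto simp: lab_def)
  then show ?thesis using lab_nth[OF assms(1)] by (simp add: flags_nth[OF assms(2)])
qed

lemma req_entry_pos:
  assumes "i \<in> {1, 2, 3}" "w < length pts"
  shows "0 < map2 (\<lambda>x y. x + flags E ! w * y) (lab a) (lab b) ! (i - 1) \<longleftrightarrow> i = a \<or> (pts ! w \<in> E \<and> i = b)"
  unfolding req_entry[OF assms] by auto

text \<open>All entries are nonnegative, so the sum of products is positive exactly if one product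
  is, that is, if an item inside \<open>W\<close> together with one of its ends carries both
  labels.\<close>

lemma switch_sum_pos:
  assumes W: "W \<subseteq> V" and ij: "i \<in> {1, 2, 3}" "j \<in> {1, 2, 3}" "i \<noteq> j"
  shows "0 \<le> switch_sum (reqs_of (guess_of l)) (flags W) (i - 1) (j - 1)"
    "0 < switch_sum (reqs_of (guess_of l)) (flags W) (i - 1) (j - 1) \<longleftrightarrow> switches l V W i j"
proof -
  let ?rq = "reqs_of (guess_of l)"
  define cond where "cond q \<longleftrightarrow> 0 < dot (fst q) (map (\<lambda>w. 1 - w) (flags W))" for q :: "real list \<times> real list"
  define P where "P q = snd q ! (i - 1) * snd q ! (j - 1)" for q :: "real list \<times> real list"
  define h where "h q = (if cond q then 0 else P q)" for q
  have fs: "switch_sum rq (flags W) (i - 1) (j - 1) = sum_list (map h rq)" for rq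
  proof -
    have "foldl (\<lambda>s q. if cond q then s else s + P q) s rq = s + sum_list (map h rq)" for s
      by (induction rq arbitrary: s) (auto simp: h_def)
    from this[of 0] show ?thesis unfolding switch_sum_def cond_def P_def by simp
  qed
  have cW: "map (\<lambda>w. 1 - w) (flags W) = map (\<lambda>p. if p \<in> W then 0 else 1) pts" by (simp add: flags_def)
  have sub: "cond (flags E, I) \<longleftrightarrow> \<not> E \<subseteq> W" if "E \<subseteq> V" for E I
  proof -
    have "dot (flags E) (map (\<lambda>p. if p \<in> W then 0 else 1) pts) = (\<Sum>p\<in>E. if p \<in> W then 0 else 1)"
      using dot_flags[of E "\<lambda>p. if p \<in> W then 0 else 1"] that by (simp add: Int_absorb2)
    moreover have "0 < (\<Sum>p\<in>E. if p \<in> W then 0 else (1::real)) \<longleftrightarrow> \<not> E \<subseteq> W"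
    proof
      assume "0 < (\<Sum>p\<in>E. if p \<in> W then 0 else (1::real))"
      then show "\<not> E \<subseteq> W" using sum.neutral[of E "\<lambda>p. if p \<in> W then 0 else (1::real)"] by fastforce
    next
      assume "\<not> E \<subseteq> W"
      then obtain p where "p \<in> E" "p \<notin> W" by blast
      then show "0 < (\<Sum>p\<in>E. if p \<in> W then 0 else (1::real))"
        using finite_subset[OF that finite_V] by (intro sum_pos2[of _ p]) auto
    qed
    ultimately show ?thesis by (simp add: cond_def cW)
  qed
  have nn: "0 \<le> h q" if "q \<in> set ?rq" for q
  proof -
    obtain E w where q: "q = (flags E, map2 (\<lambda>x y. x + flags E ! w * y) (lab (l E)) (lab (l {pts ! w})))" "w < length pts"
      using \<open>q \<in> set ?rq\<close> unfolding reqs_guess by blast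
    show ?thesis unfolding h_def P_def q snd_conv using req_entry[OF ij(1) q(2)] req_entry[OF ij(2) q(2)] by auto
  qed
  show "0 \<le> switch_sum ?rq (flags W) (i - 1) (j - 1)" unfolding fs using nn by (intro sum_list_nonneg) auto
  have "0 < sum_list (map h ?rq) \<longleftrightarrow> (\<exists>q\<in>set ?rq. 0 < h q)"
  proof -
    have "(\<forall>q\<in>set rq. 0 \<le> h q) \<Longrightarrow> 0 < sum_list (map h rq) \<longleftrightarrow> (\<exists>q\<in>set rq. 0 < h q)" for rq
    proof (induction rq)
      case (Cons q rq)
      moreover have "0 \<le> sum_list (map h rq)" using Cons.prems by (intro sum_list_nonneg) auto
      ultimately show ?case by auto
    qed simp
    then show ?thesis using nn by blast
  qed
  also have "\<dots> \<longleftrightarrow> switches l V W i j"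
  proof
    assume "\<exists>q\<in>set ?rq. 0 < h q"
    then obtain E w where E: "E \<in> set face_list" "w < length pts"
      and h: "0 < h (flags E, map2 (\<lambda>x y. x + flags E ! w * y) (lab (l E)) (lab (l {pts ! w})))" unfolding reqs_guess by blast
    obtain u v where uv: "u \<in> V" "v \<in> V" "E = {u, v}" "cface V {u, v}" using E(1) unfolding set_face_list by blast
    have EW: "E \<subseteq> W" using h sub[of E] uv by (auto simp: h_def split: if_splits)
    have "i = l E \<or> (pts ! w \<in> E \<and> i = l {pts ! w})" "j = l E \<or> (pts ! w \<in> E \<and> j = l {pts ! w})"
    proof -
      define I where "I = map2 (\<lambda>x y. x + flags E ! w * y) (lab (l E)) (lab (l {pts ! w}))"
      have "0 < I ! (i - 1) * I ! (j - 1)" using h unfolding h_def P_def I_def by (simp split: if_splits)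
      moreover have "0 \<le> I ! (i - 1)" "0 \<le> I ! (j - 1)" unfolding I_def req_entry[OF ij(1) E(2)] req_entry[OF ij(2) E(2)] by auto
      ultimately have "0 < I ! (i - 1)" "0 < I ! (j - 1)" by (auto simp: zero_less_mult_iff)
      then show "i = l E \<or> (pts ! w \<in> E \<and> i = l {pts ! w})" "j = l E \<or> (pts ! w \<in> E \<and> j = l {pts ! w})"
        using req_entry_pos[OF ij(1) E(2)] req_entry_pos[OF ij(2) E(2)] unfolding I_def by blast+
    qed
    \<comment> \<open>As \<open>i \<noteq> j\<close>, the label of \<open>E\<close> accounts for
      only one of the two indices; the other one comes from a vertex of \<open>E\<close>.\<close>
    then have w: "pts ! w \<in> E" "{l E, l {pts ! w}} = {i, j}" using ij(3) by auto
    obtain v' where v': "E = {pts ! w, v'}" using w(1) uv(3) by auto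
    then show "switches l V W i j" unfolding switches_def using w EW uv(3,4) by (intro bexI[of _ "pts ! w"] bexI[of _ v']) auto
  next
    assume "switches l V W i j"
    then obtain u v where uv: "u \<in> W" "v \<in> W" "cface V {u, v}" "{l {u, v}, l {u}} = {i, j}" unfolding switches_def by metis
    have "u \<in> V" using uv W by auto
    then obtain w where w: "w < length pts" "pts ! w = u" by (auto simp: V_def in_set_conv_nth)
    define I where "I = map2 (\<lambda>x y. x + flags {u, v} ! w * y) (lab (l {u, v})) (lab (l {pts ! w}))"
    have "{u, v} \<in> set face_list" unfolding set_face_list using uv W by blast
    then have "(flags {u, v}, I) \<in> set ?rq" unfolding reqs_guess I_def using w by blast
    moreover have "i = l {u, v} \<or> i = l {u}" "j = l {u, v} \<or> j = l {u}" using uv(4) by blast+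
    then have "0 < I ! (i - 1)" "0 < I ! (j - 1)"
      using req_entry_pos[OF ij(1) w(1)] req_entry_pos[OF ij(2) w(1)] w(2) unfolding I_def by auto
    then have "0 < P (flags {u, v}, I)" by (simp add: P_def)
    then have "0 < h (flags {u, v}, I)" using sub[of "{u, v}" I] uv W by (auto simp: h_def)
    ultimately show "\<exists>q\<in>set ?rq. 0 < h q" by blast
  qed
  finally show "0 < switch_sum ?rq (flags W) (i - 1) (j - 1) \<longleftrightarrow> switches l V W i j" unfolding fs .
qed

lemma set_triples: "set triples = {flags (minface V {a, b, c'}) |a b c'. a \<in> V \<and> b \<in> V \<and> c' \<in> V}"
proof -
  have "set triples = {face_flags [pt a, pt b, pt c'] |a b c'. a \<in> V \<and> b \<in> V \<and> c' \<in> V}"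
    by (auto simp: triples_def V_def)
  also have "\<dots> = {flags (minface V {a, b, c'}) |a b c'. a \<in> V \<and> b \<in> V \<and> c' \<in> V}"
    by (intro Collect_cong ex_cong1) (auto simp: face_flags_eq)
  finally show ?thesis .
qed

section \<open>The sets of scenarios served by each solution, and the meaning of one block\<close>

definition region :: "real list \<Rightarrow> (nat \<Rightarrow> real list) \<Rightarrow> nat \<Rightarrow> point set" where
  "region x y i = {w. \<forall>r<mrows. dot (mat_list (A_mat D) ! r) x + dot (mat_list (B_mat D) ! r) (y i) \<le>
     list_of_vec (b_const D) ! r + dot (mat_list (b_lin D) ! r) (pt w)}"

lemma linear_dot_pt: "length xs = u_dim D \<Longrightarrow> linear (\<lambda>w. dot xs (pt w))"
proof -
  assume l: "length xs = u_dim D"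
  have "(\<lambda>w. dot xs (pt w)) = (\<lambda>w. \<Sum>l<u_dim D. xs ! l * Poly_Mapping.lookup w l)"
    using l by (auto simp: dot_sum nth_pt)
  moreover have "linear (\<lambda>w::point. \<Sum>l<u_dim D. xs ! l * Poly_Mapping.lookup w l)"
    by (rule linearI) (simp_all add: lookup_add lookup_scaleR sum.distrib sum_distrib_left algebra_simps)
  ultimately show ?thesis by simp
qed

lemma length_rows: "r < mrows \<Longrightarrow> length (mat_list (A_mat D) ! r) = nx" "r < mrows \<Longrightarrow> length (mat_list (B_mat D) ! r) = ny"
    "r < mrows \<Longrightarrow> length (mat_list (b_lin D) ! r) = u_dim D"
  using mat_list_props[OF okD(5)] mat_list_props[OF okD(6)] mat_list_props[OF okD(7)] by (metis nth_mem)+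

lemma polyhedral_region: "polyhedral (region x y i)"
proof -
  let ?h = "\<lambda>r w. dot (mat_list (b_lin D) ! r) (pt w) + (list_of_vec (b_const D) ! r -
     (dot (mat_list (A_mat D) ! r) x + dot (mat_list (B_mat D) ! r) (y i)))"
  have "affine_fun (?h r)" if "r < mrows" for r
    unfolding affine_fun_def using linear_dot_pt[OF length_rows(3)[OF that]] by blast
  moreover have "region x y i = {w. \<forall>h\<in>?h ` {..<mrows}. 0 \<le> h w}"
    by (auto simp: region_def algebra_simps)
  ultimately show ?thesis unfolding polyhedral_def by (intro exI[of _ "?h ` {..<mrows}"]) blast
qed

text \<open>The flags, used as upper bounds, force the weights to vanish outside \<open>W\<close>,
  and the coordinate rows determine \<open>om\<close>. Conversely, nonnegative weights with sum 1
  never exceed 1, so the bounds exclude nothing inside \<open>W\<close>.\<close>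

lemma block_hit:
  assumes "pts \<noteq> []" and W: "W \<subseteq> V"
  shows "(\<exists>al om. length al = length pts \<and> length om = dim \<and> block_sat (flags W, I) x y al om) \<longleftrightarrow>
    (\<exists>q\<in>convex hull W. \<forall>i\<in>{1, 2, 3}. 0 < I ! (i - 1) \<longrightarrow> q \<in> region x y i)"
proof -
  have dim: "dim = u_dim D" using assms by (simp add: dim_def)
  have fW: "finite W" using finite_V W finite_subset by blast
  have bs: "block_sat (flags W, I) x y al om \<longleftrightarrow>
     (\<forall>v\<in>V. 0 \<le> weight al v \<and> weight al v \<le> (if v \<in> W then 1 else 0)) \<and> sum (weight al) V = 1 \<and>
     om = pt (\<Sum>v\<in>V. weight al v *\<^sub>R v) \<and> (\<forall>i\<in>{1, 2, 3}. 0 < I ! (i - 1) \<longrightarrow> (\<Sum>v\<in>V. weight al v *\<^sub>R v) \<in> region x y i)"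
    if l: "length al = length pts" "length om = dim" for al om
  proof -
    have 1: "(\<forall>v<length (map pt pts). 0 \<le> al ! v \<and> al ! v \<le> flags W ! v) \<longleftrightarrow> (\<forall>v\<in>V. 0 \<le> weight al v \<and> weight al v \<le> (if v \<in> W then 1 else 0))"
      unfolding V_def all_set_conv_all_nth by (simp add: weight_nth flags_nth)
    have 2: "sum_list al = sum (weight al) V"
      by (subst sum_V) (simp add: weight_nth sum_list_sum_nth l atLeast0LessThan)
    have p: "pt (\<Sum>v\<in>V. weight al v *\<^sub>R v) ! j = (\<Sum>v<length (map pt pts). al ! v * map pt pts ! v ! j)" if "j < dim" for j
      proof -
      have "pt (\<Sum>v\<in>V. weight al v *\<^sub>R v) ! j = (\<Sum>v\<in>V. weight al v * Poly_Mapping.lookup v j)"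
        using that dim by (subst nth_pt) (simp_all only: lookup_sum_scaleR)
      then show ?thesis using that dim by (simp add: sum_V weight_nth nth_pt)
    qed
    have 3: "(\<forall>j<dim. (\<Sum>v<length (map pt pts). al ! v * map pt pts ! v ! j) = om ! j) \<longleftrightarrow> om = pt (\<Sum>v\<in>V. weight al v *\<^sub>R v)"
      using p l dim by (auto simp: list_eq_iff_nth_eq)
    show ?thesis unfolding block_sat_def fst_conv snd_conv 1 2 3
      by (auto simp: region_def algebra_simps)
  qed
  show ?thesis
  proof
    assume "\<exists>al om. length al = length pts \<and> length om = dim \<and> block_sat (flags W, I) x y al om"
    then obtain al om where l: "length al = length pts" "length om = dim" and b: "block_sat (flags W, I) x y al om" by blast
    note b = b[unfolded bs[OF l]]
    have z: "weight al v = 0" if "v \<in> V - W" for v using b that by force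
    have "(\<Sum>v\<in>V. weight al v *\<^sub>R v) = (\<Sum>v\<in>W. weight al v *\<^sub>R v)"
      by (rule sum.mono_neutral_right[OF finite_V W]) (use z in simp)
    moreover have "sum (weight al) W = 1" using sum.mono_neutral_right[OF finite_V W, of "weight al"] z b by simp
    moreover have "\<forall>v\<in>W. 0 \<le> weight al v" using b W by blast
    ultimately have "(\<Sum>v\<in>V. weight al v *\<^sub>R v) \<in> convex hull W" unfolding convex_hull_finite[OF fW] mem_Collect_eq by (intro exI[of _ "weight al"]) simp
    then show "\<exists>q\<in>convex hull W. \<forall>i\<in>{1, 2, 3}. 0 < I ! (i - 1) \<longrightarrow> q \<in> region x y i" using b by blast
  next
    assume "\<exists>q\<in>convex hull W. \<forall>i\<in>{1, 2, 3}. 0 < I ! (i - 1) \<longrightarrow> q \<in> region x y i"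
    then obtain u q where u: "\<forall>v\<in>W. 0 \<le> u v" "sum u W = 1" "(\<Sum>v\<in>W. u v *\<^sub>R v) = q"
      and q: "\<forall>i\<in>{1, 2, 3}. 0 < I ! (i - 1) \<longrightarrow> q \<in> region x y i" unfolding convex_hull_finite[OF fW] by blast
    define al where "al = map (\<lambda>v. if v \<in> W then u v else 0) pts"
    have w: "weight al v = (if v \<in> W then u v else 0)" if "v \<in> V" for v
    proof -
      obtain k where k: "k < length pts" "v = pts ! k" using \<open>v \<in> V\<close> by (auto simp: V_def in_set_conv_nth)
      then show ?thesis using weight_nth[OF k(1), of al] by (simp add: al_def)
    qed
    have le: "u v \<le> 1" if "v \<in> W" for v using member_le_sum[OF that, of u] u fW by auto
    have s: "(\<Sum>v\<in>V. weight al v *\<^sub>R v) = q" unfolding u(3)[symmetric]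
      by (rule sum.mono_neutral_cong_right[OF finite_V W]) (use w W in auto)
    have "sum (weight al) V = 1" unfolding u(2)[symmetric]
      by (rule sum.mono_neutral_cong_right[OF finite_V W]) (use w W in auto)
    then have "block_sat (flags W, I) x y al (pt q)"
      by (subst bs) (use w u le q s dim in \<open>auto simp: al_def\<close>)
    then show "\<exists>al om. length al = length pts \<and> length om = dim \<and> block_sat (flags W, I) x y al om"
      using dim by (intro exI[of _ al] exI[of _ "pt q"]) (simp add: al_def)
  qed
qed

lemma triple_req_pos:
  assumes W: "W \<subseteq> V" and i: "i \<in> {1, 2, 3}"
  shows "0 < snd (triple_req (reqs_of (guess_of l)) (flags W)) ! (i - 1) \<longleftrightarrow>
    switches l V W 1 2 \<and> switches l V W 1 3 \<and> switches l V W 2 3"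
proof -
  let ?s = "switch_sum (reqs_of (guess_of l)) (flags W)"
  have "[p, p, p] ! (i - 1) = p" for p :: real using i by auto
  then have 1: "snd (triple_req (reqs_of (guess_of l)) (flags W)) ! (i - 1) = ?s 0 1 * (?s 0 2 * ?s 1 2)"
    by (simp add: triple_req_def Let_def)
  have "0 \<le> ?s 0 1" "0 \<le> ?s 0 2" "0 \<le> ?s 1 2"
    "0 < ?s 0 1 \<longleftrightarrow> switches l V W 1 2" "0 < ?s 0 2 \<longleftrightarrow> switches l V W 1 3" "0 < ?s 1 2 \<longleftrightarrow> switches l V W 2 3"
    using switch_sum_pos[OF W, of 1 2 l] switch_sum_pos[OF W, of 1 3 l] switch_sum_pos[OF W, of 2 3 l] by simp_all
  then show ?thesis unfolding 1 by (auto simp: zero_less_mult_iff)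
qed

lemma all_reqs_hit:
  assumes l: "\<And>E. l E \<in> {1, 2, 3}"
  shows "(\<forall>q\<in>set (all_reqs triples (guess_of l)). \<exists>al om. length al = length (map pt pts) \<and> length om = dim \<and> block_sat q x y al om) \<longleftrightarrow>
     (\<forall>u\<in>V. \<forall>v\<in>V. cface V {u, v} \<longrightarrow> hit (region x y) {u, v} {l {u, v}, l {u}}) \<and>
     (\<forall>a\<in>V. \<forall>b\<in>V. \<forall>c'\<in>V. let W = minface V {a, b, c'} in
        switches l V W 1 2 \<longrightarrow> switches l V W 1 3 \<longrightarrow> switches l V W 2 3 \<longrightarrow> hit (region x y) W {1, 2, 3})"
proof -
  let ?C = "region x y"
  let ?P = "\<lambda>q. \<exists>al om. length al = length (map pt pts) \<and> length om = dim \<and> block_sat q x y al om"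
  have H: "?P (flags W, I) \<longleftrightarrow> (\<exists>q\<in>convex hull W. \<forall>i\<in>{1, 2, 3}. 0 < I ! (i - 1) \<longrightarrow> q \<in> ?C i)" if "W \<subseteq> V" "v \<in> V" for W I v
  proof -
    have "pts \<noteq> []" using that(2) by (auto simp: V_def)
    from block_hit[OF this that(1), of I x y] show ?thesis by (simp only: length_map)
  qed
  have E: "?P (flags E, map2 (\<lambda>x y. x + flags E ! w * y) (lab (l E)) (lab (l {pts ! w}))) \<longleftrightarrow>
      hit ?C E (if pts ! w \<in> E then {l E, l {pts ! w}} else {l E})" if "E \<subseteq> V" "w < length pts" for E w
    unfolding H[OF that(1) pts_V[OF that(2)]] hit_def
  proof (intro bex_cong refl)
    fix q
    have "(\<forall>i\<in>{1, 2, 3}. 0 < map2 (\<lambda>x y. x + flags E ! w * y) (lab (l E)) (lab (l {pts ! w})) ! (i - 1) \<longrightarrow> q \<in> ?C i) \<longleftrightarrow>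
        (\<forall>i\<in>{1, 2, 3}. i = l E \<or> (pts ! w \<in> E \<and> i = l {pts ! w}) \<longrightarrow> q \<in> ?C i)"
      by (intro ball_cong refl) (simp only: req_entry_pos[OF _ that(2)])
    also have "\<dots> \<longleftrightarrow> (\<forall>i\<in>if pts ! w \<in> E then {l E, l {pts ! w}} else {l E}. q \<in> ?C i)"
      using l[of E] l[of "{pts ! w}"] by (simp only: split: if_split) blast
    finally show "(\<forall>i\<in>{1, 2, 3}. 0 < map2 (\<lambda>x y. x + flags E ! w * y) (lab (l E)) (lab (l {pts ! w})) ! (i - 1) \<longrightarrow> q \<in> ?C i) \<longleftrightarrow>
      (\<forall>i\<in>if pts ! w \<in> E then {l E, l {pts ! w}} else {l E}. q \<in> ?C i)" .
  qed
  have 1: "(\<forall>q\<in>set (reqs_of (guess_of l)). ?P q) \<longleftrightarrow> (\<forall>u\<in>V. \<forall>v\<in>V. cface V {u, v} \<longrightarrow> hit ?C {u, v} {l {u, v}, l {u}})"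
  proof
    assume a: "\<forall>q\<in>set (reqs_of (guess_of l)). ?P q"
    show "\<forall>u\<in>V. \<forall>v\<in>V. cface V {u, v} \<longrightarrow> hit ?C {u, v} {l {u, v}, l {u}}"
    proof (intro ballI impI)
      fix u v assume uv: "u \<in> V" "v \<in> V" "cface V {u, v}"
      obtain w where w: "w < length pts" "pts ! w = u" using uv(1) by (auto simp: V_def in_set_conv_nth)
      have f: "{u, v} \<in> set face_list" unfolding set_face_list using uv by blast
      have "?P (flags {u, v}, map2 (\<lambda>x y. x + flags {u, v} ! w * y) (lab (l {u, v})) (lab (l {pts ! w})))"
        by (rule a[rule_format]) (unfold reqs_guess, use w f in blast)
      then show "hit ?C {u, v} {l {u, v}, l {u}}" using E[of "{u, v}" w] uv w by simp
    qed
  next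
    assume a: "\<forall>u\<in>V. \<forall>v\<in>V. cface V {u, v} \<longrightarrow> hit ?C {u, v} {l {u, v}, l {u}}"
    show "\<forall>q\<in>set (reqs_of (guess_of l)). ?P q"
    proof
      fix q assume "q \<in> set (reqs_of (guess_of l))"
      then obtain F w where q: "q = (flags F, map2 (\<lambda>x y. x + flags F ! w * y) (lab (l F)) (lab (l {pts ! w})))"
        and F: "F \<in> set face_list" and w: "w < length pts" unfolding reqs_guess by blast
      obtain u v where uv: "u \<in> V" "v \<in> V" "F = {u, v}" "cface V {u, v}" using F unfolding set_face_list by blast
      have "hit ?C F (if pts ! w \<in> F then {l F, l {pts ! w}} else {l F})"
      proof (cases "pts ! w \<in> F")
        case True
        then obtain v' where v': "v' \<in> V" "F = {pts ! w, v'}" using uv by auto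
        then show ?thesis using a[rule_format, OF pts_V[OF w] v'(1)] uv True by simp
      next
        \<comment> \<open>A vertex outside the item contributes no index, so this requirement is
          weaker than the one for an end of the item.\<close>
        case False
        have "hit ?C F {l F, l {u}}" using a[rule_format, OF uv(1,2,4)] uv(3) by simp
        then show ?thesis using False by (auto simp: hit_def)
      qed
      then show "?P q" unfolding q using E[OF _ w, of F] uv by simp
    qed
  qed
  have T: "?P (triple_req (reqs_of (guess_of l)) (flags W)) \<longleftrightarrow>
      (switches l V W 1 2 \<longrightarrow> switches l V W 1 3 \<longrightarrow> switches l V W 2 3 \<longrightarrow> hit ?C W {1, 2, 3})"
    if "W = minface V {a, b, c'}" "a \<in> V" "b \<in> V" "c' \<in> V" for W a b c'
  proof -
    have W: "W \<subseteq> V" "a \<in> W" using that subset_minface[OF finite_V, of "{a, b, c'}"] by (auto simp: minface_def)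
    have tr: "triple_req (reqs_of (guess_of l)) (flags W) = (flags W, snd (triple_req (reqs_of (guess_of l)) (flags W)))"
      by (simp add: triple_req_def Let_def)
    have "?P (triple_req (reqs_of (guess_of l)) (flags W)) \<longleftrightarrow>
       (\<exists>q\<in>convex hull W. \<forall>i\<in>{1, 2, 3}. (switches l V W 1 2 \<and> switches l V W 1 3 \<and> switches l V W 2 3) \<longrightarrow> q \<in> ?C i)"
      by (subst tr, subst H[OF W(1) that(2)]) (intro bex_cong ball_cong refl, simp only: triple_req_pos[OF W(1)])
    \<comment> \<open>If a kind of change is missing, no index is required and any point of the
      nonempty hull will do.\<close>
    also have "\<dots> \<longleftrightarrow> (switches l V W 1 2 \<longrightarrow> switches l V W 1 3 \<longrightarrow> switches l V W 2 3 \<longrightarrow> hit ?C W {1, 2, 3})"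
      unfolding hit_def using hull_inc[OF W(2), of convex] by blast
    finally show ?thesis .
  qed
  have 2: "(\<forall>q\<in>set (map (triple_req (reqs_of (guess_of l))) triples). ?P q) \<longleftrightarrow>
     (\<forall>a\<in>V. \<forall>b\<in>V. \<forall>c'\<in>V. let W = minface V {a, b, c'} in
        switches l V W 1 2 \<longrightarrow> switches l V W 1 3 \<longrightarrow> switches l V W 2 3 \<longrightarrow> hit ?C W {1, 2, 3})"
  proof -
    have "(\<forall>q\<in>set (map (triple_req (reqs_of (guess_of l))) triples). ?P q) \<longleftrightarrow>
        (\<forall>a\<in>V. \<forall>b\<in>V. \<forall>c'\<in>V. ?P (triple_req (reqs_of (guess_of l)) (flags (minface V {a, b, c'}))))"
      unfolding set_map set_triples by blast
    also have "\<dots> \<longleftrightarrow> (\<forall>a\<in>V. \<forall>b\<in>V. \<forall>c'\<in>V. let W = minface V {a, b, c'} in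
        switches l V W 1 2 \<longrightarrow> switches l V W 1 3 \<longrightarrow> switches l V W 2 3 \<longrightarrow> hit ?C W {1, 2, 3})"
      unfolding Let_def by (intro ball_cong refl) (rule T[OF refl])
    finally show ?thesis .
  qed
  show ?thesis unfolding all_reqs_def set_append ball_Un 1 2 ..
qed

end

section \<open>Feasible solutions and their costs\<close>

lemma base_split:
  assumes "length z = nx + 3 * ny + 1"
  obtains x y1 y2 y3 t where "z = x @ y1 @ y2 @ y3 @ [t]" "length x = nx" "length y1 = ny" "length y2 = ny" "length y3 = ny"
proof -
  define z1 where "z1 = drop nx z"
  define z2 where "z2 = drop ny z1"
  define z3 where "z3 = drop ny z2"
  define z4 where "z4 = drop ny z3"
  have "length z4 = 1" using assms by (simp add: z1_def z2_def z3_def z4_def)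
  then obtain t where "z4 = [t]" by (cases z4) auto
  then have "z = take nx z @ take ny z1 @ take ny z2 @ take ny z3 @ [t]"
    unfolding z1_def z2_def z3_def z4_def by (metis append_take_drop_id)
  then show thesis by (rule that) (use assms in \<open>simp_all add: z1_def z2_def z3_def\<close>)
qed

context adapt_instance
begin

definition solution :: "real list \<Rightarrow> real vec \<times> (nat \<Rightarrow> real vec)" where
  "solution z = (vec_of_list (take nx z), \<lambda>i. vec_of_list (take ny (drop (nx + (i - 1) * ny) z)))"

lemma enc_base_solution: "enc_base nx ny z = enc_adapt_solution 3 (solution z)"
proof -
  have i: "[1..<Suc 3] = [1, 2, 3]" by (simp add: upt_rec)
  have d: "drop ny (drop nx z) = drop (nx + (2 - 1) * ny) z" by (simp add: add.commute)
  have e: "ny + (ny + nx) = nx + (3 - 1) * ny" by simp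
  have d': "drop ny (drop ny (drop nx z)) = drop (nx + (3 - 1) * ny) z" unfolding drop_drop e ..
  have "enc_base nx ny z = Node (encl Num (take nx z)) (encl (\<lambda>i. encl Num (take ny (drop (nx + (i - 1) * ny) z))) [1, 2, 3])"
    unfolding enc_base_def unfolding d' unfolding d by simp
  then show ?thesis unfolding enc_adapt_solution_def solution_def i by (simp add: enc_vec_list encl_def)
qed

lemma enc_outcome_solution: "enc_outcome (enc_base nx ny) r = enc_outcome (enc_adapt_solution 3) (map_outcome solution r)"
  by (cases r) (simp_all add: enc_base_solution)

lemma solution_base_vec:
  assumes "length x = nx" "\<And>i. length (y i) = ny"
  shows "fst (solution (base_vec x y t)) = vec_of_list x" "i \<in> {1, 2, 3} \<Longrightarrow> snd (solution (base_vec x y t)) i = vec_of_list (y i)"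
  using assms by (auto simp: solution_def base_vec_def)

lemma bools_nth: "i < k \<Longrightarrow> bools k I ! i = of_bool (i \<in> I)" and length_bools [simp]: "length (bools k I) = k"
  by (simp_all add: bools_def)

lemma partly_integral_list:
  assumes "I \<subseteq> {..<k}" "length x = k"
  shows "vec_of_list x \<in> partly_integral k I \<longleftrightarrow> list_all2 (\<lambda>b r. b = 1 \<longrightarrow> r \<in> \<int>) (bools k I) x"
proof -
  have "(\<forall>i<k. bools k I ! i = 1 \<longrightarrow> x ! i \<in> \<int>) \<longleftrightarrow> (\<forall>i\<in>I. x ! i \<in> \<int>)"
  proof -
    have "bools k I ! i = 1 \<longleftrightarrow> i \<in> I" if "i < k" for i using bools_nth[OF that] by simp
    then show ?thesis using assms(1) by blast
  qed
  moreover have "list_all2 (\<lambda>b r. b = 1 \<longrightarrow> r \<in> \<int>) (bools k I) x \<longleftrightarrow> (\<forall>i<k. bools k I ! i = 1 \<longrightarrow> x ! i \<in> \<int>)"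
    unfolding list_all2_conv_all_nth using assms(2) by (simp only: length_bools simp_thms)
  moreover have "vec_of_list x \<in> carrier_vec k" using assms(2) by (intro carrier_vecI) simp
  ultimately show ?thesis unfolding partly_integral_def mem_Collect_eq vec_of_list_index by (simp only: simp_thms)
qed

lemma base_ints_iff:
  assumes "length x = nx" "\<And>i. length (y i) = ny"
  shows "(\<forall>i<base_dim. base_ints ! i = 1 \<longrightarrow> base_vec x y t ! i \<in> \<int>) \<longleftrightarrow>
    vec_of_list x \<in> partly_integral nx (x_ints D) \<and> (\<forall>i\<in>{1, 2, 3}. vec_of_list (y i) \<in> partly_integral ny (y_ints D))"
proof -
  have l: "length (base_vec x y t) = base_dim" using assms by (simp add: base_vec_def base_dim_def)
  have "(\<forall>i<base_dim. base_ints ! i = 1 \<longrightarrow> base_vec x y t ! i \<in> \<int>) \<longleftrightarrow>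
      list_all2 (\<lambda>b r. b = 1 \<longrightarrow> r \<in> \<int>) base_ints (base_vec x y t)"
    using l length_base_ints by (auto simp: list_all2_conv_all_nth)
  also have "\<dots> \<longleftrightarrow> list_all2 (\<lambda>b r. b = 1 \<longrightarrow> r \<in> \<int>) (bools nx (x_ints D)) x \<and>
      (\<forall>i\<in>{1, 2, 3}. list_all2 (\<lambda>b r. b = 1 \<longrightarrow> r \<in> \<int>) (bools ny (y_ints D)) (y i))"
    using assms by (simp add: base_ints_def base_vec_def list_all2_append)
  also have "\<dots> \<longleftrightarrow> vec_of_list x \<in> partly_integral nx (x_ints D) \<and> (\<forall>i\<in>{1, 2, 3}. vec_of_list (y i) \<in> partly_integral ny (y_ints D))"
    using partly_integral_list[OF okD(8) assms(1)] partly_integral_list[OF okD(9) assms(2)] by simp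
  finally show ?thesis .
qed

lemma mult_mat_list:
  assumes "X \<in> carrier_mat k l" "length z = l" "r < k"
  shows "vec_index (X *\<^sub>v vec_of_list z) r = dot (mat_list X ! r) z"
proof -
  have "vec_index (X *\<^sub>v vec_of_list z) r = scalar_prod (vec_of_list (mat_list X ! r)) (vec_of_list z)"
    using assms mat_list_props(3)[OF assms(1,3)] by (simp add: vec_list)
  then show ?thesis using assms mat_list_props(3)[OF assms(1,3)] by (subst (asm) scalar_prod_lists) auto
qed

lemma constraint_region:
  assumes "length x = nx" "length (y i) = ny"
  shows "A_mat D *\<^sub>v vec_of_list x + B_mat D *\<^sub>v vec_of_list (y i) \<le> b_const D + b_lin D *\<^sub>v coords (u_dim D) w \<longleftrightarrow>
    w \<in> region x y i"
proof -
  have c: "coords (u_dim D) w = vec_of_list (pt w)" by (simp add: pt_def vec_list)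
  have "A_mat D *\<^sub>v vec_of_list x + B_mat D *\<^sub>v vec_of_list (y i) \<le> b_const D + b_lin D *\<^sub>v coords (u_dim D) w \<longleftrightarrow>
    (\<forall>r<mrows. vec_index (A_mat D *\<^sub>v vec_of_list x) r + vec_index (B_mat D *\<^sub>v vec_of_list (y i)) r \<le>
       vec_index (b_const D) r + vec_index (b_lin D *\<^sub>v coords (u_dim D) w) r)"
    using okD(5-7) by (auto simp: less_eq_vec_def)
  also have "\<dots> \<longleftrightarrow> w \<in> region x y i"
    unfolding region_def mem_Collect_eq c
    using mult_mat_list[OF okD(5) assms(1)] mult_mat_list[OF okD(6) assms(2)] mult_mat_list[OF okD(7) length_pt]
    by (simp add: list_of_vec_index)
  finally show ?thesis .
qed

abbreviation "feasible \<equiv> adapt_feasible 3 (u_set D) (\<lambda>\<omega>. A_mat D) (\<lambda>\<omega>. B_mat D)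
        (\<lambda>\<omega>. b_const D + b_lin D *\<^sub>v coords (u_dim D) \<omega>)
        (partly_integral nx (x_ints D)) (partly_integral ny (y_ints D))"

text \<open>A suitable cover exists if and only if the largest candidates, the traces of the regions
  on the polytope, form one.\<close>

lemma feasible_iff:
  assumes "length x = nx" "\<And>i. length (y i) = ny" and p: "fst p = vec_of_list x" "\<And>i. i \<in> {1, 2, 3} \<Longrightarrow> snd p i = vec_of_list (y i)"
  shows "p \<in> feasible \<longleftrightarrow> vec_of_list x \<in> partly_integral nx (x_ints D) \<and>
    (\<forall>i\<in>{1, 2, 3}. vec_of_list (y i) \<in> partly_integral ny (y_ints D)) \<and>
    convex hull V \<subseteq> region x y 1 \<union> region x y 2 \<union> region x y 3"
proof -
  have I: "{1..3::nat} = {1, 2, 3}" by auto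
  obtain p1 p2 where pp: "p = (p1, p2)" by (cases p)
  have p': "p1 = vec_of_list x" "\<And>i. i \<in> {1, 2, 3} \<Longrightarrow> p2 i = vec_of_list (y i)" using p pp by simp_all
  have R: "A_mat D *\<^sub>v p1 + B_mat D *\<^sub>v p2 i \<le> b_const D + b_lin D *\<^sub>v coords (u_dim D) w \<longleftrightarrow> w \<in> region x y i"
    if "i \<in> {1, 2, 3}" for i w using constraint_region[OF assms(1,2)] p' that by simp
  have "(\<exists>\<Omega>s. (\<Union>i\<in>{1..3}. \<Omega>s i) = u_set D \<and>
       (\<forall>i\<in>{1..3}. \<forall>w\<in>\<Omega>s i. A_mat D *\<^sub>v p1 + B_mat D *\<^sub>v p2 i \<le> b_const D + b_lin D *\<^sub>v coords (u_dim D) w)) \<longleftrightarrow>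
     u_set D \<subseteq> region x y 1 \<union> region x y 2 \<union> region x y 3" (is "(\<exists>\<Omega>s. ?P \<Omega>s) \<longleftrightarrow> _")
  proof
    assume "\<exists>\<Omega>s. ?P \<Omega>s"
    then obtain \<Omega>s where O: "?P \<Omega>s" ..
    show "u_set D \<subseteq> region x y 1 \<union> region x y 2 \<union> region x y 3"
    proof
      fix w assume "w \<in> u_set D"
      then obtain i where i: "i \<in> {1, 2, 3::nat}" "w \<in> \<Omega>s i" using O unfolding I by blast
      then have "w \<in> region x y i" using O R[OF i(1)] unfolding I by blast
      then show "w \<in> region x y 1 \<union> region x y 2 \<union> region x y 3" using i(1) by blast
    qed
  next
    assume "u_set D \<subseteq> region x y 1 \<union> region x y 2 \<union> region x y 3"
    then have "(\<Union>i\<in>{1, 2, 3::nat}. u_set D \<inter> region x y i) = u_set D" by blast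
    then have "?P (\<lambda>i. u_set D \<inter> region x y i)" unfolding I by (intro conjI ballI) (assumption, subst R, assumption, erule IntD2)
    then show "\<exists>\<Omega>s. ?P \<Omega>s" by blast
  qed
  then show ?thesis unfolding pp adapt_feasible_def I hull_V[symmetric] using p' by simp
qed

lemma base_obj_base_vec:
  assumes "length x = nx" "\<And>i. length (y i) = ny"
  shows "dot base_obj (base_vec x y t) = scalar_prod (c_vec D) (vec_of_list x) + t"
proof -
  have "scalar_prod (c_vec D) (vec_of_list x) = dot (list_of_vec (c_vec D)) x"
    using scalar_prod_lists[of "list_of_vec (c_vec D)" x] assms by (simp add: vec_list)
  then show ?thesis using assms by (simp add: base_obj_def base_row_def slot_def base_vec_def)
qed

lemma cost_eq:
  assumes "\<And>i. length (y i) = ny" "fst p = vec_of_list x" "\<And>i. i \<in> {1, 2, 3} \<Longrightarrow> snd p i = vec_of_list (y i)"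
  shows "adapt_cost 3 (c_vec D) (d_vec D) p =
    scalar_prod (c_vec D) (vec_of_list x) + Max ((\<lambda>i. dot (list_of_vec (d_vec D)) (y i)) ` {1, 2, 3})"
proof -
  have I: "{1..3::nat} = {1, 2, 3}" by auto
  have d: "scalar_prod (d_vec D) (vec_of_list (y i)) = dot (list_of_vec (d_vec D)) (y i)" for i
    using scalar_prod_lists[of "list_of_vec (d_vec D)" "y i"] assms(1) by (simp add: vec_list)
  have "(\<lambda>i. scalar_prod (d_vec D) (snd p i)) ` {1, 2, 3} = (\<lambda>i. dot (list_of_vec (d_vec D)) (y i)) ` {1, 2, 3}"
    by (rule image_cong) (use assms(3) d in auto)
  then show ?thesis unfolding adapt_cost_def I case_prod_beta assms(2) by (rule arg_cong)
qed

lemma base_set_iff: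
  assumes "length x = nx" "\<And>i. length (y i) = ny" "\<And>E. l E \<in> {1, 2, 3}"
  shows "base_vec x y t \<in> base_set (all_reqs triples (guess_of l)) \<longleftrightarrow>
    vec_of_list x \<in> partly_integral nx (x_ints D) \<and>
    (\<forall>i\<in>{1, 2, 3}. vec_of_list (y i) \<in> partly_integral ny (y_ints D)) \<and>
    (\<forall>i\<in>{1, 2, 3}. dot (list_of_vec (d_vec D)) (y i) \<le> t) \<and>
    (\<forall>u\<in>V. \<forall>v\<in>V. cface V {u, v} \<longrightarrow> hit (region x y) {u, v} {l {u, v}, l {u}}) \<and>
    (\<forall>a\<in>V. \<forall>b\<in>V. \<forall>c'\<in>V. let W = minface V {a, b, c'} in
        switches l V W 1 2 \<longrightarrow> switches l V W 1 3 \<longrightarrow> switches l V W 2 3 \<longrightarrow> hit (region x y) W {1, 2, 3})"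
proof -
  let ?q = "all_reqs triples (guess_of l)"
  have len: "length x = length (list_of_vec (c_vec D))" "\<And>k. length (y k) = length (list_of_vec (d_vec D))"
    using assms by auto
  have q1: "length (fst q) = length (map pt pts)" if "q \<in> set ?q" for q
  proof -
    have "\<exists>W. fst q = flags W" using that unfolding all_reqs_def set_append reqs_guess set_map set_triples
      by (auto simp: triple_req_def Let_def)
    then show ?thesis by auto
  qed
  have q2: "?q = []" if "map pt pts = []"
  proof -
    have "pts = []" using that by simp
    then have V: "V = {}" by (simp add: V_def)
    have 1: "face_list = []" using \<open>pts = []\<close> by (simp add: face_list_def edge_list_def pairs_def)
    have "set triples = {}" unfolding set_triples V by blast
    then have "triples = []" by (simp only: set_empty)
    then show ?thesis unfolding all_reqs_def guess_of_def reqs_of_def 1 by simp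
  qed
  have l: "length (base_vec x y t) = base_dim" using assms by (simp add: base_vec_def base_dim_def)
  have E: "(\<exists>w. length w = length (snd (build ?q)) \<and> sat (fst (build ?q)) (w @ base_vec x y t)) \<longleftrightarrow>
     (\<forall>i\<in>{1, 2, 3}. dot (list_of_vec (d_vec D)) (y i) \<le> t) \<and>
     (\<forall>q\<in>set ?q. \<exists>al om. length al = length (map pt pts) \<and> length om = dim \<and> block_sat q x y al om)"
    by (rule ex_sat_build[OF len q1 q2])
  show ?thesis unfolding base_set_def mem_Collect_eq base_ints_iff[OF assms(1,2)] E all_reqs_hit[OF assms(3)] using l by blast
qed

text \<open>A point of the program of a guess gives a covered polytope by
  \<open>labels_imp_cover\<close>; its last variable is at least the maximum, so the costs satisfy
  an inequality. A feasible solution meets some guess by \<open>cover_imp_labels\<close>, and with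
  the maximum as last variable the costs agree.\<close>

lemma outcome_correct:
  assumes "is_outcome (\<Union>g\<in>set (guesses items). base_set (all_reqs triples g)) (dot base_obj) r"
  shows "adapt_outcome 3 D (map_outcome solution r)"
  unfolding adapt_outcome_def
proof (rule map_outcome_correct[OF assms])
  fix z assume "z \<in> (\<Union>g\<in>set (guesses items). base_set (all_reqs triples g))"
  then obtain l where l: "\<And>E. l E \<in> {1, 2, 3}" and z: "z \<in> base_set (all_reqs triples (guess_of l))"
    unfolding guesses_eq by blast
  have "length z = nx + 3 * ny + 1" using z by (simp add: base_set_def base_dim_def)
  then obtain x y1 y2 y3 t where zz: "z = x @ y1 @ y2 @ y3 @ [t]" "length x = nx" "length y1 = ny" "length y2 = ny" "length y3 = ny"
    by (rule base_split)
  define y where "y i = (if i = 1 then y1 else if i = 2 then y2 else y3)" for i :: nat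
  have y: "\<And>i. length (y i) = ny" using zz by (simp add: y_def)
  have zb: "z = base_vec x y t" using zz(1) by (simp add: base_vec_def y_def)
  note B = z[unfolded zb base_set_iff[OF zz(2) y l]]
  have S: "fst (solution (base_vec x y t)) = vec_of_list x" "\<And>i. i \<in> {1, 2, 3} \<Longrightarrow> snd (solution (base_vec x y t)) i = vec_of_list (y i)"
    by (rule solution_base_vec[where y = y, OF zz(2) y], assumption?)+
  have "convex hull V \<subseteq> region x y 1 \<union> region x y 2 \<union> region x y 3"
  proof (rule labels_imp_cover[OF finite_V V_single polyhedral_region, where l = l])
    show "l E \<in> {1, 2, 3}" for E by (rule l)
    show "hit (region x y) {u, v} {l {u, v}, l {u}}" if "u \<in> V" "v \<in> V" "cface V {u, v}" for u v using B that by blast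
    show "hit (region x y) W {1, 2, 3}" if "a \<in> V" "b \<in> V" "c' \<in> V" "W = minface V {a, b, c'}"
      "switches l V W 1 2" "switches l V W 1 3" "switches l V W 2 3" for a b c' W using B that unfolding Let_def by blast
  qed
  then have "solution z \<in> feasible" unfolding zb using feasible_iff[OF zz(2) y S] B by blast
  moreover have "Max ((\<lambda>i. dot (list_of_vec (d_vec D)) (y i)) ` {1, 2, 3}) \<le> t" using B by (subst Max_le_iff) auto
  then have "adapt_cost 3 (c_vec D) (d_vec D) (solution z) \<le> dot base_obj z"
    unfolding zb base_obj_base_vec[OF zz(2) y] using cost_eq[OF y S] by simp
  ultimately show "solution z \<in> feasible \<and> adapt_cost 3 (c_vec D) (d_vec D) (solution z) \<le> dot base_obj z" ..
next
  fix p assume p: "p \<in> feasible"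
  have I: "{1..3::nat} = {1, 2, 3}" by auto
  define x where "x = list_of_vec (fst p)"
  \<comment> \<open>Lists of length \<open>ny\<close> are wanted at every index, hence the zeros
    outside \<open>{1, 2, 3}\<close>.\<close>
  define y where "y i = (if i \<in> {1, 2, 3} then list_of_vec (snd p i) else replicate ny 0)" for i :: nat
  have pp: "fst p \<in> partly_integral nx (x_ints D)" "\<And>i. i \<in> {1, 2, 3} \<Longrightarrow> snd p i \<in> partly_integral ny (y_ints D)"
    using p unfolding adapt_feasible_def I by auto
  have x: "length x = nx" using pp(1) by (simp add: x_def partly_integral_def)
  have y: "length (y i) = ny" for i using pp(2)[of i] by (cases "i \<in> {1, 2, 3}") (simp_all add: y_def partly_integral_def del: insert_iff)
  have f: "fst p = vec_of_list x" "\<And>i. i \<in> {1, 2, 3} \<Longrightarrow> snd p i = vec_of_list (y i)"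
    by (simp_all only: x_def y_def vec_list if_True)
  define t where "t = Max ((\<lambda>i. dot (list_of_vec (d_vec D)) (y i)) ` {1, 2, 3})"
  have t: "\<forall>i\<in>{1, 2, 3}. dot (list_of_vec (d_vec D)) (y i) \<le> t" unfolding t_def by (intro ballI Max_ge) auto
  have T: "p \<in> feasible \<longleftrightarrow> vec_of_list x \<in> partly_integral nx (x_ints D) \<and>
    (\<forall>i\<in>{1, 2, 3}. vec_of_list (y i) \<in> partly_integral ny (y_ints D)) \<and>
    convex hull V \<subseteq> region x y 1 \<union> region x y 2 \<union> region x y 3" by (rule feasible_iff[OF x y f])
  note T = iffD1[OF T p]
  note F = T[THEN conjunct1] T[THEN conjunct2, THEN conjunct1] T[THEN conjunct2, THEN conjunct2]
  from cover_imp_labels[of "region x y" V, OF polyhedral_region F(3)]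
  obtain l where l: "\<forall>E. l E \<in> {1, 2, 3}" "\<forall>u\<in>V. \<forall>v\<in>V. hit (region x y) {u, v} {l {u, v}, l {u}}"
    "\<forall>W\<subseteq>V. switches l V W 1 2 \<longrightarrow> switches l V W 1 3 \<longrightarrow> switches l V W 2 3 \<longrightarrow> hit (region x y) W {1, 2, 3}"
    by (elim exE conjE)
  note l1 = l(1)[rule_format]
  have W: "minface V T \<subseteq> V" for T by (auto simp: minface_def)
  have "base_vec x y t \<in> base_set (all_reqs triples (guess_of l))"
    unfolding base_set_iff[OF x y l1] Let_def
  proof (intro conjI)
    show "vec_of_list x \<in> partly_integral nx (x_ints D)" by (rule F(1))
    show "\<forall>i\<in>{1, 2, 3}. vec_of_list (y i) \<in> partly_integral ny (y_ints D)" by (rule F(2))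
    show "\<forall>i\<in>{1, 2, 3}. dot (list_of_vec (d_vec D)) (y i) \<le> t" by (rule t)
    show "\<forall>u\<in>V. \<forall>v\<in>V. cface V {u, v} \<longrightarrow> hit (region x y) {u, v} {l {u, v}, l {u}}" using l(2) by blast
    show "\<forall>a\<in>V. \<forall>b\<in>V. \<forall>c'\<in>V. switches l V (minface V {a, b, c'}) 1 2 \<longrightarrow> switches l V (minface V {a, b, c'}) 1 3 \<longrightarrow>
        switches l V (minface V {a, b, c'}) 2 3 \<longrightarrow> hit (region x y) (minface V {a, b, c'}) {1, 2, 3}"
      by (intro ballI l(3)[rule_format, OF W] impI)
  qed
  moreover have "guess_of l \<in> set (guesses items)" unfolding guesses_eq using l(1) by (intro CollectI exI[of _ l]) simp
  moreover have "dot base_obj (base_vec x y t) = adapt_cost 3 (c_vec D) (d_vec D) p"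
    unfolding base_obj_base_vec[OF x y] t_def by (rule cost_eq[OF y f, symmetric])
  ultimately show "\<exists>s\<in>\<Union>g\<in>set (guesses items). base_set (all_reqs triples g). dot base_obj s = adapt_cost 3 (c_vec D) (d_vec D) p"
    by blast
qed

end

section \<open>Encoding lengths and the number of calls\<close>

lemma quotient_of_the: "(THE q. of_rat q = (of_rat p :: real)) = p"
  by (rule the_equality) simp_all

lemma num_len_uminus: "num_len (- r) = num_len r"
proof (cases "r \<in> \<rat>")
  case True
  then obtain p where r: "r = of_rat p" by (auto elim: Rats_cases)
  have "- r = of_rat (- p)" by (simp add: r of_rat_minus)
  moreover obtain a b where "quotient_of p = (a, b)" by fastforce
  ultimately show ?thesis using r unfolding num_len_def
    by (simp add: quotient_of_the rat_uminus_code Rats_of_rat del: of_rat_minus)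
next
  case False
  then show ?thesis by (simp add: num_len_def)
qed

lemma num_len_0_1: "num_len 0 = 1" "num_len 1 = 2"
proof -
  have 0: "(THE q. of_rat q = (0::real)) = 0" using quotient_of_the[of 0] by simp
  have 1: "(THE q. of_rat q = (1::real)) = 1" using quotient_of_the[of 1] by simp
  have f: "floorlog 2 1 = 1" "floorlog 2 0 = 0" by (simp_all add: floorlog_def)
  show "num_len 0 = 1" unfolding num_len_def 0 using f by simp
  show "num_len 1 = 2" unfolding num_len_def 1 using f by simp
qed

lemma val_len_encl: "val_len (encl X xs) = 1 + length xs + (\<Sum>x\<leftarrow>xs. val_len (X x))"
  by (induction xs) auto

lemma length_le_val_len: "length xs \<le> val_len (encl X xs)"
  by (simp add: val_len_encl)

lemma elem_le_val_len: "x \<in> set xs \<Longrightarrow> val_len (X x) \<le> val_len (encl X xs)"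
  by (induction xs) auto

lemma val_len_encl_le:
  assumes "\<And>x. x \<in> set xs \<Longrightarrow> val_len (X x) \<le> K"
  shows "val_len (encl X xs) \<le> 1 + length xs * (1 + K)"
  using assms by (induction xs) fastforce+

section \<open>Sizes of the numbers in the linear programs\<close>

definition smalls :: "nat \<Rightarrow> real list \<Rightarrow> bool" where
  "smalls K xs \<longleftrightarrow> (\<forall>r\<in>set xs. num_len r \<le> K)"

lemma smalls_simps [simp]: "smalls K []" "smalls K (x # xs) \<longleftrightarrow> num_len x \<le> K \<and> smalls K xs"
  "smalls K (xs @ ys) \<longleftrightarrow> smalls K xs \<and> smalls K ys" "smalls K (map uminus xs) \<longleftrightarrow> smalls K xs"
  "smalls K (replicate k r) \<longleftrightarrow> k = 0 \<or> num_len r \<le> K"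
  by (auto simp: smalls_def num_len_uminus)

lemma smalls_bits: "2 \<le> K \<Longrightarrow> set xs \<subseteq> {0, 1} \<Longrightarrow> smalls K xs"
  unfolding smalls_def using num_len_0_1 by force

lemma smalls_unit_rows: "2 \<le> K \<Longrightarrow> e \<in> set (unit_rows k) \<Longrightarrow> smalls K e"
  by (induction k arbitrary: e) (auto simp: num_len_0_1)

lemma smalls_transp:
  assumes "\<And>v. v \<in> set vs \<Longrightarrow> length v = n \<and> smalls K v" "t \<in> set (transp n vs)"
  shows "smalls K t"
  using assms unfolding smalls_def transp_def by auto

lemma smalls_encl: "val_len (encl Num xs) \<le> K \<Longrightarrow> smalls K xs"
  unfolding smalls_def using elem_le_val_len[of _ xs Num] by fastforce

text \<open>With \<open>K\<close> bounding single numbers and \<open>X\<close> both dimensions, a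
  row has length at most about \<open>X * X\<close> and the matrix about \<open>X\<close> times as
  much. The premise \<open>K + 10 \<le> X\<close> makes \<open>X\<close> at least 10, so that a
  fourth factor absorbs the coefficients of the cubic bound.\<close>

lemma val_len_lp_val:
  assumes rows: "\<And>q. q \<in> set rs \<Longrightarrow> length (fst q) = length ob \<and> smalls K (fst q) \<and> num_len (snd q) \<le> K"
    and ob: "smalls K ob" and I: "length I = length ob" "smalls K I"
    and N: "length ob \<le> X" and R: "length rs \<le> X" and K: "K + 10 \<le> X"
  shows "val_len (lp_val ob rs I) \<le> X ^ 4"
proof -
  have v: "val_len (encl Num xs) \<le> 1 + length xs * (2 + K)" if "smalls K xs" for xs
    using val_len_encl_le[of xs Num "1 + K"] that by (simp add: smalls_def)
  have "length ob * (2 + K) \<le> X * X" by (intro mult_mono) (use N K in auto)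
  note v1 = this
  have f: "val_len (encl Num (fst q)) \<le> 1 + X * X" if "q \<in> set rs" for q
    using v[of "fst q"] rows[OF that] v1 by simp
  have "val_len (encl (encl Num) (map fst rs)) \<le> 1 + length rs * (1 + (1 + X * X))"
  proof -
    have "val_len (encl Num x) \<le> 1 + X * X" if "x \<in> set (map fst rs)" for x using f that by fastforce
    then have "val_len (encl (encl Num) (map fst rs)) \<le> 1 + length (map fst rs) * (1 + (1 + X * X))" by (rule val_len_encl_le)
    then show ?thesis by (simp only: length_map)
  qed
  also have "\<dots> \<le> 1 + X * (2 + X * X)" using R by (intro add_left_mono mult_mono) auto
  finally have 1: "val_len (encl (encl Num) (map fst rs)) \<le> 1 + X * (2 + X * X)" .
  have "smalls K (map snd rs)" using rows by (auto simp: smalls_def)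
  from v[OF this] have "val_len (encl Num (map snd rs)) \<le> 1 + length rs * (2 + K)" by simp
  also have "\<dots> \<le> 1 + X * X" using R K by (intro add_left_mono mult_mono) auto
  finally have 2: "val_len (encl Num (map snd rs)) \<le> 1 + X * X" .
  have 3: "val_len (encl Num ob) \<le> 1 + X * X" "val_len (encl Num I) \<le> 1 + X * X"
    using v[OF ob] v[OF I(2)] v1 I(1) by simp_all
  have "val_len (lp_val ob rs I) \<le> 5 + (1 + X * X) + (1 + X * (2 + X * X)) + (1 + X * X) + (1 + X * X)"
    unfolding lp_val_def using 1 2 3 by simp
  also have "\<dots> = 9 + 2 * X + 3 * (X * X) + X * (X * X)" by (simp add: algebra_simps)
  also have "\<dots> \<le> X ^ 4"
  proof -
    have X: "10 \<le> X" using K by simp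
    have "10 * X \<le> X * X" "10 * (X * X) \<le> X * (X * X)" "10 * (X * (X * X)) \<le> X * (X * (X * X))" by (rule mult_le_mono1[OF X])+
    then show ?thesis using X unfolding power4_eq_xxxx mult.assoc by linarith
  qed
  finally show ?thesis .
qed

context adapt_lists
begin

lemma smalls_base_row:
  "1 \<le> K \<Longrightarrow> smalls K a \<Longrightarrow> smalls K b \<Longrightarrow> num_len w \<le> K \<Longrightarrow> smalls K (base_row i a b w)"
  by (simp add: base_row_def slot_def num_len_0_1)

definition small_rows :: "nat \<Rightarrow> (real list \<times> real) list \<Rightarrow> bool" where
  "small_rows K rs \<longleftrightarrow> (\<forall>q\<in>set rs. smalls K (fst q) \<and> num_len (snd q) \<le> K)"

definition small_data :: "nat \<Rightarrow> bool" where
  "small_data K \<longleftrightarrow> 2 \<le> K \<and> (\<forall>v\<in>set vs \<union> set A \<union> set B \<union> set bl \<union> {bc, c, d}. smalls K v)"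

lemma small_con_rows:
  assumes K: "small_data K" and Z: "smalls K Z"
  shows "small_rows K (con_rows Z i)"
  unfolding small_rows_def
proof
  fix q assume "q \<in> set (con_rows Z i)"
  then obtain a b l r where q: "q = (replicate (length vs) 0 @ map uminus l @ Z @ base_row i a b 0, r)" "(a, b, l, r) \<in> set row_data"
    unfolding con_rows_def by auto
  then have "a \<in> set A" "b \<in> set B" "l \<in> set bl" "r \<in> set bc" unfolding row_data_def
    by (meson set_zip_leftD set_zip_rightD)+
  then have "smalls K a" "smalls K b" "smalls K l" "num_len r \<le> K" "2 \<le> K"
    using K by (auto simp: small_data_def smalls_def)
  then show "smalls K (fst q) \<and> num_len (snd q) \<le> K"
    unfolding q(1) using Z smalls_base_row[of K a b 0 i] by (simp add: num_len_0_1)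
qed

text \<open>Rows contain only input numbers, flags, their negatives and 0, 1 or -1. The sums and
  products computed for a requirement are in \<open>I\<close>, which affects the rows through the
  signs of its entries and never supplies a coefficient.\<close>

lemma small_block_rows:
  assumes K: "small_data K" and Z: "smalls K Z" and F: "smalls K F"
  shows "small_rows K (block_rows F I Z)"
proof -
  have K2: "2 \<le> K" and vs: "\<And>v. v \<in> set vs \<Longrightarrow> smalls K v" using K by (auto simp: small_data_def)
  have u: "smalls K e" if "e \<in> set (unit_rows k)" for e k by (rule smalls_unit_rows[OF K2 that])
  have t: "smalls K t" if "t \<in> set (transp n vs)" for t by (rule smalls_transp[OF _ that]) (use vs vs_len in auto)
  show ?thesis unfolding small_rows_def
  proof
    fix q assume "q \<in> set (block_rows F I Z)"
    then show "smalls K (fst q) \<and> num_len (snd q) \<le> K"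
      unfolding block_rows_def Let_def set_append
    proof (elim UnE)
      assume "q \<in> set (map2 (\<lambda>e f. (e @ replicate n 0 @ Z @ replicate base_dim 0, f)) (unit_rows (length vs)) F)"
      from in_map2[OF this] obtain e f where q: "e \<in> set (unit_rows (length vs))" "f \<in> set F"
        "q = (e @ replicate n 0 @ Z @ replicate base_dim 0, f)" by blast
      then show ?thesis using F u Z K2 by (simp add: num_len_0_1 smalls_def[of K F])
    next
      assume "q \<in> set (map2 (\<lambda>t e. (t @ map uminus e @ Z @ replicate base_dim 0, 0)) (transp n vs) (unit_rows n))"
      from in_map2[OF this] show ?thesis using u t Z K2 by (auto simp: num_len_0_1)
    next
      assume "q \<in> set (map2 (\<lambda>t e. (map uminus t @ e @ Z @ replicate base_dim 0, 0)) (transp n vs) (unit_rows n))"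
      from in_map2[OF this] show ?thesis using u t Z K2 by (auto simp: num_len_0_1)
    next
      assume "q \<in> set (concat (map (\<lambda>i. if 0 < I ! (i - 1) then con_rows Z i else []) [1, 2, 3]))"
      then obtain i where "q \<in> set (con_rows Z i)" by (auto split: if_splits)
      then show ?thesis using small_con_rows[OF K Z] unfolding small_rows_def by blast
    qed (use u Z K2 in \<open>auto simp: num_len_0_1 num_len_uminus\<close>)
  qed
qed

lemma small_build:
  assumes K: "small_data K" and qs: "\<And>q. q \<in> set qs \<Longrightarrow> smalls K (fst q)"
  shows "small_rows K (fst (build qs))" "smalls K (snd (build qs))"
proof -
  have K2: "1 \<le> K" "2 \<le> K" using K by (auto simp: small_data_def)
  show Z: "smalls K (snd (build qs))" for qs using K2 by (simp add: snd_build num_len_0_1)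
  show "small_rows K (fst (build qs))" using qs
  proof (induction qs rule: rev_induct)
    case Nil
    have "smalls K d" using K by (simp add: small_data_def)
    then have "smalls K (base_row i (replicate (length c) 0) d (- 1))" for i
      by (rule smalls_base_row[OF K2(1), rotated]) (use K2 in \<open>simp_all add: num_len_0_1 num_len_uminus\<close>)
    then show ?case using K2 by (simp add: build_def base_rows_def small_rows_def num_len_0_1)
  next
    case (snoc q qs)
    have "small_rows K (fst (build qs))" using snoc by simp
    moreover have "small_rows K (block_rows (fst q) (snd q) (snd (build qs)))"
      by (rule small_block_rows[OF K Z]) (use snoc in simp)
    ultimately show ?case using K2 by (auto simp: build_snoc step_rows_def Let_def small_rows_def num_len_0_1)
  qed
qed

end

context adapt_machine
begin

definition input_size :: nat where
  "input_size = val_len input_env"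

lemma input_size_props:
  assumes ne: "vs = [] \<Longrightarrow> n = 0"
  shows "small_data input_size" "length vs \<le> input_size" "n \<le> input_size" "length bc \<le> input_size"
    "length c \<le> input_size" "length d \<le> input_size" "smalls input_size xi" "smalls input_size yi"
proof -
  have le: "val_len (encl (encl Num) vs) \<le> input_size" "val_len (encl (encl Num) A) \<le> input_size" "val_len (encl (encl Num) B) \<le> input_size"
     "val_len (encl Num bc) \<le> input_size" "val_len (encl (encl Num) bl) \<le> input_size" "val_len (encl Num c) \<le> input_size"
     "val_len (encl Num d) \<le> input_size" "10 \<le> input_size"
    unfolding input_size_def input_env_def by simp_all
  have m: "smalls input_size v" if "v \<in> set X" "val_len (encl (encl Num) X) \<le> input_size" for v X
    by (rule smalls_encl, rule order_trans[OF elem_le_val_len[OF that(1)] that(2)])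
  show "small_data input_size" unfolding small_data_def
    using le m smalls_encl[OF le(4)] smalls_encl[OF le(6)] smalls_encl[OF le(7)] by auto
  show "length vs \<le> input_size" "length bc \<le> input_size" "length c \<le> input_size" "length d \<le> input_size"
    using le order_trans[OF length_le_val_len] by blast+
  show "n \<le> input_size"
  proof (cases vs)
    case Nil then show ?thesis using ne by simp
  next
    case (Cons v us)
    then have "length v = n" using vs_len by simp
    then have "n \<le> val_len (encl Num v)" using length_le_val_len by metis
    also have "\<dots> \<le> val_len (encl (encl Num) vs)" by (rule elem_le_val_len) (simp add: Cons)
    finally show ?thesis using le(1) by simp
  qed
  show "smalls input_size xi" "smalls input_size yi"
    by (rule smalls_bits; use le ints_len in simp)+
qed

text \<open>With \<open>s = input_size + 10\<close>, at most \<open>3 * s ^ 3\<close> units of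
  \<open>width\<close>, itself at most \<open>11 * s\<close>, have to be accommodated, which gives
  \<open>33 * s ^ 4\<close>. Since \<open>10 \<le> s\<close>, two more factors absorb the
  constant.\<close>

definition bound :: nat where
  "bound = (input_size + 10) ^ 6"

lemma input_size_bounds:
  assumes ne: "vs = [] \<Longrightarrow> n = 0"
  shows "(length items * length vs + length items + length vs * length vs * length vs + 2) * width \<le> bound"
    "2 * n + length vs * length vs + length vs + 10 \<le> bound" "2 * (n + 1) + (length vs + 3) + 1 \<le> bound"
    "input_size + 10 \<le> bound" "length items + 10 \<le> bound"
proof -
  define s where "s = input_size + 10"
  have s: "10 \<le> s" and le: "length vs \<le> s - 10" "n \<le> s - 10" "length bc \<le> s - 10" "length c \<le> s - 10" "length d \<le> s - 10"
    using input_size_props[OF ne] by (simp_all add: s_def)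
  let ?V = "length vs"
  have V2: "?V * ?V \<le> (s - 10) * (s - 10)" by (intro mult_mono) (use le in auto)
  have V2': "?V * ?V \<le> s * (s - 10)" by (rule order_trans[OF V2]) simp
  have it: "length items \<le> s * s - 9 * s"
  proof -
    have "length items \<le> (s - 10) + s * (s - 10)" using items_length(2) le(1) V2' by linarith
    also have "\<dots> \<le> s * s - 9 * s" using s by (simp add: diff_mult_distrib2)
    finally show ?thesis .
  qed
  have w: "width \<le> 11 * s" unfolding width_def base_dim_def using le s by simp
  have s2: "10 * s \<le> s * s" by (rule mult_le_mono1[OF s])
  have s3: "10 * (s * s) \<le> s * (s * s)" by (rule mult_le_mono1[OF s])
  have s4: "10 * (s * (s * s)) \<le> s * (s * (s * s))" by (rule mult_le_mono1[OF s])
  have s5: "10 * (s * (s * (s * s))) \<le> s * (s * (s * (s * s)))" by (rule mult_le_mono1[OF s])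
  have s6: "10 * (s * (s * (s * (s * s)))) \<le> s * (s * (s * (s * (s * s))))" by (rule mult_le_mono1[OF s])
  have b: "bound = s * (s * (s * (s * (s * s))))" unfolding bound_def s_def[symmetric] by (simp add: eval_nat_numeral)
  have it': "length items \<le> s * s" using it by simp
  have "length items * ?V \<le> s * (s * s)" by (subst mult.commute, intro mult_mono) (use it le in auto)
  moreover have "?V * ?V * ?V \<le> s * (s * s)" unfolding mult.assoc by (intro mult_mono) (use le in auto)
  ultimately have "length items * ?V + length items + ?V * ?V * ?V + 2 \<le> 3 * (s * (s * s))"
    using it' s s2 s3 by linarith
  then have "(length items * ?V + length items + ?V * ?V * ?V + 2) * width \<le> (3 * (s * (s * s))) * (11 * s)"
    using w by (intro mult_mono) auto
  also have "\<dots> = 33 * (s * (s * (s * s)))" by simp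
  also have "\<dots> \<le> bound" unfolding b using s5 s6 by linarith
  finally show "(length items * length vs + length items + length vs * length vs * length vs + 2) * width \<le> bound" .
  have vv: "?V * ?V \<le> s * s" by (intro mult_mono) (use le in auto)
  have v1: "?V + 10 \<le> s" "n + 10 \<le> s" using le s by linarith+
  have sb: "3 * (s * s) \<le> bound" unfolding b using s3 s4 s5 s6 by linarith
  have s1: "s \<le> s * s" by simp
  have "2 * n + ?V * ?V + ?V + 10 \<le> s * s + 3 * s" using vv v1 by linarith
  also have "\<dots> \<le> bound" using sb s2 by linarith
  finally show "2 * n + length vs * length vs + length vs + 10 \<le> bound" .
  have "2 * (n + 1) + (?V + 3) + 1 \<le> 3 * s" using v1 by simp
  also have "\<dots> \<le> bound" using sb s1 by linarith
  finally show "2 * (n + 1) + (length vs + 3) + 1 \<le> bound" .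
  have ss: "s * s \<le> bound" using sb by simp
  show "input_size + 10 \<le> bound" using order_trans[OF s1 ss] by (simp add: s_def)
  have "length items + 10 \<le> s * s + s" using it' s by linarith
  also have "\<dots> \<le> 3 * (s * s)" using s1 by linarith
  finally show "length items + 10 \<le> bound" using sb by (rule order_trans)
qed

lemma face_lp_size:
  assumes ne: "vs = [] \<Longrightarrow> n = 0" and T: "a \<in> set vs" "b \<in> set vs" "c' \<in> set vs" and e: "e \<in> set (unit_rows (length vs))"
  shows "q \<in> set (face_rows (n + 1) (face_gens vs [a, b, c']) e) \<Longrightarrow> length (fst q) = length vs + 3"
    "val_len (lp_val (replicate (length vs + 3) 0) (face_rows (n + 1) (face_gens vs [a, b, c']) e) (replicate (length vs + 3) 0)) \<le> bound ^ 4"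
proof -
  note P = input_size_props[OF ne]
  let ?G = "face_gens vs [a, b, c']" and ?K = input_size
  have K: "2 \<le> ?K" and vs: "\<And>v. v \<in> set vs \<Longrightarrow> smalls ?K v" using P(1) by (auto simp: small_data_def)
  have lG: "length ?G = length vs + 3" by (simp add: face_gens_def)
  have G: "length v = n + 1 \<and> smalls ?K v" if "v \<in> set ?G" for v
    using that vs vs_len T K by (auto simp: face_gens_def num_len_0_1 num_len_uminus)
  have t: "smalls ?K t" if "t \<in> set (transp (n + 1) ?G)" for t by (rule smalls_transp[OF G that])
  have u: "smalls ?K t" if "t \<in> set (unit_rows k)" for t k by (rule smalls_unit_rows[OF K that])
  have rows: "length (fst q) = length (replicate (length vs + 3) (0::real)) \<and> smalls ?K (fst q) \<and> num_len (snd q) \<le> ?K"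
    if "q \<in> set (face_rows (n + 1) ?G e)" for q
    using that t u e K lG unfolding face_rows_def by (auto simp: num_len_0_1 num_len_uminus)
  then show "q \<in> set (face_rows (n + 1) ?G e) \<Longrightarrow> length (fst q) = length vs + 3" by simp
  show "val_len (lp_val (replicate (length vs + 3) 0) (face_rows (n + 1) ?G e) (replicate (length vs + 3) 0)) \<le> bound ^ 4"
  proof (rule val_len_lp_val[OF rows])
    show "length (face_rows (n + 1) ?G e) \<le> bound"
      using input_size_bounds(3)[OF ne] unfolding face_rows_def by (simp add: lG)
  qed (use K input_size_bounds(3,4)[OF ne] in \<open>auto simp: num_len_0_1\<close>)
qed

lemma face_flags_bits: "set (face_flags T) \<subseteq> {0, 1}"
  by (auto simp: face_flags_def)

lemma all_reqs_bits:
  assumes g: "g \<in> set (guesses items)" and q: "q \<in> set (all_reqs triples g)"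
  shows "set (fst q) \<subseteq> {0, 1}" "length (fst q) = length vs"
proof -
  have it: "set F \<subseteq> {0, 1}" if "F \<in> set items" for F
    using that edge_items_rec face_flags_bits unfolding items_def vertex_items_def by fastforce
  have tr: "set F \<subseteq> {0, 1}" if "F \<in> set triples" for F
    using that face_flags_bits unfolding triples_def by auto
  obtain ls where ls: "g = zip items ls" using g unfolding set_guesses by blast
  have "fst q \<in> set items \<or> fst q \<in> set triples"
    using q set_zip_leftD[of _ _ items ls] unfolding all_reqs_def reqs_of_def ls by (fastforce simp: triple_req_def Let_def)
  then show "set (fst q) \<subseteq> {0, 1}" "length (fst q) = length vs" using it tr items_length(1) triples_length(1) by auto
qed

lemma build_lp_size:
  assumes ne: "vs = [] \<Longrightarrow> n = 0" and g: "g \<in> set (guesses items)"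
  defines "qs \<equiv> all_reqs triples g"
  shows "q \<in> set (fst (build qs)) \<Longrightarrow> length (fst q) = length (snd (build qs) @ base_obj)"
    "val_len (build_lp qs) \<le> bound ^ 4"
proof -
  note P = input_size_props[OF ne]
  let ?K = input_size
  have K: "2 \<le> ?K" and c: "smalls ?K c" using P(1) by (auto simp: small_data_def)
  have e: "qs = []" if "vs = []"
  proof -
    have "g = []" "triples = []" using guess_props(1)[OF g] items_length(2) triples_length(2) that by auto
    then show ?thesis by (simp add: qs_def all_reqs_def reqs_of_def)
  qed
  show len: "q \<in> set (fst (build qs)) \<Longrightarrow> length (fst q) = length (snd (build qs) @ base_obj)" for q
    using build_row_length[of qs] e length_base_obj by simp
  have S: "small_rows ?K (fst (build qs))" "smalls ?K (snd (build qs))"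
    by (rule small_build[OF P(1)]; use all_reqs_bits(1)[OF g] smalls_bits[OF K] in \<open>auto simp: qs_def\<close>)+
  have "length (reqs_of g) \<le> length g * length vs" by (rule length_reqs_of) (use guess_props(2)[OF g] in simp)
  then have lq: "length qs \<le> length items * length vs + length vs * length vs * length vs"
    using guess_props(1)[OF g] triples_length(2) by (simp add: qs_def all_reqs_def)
  have B: "(length qs + 1) * width \<le> bound"
    by (rule order_trans[OF mult_le_mono1 input_size_bounds(1)[OF ne]]) (use lq in simp)
  have wd: "base_dim \<le> width" "3 \<le> width" "length vs + n \<le> width" by (simp_all add: width_def)
  have "length (fst (build qs)) \<le> 3 + length qs * width" by (rule length_build) (use all_reqs_bits(2)[OF g] in \<open>simp add: qs_def\<close>)
  then have R: "length (fst (build qs)) \<le> bound" using B wd(2) by simp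
  have B': "length qs * width + width \<le> bound" using B by simp
  have "length qs * (length vs + n) \<le> length qs * width" using wd(3) by (rule mult_le_mono2)
  then have N: "length (snd (build qs) @ base_obj) \<le> bound"
    using B' wd(1) unfolding length_append snd_build length_replicate length_base_obj by linarith
  show "val_len (build_lp qs) \<le> bound ^ 4" unfolding build_lp_def
  proof (rule val_len_lp_val[OF _ _ _ _ N R input_size_bounds(4)[OF ne]])
    show "length (fst q) = length (snd (build qs) @ base_obj) \<and> smalls ?K (fst q) \<and> num_len (snd q) \<le> ?K"
      if "q \<in> set (fst (build qs))" for q using len[OF that] S(1) that unfolding small_rows_def by blast
    show "smalls ?K (snd (build qs) @ base_obj)"
      using S(2) smalls_base_row[of ?K c "[]" 1 0] c K unfolding base_obj_def by (simp add: num_len_0_1)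
    show "length (snd (build qs) @ base_ints) = length (snd (build qs) @ base_obj)"
      using length_base_obj length_base_ints by simp
    show "smalls ?K (snd (build qs) @ base_ints)"
      using S(2) P(7,8) K unfolding base_ints_def by (simp add: num_len_0_1)
  qed
qed

lemma base_ints_bits: "set base_ints \<subseteq> {0, 1}"
  using ints_len by (auto simp: base_ints_def)

end

section \<open>Total numbers of calls and steps\<close>

definition lp_call :: "adapt_input \<Rightarrow> nat \<Rightarrow> val \<Rightarrow> bool" where
  "lp_call D k q \<longleftrightarrow> (\<exists>P. lp_ok P \<and> q = enc_lp P \<and> (\<not> has_integral_variables D \<longrightarrow> ints P = {}) \<and> val_len q \<le> k)"

lemma lp_callI:
  assumes "\<And>q. q \<in> set rs \<Longrightarrow> length (fst q) = length ob" "length I = length ob" "set I \<subseteq> {0, 1}"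
    "\<not> has_integral_variables D \<Longrightarrow> 1 \<notin> set I" "val_len (lp_val ob rs I) \<le> k"
  shows "lp_call D k (lp_val ob rs I)"
  unfolding lp_call_def
proof (intro exI conjI impI)
  show "lp_val ob rs I = enc_lp (list_lp ob rs I)" using enc_list_lp[OF assms(1-3)] by simp
  show "ints (list_lp ob rs I) = {}" if "\<not> has_integral_variables D"
    using assms(2) assms(4)[OF that] unfolding list_lp_def by (auto simp: in_set_conv_nth)
qed (use assms(5) lp_ok_list_lp in auto)

text \<open>From \<open>m = 2\<close> on, each summand grows by at most the factor 7 when
  \<open>m\<close> increases by one. The values at 0, 1 and 2 are 1, 6 and 37, against 1, 7 and
  49.\<close>

lemma call_budget:
  assumes "v \<le> (m::nat)" "k \<le> m"
  shows "v * v + v * v * v + v * v * v * v + 3 ^ k \<le> (7::nat) ^ m"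
proof -
  have 1: "m * m + m * m * m + m * m * m * m + 3 ^ m \<le> (7::nat) ^ m" for m :: nat
  proof (cases "m < 2")
    case True
    then have "m = 0 \<or> m = 1" by auto
    then show ?thesis by auto
  next
    case False
    have "(j + 2) * (j + 2) + (j + 2) * (j + 2) * (j + 2) + (j + 2) * (j + 2) * (j + 2) * (j + 2) + 3 ^ (j + 2) \<le> (7::nat) ^ (j + 2)" for j
    proof (induction j)
      case (Suc j)
      define a where "a = j + 2"
      define x where "x = Suc j + 2"
      \<comment> \<open>As \<open>x = a + 1\<close> with \<open>2 \<le> a\<close>, the quotient of
        \<open>x\<close> and \<open>a\<close> is at most 3/2, and its fourth power 81/16 is less
        than 7.\<close>
      have 1: "2 * x \<le> 3 * a" by (simp add: a_def x_def)
      note 2 = mult_le_mono[OF 1 1]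
      note 3 = mult_le_mono[OF 2 1]
      note 4 = mult_le_mono[OF 3 1]
      have "4 * (x * x) \<le> 9 * (a * a)" "8 * (x * x * x) \<le> 27 * (a * a * a)" "16 * (x * x * x * x) \<le> 81 * (a * a * a * a)"
        using 2 3 4 by simp_all
      then have "x * x \<le> 7 * (a * a)" "x * x * x \<le> 7 * (a * a * a)" "x * x * x * x \<le> 7 * (a * a * a * a)" by simp_all
      then have "x * x + x * x * x + x * x * x * x \<le> 7 * (a * a + a * a * a + a * a * a * a)" by simp
      moreover have "3 ^ x \<le> (7::nat) * 3 ^ a" "7 ^ x = (7::nat) * 7 ^ a" by (simp_all add: a_def x_def)
      moreover have "p \<le> 7 * p' \<Longrightarrow> q \<le> 7 * q' \<Longrightarrow> r = 7 * r' \<Longrightarrow> p' + q' \<le> r' \<Longrightarrow> p + q \<le> r" for p p' q q' r r' :: nat by linarith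
      ultimately show ?case using Suc unfolding a_def[symmetric] x_def[symmetric] by blast
    qed simp
    moreover obtain j where "m = j + 2" using False by (metis add.commute le_Suc_ex not_less)
    ultimately show ?thesis by blast
  qed
  have "v * v \<le> m * m" "v * v * v \<le> m * m * m" "v * v * v * v \<le> m * m * m * m"
    by (intro mult_mono assms(1); simp)+
  moreover have "(3::nat) ^ k \<le> 3 ^ m" using assms(2) by (rule power_increasing) simp
  ultimately show ?thesis using 1[of m] by linarith
qed

text \<open>The program runs along a list of up to \<open>3 ^ k\<close> guesses, so its cost must be
  linear in the length: a quadratic bound of order \<open>9 ^ k\<close> would not fit under
  \<open>7 ^ k\<close> times a polynomial. Linearity holds because the program contains a single
  fold.\<close>

lemma cost_guess_step:
  assumes "1 \<le> M"
  shows "cost M guess_step_prog \<le> M * cost 1 guess_step_prog"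
  using assms unfolding guess_step_prog_def fold_in_def var_def label_prog_def list_prog_def
  by (simp add: numeral_eq_Suc)

context adapt_instance
begin

lemma dim_eq_0: "map pt pts = [] \<Longrightarrow> dim = 0"
  by (simp add: dim_def)

lemma bound_eq: "bound = (val_len (enc_adapt_input D) + 10) ^ 6"
  by (simp add: bound_def input_size_def input_env_eq)

lemma no_ints: "\<not> has_integral_variables D \<Longrightarrow> 1 \<notin> set base_ints"
proof -
  assume "\<not> has_integral_variables D"
  then have "1 \<notin> set (bools nx (x_ints D))" "1 \<notin> set (bools ny (y_ints D))" by (auto simp: has_integral_variables_def bools_def)
  then show ?thesis unfolding base_ints_def by simp
qed

lemma run_bounds:
  assumes slv: "lp_solver slv" and good: "good = lp_call D (bound ^ 4)" and M: "M = bound"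
  shows "\<exists>r t Q. run slv main_prog (enc_adapt_input D) = (enc_outcome (enc_adapt_solution 3) r, t, Q) \<and> adapt_outcome 3 D r \<and>
    length Q \<le> 7 ^ (card (vertices (u_set D)) + card (edges (u_set D))) \<and> (\<forall>q\<in>set Q. lp_call D (bound ^ 4) q) \<and>
    t \<le> 7 ^ (card (vertices (u_set D)) + card (edges (u_set D))) *
      (59 + cost bound (Fork items_prog (Fork triples_prog (Fork prep_prog (rev_of (var 0))))) +
       bound * (9 + cost 1 guess_step_prog) + cost bound best_prog)"
proof -
  let ?m = "card (vertices (u_set D)) + card (edges (u_set D))"
  have fg: face_good unfolding face_good_def unfolding good
    by (intro ballI lp_callI) (use face_lp_size[OF dim_eq_0] in auto)
  have gg: "good (build_lp (all_reqs triples g))" if "g \<in> set (guesses items)" for g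
    unfolding good build_lp_def
  proof (rule lp_callI)
    show "length (fst q) = length (snd (build (all_reqs triples g)) @ base_obj)" if "q \<in> set (fst (build (all_reqs triples g)))" for q
      by (rule build_lp_size(1)[OF dim_eq_0 \<open>g \<in> set (guesses items)\<close> that])
    show "val_len (lp_val (snd (build (all_reqs triples g)) @ base_obj) (fst (build (all_reqs triples g)))
       (snd (build (all_reqs triples g)) @ base_ints)) \<le> bound ^ 4"
      using build_lp_size(2)[OF dim_eq_0 that] unfolding build_lp_def .
    show "length (snd (build (all_reqs triples g)) @ base_ints) = length (snd (build (all_reqs triples g)) @ base_obj)"
      using length_base_obj length_base_ints by simp
    show "set (snd (build (all_reqs triples g)) @ base_ints) \<subseteq> {0, 1}" using base_ints_bits by (auto simp: snd_build)
    show "1 \<notin> set (snd (build (all_reqs triples g)) @ base_ints)" if "\<not> has_integral_variables D"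
      using no_ints[OF that] by (auto simp: snd_build)
  qed
  have "\<exists>r t Q. run slv main_prog input_env = (enc_outcome (enc_base (length (list_of_vec (c_vec D))) (length (list_of_vec (d_vec D)))) r, t, Q) \<and>
    is_outcome (\<Union>g\<in>set (guesses items). base_set (all_reqs triples g)) (dot base_obj) r \<and>
    t \<le> 50 + cost M (Fork items_prog (Fork triples_prog (Fork prep_prog (rev_of (var 0))))) +
       length items * (9 + cost (3 ^ length items) guess_step_prog) + 3 ^ length items * (9 + cost M best_prog) \<and>
    length Q \<le> length (map pt pts) * length (map pt pts) + length (map pt pts) * length (map pt pts) * length (map pt pts) +
       length (map pt pts) * length (map pt pts) * length (map pt pts) * length (map pt pts) + 3 ^ length items \<and>
    (\<forall>x\<in>set Q. good x)"
    by (rule run_main[OF slv fg gg dim_eq_0]) (assumption | rule input_size_bounds(1,2)[OF dim_eq_0, folded M], assumption)+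
  then obtain r t Q where R: "run slv main_prog input_env = (enc_outcome (enc_base (length (list_of_vec (c_vec D))) (length (list_of_vec (d_vec D)))) r, t, Q)"
    "is_outcome (\<Union>g\<in>set (guesses items). base_set (all_reqs triples g)) (dot base_obj) r"
    "t \<le> 50 + cost M (Fork items_prog (Fork triples_prog (Fork prep_prog (rev_of (var 0))))) +
       length items * (9 + cost (3 ^ length items) guess_step_prog) + 3 ^ length items * (9 + cost M best_prog)"
    "length Q \<le> length (map pt pts) * length (map pt pts) + length (map pt pts) * length (map pt pts) * length (map pt pts) +
       length (map pt pts) * length (map pt pts) * length (map pt pts) * length (map pt pts) + 3 ^ length items"
    "\<forall>x\<in>set Q. good x"
    by (elim exE conjE)
  have "run slv main_prog (enc_adapt_input D) = (enc_outcome (enc_adapt_solution 3) (map_outcome solution r), t, Q)"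
    using R(1) unfolding input_env_eq by (simp add: enc_outcome_solution)
  moreover have "adapt_outcome 3 D (map_outcome solution r)" by (rule outcome_correct[OF R(2)])
  moreover have "length (map pt pts) \<le> ?m" using okD(3,4) by (simp add: V_def distinct_card[symmetric])
  then have "length Q \<le> 7 ^ ?m" using R(4) call_budget[OF _ length_items] by (meson order_trans)
  moreover have "t \<le> 7 ^ ?m * (59 + cost bound (Fork items_prog (Fork triples_prog (Fork prep_prog (rev_of (var 0))))) +
       bound * (9 + cost 1 guess_step_prog) + cost bound best_prog)"
  proof -
    \<comment> \<open>Each part of the step count is at most \<open>N\<close> times a term
      polynomial in \<open>bound\<close>; 59 consists of the 50 in \<open>run_main\<close> and the 9
      charged for each iteration of the final loop.\<close>
    define N :: nat where "N = 3 ^ length items"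
    have N1: "1 \<le> N" by (simp add: N_def)
    have N7: "N \<le> 7 ^ ?m" unfolding N_def
      by (rule order_trans[OF power_increasing[OF length_items] power_mono]) simp_all
    let ?a = "cost bound (Fork items_prog (Fork triples_prog (Fork prep_prog (rev_of (var 0)))))"
    let ?b = "cost bound best_prog" and ?g = "cost 1 guess_step_prog"
    have "length items * (9 + cost N guess_step_prog) \<le> bound * (N * (9 + ?g))"
    proof (rule mult_mono)
      show "length items \<le> bound" using input_size_bounds(5)[OF dim_eq_0] by simp
      have "9 + cost N guess_step_prog \<le> N * 9 + N * ?g" using cost_guess_step[OF N1] N1 by linarith
      then show "9 + cost N guess_step_prog \<le> N * (9 + ?g)" by (simp add: distrib_left)
    qed auto
    moreover have "50 + ?a \<le> N * (50 + ?a)" using mult_le_mono1[OF N1, of "50 + ?a"] by simp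
    moreover have "N * (59 + ?a + bound * (9 + ?g) + ?b) = N * (50 + ?a) + bound * (N * (9 + ?g)) + N * (9 + ?b)"
      by (simp add: distrib_left mult.commute mult.left_commute)
    ultimately have "t \<le> N * (59 + ?a + bound * (9 + ?g) + ?b)"
      using R(3) unfolding M N_def[symmetric] by linarith
    also have "\<dots> \<le> 7 ^ ?m * (59 + ?a + bound * (9 + ?g) + ?b)" by (rule mult_le_mono1[OF N7])
    finally show ?thesis .
  qed
  ultimately show ?thesis using R(5) unfolding good by blast
qed

end

theorem theorem1p2:
  shows "solvable_by_lp_resolutions
           {D. adapt_input_ok D}
           enc_adapt_input
           (\<lambda>D out. \<exists>r. adapt_outcome 3 D r \<and> out = enc_outcome (enc_adapt_solution 3) r)
           has_integral_variables
           (\<lambda>D. 7 ^ (card (vertices (u_set D)) + card (edges (u_set D))))"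
proof -
  obtain \<alpha> where \<alpha>: "\<And>M. cost M (Fork items_prog (Fork triples_prog (Fork prep_prog (rev_of (var 0))))) = poly \<alpha> M"
    using cost_poly by blast
  obtain \<gamma> where \<gamma>: "\<And>M. cost M best_prog = poly \<gamma> M" using cost_poly by blast
  define \<beta> :: "nat poly" where "\<beta> = [:10, 1:] ^ 6"
  \<comment> \<open>One polynomial has to serve both purposes: \<beta> is \<open>bound\<close> as a
    function of the input length, its fourth power bounds the encodings of the calls, and the other
    summand bounds the steps for each resolution.\<close>
  define \<pi> where "\<pi> = \<beta> ^ 4 + (59 + pcompose \<alpha> \<beta> + \<beta> * of_nat (9 + cost 1 guess_step_prog) + pcompose \<gamma> \<beta>)"
  have main: "case run slv main_prog (enc_adapt_input D) of (out, steps, calls) \<Rightarrow>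
         (\<exists>r. adapt_outcome 3 D r \<and> out = enc_outcome (enc_adapt_solution 3) r) \<and>
         length calls \<le> 7 ^ (card (vertices (u_set D)) + card (edges (u_set D))) \<and>
         (\<forall>q\<in>set calls. \<exists>P. lp_ok P \<and> q = enc_lp P \<and>
            (\<not> has_integral_variables D \<longrightarrow> ints P = {}) \<and> val_len q \<le> poly \<pi> (val_len (enc_adapt_input D))) \<and>
         steps \<le> 7 ^ (card (vertices (u_set D)) + card (edges (u_set D))) * poly \<pi> (val_len (enc_adapt_input D))"
    if D: "adapt_input_ok D" and slv: "lp_solver slv" for D slv
  proof -
    define B where "B = (val_len (enc_adapt_input D) + 10) ^ 6"
    interpret adapt_instance D slv "lp_call D (B ^ 4)" B by unfold_locales (rule D)
    have b: "bound = B" by (simp add: bound_eq B_def)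
    have \<beta>: "poly \<beta> (val_len (enc_adapt_input D)) = B" by (simp add: \<beta>_def B_def poly_power add.commute)
    have p: "poly \<pi> (val_len (enc_adapt_input D)) = B ^ 4 + (59 + cost B (Fork items_prog (Fork triples_prog (Fork prep_prog (rev_of (var 0))))) +
       B * (9 + cost 1 guess_step_prog) + cost B best_prog)"
      unfolding \<pi>_def \<alpha> \<gamma> poly_add poly_power poly_mult poly_pcompose \<beta> by simp
    obtain r t Q where R: "run slv main_prog (enc_adapt_input D) = (enc_outcome (enc_adapt_solution 3) r, t, Q)" "adapt_outcome 3 D r"
      "length Q \<le> 7 ^ (card (vertices (u_set D)) + card (edges (u_set D)))" "\<forall>q\<in>set Q. lp_call D (B ^ 4) q"
      "t \<le> 7 ^ (card (vertices (u_set D)) + card (edges (u_set D))) *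
        (59 + cost B (Fork items_prog (Fork triples_prog (Fork prep_prog (rev_of (var 0))))) + B * (9 + cost 1 guess_step_prog) + cost B best_prog)"
      using run_bounds[OF slv] unfolding b by blast
    have "t \<le> 7 ^ (card (vertices (u_set D)) + card (edges (u_set D))) * poly \<pi> (val_len (enc_adapt_input D))"
      unfolding p by (rule order_trans[OF R(5) mult_le_mono2]) simp
    moreover have "B ^ 4 \<le> poly \<pi> (val_len (enc_adapt_input D))" unfolding p by simp
    then have "\<exists>P. lp_ok P \<and> q = enc_lp P \<and> (\<not> has_integral_variables D \<longrightarrow> ints P = {}) \<and>
        val_len q \<le> poly \<pi> (val_len (enc_adapt_input D))" if "q \<in> set Q" for q
      using R(4) that unfolding lp_call_def by (meson order_trans)
    ultimately show ?thesis unfolding R(1) prod.case using R(2,3) by blast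
  qed
  show ?thesis unfolding solvable_by_lp_resolutions_def
    by (intro exI[of _ main_prog] exI[of _ \<pi>] ballI allI impI main) simp_all
qed

end
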